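(* The matrix $\mathcal{A}=\mathcal{S}^T\mathcal{M}\mathcal{S}+\nu\mathcal{B}_{\mathbb{B},\mathbb{B}}$ is symmetric and positive definite for all $\nu\ge 0$, and there exists $C>0$ independent of $h$ and $\nu$ such that its (spectral) condition number is bounded by $$\kappa(\mathcal{A})\le\frac{C\,\dfrac{\lambda_{N_{\mathbb{B}}}(\mathcal{B}_{\mathbb{B},\mathbb{B}})}{\lambda_1(\mathcal{M})}\,\lambda_N(\mathcal{M})+\nu\,\lambda_{N_{\mathbb{B}}}(\mathcal{B}_{\mathbb{B},\mathbb{B}})}{\lambda_1(\mathcal{M})+\nu\,\lambda_1(\mathcal{B}_{\mathbb{B},\mathbb{B}})},$$ where $0<\lambda_1(\mathcal{B}_{\mathbb{B},\mathbb{B}})<\lambda_{N_{\mathbb{B}}}(\mathcal{B}_{\mathbb{B},\mathbb{B}})$ and $0<\lambda_1(\mathcal{M})<\lambda_N(\mathcal{M})$ are respectively the smallest and greatest eigenvalues of the matrices $\mathcal{B}_{\mathbb{B},\mathbb{B}}$ and $\mathcal{M}$.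
   Context: $\Omega\subset\mathbb{R}^d$, $d=2$ or $d=3$, is a bounded Lipschitz domain whose boundary $\Gamma$ is polygonal or polyhedral, and $\{\mathcal{T}_h\}_h$ is a regular family of triangulations of $\bar\Omega$. $Y_h=\{y_h\in C(\bar\Omega): y_h|_T\in P^1(T)\ \forall T\in\mathcal{T}_h\}$, with nodes $x_1,\dots,x_N$ and nodal basis $e_1,\dots,e_N$. $\mathbb{I}=\{j:x_j\in\Omega\}$ and $\mathbb{B}=\{j:x_j\in\Gamma\}$ are the sets of interior and boundary indexes, with cardinalities $N_{\mathbb{I}}$ and $N_{\mathbb{B}}$; vectors in $\mathbb{R}^N$ are ordered with the interior indexes first. For $1\le i,j\le N$, $\mathcal{K}_{i,j}=\int_\Omega\nabla e_i\cdot\nabla e_j\,dx$, $\mathcal{M}_{i,j}=\int_\Omega e_ie_j\,dx$, $\mathcal{B}_{i,j}=\int_\Gamma e_ie_j\,ds$. $\mathcal{I}$ and $\mathcal{O}$ are the $N\times N$ identity and zero matrices; index sets in subscripts denote the corresponding submatrices, and ":" means all indexes. The matrix $\mathcal{S}\in\mathbb{R}^{N\times N_{\mathbb{B}}}$ (which maps boundary nodal values to the nodal values of the discrete harmonic extension) is $$\mathcal{S}=\begin{pmatrix}\mathcal{K}_{\mathbb{I},\mathbb{I}}&\mathcal{K}_{\mathbb{I},\mathbb{B}}\\ \mathcal{O}_{\mathbb{B},\mathbb{I}}&\mathcal{I}_{\mathbb{B},\mathbb{B}}\end{pmatrix}^{-1}\mathcal{I}_{:,\mathbb{B}}.$$ 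*)

theory Defs
  imports
    "HOL-Analysis.Analysis"
    "Jordan_Normal_Form.Char_Poly"
    "Jordan_Normal_Form.Gauss_Jordan_Elimination"
    "Jordan_Normal_Form.DL_Submatrix"
begin

section \<open>Surface measure\<close>

text \<open>Hausdorff measure, normalized to agree with Lebesgue measure on the flat
  \<open>s\<close>-dimensional pieces. The case distinction on \<open>U = {}\<close> matters only for \<open>s = 0\<close>.\<close>

definition hausdorff_gauge :: "nat \<Rightarrow> 'a::metric_space set \<Rightarrow> ennreal" where
  "hausdorff_gauge s U =
     (if U = {} then 0 else ennreal (unit_ball_vol (real s) * (diameter U / 2) ^ s))"

definition hausdorff_content :: "nat \<Rightarrow> real \<Rightarrow> 'a::metric_space set \<Rightarrow> ennreal" where
  "hausdorff_content s \<delta> A =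
     (INF U \<in> {U. A \<subseteq> (\<Union>n::nat. U n) \<and> (\<forall>n. bounded (U n) \<and> diameter (U n) \<le> \<delta>)}.
        \<Sum>n. hausdorff_gauge s (U n))"

definition hausdorff_outer :: "nat \<Rightarrow> 'a::metric_space set \<Rightarrow> ennreal" where
  "hausdorff_outer s A = (SUP \<delta>\<in>{0<..}. hausdorff_content s \<delta> A)"

definition hausdorff_measure :: "nat \<Rightarrow> 'a::metric_space measure" where
  "hausdorff_measure s = measure_of UNIV (sets borel) (hausdorff_outer s)"

text \<open>The constant \<^const>\<open>measure_of\<close> yields the zero measure unless its argument is countably
  additive, so we check that it is, using Caratheodory's criterion for metric outer measures.\<close>

lemma hausdorff_content_mono: "A \<subseteq> B \<Longrightarrow> hausdorff_content s \<delta> A \<le> hausdorff_content s \<delta> B"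
  unfolding hausdorff_content_def by (rule INF_superset_mono) auto

lemma hausdorff_content_antimono:
  "\<delta> \<le> \<epsilon> \<Longrightarrow> hausdorff_content s \<epsilon> A \<le> hausdorff_content s \<delta> A"
  unfolding hausdorff_content_def by (rule INF_superset_mono) (auto intro: order_trans)

lemma hausdorff_content_empty: "0 < \<delta> \<Longrightarrow> hausdorff_content s \<delta> {} = 0"
proof -
  assume "0 < \<delta>"
  then have "hausdorff_content s \<delta> ({} :: 'a set) \<le> (\<Sum>n. hausdorff_gauge s ({} :: 'a set))"
    unfolding hausdorff_content_def
    by (intro INF_lower2[of "\<lambda>_. {}"]) auto
  then show ?thesis by (simp add: hausdorff_gauge_def)
qed

lemma hausdorff_content_countably_subadditive:
  assumes "0 < \<delta>"
  shows "hausdorff_content s \<delta> (\<Union>i. A i) \<le> (\<Sum>i::nat. hausdorff_content s \<delta> (A i))"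
proof (rule ennreal_le_epsilon)
  fix e :: real
  assume fin: "(\<Sum>i. hausdorff_content s \<delta> (A i)) < Orderings.top" and e: "0 < e"
  have "(\<lambda>i. e * (1/2) ^ Suc i) sums e"
    using sums_mult[OF power_half_series, of e] by (simp only: mult_1_right)
  then have pow: "(\<Sum>i. ennreal (e * (1/2) ^ Suc i)) = ennreal e"
    using e by (intro suminf_ennreal_eq) auto
  have "\<exists>U. A i \<subseteq> (\<Union>n::nat. U n) \<and> (\<forall>n. bounded (U n) \<and> diameter (U n) \<le> \<delta>) \<and>
      (\<Sum>n. hausdorff_gauge s (U n)) \<le> hausdorff_content s \<delta> (A i) + ennreal (e * (1/2) ^ Suc i)" for i
  proof -
    have "hausdorff_content s \<delta> (A i) \<noteq> Orderings.top"
      using fin ennreal_suminf_lessD by (metis less_irrefl)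
    then have "hausdorff_content s \<delta> (A i) < hausdorff_content s \<delta> (A i) + ennreal (e * (1/2) ^ Suc i)"
      using e by (simp add: ennreal_add_left_cancel_less[of _ 0, simplified] less_top)
    then show ?thesis
      by (subst (asm) hausdorff_content_def) (auto simp: INF_less_iff intro: less_imp_le)
  qed
  then obtain U where U: "\<And>i. A i \<subseteq> (\<Union>n::nat. U i n)"
    "\<And>i n. bounded (U i n) \<and> diameter (U i n) \<le> \<delta>"
    "\<And>i. (\<Sum>n. hausdorff_gauge s (U i n)) \<le> hausdorff_content s \<delta> (A i) + ennreal (e * (1/2) ^ Suc i)"
    by metis
  define V where "V = (\<lambda>k. case prod_decode k of (i, n) \<Rightarrow> U i n)"
  have cov: "(\<Union>i. A i) \<subseteq> (\<Union>k. V k)"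
  proof
    fix x assume "x \<in> (\<Union>i. A i)"
    then obtain i n where "x \<in> U i n" using U(1) by blast
    then have "x \<in> V (prod_encode (i, n))" by (simp add: V_def)
    then show "x \<in> (\<Union>k. V k)" by blast
  qed
  have "hausdorff_content s \<delta> (\<Union>i. A i) \<le> (\<Sum>k. hausdorff_gauge s (V k))"
    unfolding hausdorff_content_def using cov U(2)
    by (intro INF_lower) (auto simp: V_def split: prod.split)
  also have "\<dots> = (\<Sum>i. \<Sum>n. hausdorff_gauge s (U i n))"
    using suminf_ennreal_2dimen[of "\<lambda>i. \<Sum>n. hausdorff_gauge s (U i n)"
        "\<lambda>(i, n). hausdorff_gauge s (U i n)"]
    by (simp add: V_def comp_def split_def)
  also have "\<dots> \<le> (\<Sum>i. hausdorff_content s \<delta> (A i) + ennreal (e * (1/2) ^ Suc i))"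
    by (intro suminf_le U) auto
  also have "\<dots> = (\<Sum>i. hausdorff_content s \<delta> (A i)) + ennreal e"
    by (subst suminf_add[symmetric]) (simp_all only: summableI pow)
  finally show "hausdorff_content s \<delta> (\<Union>i. A i) \<le> (\<Sum>i. hausdorff_content s \<delta> (A i)) + ennreal e" .
qed

lemma hausdorff_content_separated:
  assumes sep: "\<And>x y. x \<in> A \<Longrightarrow> y \<in> B \<Longrightarrow> d \<le> dist x y" and "\<delta> < d" "0 < \<delta>"
  shows "hausdorff_content s \<delta> A + hausdorff_content s \<delta> B \<le> hausdorff_content s \<delta> (A \<union> B)"
  unfolding hausdorff_content_def[of s \<delta> "A \<union> B"]
proof (rule INF_greatest, safe)
  fix U :: "nat \<Rightarrow> 'a set"
  assume cov: "A \<union> B \<subseteq> (\<Union>n. U n)" and U: "\<forall>n. bounded (U n) \<and> diameter (U n) \<le> \<delta>"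
  define V where "V C n = (if U n \<inter> C = {} then {} else U n)" for C n
  have le: "hausdorff_content s \<delta> C \<le> (\<Sum>n. hausdorff_gauge s (V C n))" if "C \<subseteq> A \<union> B" for C
    unfolding hausdorff_content_def using that cov U \<open>0 < \<delta>\<close>
    by (intro INF_lower) (auto simp: V_def disjoint_iff split: if_splits, blast)
  have one: "U n \<inter> A = {} \<or> U n \<inter> B = {}" for n
  proof (rule ccontr)
    assume "\<not> ?thesis"
    then obtain x y where xy: "x \<in> A" "y \<in> B" "x \<in> U n" "y \<in> U n" by blast
    with U have "dist x y \<le> \<delta>"
      using diameter_bounded_bound[of "U n" x y] by (meson order_trans)
    with sep[OF xy(1,2)] \<open>\<delta> < d\<close> show False by simp
  qed
  have "hausdorff_content s \<delta> A + hausdorff_content s \<delta> B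
      \<le> (\<Sum>n. hausdorff_gauge s (V A n)) + (\<Sum>n. hausdorff_gauge s (V B n))"
    by (intro add_mono le) auto
  also have "\<dots> = (\<Sum>n. hausdorff_gauge s (V A n) + hausdorff_gauge s (V B n))"
    by (rule suminf_add) auto
  also have "\<dots> \<le> (\<Sum>n. hausdorff_gauge s (U n))"
    using one by (intro suminf_le) (auto simp: V_def hausdorff_gauge_def)
  finally show "hausdorff_content s \<delta> A + hausdorff_content s \<delta> B
      \<le> (\<Sum>n. hausdorff_gauge s (U n))" .
qed

lemma hausdorff_outer_separated:
  assumes sep: "\<And>x y. x \<in> A \<Longrightarrow> y \<in> B \<Longrightarrow> d \<le> dist x y" and "0 < d"
  shows "hausdorff_outer s A + hausdorff_outer s B \<le> hausdorff_outer s (A \<union> B)"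
proof -
  let ?c = "hausdorff_content s"
  have "hausdorff_outer s A + hausdorff_outer s B = (SUP \<delta>\<in>{0<..}. ?c \<delta> A + ?c \<delta> B)"
    unfolding hausdorff_outer_def
  proof (rule SUP_add_directed_ennreal[symmetric])
    fix i j :: real assume "i \<in> {0<..}" "j \<in> {0<..}"
    then show "\<exists>k\<in>{0<..}. ?c i A + ?c j B \<le> ?c k A + ?c k B"
      by (intro bexI[of _ "min i j"] add_mono hausdorff_content_antimono) auto
  qed
  also have "\<dots> \<le> hausdorff_outer s (A \<union> B)"
  proof (rule SUP_least)
    fix \<delta> :: real assume "\<delta> \<in> {0<..}"
    define \<epsilon> where "\<epsilon> = min \<delta> (d / 2)"
    have \<epsilon>: "0 < \<epsilon>" "\<epsilon> < d" "\<epsilon> \<le> \<delta>" using \<open>0 < d\<close> \<open>\<delta> \<in> {0<..}\<close> by (auto simp: \<epsilon>_def)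
    have "?c \<delta> A + ?c \<delta> B \<le> ?c \<epsilon> A + ?c \<epsilon> B"
      by (intro add_mono hausdorff_content_antimono \<epsilon>)
    also have "\<dots> \<le> ?c \<epsilon> (A \<union> B)"
      using sep \<epsilon> by (intro hausdorff_content_separated[of A B d]) auto
    also have "\<dots> \<le> hausdorff_outer s (A \<union> B)"
      unfolding hausdorff_outer_def using \<epsilon> by (intro SUP_upper) auto
    finally show "?c \<delta> A + ?c \<delta> B \<le> hausdorff_outer s (A \<union> B)" .
  qed
  finally show ?thesis .
qed

lemma hausdorff_outer_mono: "A \<subseteq> B \<Longrightarrow> hausdorff_outer s A \<le> hausdorff_outer s B"
  unfolding hausdorff_outer_def by (rule SUP_mono') (rule hausdorff_content_mono)

lemma hausdorff_outer_empty [simp]: "hausdorff_outer s {} = 0"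
  by (simp add: hausdorff_outer_def hausdorff_content_empty cong: SUP_cong_simp)

lemma hausdorff_outer_UN: "hausdorff_outer s (\<Union>i. A i) \<le> (\<Sum>i::nat. hausdorff_outer s (A i))"
  unfolding hausdorff_outer_def[of s "\<Union>i. A i"]
proof (rule SUP_least)
  fix \<delta> :: real assume \<delta>: "\<delta> \<in> {0<..}"
  then have "hausdorff_content s \<delta> (\<Union>i. A i) \<le> (\<Sum>i. hausdorff_content s \<delta> (A i))"
    by (intro hausdorff_content_countably_subadditive) auto
  also have "\<dots> \<le> (\<Sum>i. hausdorff_outer s (A i))"
    unfolding hausdorff_outer_def using \<delta> by (intro suminf_le SUP_upper) auto
  finally show "hausdorff_content s \<delta> (\<Union>i. A i) \<le> (\<Sum>i. hausdorff_outer s (A i))" .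
qed

lemma outer_measure_space_hausdorff_outer:
  "outer_measure_space (Pow UNIV) (hausdorff_outer s)"
  unfolding outer_measure_space_def positive_def increasing_def countably_subadditive_def
  by (auto intro: hausdorff_outer_mono hausdorff_outer_UN)

lemma hausdorff_outer_Un:
  "hausdorff_outer s (A \<union> B) \<le> hausdorff_outer s A + hausdorff_outer s B"
proof -
  have "hausdorff_outer s (A \<union> B) \<le> (\<Sum>i. hausdorff_outer s (binaryset A B i))"
    using hausdorff_outer_UN[of s "binaryset A B"] by (simp add: UN_binaryset_eq)
  then show ?thesis by (simp add: suminf_binaryset_eq)
qed

lemma hausdorff_outer_closed:
  fixes C A :: "'a::metric_space set"
  assumes "closed C"
  shows "hausdorff_outer s (A \<inter> C) + hausdorff_outer s (A - C) \<le> hausdorff_outer s A"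
proof (cases "C = {} \<or> hausdorff_outer s A = \<infinity>")
  case True
  then show ?thesis by auto
next
  case False
  then have ne: "C \<noteq> {}" and fin: "hausdorff_outer s A \<noteq> \<infinity>" by auto
  let ?h = "hausdorff_outer s"
  define f where "f x = infdist x C" for x
  define E where "E n = {x \<in> A. 1 / real (Suc n) \<le> f x}" for n
  define D where "D k = E (Suc k) - E k" for k
  have dist_ge: "a - b \<le> dist x y" if "a \<le> f x" "f y \<le> b" for x y a b
    using infdist_triangle[of x C y] that by (simp add: f_def)
  have E_mono: "E m \<subseteq> E n" if "m \<le> n" for m n
  proof -
    have "1 / real (Suc n) \<le> 1 / real (Suc m)" using that by (simp add: frac_le)
    then show ?thesis by (auto simp: E_def)
  qed
  have D_f: "f x < 1 / real (Suc k)" if "x \<in> D k" for x k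
    using that by (auto simp: D_def E_def)
  have gap: "0 < 1 / real (Suc n) - 1 / real (Suc (Suc n))" for n
    by (simp add: frac_less2)
  have sep: "?h X + ?h Y \<le> ?h (X \<union> Y)" if "X \<subseteq> E n" "Y \<subseteq> D (Suc n)" for X Y n
    using that gap[of n] D_f[of _ "Suc n"]
    by (intro hausdorff_outer_separated[of _ _ "1 / real (Suc n) - 1 / real (Suc (Suc n))"] dist_ge)
       (auto simp: E_def intro: less_imp_le)
  have part: "(\<Sum>k<m. ?h (D (Suc (2 * k + j)))) \<le> ?h (E (2 * m + j))" for m j
  proof (induction m)
    case (Suc m)
    have "(\<Sum>k<Suc m. ?h (D (Suc (2 * k + j)))) \<le> ?h (E (2 * m + j)) + ?h (D (Suc (2 * m + j)))"
      using Suc.IH by (simp add: add_right_mono)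
    also have "\<dots> \<le> ?h (E (2 * m + j) \<union> D (Suc (2 * m + j)))"
      by (rule sep) auto
    also have "\<dots> \<le> ?h (E (2 * Suc m + j))"
      using E_mono[of "2 * m + j" "2 * Suc m + j"]
      by (intro hausdorff_outer_mono) (auto simp: D_def)
    finally show ?case .
  qed simp
  have EA: "?h (E n) \<le> ?h A" for n
    by (intro hausdorff_outer_mono) (auto simp: E_def)
  have "(\<Sum>n<m. ?h (D (Suc n))) \<le> ?h A + ?h A" for m
  proof -
    have "(\<Sum>n<m. ?h (D (Suc n))) \<le> (\<Sum>n<2 * m. ?h (D (Suc n)))"
      by (intro sum_mono2) auto
    also have "\<dots> = (\<Sum>k<m. ?h (D (Suc (2 * k + 0)))) + (\<Sum>k<m. ?h (D (Suc (2 * k + 1))))"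
      by (induction m) (simp_all add: algebra_simps)
    also have "\<dots> \<le> ?h A + ?h A"
      by (intro add_mono order_trans[OF part EA])
    finally show ?thesis .
  qed
  then have "(\<Sum>n. ?h (D (Suc n))) \<le> ?h A + ?h A"
    by (intro suminf_le_const summableI)
  then have tot: "(\<Sum>n. ?h (D (Suc n))) < \<infinity>"
    using fin by (simp add: ennreal_add_less_top less_top order.strict_trans1)
  have fpos: "0 < f x" if "x \<notin> C" for x
    using infdist_pos_not_in_closed[OF \<open>closed C\<close> ne that] by (simp add: f_def)
  have split: "A - C \<subseteq> E (Suc n) \<union> (\<Union>k. D (Suc (k + n)))" for n
  proof
    fix x assume x: "x \<in> A - C"
    define m where "m = (LEAST m. x \<in> E m)"
    obtain m0 where "inverse (real (Suc m0)) < f x"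
      using reals_Archimedean fpos x by blast
    with x have "x \<in> E m0" by (simp add: E_def inverse_eq_divide)
    then have m: "x \<in> E m" "\<And>k. k < m \<Longrightarrow> x \<notin> E k"
      unfolding m_def by (auto intro: LeastI dest: not_less_Least)
    show "x \<in> E (Suc n) \<union> (\<Union>k. D (Suc (k + n)))"
    proof (cases "m \<le> Suc n")
      case True
      with m E_mono show ?thesis by blast
    next
      case False
      then obtain k where k: "m = Suc (Suc (k + n))"
        by (metis add.commute add_Suc less_imp_Suc_add not_le)
      with m have "x \<in> D (Suc (k + n))" by (simp add: D_def)
      then show ?thesis by blast
    qed
  qed
  have bound: "?h (A \<inter> C) + ?h (A - C) \<le> ?h A + (\<Sum>k. ?h (D (Suc (k + n))))" for n
  proof -
    have "?h (A \<inter> C) + ?h (E (Suc n)) \<le> ?h ((A \<inter> C) \<union> E (Suc n))"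
    proof (rule hausdorff_outer_separated)
      fix x y assume "x \<in> A \<inter> C" "y \<in> E (Suc n)"
      then show "1 / real (Suc (Suc n)) \<le> dist x y"
        using dist_ge[of "1 / real (Suc (Suc n))" y x 0]
        by (simp add: E_def f_def dist_commute del: of_nat_Suc)
    qed simp
    also have "\<dots> \<le> ?h A"
      by (intro hausdorff_outer_mono) (auto simp: E_def)
    finally have *: "?h (A \<inter> C) + ?h (E (Suc n)) \<le> ?h A" .
    have "?h (A - C) \<le> ?h (E (Suc n)) + ?h (\<Union>k. D (Suc (k + n)))"
      using hausdorff_outer_mono[OF split] hausdorff_outer_Un by (rule order_trans)
    also have "\<dots> \<le> ?h (E (Suc n)) + (\<Sum>k. ?h (D (Suc (k + n))))"
      by (intro add_left_mono hausdorff_outer_UN)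
    finally have "?h (A \<inter> C) + ?h (A - C)
        \<le> (?h (A \<inter> C) + ?h (E (Suc n))) + (\<Sum>k. ?h (D (Suc (k + n))))"
      by (simp add: add_left_mono add.assoc)
    also have "\<dots> \<le> ?h A + (\<Sum>k. ?h (D (Suc (k + n))))"
      by (intro add_right_mono *)
    finally show ?thesis .
  qed
  show ?thesis
  proof (rule ennreal_le_epsilon)
    fix e :: real assume e: "0 < e"
    define r where "r k = enn2real (?h (D (Suc k)))" for k
    have hr: "?h (D (Suc k)) = ennreal (r k)" for k
      using ennreal_suminf_lessD[OF tot, of k] by (simp add: r_def)
    have r0: "0 \<le> r k" for k by (simp add: r_def)
    have "summable r"
      using tot unfolding hr by (intro summable_suminf_not_top) (auto simp: r0)
    then obtain n where n: "norm (\<Sum>i. r (i + n)) < e"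
      using suminf_exist_split[OF e] by blast
    have "(\<Sum>k. ?h (D (Suc (k + n)))) = ennreal (\<Sum>k. r (k + n))"
      unfolding hr using \<open>summable r\<close>
      by (intro suminf_ennreal_eq summable_sums) (auto simp: r0 summable_iff_shift)
    also have "\<dots> \<le> ennreal e" using n by (intro ennreal_leI) auto
    finally show "?h (A \<inter> C) + ?h (A - C) \<le> ?h A + ennreal e"
      using bound[of n] by (meson add_left_mono order_trans)
  qed
qed

theorem emeasure_hausdorff_measure:
  assumes "A \<in> sets borel"
  shows "emeasure (hausdorff_measure s) A = hausdorff_outer s A"
proof -
  interpret P: sigma_algebra UNIV "Pow UNIV :: 'a set set" by (rule sigma_algebra_Pow)
  let ?L = "lambda_system UNIV (Pow UNIV) (hausdorff_outer s :: 'a set \<Rightarrow> ennreal)"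
  have L: "measure_space UNIV ?L (hausdorff_outer s)"
    by (rule P.caratheodory_lemma) (rule outer_measure_space_hausdorff_outer)
  then interpret L: sigma_algebra UNIV ?L by (simp add: measure_space_def)
  have "C \<in> ?L" if "closed C" for C
  proof -
    have "hausdorff_outer s (C \<inter> X) + hausdorff_outer s ((UNIV - C) \<inter> X) = hausdorff_outer s X" for X
    proof -
      have "C \<inter> X = X \<inter> C" "(UNIV - C) \<inter> X = X - C" by auto
      then show ?thesis
        using hausdorff_outer_closed[OF that, of s X] hausdorff_outer_Un[of s "X \<inter> C" "X - C"]
        by (simp only: Int_Diff_Un antisym)
    qed
    then show ?thesis by (simp add: lambda_system_def)
  qed
  then have "sigma_sets UNIV (Collect closed) \<subseteq> ?L"
    by (intro L.sigma_sets_subset) auto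
  then have sub: "sets borel \<subseteq> ?L"
    by (simp add: borel_eq_closed)
  have sig: "sigma_algebra UNIV (sets borel :: 'a set set)"
    using sets.sigma_algebra_axioms[of "borel :: 'a measure"] by simp
  have "measure_space UNIV (sets borel) (hausdorff_outer s :: 'a set \<Rightarrow> ennreal)"
    by (rule measure_down[OF L sig sub])
  then show ?thesis
    unfolding hausdorff_measure_def using assms
    by (intro emeasure_measure_of_sigma) (auto simp: measure_space_def)
qed

lemma sets_hausdorff_measure [simp, measurable_cong]: "sets (hausdorff_measure s) = sets borel"
  unfolding hausdorff_measure_def
  by (subst sets_measure_of_conv) (simp add: sets.sigma_sets_eq[of borel, simplified])


section \<open>Domain and triangulations\<close>

definition lipschitz_domain :: "'a::euclidean_space set \<Rightarrow> bool" where
  "lipschitz_domain \<Omega> \<longleftrightarrow> open \<Omega> \<and> connected \<Omega> \<and> \<Omega> \<noteq> {} \<and> bounded \<Omega> \<and>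
     (\<forall>p\<in>frontier \<Omega>. \<exists>n \<phi> L r. norm n = 1 \<and> 0 < r \<and>
        L-lipschitz_on {z. inner z n = 0} \<phi> \<and>
        \<Omega> \<inter> ball p r = {y \<in> ball p r. \<phi> (y - inner y n *\<^sub>R n) < inner y n})"

text \<open>For dimension 2 the boundary is a finite union of segments, for dimension 3 a finite union
  of convex polygons.\<close>

definition polyhedral_boundary :: "'a::euclidean_space set \<Rightarrow> bool" where
  "polyhedral_boundary \<Omega> \<longleftrightarrow>
     (\<exists>\<F>. finite \<F> \<and> (\<forall>F\<in>\<F>. polytope F \<and> aff_dim F = int DIM('a) - 1) \<and> frontier \<Omega> = \<Union>\<F>)"

definition triangulation_of :: "'a::euclidean_space set \<Rightarrow> 'a set set \<Rightarrow> bool" where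
  "triangulation_of X \<T> \<longleftrightarrow>
     triangulation \<T> \<and> (\<forall>T\<in>\<T>. int DIM('a) simplex T) \<and> \<Union>\<T> = X"

definition inscribed_diameter :: "'a::euclidean_space set \<Rightarrow> real" where
  "inscribed_diameter T = Sup {diameter (cball p r) | p r. cball p r \<subseteq> T}"

text \<open>Regularity in the sense of Ciarlet (shape regularity). The meshes need not be quasi-uniform.\<close>

definition regular_family :: "('h \<Rightarrow> 'a::euclidean_space set set) \<Rightarrow> bool" where
  "regular_family \<T> \<longleftrightarrow> (\<exists>\<sigma>. \<forall>h. \<forall>T\<in>\<T> h. diameter T \<le> \<sigma> * inscribed_diameter T)"


section \<open>Linear finite elements\<close>

text \<open>Only the values of the elements of this space on \<open>closure \<Omega>\<close> are meaningful.\<close>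

definition P1_space :: "'a::euclidean_space set \<Rightarrow> 'a set set \<Rightarrow> ('a \<Rightarrow> real) set" where
  "P1_space \<Omega> \<T> =
     {y. continuous_on (closure \<Omega>) y \<and> (\<forall>T\<in>\<T>. \<exists>a b. \<forall>p\<in>T. y p = inner a p + b)}"

definition nodes :: "'a::euclidean_space set set \<Rightarrow> 'a set" where
  "nodes \<T> = {p. \<exists>T\<in>\<T>. p extreme_point_of T}"

definition node_numbering ::
  "'a::euclidean_space set \<Rightarrow> 'a set set \<Rightarrow> nat \<Rightarrow> (nat \<Rightarrow> 'a) \<Rightarrow> bool" where
  "node_numbering \<Omega> \<T> N x \<longleftrightarrow> bij_betw x {..<N} (nodes \<T>) \<and>
     (\<forall>i<N. \<forall>j<N. x i \<in> \<Omega> \<and> x j \<in> frontier \<Omega> \<longrightarrow> i < j)"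

definition nodal_basis ::
  "'a::euclidean_space set \<Rightarrow> 'a set set \<Rightarrow> nat \<Rightarrow> (nat \<Rightarrow> 'a) \<Rightarrow> (nat \<Rightarrow> 'a \<Rightarrow> real) \<Rightarrow> bool" where
  "nodal_basis \<Omega> \<T> N x e \<longleftrightarrow>
     (\<forall>j<N. e j \<in> P1_space \<Omega> \<T> \<and> (\<forall>i<N. e j (x i) = (if i = j then 1 else 0)))"

definition interior_indexes :: "'a::euclidean_space set \<Rightarrow> nat \<Rightarrow> (nat \<Rightarrow> 'a) \<Rightarrow> nat set" where
  "interior_indexes \<Omega> N x = {j. j < N \<and> x j \<in> \<Omega>}"

definition boundary_indexes :: "'a::euclidean_space set \<Rightarrow> nat \<Rightarrow> (nat \<Rightarrow> 'a) \<Rightarrow> nat set" where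
  "boundary_indexes \<Omega> N x = {j. j < N \<and> x j \<in> frontier \<Omega>}"

text \<open>The classical gradient of a piecewise affine function exists off the mesh skeleton, which is
  a null set; the arbitrary value there does not affect integrals.\<close>

definition gradient :: "('a::euclidean_space \<Rightarrow> real) \<Rightarrow> 'a \<Rightarrow> 'a" where
  "gradient f p = (THE D. GDERIV f p :> D)"

definition stiffness_matrix ::
  "'a::euclidean_space set \<Rightarrow> nat \<Rightarrow> (nat \<Rightarrow> 'a \<Rightarrow> real) \<Rightarrow> real mat" where
  "stiffness_matrix \<Omega> N e = Matrix.mat N N
     (\<lambda>(i, j). LINT p:\<Omega>|lebesgue. inner (gradient (e i) p) (gradient (e j) p))"

definition mass_matrix ::
  "'a::euclidean_space set \<Rightarrow> nat \<Rightarrow> (nat \<Rightarrow> 'a \<Rightarrow> real) \<Rightarrow> real mat" where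
  "mass_matrix \<Omega> N e = Matrix.mat N N (\<lambda>(i, j). LINT p:\<Omega>|lebesgue. e i p * e j p)"

definition boundary_mass_matrix ::
  "'a::euclidean_space set \<Rightarrow> nat \<Rightarrow> (nat \<Rightarrow> 'a \<Rightarrow> real) \<Rightarrow> real mat" where
  "boundary_mass_matrix \<Omega> N e = Matrix.mat N N
     (\<lambda>(i, j). LINT p:frontier \<Omega>|hausdorff_measure (DIM('a) - 1). e i p * e j p)"


section \<open>Matrices\<close>

text \<open>The option \<^const>\<open>mat_inverse\<close> is \<^const>\<open>None\<close> exactly for matrices that are not invertible.\<close>

definition inv_mat :: "real mat \<Rightarrow> real mat" where
  "inv_mat A = the (mat_inverse A)"

text \<open>\<open>I\<close> and \<open>B\<close> are the sets of interior and boundary indexes; in the block matrix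
  the former come first.\<close>

definition extension_matrix :: "real mat \<Rightarrow> nat set \<Rightarrow> nat set \<Rightarrow> real mat" where
  "extension_matrix K I B = (let N = dim_row K in
     inv_mat (four_block_mat
       (submatrix K I I)           (submatrix K I B)
       (submatrix (0\<^sub>m N N) B I) (submatrix (1\<^sub>m N) B B))
     * submatrix (1\<^sub>m N) UNIV B)"

definition boundary_block ::
  "'a::euclidean_space set \<Rightarrow> nat \<Rightarrow> (nat \<Rightarrow> 'a) \<Rightarrow> (nat \<Rightarrow> 'a \<Rightarrow> real) \<Rightarrow> real mat" where
  "boundary_block \<Omega> N x e =
     submatrix (boundary_mass_matrix \<Omega> N e) (boundary_indexes \<Omega> N x) (boundary_indexes \<Omega> N x)"

definition control_matrix ::
  "'a::euclidean_space set \<Rightarrow> nat \<Rightarrow> (nat \<Rightarrow> 'a) \<Rightarrow> (nat \<Rightarrow> 'a \<Rightarrow> real) \<Rightarrow> real \<Rightarrow> real mat" where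
  "control_matrix \<Omega> N x e \<nu> =
     (let S = extension_matrix (stiffness_matrix \<Omega> N e)
                (interior_indexes \<Omega> N x) (boundary_indexes \<Omega> N x)
      in transpose_mat S * mass_matrix \<Omega> N e * S + \<nu> \<cdot>\<^sub>m boundary_block \<Omega> N x e)"

definition symmetric_mat :: "real mat \<Rightarrow> bool" where
  "symmetric_mat A \<longleftrightarrow> transpose_mat A = A"

definition pos_def_mat :: "real mat \<Rightarrow> bool" where
  "pos_def_mat A \<longleftrightarrow>
     (\<forall>v\<in>carrier_vec (dim_col A). v \<noteq> 0\<^sub>v (dim_col A) \<longrightarrow> 0 < scalar_prod v (A *\<^sub>v v))"

definition min_eigenvalue :: "real mat \<Rightarrow> real" where
  "min_eigenvalue A = Min {k. eigenvalue A k}"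

definition max_eigenvalue :: "real mat \<Rightarrow> real" where
  "max_eigenvalue A = Max {k. eigenvalue A k}"

definition spectral_norm :: "real mat \<Rightarrow> real" where
  "spectral_norm A = Sup {sqrt (scalar_prod (A *\<^sub>v v) (A *\<^sub>v v)) | v.
     v \<in> carrier_vec (dim_col A) \<and> scalar_prod v v = 1}"

definition condition_number :: "real mat \<Rightarrow> real" where
  "condition_number A = spectral_norm A * spectral_norm (inv_mat A)"

end

theory Submission
  imports Defs
begin

text \<open>Lower bound: \<open>S v\<close> has boundary values \<open>v\<close>, so \<open>|S v| \<ge> |v|\<close>.

  Upper bound: let \<open>y\<close> be the discrete harmonic extension of \<open>v\<close> and \<open>H\<close> the largest element diameter.
  The central estimate is \<open>\<parallel>y\<parallel>\<^sup>2 \<le> C H\<^bsup>d-1\<^esup> |v|\<^sup>2\<close> in \<open>L\<^sup>2(\<Omega>)\<close>. It follows by duality: test \<open>y\<close> against the solution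
  of the Poisson problem with right-hand side \<open>y\<close>. On a Lipschitz domain that solution gains half a
  derivative by Savare's translation argument (compare an energy minimizer with its translates into
  the domain), so its energy in a strip of width \<open>O(H)\<close> and its quasi-interpolation error are bounded
  by \<open>O(\<surd>H) \<parallel>y\<parallel>\<close>; the energy of the extension of \<open>v\<close> by zero is bounded by \<open>O(H\<^bsup>d-2\<^esup>) |v|\<^sup>2\<close>.

  The power of \<open>H\<close> is absorbed by Rayleigh quotients: the vector \<open>1\<close> on the boundary nodes gives
  \<open>\<lambda>\<^sub>1(M) N\<^sub>B \<le> C H\<close>, since the strip of width \<open>H\<close> along the polyhedral boundary has volume \<open>O(H)\<close>; it also gives
  \<open>\<lambda>\<^sub>m\<^sub>a\<^sub>x(B) N\<^sub>B \<ge> |\<Gamma>|\<close>; the indicator of the vertices of a largest element gives \<open>\<lambda>\<^sub>m\<^sub>a\<^sub>x(M) \<ge> c H\<^sup>d\<close>. Hence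
  \<open>H\<^bsup>d-1\<^esup> \<le> C \<lambda>\<^sub>m\<^sub>a\<^sub>x(B) \<lambda>\<^sub>m\<^sub>a\<^sub>x(M) / \<lambda>\<^sub>1(M)\<close> without any quasi-uniformity.\<close>

text \<open>No Sobolev space is built: the Poisson problem enters through functions that minimize
  the energy up to a tolerance, among continuous piecewise smooth functions vanishing outside
  \<Omega>. The tolerance H |f|^2 has the order of the error that the duality argument concedes
  anyway, so no limit is taken.

  Half a derivative is exactly enough: its factor H meets the energy H^(d-2) of the extension of the
  boundary values by zero.

  The obstacle is local refinement, since elements may be much smaller than H. All averages of the
  quasi-interpolation therefore use the one radius H; on a small element two averages differ by a
  term with the factor |x_i - x_j|, which shape regularity turns into a gradient bound. The
  approximate solution is first made to vanish within 2 H of the boundary, so that the averages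
  vanish at every vertex of an element with a boundary node.

  The strict inequalities between extreme eigenvalues come from nonzero off-diagonal entries:
  without them each point would carry a single basis function, and an atomless measure would live on
  finitely many nodes.\<close>

unbundle no vec_syntax and no inner_syntax

section \<open>Symmetric real matrices\<close>

text \<open>Common source of the Cauchy-Schwarz inequalities for vectors, semidefinite forms and
  integrals, and of the approximate Euler-Lagrange equation, where near-minimality makes a quadratic
  polynomial in the step length nonnegative.\<close>

lemma discriminant_nonpos:
  fixes a b c :: real
  assumes "\<And>t. 0 \<le> a + 2 * b * t + c * t\<^sup>2"
  shows "b\<^sup>2 \<le> a * c"
proof (cases "c = 0")
  case True
  have "b = 0"
  proof (rule ccontr)
    assume "b \<noteq> 0"
    with assms[of "- (a + 1) / (2 * b)"] True show False by (simp add: field_simps)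
  qed
  then show ?thesis using True by simp
next
  case False
  have "0 \<le> c"
  proof (rule ccontr)
    assume "\<not> 0 \<le> c"
    then have c: "c < 0" by simp
    \<comment> \<open>A point so far out that the negative quadratic term outweighs the other
      two.\<close>
    define t where "t = (1 + \<bar>a\<bar> + 2 * \<bar>b\<bar>) / (- c) + 1"
    have t: "1 \<le> t" "- c * t \<ge> 1 + \<bar>a\<bar> + 2 * \<bar>b\<bar>"
      using c by (auto simp: t_def field_simps divide_nonneg_neg)
    have "(- c * t) * t \<ge> (1 + \<bar>a\<bar> + 2 * \<bar>b\<bar>) * t" using t by (intro mult_right_mono) auto
    moreover have "(1 + \<bar>a\<bar>) * t \<ge> (1 + \<bar>a\<bar>) * 1" using t by (intro mult_left_mono) auto
    moreover have "2 * b * t \<le> 2 * \<bar>b\<bar> * t" using t by (intro mult_right_mono) auto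
    ultimately have "a + 2 * b * t + c * t\<^sup>2 < 0"
      by (simp add: power2_eq_square algebra_simps)
    with assms[of t] show False by simp
  qed
  with False have "0 < c" by simp
  with assms[of "- b / c"] show ?thesis by (simp add: field_simps power2_eq_square)
qed

lemma scalar_prod_self_nonneg: "0 \<le> scalar_prod v (v :: real vec)"
  unfolding scalar_prod_def by (intro sum_nonneg) auto

lemma scalar_prod_self_pos:
  assumes "v \<in> carrier_vec n" "v \<noteq> 0\<^sub>v n"
  shows "0 < scalar_prod v (v :: real vec)"
proof -
  obtain i where i: "i < n" "v $ i \<noteq> 0"
    using assms by (auto simp: vec_eq_iff)
  then have "0 < v $ i * v $ i" by (simp add: zero_less_mult_iff linorder_neq_iff disj_commute)
  also have "\<dots> \<le> scalar_prod v v"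
    unfolding scalar_prod_def using i assms by (intro member_le_sum) auto
  finally show ?thesis .
qed

lemma scalar_prod_Cauchy_Schwarz:
  assumes "u \<in> carrier_vec n" "v \<in> carrier_vec n"
  shows "(scalar_prod u (v :: real vec))\<^sup>2 \<le> scalar_prod u u * scalar_prod v v"
proof (rule discriminant_nonpos)
  fix t :: real
  have "scalar_prod u u + 2 * scalar_prod u v * t + scalar_prod v v * t\<^sup>2
      = (\<Sum>i\<in>{0..<n}. (u $ i + t * v $ i)\<^sup>2)"
    using assms unfolding scalar_prod_def
    by (simp add: sum_distrib_left sum_distrib_right sum.distrib[symmetric] power2_eq_square algebra_simps)
  then show "0 \<le> scalar_prod u u + 2 * scalar_prod u v * t + scalar_prod v v * t\<^sup>2"
    by (simp add: sum_nonneg)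
qed

lemma mat_vec_bound:
  fixes A :: "real mat"
  assumes "A \<in> carrier_mat m n"
  obtains b where "0 < b"
    "\<And>v. v \<in> carrier_vec n \<Longrightarrow> scalar_prod (A *\<^sub>v v) (A *\<^sub>v v) \<le> b * scalar_prod v v"
proof
  \<comment> \<open>Squared Frobenius norm, so that Cauchy-Schwarz applies row by row; the added 1
    keeps it positive for the zero matrix.\<close>
  define b where "b = 1 + (\<Sum>i\<in>{0..<m}. scalar_prod (row A i) (row A i))"
  show "0 < b" unfolding b_def by (intro add_pos_nonneg sum_nonneg scalar_prod_self_nonneg) auto
  fix v :: "real vec" assume v: "v \<in> carrier_vec n"
  have "scalar_prod (A *\<^sub>v v) (A *\<^sub>v v) = (\<Sum>i\<in>{0..<m}. (scalar_prod (row A i) v)\<^sup>2)"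
    using assms v by (subst scalar_prod_def) (simp add: power2_eq_square)
  also have "\<dots> \<le> (\<Sum>i\<in>{0..<m}. scalar_prod (row A i) (row A i) * scalar_prod v v)"
    using assms v by (intro sum_mono scalar_prod_Cauchy_Schwarz) auto
  also have "\<dots> \<le> b * scalar_prod v v"
    using scalar_prod_self_nonneg[of v] by (simp add: b_def sum_distrib_right distrib_right)
  finally show "scalar_prod (A *\<^sub>v v) (A *\<^sub>v v) \<le> b * scalar_prod v v" .
qed

lemma inv_mat_props:
  assumes "A \<in> carrier_mat n n" "det A \<noteq> 0"
  shows "inv_mat A \<in> carrier_mat n n" "A * inv_mat A = 1\<^sub>m n" "inv_mat A * A = 1\<^sub>m n"
proof -
  obtain B where "mat_inverse A = Some B"
    using mat_inverse(1)[OF assms(1)] det_non_zero_imp_unit[OF assms] by (metis option.exhaust)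
  with mat_inverse(2)[OF assms(1) this]
  show "inv_mat A \<in> carrier_mat n n" "A * inv_mat A = 1\<^sub>m n" "inv_mat A * A = 1\<^sub>m n"
    by (auto simp: inv_mat_def)
qed

lemma inv_mat_props_inj:
  assumes "A \<in> carrier_mat n n" "\<And>v. v \<in> carrier_vec n \<Longrightarrow> A *\<^sub>v v = 0\<^sub>v n \<Longrightarrow> v = 0\<^sub>v n"
  shows "inv_mat A \<in> carrier_mat n n" "A * inv_mat A = 1\<^sub>m n" "inv_mat A * A = 1\<^sub>m n"
  using inv_mat_props[OF assms(1)] assms(2) det_0_iff_vec_prod_zero[OF assms(1)] by blast+

lemma smult_mat_vec:
  assumes "A \<in> carrier_mat m n" "v \<in> carrier_vec n"
  shows "(k \<cdot>\<^sub>m A) *\<^sub>v v = k \<cdot>\<^sub>v (A *\<^sub>v (v :: real vec))"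
  using assms by (intro eq_vecI) auto

lemma scalar_prod_symmetric_mat:
  fixes A :: "real mat"
  assumes "A \<in> carrier_mat n n" "transpose_mat A = A" "u \<in> carrier_vec n" "v \<in> carrier_vec n"
  shows "scalar_prod u (A *\<^sub>v v) = scalar_prod (A *\<^sub>v u) (v :: real vec)"
  using transpose_vec_mult_scalar[OF assms(1,4,3)] assms by simp

lemma psd_Cauchy_Schwarz:
  fixes A :: "real mat"
  assumes A: "A \<in> carrier_mat n n" and sym: "transpose_mat A = A"
    and psd: "\<And>v. v \<in> carrier_vec n \<Longrightarrow> 0 \<le> scalar_prod v (A *\<^sub>v v)"
    and u: "u \<in> carrier_vec n" and v: "v \<in> carrier_vec n"
  shows "(scalar_prod u (A *\<^sub>v v))\<^sup>2 \<le> scalar_prod u (A *\<^sub>v u) * scalar_prod v (A *\<^sub>v v)"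
proof (rule discriminant_nonpos)
  fix t :: real
  have Au: "A *\<^sub>v u \<in> carrier_vec n" and Av: "A *\<^sub>v v \<in> carrier_vec n" using A u v by auto
  have "scalar_prod v (A *\<^sub>v u) = scalar_prod u (A *\<^sub>v v)"
    using scalar_prod_symmetric_mat[OF A sym v u] comm_scalar_prod[OF Av u] by simp
  then have "scalar_prod (u + t \<cdot>\<^sub>v v) (A *\<^sub>v (u + t \<cdot>\<^sub>v v))
      = scalar_prod u (A *\<^sub>v u) + 2 * scalar_prod u (A *\<^sub>v v) * t + scalar_prod v (A *\<^sub>v v) * t\<^sup>2"
    using A u v Au Av
    by (simp add: mult_add_distrib_mat_vec[OF A] mult_mat_vec[OF A] scalar_prod_add_distrib[of _ n]
        add_scalar_prod_distrib[of _ n] power2_eq_square algebra_simps)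
  then show "0 \<le> scalar_prod u (A *\<^sub>v u) + 2 * scalar_prod u (A *\<^sub>v v) * t + scalar_prod v (A *\<^sub>v v) * t\<^sup>2"
    using psd[of "u + t \<cdot>\<^sub>v v"] u v by simp
qed

text \<open>The Cauchy-Schwarz inequality for the form of \<open>A\<close>, applied to \<open>v\<close> and \<open>A v\<close>.\<close>

lemma psd_norm_bound:
  fixes A :: "real mat"
  assumes A: "A \<in> carrier_mat n n" and sym: "transpose_mat A = A"
    and psd: "\<And>v. v \<in> carrier_vec n \<Longrightarrow> 0 \<le> scalar_prod v (A *\<^sub>v v)"
    and bnd: "\<And>v. v \<in> carrier_vec n \<Longrightarrow> scalar_prod v (A *\<^sub>v v) \<le> \<beta> * scalar_prod v v"
    and v: "v \<in> carrier_vec n"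
  shows "scalar_prod (A *\<^sub>v v) (A *\<^sub>v v) \<le> \<beta> * scalar_prod v (A *\<^sub>v (v :: real vec))"
proof -
  let ?w = "A *\<^sub>v v"
  let ?x = "scalar_prod ?w ?w"
  have w: "?w \<in> carrier_vec n" using A v by auto
  have "?x\<^sup>2 \<le> scalar_prod v ?w * scalar_prod ?w (A *\<^sub>v ?w)"
    using psd_Cauchy_Schwarz[OF A sym psd v w] scalar_prod_symmetric_mat[OF A sym v w] by simp
  also have "\<dots> \<le> scalar_prod v ?w * (\<beta> * ?x)"
    using bnd[OF w] psd[OF v] by (intro mult_left_mono) auto
  finally have *: "?x * ?x \<le> (\<beta> * scalar_prod v ?w) * ?x" by (simp add: power2_eq_square mult_ac)
  show ?thesis
  proof (cases "?x = 0")
    case True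
    show ?thesis
    proof (cases "v = 0\<^sub>v n")
      case False
      \<comment> \<open>The sign of \<beta> is not assumed; a nonzero vector forces it through
        \<open>psd\<close> and \<open>bnd\<close>.\<close>
      have "0 \<le> \<beta>"
        using psd[OF v] bnd[OF v] scalar_prod_self_pos[OF v False]
        by (smt (verit) mult_neg_pos)
      then show ?thesis using True psd[OF v] by simp
    qed (use A True v in simp)
  next
    case False
    then have "0 < ?x" using scalar_prod_self_nonneg[of ?w] by simp
    then show ?thesis using * by simp
  qed
qed

text \<open>Neither the spectral theorem nor compactness of the sphere is invoked: m is the infimum
  of the upper bounds of the Rayleigh quotient. Were it no eigenvalue, m I - A would be positive
  semidefinite and invertible, so its form would dominate c |v|^2 with some c > 0, and m - c would
  be a smaller upper bound.\<close>

lemma symmetric_max_eigenvalue_ex: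
  fixes A :: "real mat"
  assumes A: "A \<in> carrier_mat n n" and sym: "transpose_mat A = A" and n: "0 < n"
  obtains m where "eigenvalue A m"
    "\<And>v. v \<in> carrier_vec n \<Longrightarrow> scalar_prod v (A *\<^sub>v v) \<le> m * scalar_prod v v"
proof -
  define S where "S = {s. \<forall>v\<in>carrier_vec n. scalar_prod v (A *\<^sub>v v) \<le> s * scalar_prod v v}"
  obtain b where b: "0 < b"
    "\<And>v. v \<in> carrier_vec n \<Longrightarrow> scalar_prod (A *\<^sub>v v) (A *\<^sub>v v) \<le> b * scalar_prod v v"
    using mat_vec_bound[OF A] by blast
  have "1 + b \<in> S"
    unfolding S_def
  proof safe
    fix v :: "real vec" assume v: "v \<in> carrier_vec n"
    then have Av: "A *\<^sub>v v \<in> carrier_vec n" using A by auto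
    have "(scalar_prod v (A *\<^sub>v v))\<^sup>2 \<le> scalar_prod v v * (b * scalar_prod v v)"
      using scalar_prod_Cauchy_Schwarz[OF v Av] b(2)[OF v] scalar_prod_self_nonneg[of v]
      by (meson mult_left_mono order_trans)
    also have "\<dots> \<le> ((1 + b) * scalar_prod v v)\<^sup>2"
    proof -
      have "b \<le> (1 + b)\<^sup>2" using b by (simp add: power2_eq_square algebra_simps)
      then have "b * (scalar_prod v v)\<^sup>2 \<le> (1 + b)\<^sup>2 * (scalar_prod v v)\<^sup>2" by (intro mult_right_mono) auto
      then show ?thesis by (simp add: power2_eq_square mult_ac)
    qed
    finally show "scalar_prod v (A *\<^sub>v v) \<le> (1 + b) * scalar_prod v v"
      by (rule power2_le_imp_le) (use b scalar_prod_self_nonneg[of v] in simp)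
  qed
  then have ne: "S \<noteq> {}" by auto
  define e :: "real vec" where "e = unit_vec n 0"
  have e: "e \<in> carrier_vec n" "scalar_prod e e = (1::real)"
    using n by (auto simp: e_def scalar_prod_left_unit)
  have "bdd_below S"
    unfolding bdd_below_def S_def using e by (intro exI[of _ "scalar_prod e (A *\<^sub>v e)"]) auto
  define m where "m = Inf S"
  have mS: "scalar_prod v (A *\<^sub>v v) \<le> m * scalar_prod v v" if v: "v \<in> carrier_vec n" for v
  proof (cases "v = 0\<^sub>v n")
    case True then show ?thesis using A by simp
  next
    case False
    then have pos: "0 < scalar_prod v v" using scalar_prod_self_pos v by blast
    have "scalar_prod v (A *\<^sub>v v) / scalar_prod v v \<le> m"
      unfolding m_def using ne pos v by (intro cInf_greatest) (auto simp: S_def divide_le_eq)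
    then show ?thesis using pos by (simp add: divide_le_eq)
  qed
  have "eigenvalue A m"
  proof (rule ccontr)
    assume noe: "\<not> eigenvalue A m"
    define P where "P = m \<cdot>\<^sub>m 1\<^sub>m n - A"
    have P: "P \<in> carrier_mat n n" using A by (intro carrier_matI) (auto simp: P_def)
    have Psym: "transpose_mat P = P"
    proof (rule eq_matI)
      fix i j assume ij: "i < dim_row P" "j < dim_col P"
      have "A $$ (j, i) = A $$ (i, j)" using arg_cong[OF sym, of "\<lambda>B. B $$ (i, j)"] A P ij by auto
      then show "transpose_mat P $$ (i, j) = P $$ (i, j)" using A P ij by (auto simp: P_def)
    qed (use P in auto)
    have Pv: "P *\<^sub>v v = m \<cdot>\<^sub>v v - A *\<^sub>v v" if "v \<in> carrier_vec n" for v
      unfolding P_def using that A by (simp add: minus_mult_distrib_mat_vec[of _ n n] smult_mat_vec[of _ n n])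
    have qP: "scalar_prod v (P *\<^sub>v v) = m * scalar_prod v v - scalar_prod v (A *\<^sub>v v)" if "v \<in> carrier_vec n" for v
      using that A by (simp add: Pv scalar_prod_minus_distrib[of _ n])
    have psd: "0 \<le> scalar_prod v (P *\<^sub>v v)" if "v \<in> carrier_vec n" for v
      using qP[OF that] mS[OF that] by simp
    obtain R where R: "R \<in> carrier_mat n n" "R * P = 1\<^sub>m n"
    proof -
      have "v = 0\<^sub>v n" if v: "v \<in> carrier_vec n" and 0: "P *\<^sub>v v = 0\<^sub>v n" for v
      proof (rule ccontr)
        assume "v \<noteq> 0\<^sub>v n"
        moreover have "A *\<^sub>v v = m \<cdot>\<^sub>v v"
        proof (rule eq_vecI)
          fix i assume i: "i < dim_vec (m \<cdot>\<^sub>v v)"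
          then show "(A *\<^sub>v v) $ i = (m \<cdot>\<^sub>v v) $ i"
            using arg_cong[OF 0[unfolded Pv[OF v]], of "\<lambda>w. w $ i"] v A by auto
        qed (use A v in auto)
        ultimately show False using noe v A unfolding eigenvalue_def eigenvector_def by auto
      qed
      then show ?thesis using that inv_mat_props_inj[OF P] by blast
    qed
    obtain r where r: "0 < r"
      "\<And>v. v \<in> carrier_vec n \<Longrightarrow> scalar_prod (R *\<^sub>v v) (R *\<^sub>v v) \<le> r * scalar_prod v v"
      using mat_vec_bound[OF R(1)] by blast
    obtain \<beta> where \<beta>: "0 < \<beta>" "\<And>v. v \<in> carrier_vec n \<Longrightarrow> scalar_prod v (P *\<^sub>v v) \<le> \<beta> * scalar_prod v v"
    proof
      have "e \<in> carrier_vec n" by (rule e)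
      show "0 < \<bar>m\<bar> + 1 + b" using b by simp
      fix v :: "real vec" assume v: "v \<in> carrier_vec n"
      have Av: "A *\<^sub>v v \<in> carrier_vec n" using A v by auto
      have "- scalar_prod v (A *\<^sub>v v) \<le> (1 + b) * scalar_prod v v"
      proof -
        \<comment> \<open>Twice the mixed term is at least minus the two squares, which bounds the
          form of A from below and hence that of P from above.\<close>
        have "0 \<le> scalar_prod (v + A *\<^sub>v v) (v + A *\<^sub>v v)" by (rule scalar_prod_self_nonneg)
        also have "\<dots> = scalar_prod v v + 2 * scalar_prod v (A *\<^sub>v v) + scalar_prod (A *\<^sub>v v) (A *\<^sub>v v)"
          using v Av comm_scalar_prod[OF Av v] by (simp add: scalar_prod_add_distrib[of _ n] add_scalar_prod_distrib[of _ n])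
        finally have "- (2 * scalar_prod v (A *\<^sub>v v)) \<le> (1 + b) * scalar_prod v v"
          using b(2)[OF v] by (simp add: distrib_right)
        moreover have "0 \<le> (1 + b) * scalar_prod v v"
          using b(1) scalar_prod_self_nonneg[of v] by simp
        ultimately show ?thesis by simp
      qed
      moreover have "m * scalar_prod v v \<le> \<bar>m\<bar> * scalar_prod v v"
        using scalar_prod_self_nonneg[of v] by (intro mult_right_mono) auto
      ultimately show "scalar_prod v (P *\<^sub>v v) \<le> (\<bar>m\<bar> + 1 + b) * scalar_prod v v"
        unfolding qP[OF v] by (simp add: algebra_simps)
    qed
    \<comment> \<open>Invertibility gives |v|^2 \<le> r |P v|^2, and \<open>psd_norm_bound\<close>
      bounds |P v|^2 by \<beta> times the form of P at v.\<close>
    define c where "c = 1 / (r * \<beta>)"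
    have c: "0 < c" using r \<beta> by (simp add: c_def)
    have "m - c \<in> S"
      unfolding S_def
    proof safe
      fix v :: "real vec" assume v: "v \<in> carrier_vec n"
      then have w: "P *\<^sub>v v \<in> carrier_vec n" using P by auto
      have "v = R *\<^sub>v (P *\<^sub>v v)"
        using assoc_mult_mat_vec[OF R(1) P v] R(2) v by simp
      then have "scalar_prod v v \<le> r * scalar_prod (P *\<^sub>v v) (P *\<^sub>v v)" using r(2)[OF w] by simp
      also have "\<dots> \<le> r * (\<beta> * scalar_prod v (P *\<^sub>v v))"
        using psd_norm_bound[OF P Psym psd \<beta>(2) v] r by (intro mult_left_mono) auto
      finally have "c * scalar_prod v v \<le> scalar_prod v (P *\<^sub>v v)"
        using r \<beta> by (simp add: c_def field_simps)
      then show "scalar_prod v (A *\<^sub>v v) \<le> (m - c) * scalar_prod v v"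
        unfolding qP[OF v] by (simp add: algebra_simps)
    qed
    then have "m \<le> m - c" unfolding m_def using \<open>bdd_below S\<close> by (intro cInf_lower)
    then show False using c by simp
  qed
  then show ?thesis using that mS by blast
qed

lemma finite_eigenvalues:
  assumes "(A :: real mat) \<in> carrier_mat n n"
  shows "finite {k. eigenvalue A k}"
proof -
  have "char_poly A \<noteq> 0" using degree_monic_char_poly[OF assms] by auto
  then show ?thesis unfolding eigenvalue_root_char_poly[OF assms] by (rule poly_roots_finite)
qed

text \<open>Turns the existence of a largest eigenvalue of - A into that of a smallest eigenvalue of
  A.\<close>

lemma eigenvalue_uminus:
  assumes A: "(A :: real mat) \<in> carrier_mat n n"
  shows "eigenvalue (- A) k \<longleftrightarrow> eigenvalue A (- k)"
proof -
  have "(- A) *\<^sub>v v = k \<cdot>\<^sub>v v \<longleftrightarrow> A *\<^sub>v v = (- k) \<cdot>\<^sub>v v" if "v \<in> carrier_vec n" for v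
    using that A by (auto simp: vec_eq_iff uminus_mult_mat_vec eq_neg_iff_add_eq_0 minus_equation_iff)
  then show ?thesis using A unfolding eigenvalue_def eigenvector_def by (metis carrier_matD(1) uminus_carrier_iff_mat)
qed

text \<open>\<open>Max\<close> and \<open>Min\<close> range over the roots of the characteristic
  polynomial, a finite set, which is nonempty because an extremal eigenvalue has been constructed.
  The lower bound is the upper bound for - A.\<close>

lemma symmetric_eigenvalue_bounds:
  fixes A :: "real mat"
  assumes A: "A \<in> carrier_mat n n" and sym: "symmetric_mat A" and n: "0 < n"
  shows "eigenvalue A (max_eigenvalue A)" "eigenvalue A (min_eigenvalue A)"
    and "v \<in> carrier_vec n \<Longrightarrow> scalar_prod v (A *\<^sub>v v) \<le> max_eigenvalue A * scalar_prod v v"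
    and "v \<in> carrier_vec n \<Longrightarrow> min_eigenvalue A * scalar_prod v v \<le> scalar_prod v (A *\<^sub>v v)"
proof -
  note fin = finite_eigenvalues[OF A]
  have sym': "transpose_mat A = A" using sym by (simp add: symmetric_mat_def)
  obtain m where m: "eigenvalue A m" "\<And>v. v \<in> carrier_vec n \<Longrightarrow> scalar_prod v (A *\<^sub>v v) \<le> m * scalar_prod v v"
    using symmetric_max_eigenvalue_ex[OF A sym' n] by blast
  have A': "- A \<in> carrier_mat n n" "transpose_mat (- A) = - A"
    using A sym' by (auto simp: transpose_uminus)
  obtain m' where m': "eigenvalue (- A) m'" "\<And>v. v \<in> carrier_vec n \<Longrightarrow> scalar_prod v ((- A) *\<^sub>v v) \<le> m' * scalar_prod v v"
    using symmetric_max_eigenvalue_ex[OF A' n] by blast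
  have ne: "{k. eigenvalue A k} \<noteq> {}" using m by auto
  show "eigenvalue A (max_eigenvalue A)" "eigenvalue A (min_eigenvalue A)"
    using Max_in[OF fin ne] Min_in[OF fin ne] by (auto simp: max_eigenvalue_def min_eigenvalue_def)
  show "scalar_prod v (A *\<^sub>v v) \<le> max_eigenvalue A * scalar_prod v v" if v: "v \<in> carrier_vec n"
  proof -
    have "m \<le> max_eigenvalue A" unfolding max_eigenvalue_def using fin m by (intro Max_ge) auto
    then have "m * scalar_prod v v \<le> max_eigenvalue A * scalar_prod v v"
      using scalar_prod_self_nonneg by (intro mult_right_mono) auto
    then show ?thesis using m(2)[OF v] by simp
  qed
  show "min_eigenvalue A * scalar_prod v v \<le> scalar_prod v (A *\<^sub>v v)" if v: "v \<in> carrier_vec n"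
  proof -
    have "min_eigenvalue A \<le> - m'" unfolding min_eigenvalue_def
      using fin m'(1) eigenvalue_uminus[OF A] by (intro Min_le) auto
    then have "min_eigenvalue A * scalar_prod v v \<le> - m' * scalar_prod v v"
      using scalar_prod_self_nonneg by (intro mult_right_mono) auto
    also have "\<dots> \<le> scalar_prod v (A *\<^sub>v v)"
      using m'(2)[OF v] A v by (simp add: uminus_mult_mat_vec)
    finally show ?thesis .
  qed
qed

lemma quadratic_form_sum:
  assumes "A \<in> carrier_mat n n" "v \<in> carrier_vec n"
  shows "scalar_prod v (A *\<^sub>v v) = (\<Sum>i<n. \<Sum>j<n. v $ i * v $ j * (A $$ (i, j) :: real))"
proof -
  have "scalar_prod v (A *\<^sub>v v) = (\<Sum>i\<in>{0..<n}. v $ i * (\<Sum>j\<in>{0..<n}. A $$ (i, j) * v $ j))"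
    using assms by (subst scalar_prod_def) (auto simp: scalar_prod_def intro!: sum.cong)
  also have "\<dots> = (\<Sum>i<n. \<Sum>j<n. v $ i * v $ j * A $$ (i, j))"
    by (simp add: sum_distrib_left atLeast0LessThan mult_ac)
  finally show ?thesis .
qed

text \<open>If the extreme eigenvalues agreed, the form would be a multiple of |v|^2; its values at
  the unit vectors i and j and at their sum would then force the entry (i, j) to vanish.\<close>

lemma min_eigenvalue_less_max_eigenvalue:
  assumes A: "A \<in> carrier_mat n n" and sym: "symmetric_mat A"
    and ij: "i < n" "j < n" "i \<noteq> j" "A $$ (i, j) \<noteq> 0"
  shows "min_eigenvalue A < max_eigenvalue A"
proof (rule ccontr)
  let ?a = "min_eigenvalue A" and ?b = "max_eigenvalue A"
  assume "\<not> ?a < ?b"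
  then have ba: "?b \<le> ?a" by simp
  have n: "0 < n" using ij by simp
  have q: "scalar_prod v (A *\<^sub>v v) = ?a * scalar_prod v v" if v: "v \<in> carrier_vec n" for v
  proof (rule antisym)
    have "?b * scalar_prod v v \<le> ?a * scalar_prod v v"
      using ba scalar_prod_self_nonneg by (intro mult_right_mono) auto
    then show "scalar_prod v (A *\<^sub>v v) \<le> ?a * scalar_prod v v"
      using symmetric_eigenvalue_bounds(3)[OF A sym n v] by simp
    show "?a * scalar_prod v v \<le> scalar_prod v (A *\<^sub>v v)"
      by (rule symmetric_eigenvalue_bounds(4)[OF A sym n v])
  qed
  have sym': "A $$ (j, i) = A $$ (i, j)"
    using arg_cong[OF sym[unfolded symmetric_mat_def], of "\<lambda>B. B $$ (i, j)"] A ij by simp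
  have e: "unit_vec n k \<in> carrier_vec n" for k :: nat by simp
  have col: "A *\<^sub>v unit_vec n k = col A k" if "k < n" for k
    using A that by (intro eq_vecI) (auto simp: scalar_prod_right_unit)
  have c: "col A k \<in> carrier_vec n" if "k < n" for k using A that by auto
  have entry: "scalar_prod (unit_vec n k) (A *\<^sub>v unit_vec n l) = A $$ (k, l)" if "k < n" "l < n" for k l
    using A that by (simp add: col scalar_prod_left_unit[OF c])
  have one: "scalar_prod (unit_vec n k) (unit_vec n l) = (if k = l then 1 else (0::real))"
    if "k < n" "l < n" for k l
    using that by (simp add: scalar_prod_left_unit[of _ n])
  let ?v = "unit_vec n i + unit_vec n j :: real vec"
  have "scalar_prod ?v (A *\<^sub>v ?v) = A $$ (i, i) + A $$ (j, j) + 2 * A $$ (i, j)"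
    using ij A sym' c
    by (simp add: mult_add_distrib_mat_vec[OF A] scalar_prod_add_distrib[of _ n] add_scalar_prod_distrib[of _ n]
        entry) 
  moreover have "scalar_prod ?v ?v = 2"
    using ij by (simp add: scalar_prod_add_distrib[of _ n] add_scalar_prod_distrib[of _ n] one)
  moreover have "A $$ (k, k) = ?a" if "k < n" for k
    using q[OF e, of k] entry[OF that that] one[OF that that] by simp
  ultimately show False using q[of ?v] ij by simp
qed

text \<open>Both norms are bounded straight from the form: \<open>psd_norm_bound\<close> gives |A v|
  \<le> \<beta> on unit vectors, and Cauchy-Schwarz turns the lower form bound into |A v| \<ge>
  \<alpha> |v|, which bounds the inverse.\<close>

lemma condition_number_le:
  fixes A :: "real mat"
  assumes A: "A \<in> carrier_mat n n" and sym: "symmetric_mat A" and n: "0 < n" and \<alpha>: "0 < \<alpha>"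
    and lower: "\<And>v. v \<in> carrier_vec n \<Longrightarrow> \<alpha> * scalar_prod v v \<le> scalar_prod v (A *\<^sub>v v)"
    and upper: "\<And>v. v \<in> carrier_vec n \<Longrightarrow> scalar_prod v (A *\<^sub>v v) \<le> \<beta> * scalar_prod v v"
  shows "condition_number A \<le> \<beta> / \<alpha>"
proof -
  have sym': "transpose_mat A = A" using sym by (simp add: symmetric_mat_def)
  have psd: "0 \<le> scalar_prod v (A *\<^sub>v v)" if "v \<in> carrier_vec n" for v
    using lower[OF that] \<alpha> scalar_prod_self_nonneg[of v] by (meson mult_nonneg_nonneg less_imp_le order_trans)
  define e :: "real vec" where "e = unit_vec n 0"
  have e: "e \<in> carrier_vec n" "scalar_prod e e = 1"
    using n by (auto simp: e_def scalar_prod_left_unit)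
  have \<beta>: "0 \<le> \<beta>" using upper[OF e(1)] psd[OF e(1)] e(2) by simp
  have norm_A: "scalar_prod (A *\<^sub>v v) (A *\<^sub>v v) \<le> \<beta>\<^sup>2" if v: "v \<in> carrier_vec n" "scalar_prod v v = 1" for v
  proof -
    have "scalar_prod (A *\<^sub>v v) (A *\<^sub>v v) \<le> \<beta> * scalar_prod v (A *\<^sub>v v)"
      by (rule psd_norm_bound[OF A sym' psd upper v(1)])
    also have "\<dots> \<le> \<beta> * \<beta>" using upper[OF v(1)] v(2) \<beta> by (intro mult_left_mono) auto
    finally show ?thesis by (simp add: power2_eq_square)
  qed
  have sp_A: "spectral_norm A \<le> \<beta>"
    unfolding spectral_norm_def
  proof (rule cSup_least)
    show "{sqrt (scalar_prod (A *\<^sub>v v) (A *\<^sub>v v)) | v. v \<in> carrier_vec (dim_col A) \<and> scalar_prod v v = 1} \<noteq> {}"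
      using e A by auto
  qed (use norm_A A \<beta> in \<open>auto intro!: real_le_lsqrt\<close>)
  have ge: "\<alpha>\<^sup>2 * scalar_prod v v \<le> scalar_prod (A *\<^sub>v v) (A *\<^sub>v v)" if v: "v \<in> carrier_vec n" for v
  proof (cases "v = 0\<^sub>v n")
    case False
    let ?x = "scalar_prod v v"
    have x: "0 < ?x" by (rule scalar_prod_self_pos[OF v False])
    have Av: "A *\<^sub>v v \<in> carrier_vec n" using A v by auto
    have "(\<alpha> * ?x)\<^sup>2 \<le> (scalar_prod v (A *\<^sub>v v))\<^sup>2"
      using lower[OF v] \<alpha> x by (intro power_mono) auto
    also have "\<dots> \<le> ?x * scalar_prod (A *\<^sub>v v) (A *\<^sub>v v)" by (rule scalar_prod_Cauchy_Schwarz[OF v Av])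
    finally have "?x * (\<alpha>\<^sup>2 * ?x) \<le> ?x * scalar_prod (A *\<^sub>v v) (A *\<^sub>v v)"
      by (simp add: power2_eq_square mult_ac)
    then show ?thesis using x by simp
  qed (use A scalar_prod_self_nonneg in simp)
  have "v = 0\<^sub>v n" if v: "v \<in> carrier_vec n" "A *\<^sub>v v = 0\<^sub>v n" for v
  proof (rule ccontr)
    assume "v \<noteq> 0\<^sub>v n"
    then have "0 < \<alpha>\<^sup>2 * scalar_prod v v" using scalar_prod_self_pos[OF v(1)] \<alpha> by simp
    then show False using ge[OF v(1)] v(2) by simp
  qed
  note inv = inv_mat_props_inj[OF A this]
  have norm_inv: "scalar_prod (inv_mat A *\<^sub>v v) (inv_mat A *\<^sub>v v) \<le> (1 / \<alpha>)\<^sup>2"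
    if v: "v \<in> carrier_vec n" "scalar_prod v v = 1" for v
  proof -
    have w: "inv_mat A *\<^sub>v v \<in> carrier_vec n" using inv v by auto
    have "A *\<^sub>v (inv_mat A *\<^sub>v v) = v"
      using assoc_mult_mat_vec[OF A inv(1) v(1)] inv(2) v by simp
    then show ?thesis using ge[OF w] v \<alpha> by (simp add: field_simps power2_eq_square)
  qed
  have sp_inv: "spectral_norm (inv_mat A) \<le> 1 / \<alpha>"
    unfolding spectral_norm_def
  proof (rule cSup_least)
    show "{sqrt (scalar_prod (inv_mat A *\<^sub>v v) (inv_mat A *\<^sub>v v)) | v.
        v \<in> carrier_vec (dim_col (inv_mat A)) \<and> scalar_prod v v = 1} \<noteq> {}"
      using e inv(1) by auto
  qed (use norm_inv inv(1) \<alpha> in \<open>auto intro!: real_le_lsqrt\<close>)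
  \<comment> \<open>Needed to multiply the two norm bounds. As a \<open>Sup\<close> it is
    nonnegative because the set is bounded above and has a nonnegative member.\<close>
  have "0 \<le> spectral_norm (inv_mat A)"
    unfolding spectral_norm_def
  proof (rule cSup_upper2)
    show "sqrt (scalar_prod (inv_mat A *\<^sub>v e) (inv_mat A *\<^sub>v e)) \<in> {sqrt (scalar_prod (inv_mat A *\<^sub>v v) (inv_mat A *\<^sub>v v)) | v.
        v \<in> carrier_vec (dim_col (inv_mat A)) \<and> scalar_prod v v = 1}"
      using e inv(1) by auto
    show "bdd_above {sqrt (scalar_prod (inv_mat A *\<^sub>v v) (inv_mat A *\<^sub>v v)) | v.
        v \<in> carrier_vec (dim_col (inv_mat A)) \<and> scalar_prod v v = 1}"
      using norm_inv inv(1) \<alpha> by (auto intro!: bdd_aboveI[of _ "1 / \<alpha>"] real_le_lsqrt)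
  qed (simp add: scalar_prod_self_nonneg)
  then have "spectral_norm A * spectral_norm (inv_mat A) \<le> \<beta> * (1 / \<alpha>)"
    using sp_A sp_inv \<beta> by (intro mult_mono) auto
  then show ?thesis by (simp add: condition_number_def)
qed

section \<open>Piecewise smooth functions and translations\<close>

text \<open>A class closed under sums, products, inner products and translations whose members are
  integrable over the whole space, so that integrability of most integrands is automatic.\<close>

definition bbs :: "('a::euclidean_space \<Rightarrow> 'b::euclidean_space) \<Rightarrow> bool" where
  "bbs f \<longleftrightarrow> f \<in> borel_measurable borel \<and> (\<exists>B. \<forall>x. norm (f x) \<le> B) \<and> (\<exists>R. \<forall>x. f x \<noteq> 0 \<longrightarrow> norm x \<le> R)"

lemma bbsI:
  assumes "f \<in> borel_measurable borel" "\<And>x. norm (f x) \<le> B" "\<And>x. f x \<noteq> 0 \<Longrightarrow> norm x \<le> R"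
  shows "bbs f"
  using assms unfolding bbs_def by blast

lemma bbsE:
  assumes "bbs f"
  obtains B R where "f \<in> borel_measurable borel" "0 \<le> B" "\<And>x. norm (f x) \<le> B"
    "0 \<le> R" "\<And>x. f x \<noteq> 0 \<Longrightarrow> norm x \<le> R"
proof -
  obtain B R where "\<And>x. norm (f x) \<le> B" "\<And>x. f x \<noteq> 0 \<Longrightarrow> norm x \<le> R"
    using assms unfolding bbs_def by blast
  moreover have "norm (f x) \<le> \<bar>B\<bar>" "f x \<noteq> 0 \<Longrightarrow> norm x \<le> \<bar>R\<bar>" for x
    using calculation[of x] by auto
  ultimately show ?thesis using assms that[of "\<bar>B\<bar>" "\<bar>R\<bar>"] unfolding bbs_def by auto
qed

lemma bbs_measurable [measurable_dest]: "bbs f \<Longrightarrow> f \<in> borel_measurable borel"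
  by (simp add: bbs_def)

lemma bbs_integrable: "bbs f \<Longrightarrow> integrable lborel f"
proof (elim bbsE)
  fix B R assume f: "f \<in> borel_measurable borel" "\<And>x. norm (f x) \<le> B" "\<And>x. f x \<noteq> 0 \<Longrightarrow> norm x \<le> R"
  have fin: "emeasure lborel (cball 0 R :: 'a set) < \<infinity>"
    by (rule emeasure_bounded_finite) simp
  show "integrable lborel f"
    by (rule integrableI_bounded_set[where A="cball 0 R" and B=B, OF _ _ fin])
       (use f in \<open>auto intro!: AE_I2\<close>)
qed

lemma bbs_add [intro]: "bbs f \<Longrightarrow> bbs g \<Longrightarrow> bbs (\<lambda>x. f x + g x)"
proof (elim bbsE)
  fix B B' R R' assume f: "f \<in> borel_measurable borel" "\<And>x. norm (f x) \<le> B" "\<And>x. f x \<noteq> 0 \<Longrightarrow> norm x \<le> R"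
    and g: "g \<in> borel_measurable borel" "\<And>x. norm (g x) \<le> B'" "\<And>x. g x \<noteq> 0 \<Longrightarrow> norm x \<le> R'"
  show "bbs (\<lambda>x. f x + g x)"
  proof (rule bbsI)
    show "(\<lambda>x. f x + g x) \<in> borel_measurable borel" using f g by auto
    show "norm (f x + g x) \<le> B + B'" for x using f(2) g(2) norm_triangle_mono by blast
    show "norm x \<le> max R R'" if "f x + g x \<noteq> 0" for x using f(3)[of x] g(3)[of x] that by fastforce
  qed
qed

lemma bbs_scale:
  assumes "bbs f" "(g :: 'a::euclidean_space \<Rightarrow> real) \<in> borel_measurable borel" "\<And>x. \<bar>g x\<bar> \<le> C"
  shows "bbs (\<lambda>x. g x *\<^sub>R f x)"
  using assms(1)
proof (elim bbsE)
  fix B R assume f: "f \<in> borel_measurable borel" "0 \<le> B" "\<And>x. norm (f x) \<le> B" "\<And>x. f x \<noteq> 0 \<Longrightarrow> norm x \<le> R"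
  have C: "0 \<le> C" using assms(3)[of 0] by simp
  show ?thesis
  proof (rule bbsI)
    show "(\<lambda>x. g x *\<^sub>R f x) \<in> borel_measurable borel" using f assms(2) by auto
    show "norm (g x *\<^sub>R f x) \<le> C * B" for x using f(3) assms(3) C by (simp add: mult_mono)
  qed (use f(4) in auto)
qed

lemma bbs_scale':
  assumes "bbs (f :: 'a::euclidean_space \<Rightarrow> real)" "g \<in> borel_measurable borel" "\<And>x. norm (g x) \<le> C"
  shows "bbs (\<lambda>x. f x *\<^sub>R g x)"
  using assms(1)
proof (elim bbsE)
  fix B R assume f: "f \<in> borel_measurable borel" "0 \<le> B" "\<And>x. norm (f x) \<le> B" "\<And>x. f x \<noteq> 0 \<Longrightarrow> norm x \<le> R"
  have C: "0 \<le> C" using assms(3)[of 0] norm_ge_zero order_trans by blast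
  show ?thesis
  proof (rule bbsI)
    show "(\<lambda>x. f x *\<^sub>R g x) \<in> borel_measurable borel" using f assms(2) by auto
    show "norm (f x *\<^sub>R g x) \<le> B * C" for x using f(2,3) assms(3) C by (auto intro!: mult_mono)
  qed (use f(4) in auto)
qed

lemma bbs_cmult [intro]: "bbs f \<Longrightarrow> bbs (\<lambda>x. (c::real) *\<^sub>R f x)"
  by (rule bbs_scale[where C="\<bar>c\<bar>"]) auto

lemma bbs_cmult_real [intro]: "bbs f \<Longrightarrow> bbs (\<lambda>x. (c::real) * f x)"
  using bbs_cmult[of f c] by simp

lemma bbs_uminus [intro]: "bbs f \<Longrightarrow> bbs (\<lambda>x. - f x)"
  using bbs_cmult[of f "-1"] by simp

lemma bbs_diff [intro]: "bbs f \<Longrightarrow> bbs g \<Longrightarrow> bbs (\<lambda>x. f x - g x)"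
  using bbs_add[of f "\<lambda>x. - g x"] bbs_uminus[of g] by simp

lemma bbs_sum [intro]: "(\<And>i. i \<in> I \<Longrightarrow> bbs (f i)) \<Longrightarrow> bbs (\<lambda>x. \<Sum>i\<in>I. f i x)"
proof (induction I rule: infinite_finite_induct)
  case (insert i I) then show ?case by auto
qed (auto intro: bbsI[of _ 0 0])

lemma bbs_inner [intro]: "bbs f \<Longrightarrow> bbs g \<Longrightarrow> bbs (\<lambda>x. inner (f x) (g x))"
proof (elim bbsE)
  fix B B' R R' assume f: "f \<in> borel_measurable borel" "0 \<le> B" "\<And>x. norm (f x) \<le> B" "\<And>x. f x \<noteq> 0 \<Longrightarrow> norm x \<le> R"
    and g: "g \<in> borel_measurable borel" "\<And>x. norm (g x) \<le> B'"
  show "bbs (\<lambda>x. inner (f x) (g x))"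
  proof (rule bbsI)
    show "(\<lambda>x. inner (f x) (g x)) \<in> borel_measurable borel" using f g by auto
    show "norm (inner (f x) (g x)) \<le> B * B'" for x
      using Cauchy_Schwarz_ineq2[of "f x" "g x"] mult_mono[OF f(3) g(2), of x x] f(2) by simp
    show "norm x \<le> R" if "inner (f x) (g x) \<noteq> 0" for x using f(4)[of x] that by fastforce
  qed
qed

lemma bbs_mult [intro]: "bbs f \<Longrightarrow> bbs g \<Longrightarrow> bbs (\<lambda>x. f x * g x :: real)"
  using bbs_inner[of f g] by simp

lemma bbs_norm2 [intro]: "bbs f \<Longrightarrow> bbs (\<lambda>x. (norm (f x))\<^sup>2)"
  using bbs_inner[of f f] by (simp add: power2_norm_eq_inner)

lemma bbs_power2 [intro]: "bbs f \<Longrightarrow> bbs (\<lambda>x. (f x)\<^sup>2 :: real)"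
  using bbs_mult[of f f] by (simp add: power2_eq_square)

lemma bbs_shift [intro]: "bbs f \<Longrightarrow> bbs (\<lambda>x. f (x + z))"
proof (elim bbsE)
  fix B R assume f: "f \<in> borel_measurable borel" "\<And>x. norm (f x) \<le> B" "\<And>x. f x \<noteq> 0 \<Longrightarrow> norm x \<le> R"
  show ?thesis
  proof (rule bbsI)
    show "(\<lambda>x. f (x + z)) \<in> borel_measurable borel" using f by measurable
    show "norm x \<le> R + norm z" if "f (x + z) \<noteq> 0" for x
      using f(3)[OF that] norm_triangle_ineq4[of "x + z" z] by simp
  qed (use f in auto)
qed

lemma bbs_shift_minus [intro]: "bbs f \<Longrightarrow> bbs (\<lambda>x. f (x - z))"
  using bbs_shift[of f "- z"] by simp

lemma bbs_indicator:
  assumes "S \<in> sets borel" "bounded S" "f \<in> borel_measurable borel" "\<And>x. x \<in> S \<Longrightarrow> norm (f x) \<le> B"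
  shows "bbs (\<lambda>x. indicator S x *\<^sub>R f x)"
proof -
  obtain R where R: "\<And>x. x \<in> S \<Longrightarrow> norm x \<le> R" using assms(2) unfolding bounded_iff by blast
  show ?thesis
  proof (rule bbsI)
    show "norm (indicator S x *\<^sub>R f x) \<le> max 0 B" for x
      using assms(4)[of x] order_trans[OF _ max.cobounded2[of B 0]] by (cases "x \<in> S") auto
  qed (use assms R in \<open>auto split: split_indicator_asm\<close>)
qed

lemma bbs_continuous:
  assumes "continuous_on UNIV f" "bounded S" "\<And>x. x \<notin> S \<Longrightarrow> f x = 0"
  shows "bbs f"
proof -
  obtain R where R: "\<And>x. x \<in> S \<Longrightarrow> norm x \<le> R" using assms(2) unfolding bounded_iff by blast
  have "bounded (f ` cball 0 R)"
    using assms(1) by (intro compact_imp_bounded compact_continuous_image) (auto intro: continuous_on_subset)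
  then obtain B where B: "\<And>x. x \<in> cball 0 R \<Longrightarrow> norm (f x) \<le> B" unfolding bounded_iff by blast
  show ?thesis
  proof (rule bbsI)
    show "norm (f x) \<le> max 0 B" for x
      using assms(3)[of x] R[of x] B[of x] order_trans[OF _ max.cobounded2[of B 0]]
      by (cases "x \<in> S") auto
    show "f \<in> borel_measurable borel" using assms(1) by (rule borel_measurable_continuous_onI)
  qed (use assms(3) R in blast)
qed

lemma integral_shift:
  fixes f :: "'a::euclidean_space \<Rightarrow> 'b::euclidean_space"
  shows "(\<integral>x. f (x + z) \<partial>lborel) = (\<integral>x. f x \<partial>lborel)"
proof (cases "f \<in> borel_measurable borel")
  case True
  have "(\<integral>x. f x \<partial>lborel) = (\<integral>x. f x \<partial>(distr lborel borel ((+) z)))" by (simp add: lborel_distr_plus)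
  also have "\<dots> = (\<integral>x. f (z + x) \<partial>lborel)" using True by (intro integral_distr) auto
  finally show ?thesis by (simp add: add.commute)
next
  \<comment> \<open>Translation preserves non-measurability, so both integrals take the default
    value 0.\<close>
  case False
  have "\<not> (\<lambda>x. f (x + z)) \<in> borel_measurable borel"
  proof
    assume a: "(\<lambda>x. f (x + z)) \<in> borel_measurable borel"
    have "(\<lambda>x. (\<lambda>x. f (x + z)) (x - z)) \<in> borel_measurable borel" using a by measurable
    then show False using False by simp
  qed
  then have "\<not> integrable lborel (\<lambda>x. f (x + z))" "\<not> integrable lborel f"
    using False borel_measurable_integrable by fastforce+
  then show ?thesis by (simp add: not_integrable_integral_eq)
qed

lemma integral_shift_minus:
  fixes f :: "'a::euclidean_space \<Rightarrow> 'b::euclidean_space"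
  shows "(\<integral>x. f (x - z) \<partial>lborel) = (\<integral>x. f x \<partial>lborel)"
  using integral_shift[of f "- z"] by simp

lemma bbs_integral_mono:
  fixes f g :: "'a::euclidean_space \<Rightarrow> real"
  assumes "bbs f" "bbs g" "\<And>x. f x \<le> g x"
  shows "(\<integral>x. f x \<partial>lborel) \<le> (\<integral>x. g x \<partial>lborel)"
  using assms by (intro integral_mono bbs_integrable) auto

section \<open>Exceptional sets: finite unions of hyperplanes\<close>

definition thin :: "'a::euclidean_space set \<Rightarrow> bool" where
  "thin N \<longleftrightarrow> (\<exists>F. finite F \<and> (\<forall>(a, b)\<in>F. a \<noteq> 0) \<and> N \<subseteq> (\<Union>(a, b)\<in>F. {x. inner a x = b}))"

lemma thin_subset: "thin N \<Longrightarrow> M \<subseteq> N \<Longrightarrow> thin M"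
  unfolding thin_def by (meson order_trans)

lemma thin_empty [simp]: "thin {}"
  unfolding thin_def by (intro exI[of _ "{}"]) auto

lemma thin_Un: "thin M \<Longrightarrow> thin N \<Longrightarrow> thin (M \<union> N)"
proof -
  assume "thin M" "thin N"
  then obtain F G where "finite F" "\<forall>(a, b)\<in>F. a \<noteq> 0" "M \<subseteq> (\<Union>(a, b)\<in>F. {x. inner a x = b})"
    "finite G" "\<forall>(a, b)\<in>G. a \<noteq> 0" "N \<subseteq> (\<Union>(a, b)\<in>G. {x. inner a x = b})"
    unfolding thin_def by blast
  then show ?thesis unfolding thin_def by (intro exI[of _ "F \<union> G"]) blast
qed

lemma thin_UN: "finite I \<Longrightarrow> (\<And>i. i \<in> I \<Longrightarrow> thin (N i)) \<Longrightarrow> thin (\<Union>i\<in>I. N i)"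
  by (induction I rule: finite_induct) (auto intro: thin_Un)

lemma thin_translate: "thin N \<Longrightarrow> thin {x. x - z \<in> N}"
proof -
  assume "thin N"
  then obtain F where F: "finite F" "\<forall>(a, b)\<in>F. a \<noteq> 0" "N \<subseteq> (\<Union>(a, b)\<in>F. {x. inner a x = b})"
    unfolding thin_def by blast
  show ?thesis unfolding thin_def
  proof (intro exI conjI)
    show "finite ((\<lambda>(a, b). (a, b + inner a z)) ` F)" using F(1) by simp
    show "\<forall>(a, b)\<in>(\<lambda>(a, b). (a, b + inner a z)) ` F. a \<noteq> 0" using F(2) by fastforce
    show "{x. x - z \<in> N} \<subseteq> (\<Union>(a, b)\<in>(\<lambda>(a, b). (a, b + inner a z)) ` F. {x. inner a x = b})"
    proof
      fix x assume "x \<in> {x. x - z \<in> N}"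
      then obtain a b where ab: "(a, b) \<in> F" "inner a (x - z) = b" using F(3) by blast
      have "(a, b + inner a z) \<in> (\<lambda>(a, b). (a, b + inner a z)) ` F"
        using imageI[OF ab(1), of "\<lambda>(a, b). (a, b + inner a z)"] by simp
      then show "x \<in> (\<Union>(a, b)\<in>(\<lambda>(a, b). (a, b + inner a z)) ` F. {x. inner a x = b})"
        by (rule UN_I) (use ab(2) in \<open>simp add: inner_diff_right\<close>)
    qed
  qed
qed

lemma thin_negligible: "thin N \<Longrightarrow> negligible N"
proof -
  assume "thin N"
  then obtain F where F: "finite F" "\<forall>(a, b)\<in>F. a \<noteq> 0" "N \<subseteq> (\<Union>(a, b)\<in>F. {x. inner a x = b})"
    unfolding thin_def by blast
  have "negligible (\<Union>(a, b)\<in>F. {x. inner a x = b})"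
    using F(1,2) by (intro negligible_Union) (auto intro!: negligible_hyperplane)
  then show ?thesis using F(3) negligible_subset by blast
qed

lemma thin_AE:
  assumes "thin N"
  shows "AE x in lborel. x \<notin> N"
proof -
  obtain F where F: "finite F" "\<forall>(a, b)\<in>F. a \<noteq> 0" "N \<subseteq> (\<Union>(a, b)\<in>F. {x. inner a x = b})"
    using assms unfolding thin_def by blast
  \<comment> \<open>\<open>N\<close> itself need not be Borel; the union of hyperplanes covering it
    is closed.\<close>
  let ?U = "\<Union>(a, b)\<in>F. {x. inner a x = b}"
  have "closed ?U" using F(1) by (intro closed_UN) (auto simp: closed_hyperplane)
  moreover have "thin ?U" unfolding thin_def using F by blast
  ultimately have "?U \<in> null_sets lborel"
    using thin_negligible[of ?U] by (simp add: negligible_iff_null_sets null_sets_completion_iff borel_closed)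
  then have "AE x in lborel. x \<notin> ?U" by (rule AE_not_in)
  then show ?thesis by (rule eventually_mono) (use F(3) in blast)
qed

text \<open>The reason for hyperplanes instead of arbitrary null sets: a line parallel to a
  hyperplane lies in it for almost no x and otherwise misses it, and any other line meets it once.
  The fundamental theorem of calculus along lines then has only finitely many exceptional
  parameters.\<close>

lemma thin_line_finite:
  assumes "thin N"
  shows "AE x in lborel. finite {s::real. x + s *\<^sub>R z \<in> N}"
proof -
  obtain F where F: "finite F" "\<forall>(a, b)\<in>F. a \<noteq> 0" "N \<subseteq> (\<Union>(a, b)\<in>F. {x. inner a x = b})"
    using assms unfolding thin_def by blast
  have "thin (\<Union>(a, b)\<in>F. {x. inner a x = b})" unfolding thin_def using F by blast
  from thin_AE[OF this] show ?thesis
  proof eventually_elim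
    fix x assume x: "x \<notin> (\<Union>(a, b)\<in>F. {x. inner a x = b})"
    have "finite {s. inner a (x + s *\<^sub>R z) = b}" if "(a, b) \<in> F" for a b
    proof (cases "inner a z = 0")
      case True
      then have "{s. inner a (x + s *\<^sub>R z) = b} = {}" using x that by (auto simp: inner_add_right)
      then show ?thesis by simp
    next
      case False
      then have "{s. inner a (x + s *\<^sub>R z) = b} \<subseteq> {(b - inner a x) / inner a z}"
        by (auto simp: inner_add_right field_simps)
      then show ?thesis using finite_subset by blast
    qed
    then have "finite (\<Union>(a, b)\<in>F. {s. inner a (x + s *\<^sub>R z) = b})" using F(1) by auto
    then show "finite {s. x + s *\<^sub>R z \<in> N}" by (rule rev_finite_subset) (use F(3) in blast)
  qed
qed

section \<open>Continuous functions with a piecewise gradient, and their increments\<close>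

definition pw_grad :: "('a::euclidean_space \<Rightarrow> real) \<Rightarrow> ('a \<Rightarrow> 'a) \<Rightarrow> bool" where
  "pw_grad \<phi> G \<longleftrightarrow> continuous_on UNIV \<phi> \<and> (\<exists>N. thin N \<and> (\<forall>x. x \<notin> N \<longrightarrow> GDERIV \<phi> x :> G x))"

lemma pw_grad_add:
  assumes "pw_grad \<phi> G" "pw_grad \<psi> K"
  shows "pw_grad (\<lambda>x. \<phi> x + \<psi> x) (\<lambda>x. G x + K x)"
proof -
  obtain M N where "thin M" "thin N" "\<And>x. x \<notin> M \<Longrightarrow> GDERIV \<phi> x :> G x" "\<And>x. x \<notin> N \<Longrightarrow> GDERIV \<psi> x :> K x"
    using assms unfolding pw_grad_def by blast
  then show ?thesis using assms unfolding pw_grad_def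
    by (auto intro!: continuous_intros exI[of _ "M \<union> N"] thin_Un GDERIV_add)
qed

lemma pw_grad_mult:
  assumes "pw_grad \<phi> G" "pw_grad \<psi> K"
  shows "pw_grad (\<lambda>x. \<phi> x * \<psi> x) (\<lambda>x. \<phi> x *\<^sub>R K x + \<psi> x *\<^sub>R G x)"
proof -
  obtain M N where "thin M" "thin N" "\<And>x. x \<notin> M \<Longrightarrow> GDERIV \<phi> x :> G x" "\<And>x. x \<notin> N \<Longrightarrow> GDERIV \<psi> x :> K x"
    using assms unfolding pw_grad_def by blast
  then show ?thesis using assms unfolding pw_grad_def
    by (auto intro!: continuous_intros exI[of _ "M \<union> N"] thin_Un GDERIV_mult)
qed

lemma pw_grad_const: "pw_grad (\<lambda>x. c) (\<lambda>x. 0)"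
  unfolding pw_grad_def by (auto intro!: exI[of _ "{}"] GDERIV_const)

lemma pw_grad_cmult: "pw_grad \<phi> G \<Longrightarrow> pw_grad (\<lambda>x. c * \<phi> x) (\<lambda>x. c *\<^sub>R G x)"
  using pw_grad_mult[OF pw_grad_const[of c], of \<phi> G] by simp

lemma pw_grad_diff: "pw_grad \<phi> G \<Longrightarrow> pw_grad \<psi> K \<Longrightarrow> pw_grad (\<lambda>x. \<phi> x - \<psi> x) (\<lambda>x. G x - K x)"
  using pw_grad_add[OF _ pw_grad_cmult[of \<psi> K "-1"], of \<phi> G] by simp

lemma pw_grad_shift:
  assumes "pw_grad \<phi> G"
  shows "pw_grad (\<lambda>x. \<phi> (x - z)) (\<lambda>x. G (x - z))"
proof -
  obtain N where N: "thin N" "\<And>x. x \<notin> N \<Longrightarrow> GDERIV \<phi> x :> G x"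
    using assms unfolding pw_grad_def by blast
  have "GDERIV (\<lambda>x. \<phi> (x - z)) x :> G (x - z)" if "x - z \<notin> N" for x
  proof -
    have "((\<lambda>x. x - z) has_derivative (\<lambda>h. h)) (at x)" by (auto intro!: derivative_eq_intros)
    then have "((\<phi> \<circ> (\<lambda>x. x - z)) has_derivative ((\<lambda>h. inner h (G (x - z))) \<circ> (\<lambda>h. h))) (at x)"
      using N(2)[OF that] unfolding gderiv_def by (intro diff_chain_at) auto
    then show ?thesis unfolding gderiv_def by (simp add: o_def)
  qed
  moreover have "continuous_on UNIV (\<lambda>x. \<phi> (x - z))"
    by (rule continuous_on_compose2[of UNIV \<phi> UNIV "\<lambda>x. x - z"])
      (use assms in \<open>auto simp: pw_grad_def intro!: continuous_intros\<close>)
  ultimately show ?thesis unfolding pw_grad_def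
    using thin_translate[OF N(1), of z] by (auto intro!: exI[of _ "{x. x - z \<in> N}"])
qed

text \<open>The fundamental theorem of calculus along the segment, then Jensen on [0, 1]. Continuity
  of \<phi> across the thin set is what lets G represent the increments. The vector c is subtracted
  so that the same estimate later compares \<phi> with a linear function.\<close>

lemma pw_grad_line_ineq:
  fixes G :: "'a::euclidean_space \<Rightarrow> 'a"
  assumes "pw_grad \<phi> G" and G: "G \<in> borel_measurable borel" "\<And>x. norm (G x) \<le> B"
  shows "AE x in lborel. (\<phi> (x + z) - \<phi> x - inner c z)\<^sup>2
    \<le> (norm z)\<^sup>2 * (\<integral>s. indicator {0..1} s * (norm (G (x + s *\<^sub>R z) - c))\<^sup>2 \<partial>lborel)"
proof -
  obtain N where N: "thin N" "\<And>x. x \<notin> N \<Longrightarrow> GDERIV \<phi> x :> G x" and cont: "continuous_on UNIV \<phi>"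
    using assms(1) unfolding pw_grad_def by blast
  from thin_line_finite[OF N(1), of z] show ?thesis
  proof eventually_elim
    fix x assume fin: "finite {s. x + s *\<^sub>R z \<in> N}"
    define h where "h s = inner z (G (x + s *\<^sub>R z) - c)" for s :: real
    define D where "D = \<phi> (x + z) - \<phi> x - inner c z"
    have "((\<lambda>s. \<phi> (x + s *\<^sub>R z) - s * inner c z) has_vector_derivative h s) (at s)"
      if "s \<notin> {s. x + s *\<^sub>R z \<in> N}" for s
    proof -
      have "((\<lambda>s. x + s *\<^sub>R z) has_derivative (\<lambda>r. r *\<^sub>R z)) (at s)"
        by (auto intro!: derivative_eq_intros)
      moreover have "(\<phi> has_derivative (\<lambda>r. inner r (G (x + s *\<^sub>R z)))) (at (x + s *\<^sub>R z))"
        using N(2) that unfolding gderiv_def by auto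
      ultimately have "((\<phi> \<circ> (\<lambda>s. x + s *\<^sub>R z)) has_derivative ((\<lambda>r. inner r (G (x + s *\<^sub>R z))) \<circ> (\<lambda>r. r *\<^sub>R z))) (at s)"
        by (rule diff_chain_at)
      then have "((\<lambda>s. \<phi> (x + s *\<^sub>R z)) has_derivative (\<lambda>r. r * inner z (G (x + s *\<^sub>R z)))) (at s)"
        by (simp add: o_def)
      then have "((\<lambda>s. \<phi> (x + s *\<^sub>R z) - s * inner c z) has_derivative
          (\<lambda>r. r * inner z (G (x + s *\<^sub>R z)) - r * inner c z)) (at s)"
        by (auto intro!: derivative_eq_intros)
      then show ?thesis
        unfolding has_vector_derivative_def h_def
        by (simp add: inner_diff_right inner_commute[of z c] right_diff_distrib)
    qed
    moreover have "continuous_on {0..1} (\<lambda>s. \<phi> (x + s *\<^sub>R z) - s * inner c z)"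
      by (intro continuous_intros continuous_on_compose2[OF cont]) auto
    ultimately have "(h has_integral (\<phi> (x + 1 *\<^sub>R z) - 1 * inner c z) - (\<phi> (x + 0 *\<^sub>R z) - 0 * inner c z)) {0..1}"
      using fin by (intro fundamental_theorem_of_calculus_interior_strong[of "{s. x + s *\<^sub>R z \<in> N}"]) auto
    then have hD: "(h has_integral D) {0..1}" by (simp add: D_def algebra_simps)
    have "(\<lambda>s. x + s *\<^sub>R z) \<in> borel_measurable borel"
      by (intro borel_measurable_continuous_onI continuous_intros)
    from measurable_compose[OF this G(1)]
    have G_line: "(\<lambda>s. G (x + s *\<^sub>R z)) \<in> borel_measurable borel" .
    have h_meas: "h \<in> borel_measurable borel" unfolding h_def using G_line by simp
    have h_bound: "norm (h s) \<le> norm z * (B + norm c)" for s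
    proof -
      have "norm (G (x + s *\<^sub>R z) - c) \<le> B + norm c"
        using norm_triangle_ineq4[of "G (x + s *\<^sub>R z)" c] G(2)[of "x + s *\<^sub>R z"] by simp
      then show ?thesis unfolding h_def
        using Cauchy_Schwarz_ineq2[of z "G (x + s *\<^sub>R z) - c"] mult_left_mono[of _ _ "norm z"]
        by (smt (verit) norm_ge_zero real_norm_def)
    qed
    have bh: "bbs (\<lambda>s. indicator {0..1} s *\<^sub>R h s)"
      using h_bound h_meas by (intro bbs_indicator) auto
    have h_bound2: "(h s)\<^sup>2 \<le> (norm z * (B + norm c))\<^sup>2" for s
      using power_mono[OF h_bound[of s], of 2] by simp
    have bh2: "bbs (\<lambda>s. indicator {0..1} s *\<^sub>R (h s)\<^sup>2)"
      using h_bound2 h_meas by (intro bbs_indicator[where B="(norm z * (B + norm c))\<^sup>2"]) auto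
    have b1: "bbs (\<lambda>s. indicator {0..1::real} s *\<^sub>R (1::real))"
      by (intro bbs_indicator[where B=1]) auto
    have Dint: "(\<integral>s. indicator {0..1} s *\<^sub>R h s \<partial>lborel) = D"
      using set_borel_integral_eq_integral(2)[of "{0..1}" h] bbs_integrable[OF bh] hD
      by (simp add: set_integrable_def set_lebesgue_integral_def integral_unique)
    \<comment> \<open>The variance of h about its mean D is nonnegative, which is Jensen's
      inequality for the square.\<close>
    have "0 \<le> (\<integral>s. indicator {0..1} s *\<^sub>R (h s)\<^sup>2 - (2 * D) *\<^sub>R (indicator {0..1} s *\<^sub>R h s) + D\<^sup>2 *\<^sub>R (indicator {0..1} s *\<^sub>R 1) \<partial>lborel)"
    proof (rule integral_nonneg_AE, rule AE_I2)
      fix s :: real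
      have "indicator {0..1} s *\<^sub>R (h s)\<^sup>2 - (2 * D) *\<^sub>R (indicator {0..1} s *\<^sub>R h s) + D\<^sup>2 *\<^sub>R (indicator {0..1} s *\<^sub>R 1)
          = indicator {0..1} s * (h s - D)\<^sup>2"
        by (simp add: power2_diff algebra_simps)
      then show "0 \<le> indicator {0..1} s *\<^sub>R (h s)\<^sup>2 - (2 * D) *\<^sub>R (indicator {0..1} s *\<^sub>R h s) + D\<^sup>2 *\<^sub>R (indicator {0..1} s *\<^sub>R (1::real))"
        by simp
    qed
    also have "\<dots> = (\<integral>s. indicator {0..1} s *\<^sub>R (h s)\<^sup>2 \<partial>lborel) - (2 * D) * D + D\<^sup>2"
      using bbs_integrable[OF bh] bbs_integrable[OF bh2] bbs_integrable[OF b1]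
      by (simp add: Bochner_Integration.integral_add Bochner_Integration.integral_diff Dint[simplified])
    finally have "D\<^sup>2 \<le> (\<integral>s. indicator {0..1} s *\<^sub>R (h s)\<^sup>2 \<partial>lborel)"
      by (simp add: power2_eq_square)
    also have "\<dots> \<le> (\<integral>s. (norm z)\<^sup>2 * (indicator {0..1} s *\<^sub>R (norm (G (x + s *\<^sub>R z) - c))\<^sup>2) \<partial>lborel)"
    proof (rule bbs_integral_mono[OF bh2])
      have "bbs (\<lambda>s. indicator {0..1} s *\<^sub>R (norm (G (x + s *\<^sub>R z) - c))\<^sup>2)"
      proof (rule bbs_indicator[where B="(B + norm c)\<^sup>2"])
        show "(\<lambda>s. (norm (G (x + s *\<^sub>R z) - c))\<^sup>2) \<in> borel_measurable borel" using G_line by simp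
        show "norm ((norm (G (x + s *\<^sub>R z) - c))\<^sup>2) \<le> (B + norm c)\<^sup>2" for s
        proof -
          have "norm (G (x + s *\<^sub>R z) - c) \<le> B + norm c"
            using norm_triangle_ineq4[of "G (x + s *\<^sub>R z)" c] G(2)[of "x + s *\<^sub>R z"] by simp
          then show ?thesis by (simp add: power_mono)
        qed
      qed auto
      then show "bbs (\<lambda>s. (norm z)\<^sup>2 * (indicator {0..1} s *\<^sub>R (norm (G (x + s *\<^sub>R z) - c))\<^sup>2))"
        by (rule bbs_cmult_real)
      show "indicator {0..1} s *\<^sub>R (h s)\<^sup>2 \<le> (norm z)\<^sup>2 * (indicator {0..1} s *\<^sub>R (norm (G (x + s *\<^sub>R z) - c))\<^sup>2)" for s
        using Cauchy_Schwarz_ineq[of z "G (x + s *\<^sub>R z) - c"]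
        by (auto simp: h_def power2_norm_eq_inner split: split_indicator)
    qed
    also have "\<dots> = (norm z)\<^sup>2 * (\<integral>s. indicator {0..1} s * (norm (G (x + s *\<^sub>R z) - c))\<^sup>2 \<partial>lborel)"
      by simp
    finally show "(\<phi> (x + z) - \<phi> x - inner c z)\<^sup>2
        \<le> (norm z)\<^sup>2 * (\<integral>s. indicator {0..1} s * (norm (G (x + s *\<^sub>R z) - c))\<^sup>2 \<partial>lborel)"
      by (simp add: D_def)
  qed
qed

text \<open>Fubini in (x, s). The integrand depends on x also apart from the point of the segment,
  so that the base point can be confined to a ball as well.\<close>

lemma segment_average_integral:
  fixes f :: "'a::euclidean_space \<Rightarrow> 'a \<Rightarrow> real"
  assumes f: "case_prod f \<in> borel_measurable borel" and nonneg: "\<And>x y. 0 \<le> f x y"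
    and bnd: "\<And>x y. f x y \<le> B" and supp: "\<forall>x y. f x y \<noteq> 0 \<longrightarrow> norm y \<le> R"
    and le: "\<And>s. 0 \<le> s \<Longrightarrow> s \<le> 1 \<Longrightarrow> (\<integral>x. f x (x + s *\<^sub>R z) \<partial>lborel) \<le> K"
  shows "(\<integral>x. (\<integral>s. indicator {0..1} s * f x (x + s *\<^sub>R z) \<partial>lborel) \<partial>lborel) \<le> K"
    and "integrable lborel (\<lambda>x. \<integral>s. indicator {0..1} s * f x (x + s *\<^sub>R z) \<partial>lborel)"
proof -
  define g where "g = (\<lambda>(x, s::real). indicator {0..1} s * f x (x + s *\<^sub>R z))"
  have meas: "(\<lambda>p::'a \<times> real. f (fst p) (fst p + snd p *\<^sub>R z)) \<in> borel_measurable borel"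
  proof -
    have "(\<lambda>p::'a \<times> real. (fst p, fst p + snd p *\<^sub>R z)) \<in> borel_measurable borel"
      by (intro borel_measurable_continuous_onI continuous_intros)
    from measurable_compose[OF this f] show ?thesis by simp
  qed
  have snd_meas: "(snd :: 'a \<times> real \<Rightarrow> real) \<in> borel_measurable borel"
    by (intro borel_measurable_continuous_onI continuous_intros)
  have "bbs g"
  proof (rule bbsI)
    have "(\<lambda>p::'a \<times> real. indicator {0..1} (snd p) * f (fst p) (fst p + snd p *\<^sub>R z) :: real) \<in> borel_measurable borel"
      using meas snd_meas by measurable
    then show "g \<in> borel_measurable borel" by (simp add: g_def case_prod_unfold)
    show "norm (g p) \<le> B" for p
      using bnd nonneg order_trans[OF nonneg bnd] by (cases p) (auto simp: g_def split: split_indicator)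
    show "norm p \<le> (R + norm z) + 1" if "g p \<noteq> 0" for p
    proof -
      obtain x s where p: "p = (x, s)" by (cases p)
      have s: "0 \<le> s" "s \<le> 1" "f x (x + s *\<^sub>R z) \<noteq> 0" using that by (auto simp: p g_def split: split_indicator_asm)
      have "norm x \<le> norm (x + s *\<^sub>R z) + norm (s *\<^sub>R z)" using norm_triangle_ineq4[of "x + s *\<^sub>R z" "s *\<^sub>R z"] by simp
      also have "\<dots> \<le> R + norm z" using supp[rule_format, OF s(3)] s(1,2) mult_right_mono[of s 1 "norm z"] by auto
      finally show ?thesis using norm_Pair_le[of x s] s(1,2) by (simp add: p)
    qed
  qed
  then have int: "integrable (lborel \<Otimes>\<^sub>M lborel) g" by (simp add: bbs_integrable lborel_prod)
  from lborel_pair.integrable_fst'[OF int]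
  show "integrable lborel (\<lambda>x. \<integral>s. indicator {0..1} s * f x (x + s *\<^sub>R z) \<partial>lborel)"
    by (simp add: g_def)
  have int': "integrable (lborel \<Otimes>\<^sub>M lborel) (\<lambda>(x, s). indicator {0..1} s * f x (x + s *\<^sub>R z))"
    using int by (simp add: g_def)
  have "(\<integral>x. (\<integral>s. indicator {0..1} s * f x (x + s *\<^sub>R z) \<partial>lborel) \<partial>lborel)
      = (\<integral>s. (\<integral>x. indicator {0..1} s * f x (x + s *\<^sub>R z) \<partial>lborel) \<partial>lborel)"
    using lborel_pair.Fubini_integral[OF int'] by simp
  also have "\<dots> \<le> (\<integral>s. indicator {0..1::real} s *\<^sub>R K \<partial>lborel)"
  proof (rule Bochner_Integration.integral_mono)
    show "integrable lborel (\<lambda>s. \<integral>x. indicator {0..1} s * f x (x + s *\<^sub>R z) \<partial>lborel)"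
      using lborel_pair.integrable_snd[OF int'] by simp
    show "integrable lborel (\<lambda>s::real. indicator {0..1} s *\<^sub>R K)"
      by (intro bbs_integrable bbs_indicator[where B="norm K"]) auto
  qed (use le in \<open>auto split: split_indicator\<close>)
  also have "\<dots> = K" by simp
  finally show "(\<integral>x. (\<integral>s. indicator {0..1} s * f x (x + s *\<^sub>R z) \<partial>lborel) \<partial>lborel) \<le> K" .
qed

text \<open>The line inequality with c = 0, integrated over x: by translation invariance each
  parameter s contributes the full energy of G.\<close>

lemma pw_grad_shift_diff:
  fixes G :: "'a::euclidean_space \<Rightarrow> 'a"
  assumes "pw_grad \<phi> G" "bbs \<phi>" and G: "bbs G"
  shows "(\<integral>x. (\<phi> (x + z) - \<phi> x)\<^sup>2 \<partial>lborel) \<le> (norm z)\<^sup>2 * (\<integral>x. (norm (G x))\<^sup>2 \<partial>lborel)"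
proof -
  obtain B R where BR: "G \<in> borel_measurable borel" "0 \<le> B" "\<And>x. norm (G x) \<le> B" "\<And>x. G x \<noteq> 0 \<Longrightarrow> norm x \<le> R"
    by (rule bbsE[OF G]) (rule that)
  let ?f = "\<lambda>(x::'a) y. (norm (G y))\<^sup>2"
  have m: "case_prod ?f \<in> borel_measurable borel"
  proof -
    have "(snd :: 'a \<times> 'a \<Rightarrow> 'a) \<in> borel_measurable borel"
      by (intro borel_measurable_continuous_onI continuous_intros)
    then have "(\<lambda>p::'a \<times> 'a. (norm (G (snd p)))\<^sup>2) \<in> borel_measurable borel" using BR(1) by measurable
    then show ?thesis by (simp add: case_prod_unfold)
  qed
  have b: "?f x y \<le> B\<^sup>2" for x y using BR(3) by (simp add: power_mono)
  have s: "\<forall>x y. ?f x y \<noteq> 0 \<longrightarrow> norm y \<le> R" using BR(4) by auto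
  have le: "(\<integral>x. ?f x (x + t *\<^sub>R z) \<partial>lborel) \<le> (\<integral>x. (norm (G x))\<^sup>2 \<partial>lborel)" for t
    using integral_shift[of "\<lambda>x. (norm (G x))\<^sup>2" "t *\<^sub>R z"] by simp
  note avg = segment_average_integral[OF m _ b s le]
  have "(\<integral>x. (\<phi> (x + z) - \<phi> x)\<^sup>2 \<partial>lborel)
      \<le> (\<integral>x. (norm z)\<^sup>2 * (\<integral>s. indicator {0..1} s * (norm (G (x + s *\<^sub>R z)))\<^sup>2 \<partial>lborel) \<partial>lborel)"
  proof (rule integral_mono_AE)
    show "integrable lborel (\<lambda>x. (\<phi> (x + z) - \<phi> x)\<^sup>2)" using assms(2) by (intro bbs_integrable bbs_power2 bbs_diff bbs_shift)
    show "integrable lborel (\<lambda>x. (norm z)\<^sup>2 * (\<integral>s. indicator {0..1} s * (norm (G (x + s *\<^sub>R z)))\<^sup>2 \<partial>lborel))"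
      using avg(2) by simp
    show "AE x in lborel. (\<phi> (x + z) - \<phi> x)\<^sup>2 \<le> (norm z)\<^sup>2 * (\<integral>s. indicator {0..1} s * (norm (G (x + s *\<^sub>R z)))\<^sup>2 \<partial>lborel)"
      using pw_grad_line_ineq[OF assms(1) BR(1,3), of z 0] by simp
  qed
  also have "\<dots> \<le> (norm z)\<^sup>2 * (\<integral>x. (norm (G x))\<^sup>2 \<partial>lborel)"
    using avg(1) by (simp add: mult_left_mono)
  finally show ?thesis .
qed

lemma bbs_integral_lincomb:
  fixes f g h :: "'a::euclidean_space \<Rightarrow> real"
  assumes "bbs f" "bbs g" "bbs h"
  shows "(\<integral>x. f x + a * g x + b * h x \<partial>lborel) = (\<integral>x. f x \<partial>lborel) + a * (\<integral>x. g x \<partial>lborel) + b * (\<integral>x. h x \<partial>lborel)"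
proof -
  have "integrable lborel f" "integrable lborel (\<lambda>x. a * g x)" "integrable lborel (\<lambda>x. b * h x)"
    using assms by (auto intro: bbs_integrable)
  then show ?thesis by (simp add: Bochner_Integration.integral_add)
qed

section \<open>Averages over balls of one fixed radius\<close>

definition ball_average :: "real \<Rightarrow> ('a::euclidean_space \<Rightarrow> real) \<Rightarrow> 'a \<Rightarrow> real" where
  "ball_average H \<phi> p = (\<integral>\<zeta>. indicator (cball 0 H) \<zeta> * \<phi> (p + \<zeta>) \<partial>lborel) / measure lborel (cball (0::'a) H)"

lemma measure_cball_pos: "0 < H \<Longrightarrow> 0 < measure lborel (cball (0::'a::euclidean_space) H)"
  by (simp add: content_cball)

text \<open>With a common radius the difference of two averages is an average of increments along
  the fixed vector p - q, to which Jensen and the line inequality apply. By \<open>near\<close>, the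
  segments that start in the ball of radius H around q stay within 2 H of x0.\<close>

lemma ball_average_diff:
  fixes G :: "'a::euclidean_space \<Rightarrow> 'a"
  assumes pw: "pw_grad \<phi> G" and b\<phi>: "bbs \<phi>" and G: "bbs G" and H: "0 < H"
    and near: "\<And>s. 0 \<le> s \<Longrightarrow> s \<le> 1 \<Longrightarrow> dist x0 (q + s *\<^sub>R (p - q)) \<le> H"
  shows "(ball_average H \<phi> p - ball_average H \<phi> q - inner c (p - q))\<^sup>2
    \<le> (norm (p - q))\<^sup>2 / measure lborel (cball (0::'a) H) *
      (\<integral>\<xi>. indicator (cball 0 (2 * H)) \<xi> * (norm (G (x0 + \<xi>) - c))\<^sup>2 \<partial>lborel)"
proof -
  define V where "V = measure lborel (cball (0::'a) H)"
  have V: "0 < V" using H by (simp add: V_def measure_cball_pos)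
  define z where "z = p - q"
  define D where "D \<zeta> = \<phi> (p + \<zeta>) - \<phi> (q + \<zeta>) - inner c z" for \<zeta>
  have U: "cball (0::'a) H \<in> sets borel" "bounded (cball (0::'a) H)" by auto
  obtain B R where BR: "G \<in> borel_measurable borel" "0 \<le> B" "\<And>x. norm (G x) \<le> B" "\<And>x. G x \<noteq> 0 \<Longrightarrow> norm x \<le> R"
    by (rule bbsE[OF G]) (rule that)
  obtain M where M: "\<And>x. norm (\<phi> x) \<le> M" using b\<phi> unfolding bbs_def by blast
  have \<phi>m: "\<phi> \<in> borel_measurable borel" using b\<phi> by (rule bbs_measurable)
  have sh: "bbs (\<lambda>\<zeta>. \<phi> (w + \<zeta>))" for w using bbs_shift[OF b\<phi>, of w] by (simp add: add.commute)
  have shi: "bbs (\<lambda>\<zeta>. indicator (cball 0 H) \<zeta> *\<^sub>R \<phi> (w + \<zeta>))" for w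
    using borel_measurable_indicator[OF U(1)] by (intro bbs_scale[where C=1] sh) (auto split: split_indicator)
  have b1: "bbs (\<lambda>\<zeta>::'a. indicator (cball 0 H) \<zeta> *\<^sub>R (1::real))"
    by (rule bbs_indicator[OF U, where B=1]) simp_all
  have i1: "(\<integral>\<zeta>. indicator (cball (0::'a) H) \<zeta> *\<^sub>R (1::real) \<partial>lborel) = V"
    by (simp add: V_def)
  have Dm: "D \<in> borel_measurable borel"
    unfolding D_def using sh[THEN bbs_measurable] by simp
  have Db: "norm (D \<zeta>) \<le> 2 * M + norm (inner c z)" for \<zeta>
    using M[of "p + \<zeta>"] M[of "q + \<zeta>"] unfolding D_def real_norm_def by linarith
  have bD: "bbs (\<lambda>\<zeta>. indicator (cball 0 H) \<zeta> *\<^sub>R D \<zeta>)"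
    by (rule bbs_indicator[OF U Dm Db])
  have bD2: "bbs (\<lambda>\<zeta>. indicator (cball 0 H) \<zeta> *\<^sub>R (D \<zeta>)\<^sup>2)"
  proof (rule bbs_indicator[OF U])
    show "norm ((D \<zeta>)\<^sup>2) \<le> (2 * M + norm (inner c z))\<^sup>2" for \<zeta>
      using power_mono[OF Db[of \<zeta>], of 2] by simp
  qed (use Dm in simp)
  define E where "E = ball_average H \<phi> p - ball_average H \<phi> q - inner c z"
  have "(\<integral>\<zeta>. indicator (cball 0 H) \<zeta> *\<^sub>R D \<zeta> \<partial>lborel)
      = (\<integral>\<zeta>. indicator (cball 0 H) \<zeta> *\<^sub>R \<phi> (p + \<zeta>) + (-1) * (indicator (cball 0 H) \<zeta> *\<^sub>R \<phi> (q + \<zeta>))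
          + (- inner c z) * (indicator (cball 0 H) \<zeta> *\<^sub>R 1) \<partial>lborel)"
    by (intro Bochner_Integration.integral_cong) (auto simp: D_def algebra_simps)
  also have "\<dots> = (\<integral>\<zeta>. indicator (cball 0 H) \<zeta> *\<^sub>R \<phi> (p + \<zeta>) \<partial>lborel)
      + (-1) * (\<integral>\<zeta>. indicator (cball 0 H) \<zeta> *\<^sub>R \<phi> (q + \<zeta>) \<partial>lborel) + (- inner c z) * V"
    unfolding i1[symmetric] by (rule bbs_integral_lincomb[OF shi shi b1])
  also have "\<dots> = V * E"
    using V by (simp add: E_def ball_average_def V_def[symmetric] field_simps)
  finally have ID: "(\<integral>\<zeta>. indicator (cball 0 H) \<zeta> *\<^sub>R D \<zeta> \<partial>lborel) = V * E" .
  \<comment> \<open>Again a variance, over the ball of volume V and about the mean E.\<close>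
  have "0 \<le> (\<integral>\<zeta>. indicator (cball 0 H) \<zeta> *\<^sub>R (D \<zeta>)\<^sup>2 + (- 2 * E) * (indicator (cball 0 H) \<zeta> *\<^sub>R D \<zeta>)
      + E\<^sup>2 * (indicator (cball 0 H) \<zeta> *\<^sub>R 1) \<partial>lborel)"
  proof (rule integral_nonneg_AE, rule AE_I2)
    fix \<zeta> :: 'a
    have "indicator (cball 0 H) \<zeta> *\<^sub>R (D \<zeta>)\<^sup>2 + (- 2 * E) * (indicator (cball 0 H) \<zeta> *\<^sub>R D \<zeta>)
        + E\<^sup>2 * (indicator (cball 0 H) \<zeta> *\<^sub>R 1) = indicator (cball 0 H) \<zeta> * (D \<zeta> - E)\<^sup>2"
      by (simp add: power2_diff algebra_simps)
    then show "0 \<le> indicator (cball 0 H) \<zeta> *\<^sub>R (D \<zeta>)\<^sup>2 + (- 2 * E) * (indicator (cball 0 H) \<zeta> *\<^sub>R D \<zeta>)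
        + E\<^sup>2 * (indicator (cball 0 H) \<zeta> *\<^sub>R (1::real))" by simp
  qed
  also have "\<dots> = (\<integral>\<zeta>. indicator (cball 0 H) \<zeta> *\<^sub>R (D \<zeta>)\<^sup>2 \<partial>lborel) + (- 2 * E) * (V * E) + E\<^sup>2 * V"
    unfolding i1[symmetric] ID[unfolded i1[symmetric], symmetric] by (rule bbs_integral_lincomb[OF bD2 bD b1])
  finally have "V * E\<^sup>2 \<le> (\<integral>\<zeta>. indicator (cball 0 H) \<zeta> *\<^sub>R (D \<zeta>)\<^sup>2 \<partial>lborel)"
    by (simp add: power2_eq_square algebra_simps)
  also have "\<dots> = (\<integral>x. indicator (cball 0 H) (x - q) *\<^sub>R (\<phi> (x + z) - \<phi> x - inner c z)\<^sup>2 \<partial>lborel)"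
    using integral_shift_minus[of "\<lambda>\<zeta>. indicator (cball 0 H) \<zeta> *\<^sub>R (D \<zeta>)\<^sup>2" q]
    by (simp add: D_def z_def algebra_simps)
  also have "\<dots> \<le> (norm z)\<^sup>2 * (\<integral>\<xi>. indicator (cball 0 (2 * H)) \<xi> * (norm (G (x0 + \<xi>) - c))\<^sup>2 \<partial>lborel)"
  proof -
    \<comment> \<open>The first indicator confines the base point, the second the moving point. On
      the segments in question the second is 1, which is shown in \<open>eq\<close>; it provides the
      bounded support and is the one that survives in \<open>?K\<close> when the first is
      dropped.\<close>
    let ?f = "\<lambda>x y. indicator (cball 0 H) (x - q) * (indicator (cball 0 (2 * H)) (y - x0) * (norm (G y - c))\<^sup>2) :: real"
    let ?K = "\<integral>\<xi>. indicator (cball 0 (2 * H)) \<xi> * (norm (G (x0 + \<xi>) - c))\<^sup>2 \<partial>lborel"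
    have Gc: "norm (G y - c) \<le> B + norm c" for y
      using norm_triangle_ineq4[of "G y" c] BR(3)[of y] by simp
    have Gc2: "(norm (G y - c))\<^sup>2 \<le> (B + norm c)\<^sup>2" for y using power_mono[OF Gc[of y], of 2] by simp
    have ind_m: "(\<lambda>x. indicator (cball 0 r) (x - w) :: real) \<in> borel_measurable borel" for r and w :: 'a
    proof -
      have "(\<lambda>x. indicator (cball 0 r) (x - w) :: real) = indicator (cball w r)"
        by (auto simp: fun_eq_iff indicator_def dist_norm norm_minus_commute)
      then show ?thesis using borel_measurable_indicator[OF borel_closed[OF closed_cball[of w r]]] by simp
    qed
    have m: "case_prod ?f \<in> borel_measurable borel"
    proof -
      have "(fst :: 'a \<times> 'a \<Rightarrow> 'a) \<in> borel_measurable borel" "(snd :: 'a \<times> 'a \<Rightarrow> 'a) \<in> borel_measurable borel"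
        by (intro borel_measurable_continuous_onI continuous_intros)+
      note ms = measurable_compose[OF this(1) ind_m[of H q]] measurable_compose[OF this(2) ind_m[of "2 * H" x0]]
        measurable_compose[OF this(2) BR(1)]
      show ?thesis unfolding case_prod_unfold using ms by simp
    qed
    have b: "?f x y \<le> (B + norm c)\<^sup>2" for x y
      using Gc2[of y] order_trans[OF zero_le_power2 Gc2[of y]] by (auto split: split_indicator)
    have s: "\<forall>x y. ?f x y \<noteq> 0 \<longrightarrow> norm y \<le> norm x0 + 2 * H"
    proof (intro allI impI)
      fix x y assume "?f x y \<noteq> 0"
      then show "norm y \<le> norm x0 + 2 * H"
        using norm_triangle_sub[of y x0] by (auto split: split_indicator_asm)
    qed
    have bb: "bbs (\<lambda>\<xi>. indicator (cball 0 (2 * H)) \<xi> *\<^sub>R (norm (G (\<xi> + x0) - c))\<^sup>2)"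
      using bbs_shift[OF G, of x0, THEN bbs_measurable] Gc2
      by (intro bbs_indicator[where B="(B + norm c)\<^sup>2"]) auto
    have le: "(\<integral>x. ?f x (x + t *\<^sub>R z) \<partial>lborel) \<le> ?K" for t
    proof -
      have bb': "bbs (\<lambda>x. indicator (cball 0 (2 * H)) (x + (t *\<^sub>R z - x0)) * (norm (G (x + t *\<^sub>R z) - c))\<^sup>2)"
        using bbs_shift[OF bb, of "t *\<^sub>R z - x0"] by (simp add: algebra_simps)
      have "(\<integral>x. ?f x (x + t *\<^sub>R z) \<partial>lborel)
          \<le> (\<integral>x. indicator (cball 0 (2 * H)) (x + (t *\<^sub>R z - x0)) * (norm (G (x + t *\<^sub>R z) - c))\<^sup>2 \<partial>lborel)"
      proof (rule bbs_integral_mono[OF _ bb'])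
        have "bbs (\<lambda>x. indicator (cball 0 H) (x - q) *\<^sub>R (indicator (cball 0 (2 * H)) (x + (t *\<^sub>R z - x0)) * (norm (G (x + t *\<^sub>R z) - c))\<^sup>2))"
          by (rule bbs_scale[OF bb' ind_m, where C=1]) (auto split: split_indicator)
        then show "bbs (\<lambda>x. ?f x (x + t *\<^sub>R z))" by (simp add: algebra_simps)
      qed (auto simp: algebra_simps split: split_indicator)
      also have "\<dots> = ?K"
        using integral_shift[of "\<lambda>\<xi>. indicator (cball 0 (2 * H)) \<xi> * (norm (G (\<xi> + x0) - c))\<^sup>2" "t *\<^sub>R z - x0"]
        by (simp add: algebra_simps)
      finally show ?thesis .
    qed
    note avg = segment_average_integral[OF m _ b s le]
    have eq: "indicator (cball 0 H) (x - q) * (\<integral>s. indicator {0..1} s * (norm (G (x + s *\<^sub>R z) - c))\<^sup>2 \<partial>lborel)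
        = (\<integral>s. indicator {0..1} s * ?f x (x + s *\<^sub>R z) \<partial>lborel)" for x
    proof (cases "x - q \<in> cball 0 H")
      case True
      have "x + s *\<^sub>R z - x0 \<in> cball 0 (2 * H)" if "0 \<le> s" "s \<le> 1" for s
      proof -
        have "norm ((x - q) + (q + s *\<^sub>R (p - q) - x0)) \<le> H + H"
          using near[OF that] True
          by (intro norm_triangle_le add_mono) (auto simp: dist_norm norm_minus_commute)
        then show ?thesis by (simp add: z_def algebra_simps)
      qed
      then have eqs: "indicator {0..1} s * ?f x (x + s *\<^sub>R z) = indicator {0..1} s * (norm (G (x + s *\<^sub>R z) - c))\<^sup>2" for s :: real
        using True by (auto split: split_indicator)
      show ?thesis unfolding eqs using True by simp
    qed simp
    have "(\<integral>x. indicator (cball 0 H) (x - q) *\<^sub>R (\<phi> (x + z) - \<phi> x - inner c z)\<^sup>2 \<partial>lborel)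
      \<le> (\<integral>x. (norm z)\<^sup>2 * (\<integral>s. indicator {0..1} s * ?f x (x + s *\<^sub>R z) \<partial>lborel) \<partial>lborel)"
    proof (rule integral_mono_AE)
      have "bbs (\<lambda>x. indicator (cball 0 H) (x - q) *\<^sub>R (D (x - q))\<^sup>2)"
        using bbs_shift_minus[OF bD2, of q] by simp
      then show "integrable lborel (\<lambda>x. indicator (cball 0 H) (x - q) *\<^sub>R (\<phi> (x + z) - \<phi> x - inner c z)\<^sup>2)"
        by (intro bbs_integrable) (simp add: D_def z_def algebra_simps)
      show "integrable lborel (\<lambda>x. (norm z)\<^sup>2 * (\<integral>s. indicator {0..1} s * ?f x (x + s *\<^sub>R z) \<partial>lborel))"
        using avg(2) by simp
      show "AE x in lborel. indicator (cball 0 H) (x - q) *\<^sub>R (\<phi> (x + z) - \<phi> x - inner c z)\<^sup>2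
          \<le> (norm z)\<^sup>2 * (\<integral>s. indicator {0..1} s * ?f x (x + s *\<^sub>R z) \<partial>lborel)"
        using pw_grad_line_ineq[OF pw BR(1,3), of z c]
      proof eventually_elim
        case (elim x)
        then have "indicator (cball 0 H) (x - q) * (\<phi> (x + z) - \<phi> x - inner c z)\<^sup>2
          \<le> indicator (cball 0 H) (x - q) * ((norm z)\<^sup>2 * (\<integral>s. indicator {0..1} s * (norm (G (x + s *\<^sub>R z) - c))\<^sup>2 \<partial>lborel))"
          by (intro mult_left_mono) auto
        also have "\<dots> = (norm z)\<^sup>2 * (\<integral>s. indicator {0..1} s * ?f x (x + s *\<^sub>R z) \<partial>lborel)"
          unfolding eq[symmetric] by (simp add: mult_ac)
        finally show ?case by simp
      qed
    qed
    also have "\<dots> \<le> (norm z)\<^sup>2 * ?K"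
      using avg(1) by (simp add: mult_left_mono)
    finally show ?thesis .
  qed
  finally have "V * E\<^sup>2 \<le> (norm z)\<^sup>2 * (\<integral>\<xi>. indicator (cball 0 (2 * H)) \<xi> * (norm (G (x0 + \<xi>) - c))\<^sup>2 \<partial>lborel)" .
  then show ?thesis using V unfolding E_def V_def[symmetric] z_def[symmetric] by (simp add: field_simps)
qed

section \<open>Almost minimizers of the Dirichlet energy\<close>

text \<open>Plays the part of the Sobolev space with zero boundary values. Extension by zero is
  built in, so that translates make sense on the whole space, and G has to vanish at every point
  outside \<Omega>, not just almost everywhere.\<close>

definition test_fn :: "'a::euclidean_space set \<Rightarrow> ('a \<Rightarrow> real) \<Rightarrow> ('a \<Rightarrow> 'a) \<Rightarrow> bool" where
  "test_fn \<Omega> \<phi> G \<longleftrightarrow> bounded \<Omega> \<and> pw_grad \<phi> G \<and> bbs G \<and> (\<forall>x. x \<notin> \<Omega> \<longrightarrow> \<phi> x = 0 \<and> G x = 0)"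

lemma test_fn_bbs: "test_fn \<Omega> \<phi> G \<Longrightarrow> bbs \<phi>" "test_fn \<Omega> \<phi> G \<Longrightarrow> bbs G"
  unfolding test_fn_def pw_grad_def using bbs_continuous[of \<phi> \<Omega>] by blast+

lemma test_fn_pw_grad: "test_fn \<Omega> \<phi> G \<Longrightarrow> pw_grad \<phi> G"
  unfolding test_fn_def by blast

lemma test_fn_zero: "bounded \<Omega> \<Longrightarrow> test_fn \<Omega> (\<lambda>x. 0) (\<lambda>x. 0)"
  unfolding test_fn_def using pw_grad_const[of 0] by (auto intro: bbsI[of _ 0 0])

lemma test_fn_add:
  assumes "test_fn \<Omega> \<phi> G" "test_fn \<Omega> \<psi> K"
  shows "test_fn \<Omega> (\<lambda>x. \<phi> x + \<psi> x) (\<lambda>x. G x + K x)"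
  using assms unfolding test_fn_def by (auto intro: pw_grad_add bbs_add)

lemma test_fn_cmult: "test_fn \<Omega> \<phi> G \<Longrightarrow> test_fn \<Omega> (\<lambda>x. c * \<phi> x) (\<lambda>x. c *\<^sub>R G x)"
  unfolding test_fn_def by (auto intro: pw_grad_cmult)

lemma test_fn_diff:
  assumes "test_fn \<Omega> \<phi> G" "test_fn \<Omega> \<psi> K"
  shows "test_fn \<Omega> (\<lambda>x. \<phi> x - \<psi> x) (\<lambda>x. G x - K x)"
  using test_fn_add[OF assms(1) test_fn_cmult[OF assms(2), of "-1"]] by simp

section \<open>Squared L2 norms and Poincare's inequality\<close>

definition sq_int :: "('a::euclidean_space \<Rightarrow> 'b::euclidean_space) \<Rightarrow> real" where
  "sq_int G = (\<integral>x. (norm (G x))\<^sup>2 \<partial>lborel)"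

lemma sq_int_nonneg: "0 \<le> sq_int G"
  unfolding sq_int_def by (intro integral_nonneg_AE) auto

lemma sq_int_cmult: "sq_int (\<lambda>x. c *\<^sub>R G x) = c\<^sup>2 * sq_int G"
  unfolding sq_int_def by (simp add: power_mult_distrib)

lemma sq_int_uminus: "sq_int (\<lambda>x. - G x) = sq_int G"
  unfolding sq_int_def by simp

lemma norm_add_square_le:
  fixes a b :: "'a::real_inner"
  assumes "0 < t"
  shows "(norm (a + b))\<^sup>2 \<le> (1 + t) * (norm a)\<^sup>2 + (1 + 1 / t) * (norm b)\<^sup>2"
proof -
  have "0 \<le> (norm (t *\<^sub>R a - b))\<^sup>2" by simp
  also have "\<dots> = t * (t * inner a a) - t * (2 * inner a b) + inner b b"
    by (simp only: power2_norm_eq_inner) (simp add: inner_diff_left inner_diff_right inner_commute algebra_simps)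
  finally have "t * (2 * inner a b) \<le> t * (t * inner a a + (1 / t) * inner b b)"
    using assms by (simp add: algebra_simps)
  then have "2 * inner a b \<le> t * inner a a + (1 / t) * inner b b"
    using assms by (simp only: mult_le_cancel_left_pos)
  moreover have "(norm (a + b))\<^sup>2 = inner a a + 2 * inner a b + inner b b"
    unfolding power2_norm_eq_inner by (simp add: inner_add_left inner_add_right inner_commute)
  ultimately show ?thesis
    unfolding power2_norm_eq_inner by (simp add: algebra_simps)
qed

lemma sq_int_mono:
  assumes "bbs F" "bbs G" "\<And>x. norm (F x) \<le> norm (G x)"
  shows "sq_int F \<le> sq_int G"
  unfolding sq_int_def using assms by (intro bbs_integral_mono bbs_norm2) (auto intro!: power_mono)

lemma sq_int_add:
  assumes "bbs F" "bbs G"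
  shows "sq_int (\<lambda>x. F x + G x) \<le> 2 * sq_int F + 2 * sq_int G"
proof -
  have "sq_int (\<lambda>x. F x + G x) \<le> (\<integral>x. 2 * (norm (F x))\<^sup>2 + 2 * (norm (G x))\<^sup>2 \<partial>lborel)"
    unfolding sq_int_def using assms norm_add_square_le[of 1]
    by (intro bbs_integral_mono bbs_norm2 bbs_add bbs_cmult_real) auto
  also have "\<dots> = 2 * sq_int F + 2 * sq_int G"
    unfolding sq_int_def using assms
    by (simp add: Bochner_Integration.integral_add bbs_integrable bbs_norm2)
  finally show ?thesis .
qed

lemma sq_int_diff:
  assumes "bbs F" "bbs G"
  shows "sq_int (\<lambda>x. F x - G x) \<le> 2 * sq_int F + 2 * sq_int G"
  using sq_int_add[OF assms(1) bbs_uminus[OF assms(2)]] by (simp add: sq_int_uminus)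

lemma sq_int_shift: "sq_int (\<lambda>x. G (x + z)) = sq_int G"
  unfolding sq_int_def by (rule integral_shift)

lemma sq_int_shift_minus: "sq_int (\<lambda>x. G (x - z)) = sq_int G"
  unfolding sq_int_def by (rule integral_shift_minus)

lemma sq_int_expand:
  assumes "bbs F" "bbs G"
  shows "sq_int (\<lambda>x. F x + c *\<^sub>R G x) = sq_int F + 2 * c * (\<integral>x. inner (F x) (G x) \<partial>lborel) + c\<^sup>2 * sq_int G"
proof -
  have "sq_int (\<lambda>x. F x + c *\<^sub>R G x) = (\<integral>x. (norm (F x))\<^sup>2 + (2 * c) * inner (F x) (G x) + c\<^sup>2 * (norm (G x))\<^sup>2 \<partial>lborel)"
    unfolding sq_int_def power2_norm_eq_inner
    by (intro Bochner_Integration.integral_cong)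
       (auto simp: inner_add_left inner_add_right inner_commute algebra_simps power2_eq_square)
  also have "\<dots> = sq_int F + 2 * c * (\<integral>x. inner (F x) (G x) \<partial>lborel) + c\<^sup>2 * sq_int G"
    unfolding sq_int_def using assms
    by (simp add: Bochner_Integration.integral_add bbs_integrable bbs_norm2 bbs_inner)
  finally show ?thesis .
qed

lemma inner_integral_Cauchy_Schwarz:
  assumes "bbs F" "bbs G"
  shows "(\<integral>x. inner (F x) (G x) \<partial>lborel)\<^sup>2 \<le> sq_int F * sq_int G"
proof (rule discriminant_nonpos)
  fix t
  have "0 \<le> sq_int (\<lambda>x. F x + t *\<^sub>R G x)" by (rule sq_int_nonneg)
  then show "0 \<le> sq_int F + 2 * (\<integral>x. inner (F x) (G x) \<partial>lborel) * t + sq_int G * t\<^sup>2"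
    unfolding sq_int_expand[OF assms] by (simp add: mult_ac)
qed

lemma test_fn_shift_diff:
  assumes "test_fn \<Omega> \<phi> G"
  shows "sq_int (\<lambda>x. \<phi> (x + z) - \<phi> x) \<le> (norm z)\<^sup>2 * sq_int G"
  using pw_grad_shift_diff[OF test_fn_pw_grad[OF assms] test_fn_bbs[OF assms], of z] by (simp add: sq_int_def)

text \<open>A translation longer than the diameter of \<Omega> moves \<phi> off its own support, so
  |\<phi>| is dominated by its difference from the translate, and \<open>test_fn_shift_diff\<close>
  bounds that by the energy.\<close>

lemma poincare:
  fixes \<Omega> :: "'a::euclidean_space set"
  assumes "bounded \<Omega>"
  obtains P where "0 < P" "\<And>\<phi> G. test_fn \<Omega> \<phi> G \<Longrightarrow> sq_int \<phi> \<le> P * sq_int G"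
proof -
  obtain R where R: "0 < R" "\<And>x. x \<in> \<Omega> \<Longrightarrow> norm x \<le> R" using assms unfolding bounded_pos by blast
  obtain b :: 'a where b: "norm b = 1" using norm_Basis nonempty_Basis by blast
  \<comment> \<open>One more than 2 R, which bounds the distance between any two points of
    \<Omega>.\<close>
  define z where "z = (2 * R + 1) *\<^sub>R b"
  have z: "norm z = 2 * R + 1" using R(1) b by (simp add: z_def)
  have "sq_int \<phi> \<le> (2 * R + 1)\<^sup>2 * sq_int G" if t: "test_fn \<Omega> \<phi> G" for \<phi> G
  proof -
    have "norm (\<phi> x) \<le> norm (\<phi> (x + z) - \<phi> x)" for x
    proof (cases "x \<in> \<Omega>")
      case True
      have "x + z \<notin> \<Omega>"
      proof
        assume "x + z \<in> \<Omega>"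
        then have "norm ((x + z) - x) \<le> R + R" using R(2) True by (intro norm_triangle_le_diff add_mono) auto
        then show False using z by simp
      qed
      then show ?thesis using t unfolding test_fn_def by simp
    qed (use t in \<open>simp add: test_fn_def\<close>)
    then have "sq_int \<phi> \<le> sq_int (\<lambda>x. \<phi> (x + z) - \<phi> x)"
      using test_fn_bbs(1)[OF t] by (intro sq_int_mono bbs_diff bbs_shift) auto
    also have "\<dots> \<le> (2 * R + 1)\<^sup>2 * sq_int G" using test_fn_shift_diff[OF t, of z] z by simp
    finally show ?thesis .
  qed
  then show ?thesis using that[of "(2 * R + 1)\<^sup>2"] R(1) by auto
qed

section \<open>The Dirichlet energy and its near-minimizers\<close>

definition energy :: "('a::euclidean_space \<Rightarrow> real) \<Rightarrow> ('a \<Rightarrow> real) \<Rightarrow> ('a \<Rightarrow> 'a) \<Rightarrow> real" where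
  "energy f \<phi> G = sq_int G / 2 - (\<integral>x. f x * \<phi> x \<partial>lborel)"

text \<open>The tolerance replaces the existence of a minimizer, which this incomplete class of
  functions need not contain.\<close>

definition near_minimizer where
  "near_minimizer \<Omega> f \<epsilon> \<phi> G \<longleftrightarrow> test_fn \<Omega> \<phi> G \<and> (\<forall>\<psi> K. test_fn \<Omega> \<psi> K \<longrightarrow> energy f \<phi> G \<le> energy f \<psi> K + \<epsilon>)"

lemma mult_le_quarter: "0 < P \<Longrightarrow> a * b \<le> b\<^sup>2 / (4 * P) + P * a\<^sup>2" for a b P :: real
proof -
  assume P: "0 < P"
  have "0 \<le> (b - 2 * P * a)\<^sup>2" by simp
  then have "4 * P * (a * b) \<le> 4 * P * (b\<^sup>2 / (4 * P) + P * a\<^sup>2)"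
    using P by (simp add: power2_eq_square algebra_simps)
  then show ?thesis using P by (subst (asm) mult_le_cancel_left_pos) auto
qed

text \<open>Young's inequality with weight P: by Poincare's inequality a quarter of the energy then
  absorbs the linear term.\<close>

lemma energy_lower_bound:
  assumes P: "0 < P" "\<And>\<phi> G. test_fn \<Omega> \<phi> G \<Longrightarrow> sq_int \<phi> \<le> P * sq_int G"
    and t: "test_fn \<Omega> \<phi> G" and f: "bbs f"
  shows "sq_int G / 4 - P * sq_int f \<le> energy f \<phi> G"
proof -
  have "(\<integral>x. f x * \<phi> x \<partial>lborel) \<le> (\<integral>x. (1 / (4 * P)) * (\<phi> x)\<^sup>2 + P * (f x)\<^sup>2 \<partial>lborel)"
    using mult_le_quarter[OF P(1)] test_fn_bbs(1)[OF t] f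
    by (intro bbs_integral_mono bbs_mult bbs_add bbs_cmult_real bbs_power2) auto
  also have "\<dots> = (1 / (4 * P)) * sq_int \<phi> + P * sq_int f"
    unfolding sq_int_def using test_fn_bbs(1)[OF t] f
    by (simp add: Bochner_Integration.integral_add bbs_integrable bbs_power2)
  also have "\<dots> \<le> sq_int G / 4 + P * sq_int f"
    using P(2)[OF t] P(1) by (simp add: divide_le_eq mult.commute)
  finally show ?thesis unfolding energy_def by simp
qed

lemma near_minimizer_ex:
  assumes "bounded \<Omega>" "bbs f" "0 < \<epsilon>"
  obtains \<phi> G where "near_minimizer \<Omega> f \<epsilon> \<phi> G"
proof -
  obtain P where P: "0 < P" "\<And>\<phi> G. test_fn \<Omega> \<phi> G \<Longrightarrow> sq_int \<phi> \<le> P * sq_int G"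
    using poincare[OF assms(1)] by blast
  define S where "S = {energy f \<phi> G | \<phi> G. test_fn \<Omega> \<phi> G}"
  have ne: "S \<noteq> {}" unfolding S_def using test_fn_zero[OF assms(1)] by blast
  have "- P * sq_int f \<le> s" if sS: "s \<in> S" for s
  proof -
    obtain \<phi> G where s: "s = energy f \<phi> G" "test_fn \<Omega> \<phi> G" using sS unfolding S_def by auto
    then show ?thesis using energy_lower_bound[OF P s(2) assms(2)] sq_int_nonneg[of G] s(1) by simp
  qed
  then have bdd: "bdd_below S" unfolding bdd_below_def by blast
  obtain s where "s \<in> S" "s < Inf S + \<epsilon>" using cInf_lessD[OF ne, of "Inf S + \<epsilon>"] assms(3) by auto
  then obtain \<phi> G where t: "test_fn \<Omega> \<phi> G" "energy f \<phi> G < Inf S + \<epsilon>" unfolding S_def by auto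
  have "energy f \<phi> G \<le> energy f \<psi> K + \<epsilon>" if "test_fn \<Omega> \<psi> K" for \<psi> K
    using cInf_lower[OF _ bdd, of "energy f \<psi> K"] that t(2) unfolding S_def by fastforce
  then show ?thesis using that t(1) unfolding near_minimizer_def by blast
qed

lemma near_minimizer_bound:
  assumes P: "0 < P" "\<And>\<phi> G. test_fn \<Omega> \<phi> G \<Longrightarrow> sq_int \<phi> \<le> P * sq_int G"
    and b: "bounded \<Omega>" and f: "bbs f" and m: "near_minimizer \<Omega> f \<epsilon> \<phi> G"
  shows "sq_int G \<le> 4 * P * sq_int f + 4 * \<epsilon>"
proof -
  have "energy f \<phi> G \<le> energy f (\<lambda>x. 0) (\<lambda>x. 0) + \<epsilon>"
    using m test_fn_zero[OF b] unfolding near_minimizer_def by blast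
  then have "energy f \<phi> G \<le> \<epsilon>" by (simp add: energy_def sq_int_def)
  moreover have "sq_int G / 4 - P * sq_int f \<le> energy f \<phi> G"
    using energy_lower_bound[OF P _ f] m unfolding near_minimizer_def by blast
  ultimately show ?thesis by simp
qed

text \<open>Along \<phi> + s z the energy is quadratic in s and never drops by more than \<epsilon>
  below its value at s = 0; the discriminant then bounds the residual.\<close>

lemma near_minimizer_euler_lagrange:
  assumes m: "near_minimizer \<Omega> f \<epsilon> \<phi> G" and f: "bbs f" and t: "test_fn \<Omega> z Z"
  shows "((\<integral>x. inner (G x) (Z x) \<partial>lborel) - (\<integral>x. f x * z x \<partial>lborel))\<^sup>2 \<le> 2 * \<epsilon> * sq_int Z"
proof -
  define b where "b = (\<integral>x. inner (G x) (Z x) \<partial>lborel) - (\<integral>x. f x * z x \<partial>lborel)"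
  have m': "test_fn \<Omega> \<phi> G" using m unfolding near_minimizer_def by blast
  have "b\<^sup>2 \<le> (2 * \<epsilon>) * sq_int Z"
  proof (rule discriminant_nonpos)
    fix s
    have en: "energy f \<phi> G \<le> energy f (\<lambda>x. \<phi> x + s * z x) (\<lambda>x. G x + s *\<^sub>R Z x) + \<epsilon>"
      using m test_fn_add[OF m' test_fn_cmult[OF t, of s]] unfolding near_minimizer_def by blast
    have lin: "(\<integral>x. f x * (\<phi> x + s * z x) \<partial>lborel) = (\<integral>x. f x * \<phi> x \<partial>lborel) + s * (\<integral>x. f x * z x \<partial>lborel)"
    proof -
      have "(\<integral>x. f x * (\<phi> x + s * z x) \<partial>lborel) = (\<integral>x. f x * \<phi> x + s * (f x * z x) \<partial>lborel)"
        by (simp add: algebra_simps)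
      also have "\<dots> = (\<integral>x. f x * \<phi> x \<partial>lborel) + s * (\<integral>x. f x * z x \<partial>lborel)"
        using f test_fn_bbs(1)[OF t] test_fn_bbs(1)[OF m']
        by (simp add: Bochner_Integration.integral_add bbs_integrable bbs_mult)
      finally show ?thesis .
    qed
    from en[unfolded energy_def sq_int_expand[OF test_fn_bbs(2)[OF m'] test_fn_bbs(2)[OF t]] lin]
    show "0 \<le> 2 * \<epsilon> + 2 * b * s + sq_int Z * s\<^sup>2"
      unfolding b_def by (simp add: algebra_simps add_divide_distrib)
  qed
  then show ?thesis by (simp add: b_def)
qed

section \<open>Cutoff functions and the translation of near-minimizers\<close>

definition cutoff :: "('a::euclidean_space \<Rightarrow> real) \<Rightarrow> ('a \<Rightarrow> 'a) \<Rightarrow> real \<Rightarrow> bool" where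
  "cutoff \<theta> \<Theta> L \<longleftrightarrow> pw_grad \<theta> \<Theta> \<and> \<Theta> \<in> borel_measurable borel \<and> (\<forall>x. 0 \<le> \<theta> x \<and> \<theta> x \<le> 1) \<and>
     (\<forall>x. norm (\<Theta> x) \<le> L) \<and> (\<forall>x. \<theta> x = 0 \<longrightarrow> \<Theta> x = 0) \<and> (\<forall>x y. \<bar>\<theta> x - \<theta> y\<bar> \<le> L * norm (x - y))"

lemma cutoffD:
  assumes "cutoff \<theta> \<Theta> L"
  shows "pw_grad \<theta> \<Theta>" "\<theta> \<in> borel_measurable borel" "\<Theta> \<in> borel_measurable borel" "0 \<le> \<theta> x" "\<theta> x \<le> 1"
    "\<bar>\<theta> x\<bar> \<le> 1" "norm (\<Theta> x) \<le> L" "0 \<le> L" "\<theta> x = 0 \<Longrightarrow> \<Theta> x = 0" "\<bar>\<theta> x - \<theta> y\<bar> \<le> L * norm (x - y)"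
proof -
  show "\<theta> \<in> borel_measurable borel"
    using assms unfolding cutoff_def pw_grad_def by (auto intro: borel_measurable_continuous_onI)
  show "0 \<le> L" using assms unfolding cutoff_def by (meson norm_ge_zero order_trans)
qed (use assms in \<open>auto simp: cutoff_def\<close>)

lemma near_minimizer_eps_nonneg: "near_minimizer \<Omega> f \<epsilon> \<phi> G \<Longrightarrow> 0 \<le> \<epsilon>"
  unfolding near_minimizer_def by fastforce

lemma near_minimizer_test_fn: "near_minimizer \<Omega> f \<epsilon> \<phi> G \<Longrightarrow> test_fn \<Omega> \<phi> G"
  unfolding near_minimizer_def by blast

lemma convex_combination_norm_square:
  fixes a b :: "'a::real_inner"
  assumes "0 \<le> s" "s \<le> 1"
  shows "(norm ((1 - s) *\<^sub>R a + s *\<^sub>R b))\<^sup>2 \<le> (1 - s) * (norm a)\<^sup>2 + s * (norm b)\<^sup>2"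
proof -
  have "(1 - s) * (norm a)\<^sup>2 + s * (norm b)\<^sup>2 - (norm ((1 - s) *\<^sub>R a + s *\<^sub>R b))\<^sup>2
      = s * (1 - s) * (norm (a - b))\<^sup>2"
    unfolding power2_norm_eq_inner
    by (simp add: inner_add_left inner_add_right inner_diff_left inner_diff_right inner_commute algebra_simps)
  also have "\<dots> \<ge> 0" using assms by simp
  finally show ?thesis by simp
qed

text \<open>By \<open>adm\<close>, at a point outside \<Omega> with nonzero \<theta> the translate
  vanishes too. Where \<theta> is zero, the clause of \<open>cutoff\<close> that \<Theta> vanishes
  along with it removes the second term of the product rule at every single point.\<close>

lemma cutoff_test_fn:
  assumes t: "test_fn \<Omega> \<phi> G" and c: "cutoff \<theta> \<Theta> L"
    and adm: "\<And>x. \<theta> x \<noteq> 0 \<Longrightarrow> x - z \<in> \<Omega> \<Longrightarrow> x \<in> \<Omega>"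
  shows "test_fn \<Omega> (\<lambda>x. \<theta> x * (\<phi> (x - z) - \<phi> x)) (\<lambda>x. \<theta> x *\<^sub>R (G (x - z) - G x) + (\<phi> (x - z) - \<phi> x) *\<^sub>R \<Theta> x)"
proof -
  note b = test_fn_bbs[OF t]
  have "pw_grad (\<lambda>x. \<phi> (x - z) - \<phi> x) (\<lambda>x. G (x - z) - G x)"
    using test_fn_pw_grad[OF t] by (intro pw_grad_diff pw_grad_shift)
  from pw_grad_mult[OF cutoffD(1)[OF c] this]
  have 1: "pw_grad (\<lambda>x. \<theta> x * (\<phi> (x - z) - \<phi> x)) (\<lambda>x. \<theta> x *\<^sub>R (G (x - z) - G x) + (\<phi> (x - z) - \<phi> x) *\<^sub>R \<Theta> x)" .
  have 2: "bbs (\<lambda>x. \<theta> x *\<^sub>R (G (x - z) - G x) + (\<phi> (x - z) - \<phi> x) *\<^sub>R \<Theta> x)"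
    by (intro bbs_add bbs_scale[OF _ cutoffD(2)[OF c] cutoffD(6)[OF c]] bbs_scale'[OF _ cutoffD(3)[OF c] cutoffD(7)[OF c]]
        bbs_diff bbs_shift_minus b)
  show ?thesis unfolding test_fn_def
  proof (intro conjI 1 2 allI impI)
    show "bounded \<Omega>" using t by (simp add: test_fn_def)
    fix x assume x: "x \<notin> \<Omega>"
    have *: "\<phi> x = 0" "G x = 0" using t x by (auto simp: test_fn_def)
    have **: "\<theta> x = 0 \<or> \<phi> (x - z) = 0" "\<theta> x = 0 \<or> G (x - z) = 0" using t x adm[of x] by (auto simp: test_fn_def)
    show "\<theta> x * (\<phi> (x - z) - \<phi> x) = 0" using * ** by auto
    show "\<theta> x *\<^sub>R (G (x - z) - G x) + (\<phi> (x - z) - \<phi> x) *\<^sub>R \<Theta> x = 0"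
      using * ** cutoffD(9)[OF c, of x] by auto
  qed
qed

text \<open>Translating a minimizer into the domain increases the energy by \<open>O(|z|)\<close> only, so uniform
  convexity bounds the squared distance to the translate by \<open>O(|z|)\<close> (Savare's argument).\<close>

lemma savare_step:
  assumes m: "near_minimizer \<Omega> f \<epsilon> \<phi> G" and f: "bbs f" and c: "cutoff \<theta> \<Theta> L"
    and adm: "\<And>x. \<theta> x \<noteq> 0 \<Longrightarrow> x - z \<in> \<Omega> \<Longrightarrow> x \<in> \<Omega>" and z: "norm z \<le> 1"
  shows "sq_int (\<lambda>x. \<theta> x *\<^sub>R (G (x - z) - G x) + (\<phi> (x - z) - \<phi> x) *\<^sub>R \<Theta> x)
    \<le> 8 * \<epsilon> + 2 * norm z * ((2 + 2 * L + 2 * L\<^sup>2) * sq_int G + sq_int f)" (is "sq_int ?K \<le> ?rhs")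
proof (cases "z = 0")
  case True
  then show ?thesis using near_minimizer_eps_nonneg[OF m] by (simp add: sq_int_def)
next
  case False
  define t where "t = norm z"
  have t: "0 < t" "t \<le> 1" using False z by (auto simp: t_def)
  note tf = near_minimizer_test_fn[OF m]
  note b = test_fn_bbs[OF tf]
  note L = cutoffD(8)[OF c]
  define \<psi> where "\<psi> x = \<theta> x * (\<phi> (x - z) - \<phi> x)" for x
  have t\<psi>: "test_fn \<Omega> \<psi> ?K" unfolding \<psi>_def by (rule cutoff_test_fn[OF tf c adm])
  note b\<psi> = test_fn_bbs[OF t\<psi>]
  define D where "D x = \<phi> (x - z) - \<phi> x" for x
  define A where "A = sq_int G"
  have A0: "0 \<le> A" unfolding A_def by (rule sq_int_nonneg)
  have bD: "bbs D" unfolding D_def using b by (intro bbs_diff bbs_shift_minus)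
  have sD: "sq_int D \<le> t\<^sup>2 * A"
    using test_fn_shift_diff[OF tf, of "- z"] by (simp add: D_def[abs_def] A_def t_def)
  have bG2: "bbs (\<lambda>x. (norm (G x))\<^sup>2)" "bbs (\<lambda>x. (norm (G (x - z)))\<^sup>2)"
    using b by (auto intro: bbs_norm2 bbs_shift_minus)
  have b\<theta>: "bbs (\<lambda>x. \<theta> x * g x)" if "bbs g" for g :: "'a \<Rightarrow> real"
    using bbs_scale[OF that cutoffD(2)[OF c] cutoffD(6)[OF c]] by simp
  define X where "X = (\<integral>x. \<theta> x * (norm (G x))\<^sup>2 \<partial>lborel)"
  define Y where "Y = (\<integral>x. \<theta> x * (norm (G (x - z)))\<^sup>2 \<partial>lborel)"
  \<comment> \<open>A change of variables moves the translation from G to the cutoff and costs only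
    the Lipschitz constant of the latter.\<close>
  have YX: "Y \<le> X + L * t * A"
  proof -
    have m2: "(\<lambda>x. \<theta> (x + z)) \<in> borel_measurable borel"
      using measurable_compose[OF _ cutoffD(2)[OF c], of "\<lambda>x. x + z" borel] by simp
    have "Y = (\<integral>x. \<theta> (x + z) * (norm (G x))\<^sup>2 \<partial>lborel)"
      unfolding Y_def using integral_shift[of "\<lambda>x. \<theta> x * (norm (G (x - z)))\<^sup>2" z] by simp
    also have "\<dots> \<le> (\<integral>x. \<theta> x * (norm (G x))\<^sup>2 + (L * t) * (norm (G x))\<^sup>2 \<partial>lborel)"
    proof (rule bbs_integral_mono)
      show "bbs (\<lambda>x. \<theta> (x + z) * (norm (G x))\<^sup>2)"
        using bbs_scale[OF bG2(1) m2 cutoffD(6)[OF c]] by simp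
      show "bbs (\<lambda>x. \<theta> x * (norm (G x))\<^sup>2 + (L * t) * (norm (G x))\<^sup>2)"
        by (intro bbs_add b\<theta> bbs_cmult_real bG2)
      fix x
      have "\<theta> (x + z) \<le> \<theta> x + L * t" using cutoffD(10)[OF c, of "x + z" x] by (simp add: t_def)
      then have "\<theta> (x + z) * (norm (G x))\<^sup>2 \<le> (\<theta> x + L * t) * (norm (G x))\<^sup>2" by (intro mult_right_mono) auto
      then show "\<theta> (x + z) * (norm (G x))\<^sup>2 \<le> \<theta> x * (norm (G x))\<^sup>2 + (L * t) * (norm (G x))\<^sup>2" by (simp add: distrib_right)
    qed
    also have "\<dots> = X + L * t * A"
      unfolding X_def A_def sq_int_def
      using bbs_integrable[OF b\<theta>[OF bG2(1)]] bbs_integrable[OF bG2(1)] by (simp add: Bochner_Integration.integral_add)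
    finally show ?thesis .
  qed
  \<comment> \<open>\<open>G + ?K\<close> is the gradient of the convex combination of \<phi> and
    its translate with weight \<theta>. Convexity of the square handles the combined gradients; the
    product rule term has norm O(|z|) and is split off by Young's inequality with weight t.\<close>
  have Kt: "sq_int (\<lambda>x. G x + 1 *\<^sub>R ?K x) \<le> A + t * (1 + 2 * L + 2 * L\<^sup>2) * A"
  proof -
    have "sq_int (\<lambda>x. G x + 1 *\<^sub>R ?K x)
        \<le> (\<integral>x. (1 + t) * ((norm (G x))\<^sup>2 + (-1) * (\<theta> x * (norm (G x))\<^sup>2) + 1 * (\<theta> x * (norm (G (x - z)))\<^sup>2))
           + ((1 + 1 / t) * L\<^sup>2) * (norm (D x))\<^sup>2 + 0 * (norm (D x))\<^sup>2 \<partial>lborel)"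
      unfolding sq_int_def
    proof (rule bbs_integral_mono)
      show "bbs (\<lambda>x. (norm (G x + 1 *\<^sub>R ?K x))\<^sup>2)" by (intro bbs_norm2 bbs_add[OF b(2)] bbs_cmult[OF b\<psi>(2)])
      show "bbs (\<lambda>x. (1 + t) * ((norm (G x))\<^sup>2 + (-1) * (\<theta> x * (norm (G x))\<^sup>2) + 1 * (\<theta> x * (norm (G (x - z)))\<^sup>2))
           + ((1 + 1 / t) * L\<^sup>2) * (norm (D x))\<^sup>2 + 0 * (norm (D x))\<^sup>2)"
        by (intro bbs_add b\<theta> bbs_cmult_real bG2 bbs_norm2 bD)
      fix x
      have "G x + 1 *\<^sub>R ?K x = ((1 - \<theta> x) *\<^sub>R G x + \<theta> x *\<^sub>R G (x - z)) + D x *\<^sub>R \<Theta> x"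
        by (simp add: D_def algebra_simps)
      then have "(norm (G x + 1 *\<^sub>R ?K x))\<^sup>2
          \<le> (1 + t) * (norm ((1 - \<theta> x) *\<^sub>R G x + \<theta> x *\<^sub>R G (x - z)))\<^sup>2 + (1 + 1 / t) * (norm (D x *\<^sub>R \<Theta> x))\<^sup>2"
        using norm_add_square_le[OF t(1)] by metis
      also have "\<dots> \<le> (1 + t) * ((1 - \<theta> x) * (norm (G x))\<^sup>2 + \<theta> x * (norm (G (x - z)))\<^sup>2)
          + (1 + 1 / t) * (L\<^sup>2 * (norm (D x))\<^sup>2)"
      proof (intro add_mono mult_left_mono convex_combination_norm_square)
        have "(norm (\<Theta> x))\<^sup>2 \<le> L\<^sup>2" using cutoffD(7)[OF c, of x] by (intro power_mono) auto
        then have "(norm (\<Theta> x))\<^sup>2 * (norm (D x))\<^sup>2 \<le> L\<^sup>2 * (norm (D x))\<^sup>2" by (intro mult_right_mono) auto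
        then show "(norm (D x *\<^sub>R \<Theta> x))\<^sup>2 \<le> L\<^sup>2 * (norm (D x))\<^sup>2" by (simp add: power_mult_distrib mult.commute)
      qed (use t cutoffD(4,5)[OF c] in auto)
      finally show "(norm (G x + 1 *\<^sub>R ?K x))\<^sup>2 \<le> (1 + t) * ((norm (G x))\<^sup>2 + (-1) * (\<theta> x * (norm (G x))\<^sup>2) + 1 * (\<theta> x * (norm (G (x - z)))\<^sup>2))
           + ((1 + 1 / t) * L\<^sup>2) * (norm (D x))\<^sup>2 + 0 * (norm (D x))\<^sup>2"
        by (simp add: left_diff_distrib mult.assoc)
    qed
    also have "\<dots> = (\<integral>x. (1 + t) * ((norm (G x))\<^sup>2 + (-1) * (\<theta> x * (norm (G x))\<^sup>2) + 1 * (\<theta> x * (norm (G (x - z)))\<^sup>2)) \<partial>lborel)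
        + ((1 + 1 / t) * L\<^sup>2) * sq_int D + 0 * sq_int D"
      unfolding sq_int_def
      by (rule bbs_integral_lincomb) (intro bbs_add b\<theta> bbs_cmult_real bG2 bbs_norm2 bD)+
    also have "(\<integral>x. (1 + t) * ((norm (G x))\<^sup>2 + (-1) * (\<theta> x * (norm (G x))\<^sup>2) + 1 * (\<theta> x * (norm (G (x - z)))\<^sup>2)) \<partial>lborel)
        = (1 + t) * (A + (-1) * X + 1 * Y)"
      unfolding A_def sq_int_def X_def Y_def integral_mult_right_zero
      by (subst bbs_integral_lincomb[OF bG2(1) b\<theta>[OF bG2(1)] b\<theta>[OF bG2(2)]]) simp
    also have "(1 + t) * (A + (-1) * X + 1 * Y) + ((1 + 1 / t) * L\<^sup>2) * sq_int D + 0 * sq_int D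
        \<le> (1 + t) * (A + L * t * A) + ((1 + 1 / t) * L\<^sup>2) * (t\<^sup>2 * A) + 0"
    proof -
      have "A + (-1) * X + 1 * Y \<le> A + L * t * A" using YX by simp
      then have "(1 + t) * (A + (-1) * X + 1 * Y) \<le> (1 + t) * (A + L * t * A)"
        using t by (intro mult_left_mono) auto
      moreover have "((1 + 1 / t) * L\<^sup>2) * sq_int D \<le> ((1 + 1 / t) * L\<^sup>2) * (t\<^sup>2 * A)"
        using t sD by (intro mult_left_mono) auto
      ultimately show ?thesis by simp
    qed
    also have "\<dots> = A + t * A + (L * A) * t + (L * A) * (t * t) + (L\<^sup>2 * A) * (t * t) + (L\<^sup>2 * A) * t"
      using t by (simp add: field_simps power2_eq_square)
    also have "\<dots> \<le> A + t * A + (L * A) * t + (L * A) * t + (L\<^sup>2 * A) * t + (L\<^sup>2 * A) * t"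
      using t L A0 mult_left_mono[of t 1 t] by (intro add_mono mult_left_mono) auto
    also have "\<dots> = A + t * (1 + 2 * L + 2 * L\<^sup>2) * A" by (simp add: algebra_simps)
    finally show ?thesis .
  qed
  have f\<psi>: "- (\<integral>x. f x * \<psi> x \<partial>lborel) \<le> (t * sq_int f + t * A) / 2"
  proof -
    have "- (\<integral>x. f x * \<psi> x \<partial>lborel) = (\<integral>x. - (f x * \<psi> x) \<partial>lborel)" by simp
    also have "\<dots> \<le> (\<integral>x. (t / 2) * (norm (f x))\<^sup>2 + (1 / (2 * t)) * (norm (D x))\<^sup>2 + 0 * (norm (D x))\<^sup>2 \<partial>lborel)"
    proof (rule bbs_integral_mono)
      show "bbs (\<lambda>x. - (f x * \<psi> x))" using f b\<psi> by (intro bbs_uminus bbs_mult)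
      show "bbs (\<lambda>x. (t / 2) * (norm (f x))\<^sup>2 + (1 / (2 * t)) * (norm (D x))\<^sup>2 + 0 * (norm (D x))\<^sup>2)"
        using f bD by (intro bbs_add bbs_cmult_real bbs_norm2)
      fix x
      have "\<bar>\<psi> x\<bar> \<le> 1 * \<bar>D x\<bar>" unfolding \<psi>_def D_def abs_mult
        using cutoffD(6)[OF c] by (intro mult_right_mono) auto
      then have "(\<psi> x)\<^sup>2 \<le> (D x)\<^sup>2" by (simp add: abs_le_square_iff)
      then have "(1 / (2 * t)) * (\<psi> x)\<^sup>2 \<le> (1 / (2 * t)) * (D x)\<^sup>2" using t by (intro mult_left_mono) auto
      moreover have "(- f x) * \<psi> x \<le> (\<psi> x)\<^sup>2 / (4 * (t / 2)) + (t / 2) * (- f x)\<^sup>2"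
        using t by (intro mult_le_quarter) auto
      ultimately show "- (f x * \<psi> x) \<le> (t / 2) * (norm (f x))\<^sup>2 + (1 / (2 * t)) * (norm (D x))\<^sup>2 + 0 * (norm (D x))\<^sup>2"
        by simp
    qed
    also have "\<dots> = (\<integral>x. (t / 2) * (norm (f x))\<^sup>2 \<partial>lborel) + (1 / (2 * t)) * sq_int D + 0 * sq_int D"
      unfolding sq_int_def using f bD
      by (intro bbs_integral_lincomb bbs_cmult_real bbs_norm2)
    also have "\<dots> \<le> (t / 2) * sq_int f + (1 / (2 * t)) * (t\<^sup>2 * A)"
    proof -
      have "(1 / (2 * t)) * sq_int D \<le> (1 / (2 * t)) * (t\<^sup>2 * A)" using sD t by (intro mult_left_mono) auto
      then show ?thesis by (simp add: sq_int_def)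
    qed
    also have "\<dots> = (t * sq_int f + t * A) / 2" using t by (simp add: power2_eq_square field_simps)
    finally show ?thesis .
  qed
  \<comment> \<open>Near-minimality is tested at the midpoint. Expanding the energies for the steps
    1/2 and 1 and eliminating the linear term \<open>I\<close> leaves a fixed fraction of
    \<open>sq_int ?K\<close> to be bounded.\<close>
  have en: "energy f \<phi> G \<le> energy f (\<lambda>x. \<phi> x + (1/2) * \<psi> x) (\<lambda>x. G x + (1/2) *\<^sub>R ?K x) + \<epsilon>"
    using m test_fn_add[OF tf test_fn_cmult[OF t\<psi>, of "1/2"]] unfolding near_minimizer_def by blast
  have "(\<integral>x. f x * (\<phi> x + (1/2) * \<psi> x) \<partial>lborel) = (\<integral>x. f x * \<phi> x + (1/2) * (f x * \<psi> x) + 0 * (f x * \<psi> x) \<partial>lborel)"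
    by (simp add: algebra_simps)
  also have "\<dots> = (\<integral>x. f x * \<phi> x \<partial>lborel) + (1/2) * (\<integral>x. f x * \<psi> x \<partial>lborel) + 0 * (\<integral>x. f x * \<psi> x \<partial>lborel)"
    using f b b\<psi> by (intro bbs_integral_lincomb bbs_mult)
  finally have lin: "(\<integral>x. f x * (\<phi> x + (1/2) * \<psi> x) \<partial>lborel) = (\<integral>x. f x * \<phi> x \<partial>lborel) + (1/2) * (\<integral>x. f x * \<psi> x \<partial>lborel)"
    by simp
  define I where "I = (\<integral>x. inner (G x) (?K x) \<partial>lborel)"
  have e1: "sq_int (\<lambda>x. G x + (1/2) *\<^sub>R ?K x) = A + I + sq_int ?K / 4"
    unfolding sq_int_expand[OF b(2) b\<psi>(2)] A_def I_def by (simp add: power2_eq_square)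
  have e2: "sq_int (\<lambda>x. G x + 1 *\<^sub>R ?K x) = A + 2 * I + sq_int ?K"
    unfolding sq_int_expand[OF b(2) b\<psi>(2)] A_def I_def by simp
  have "A / 2 \<le> (A + I + sq_int ?K / 4) / 2 - (1/2) * (\<integral>x. f x * \<psi> x \<partial>lborel) + \<epsilon>"
    using en unfolding energy_def e1 lin A_def[symmetric] by simp
  then have "sq_int ?K \<le> 8 * \<epsilon> + 2 * t * (1 + 2 * L + 2 * L\<^sup>2) * A + 2 * (t * sq_int f + t * A)"
    using Kt[unfolded e2] f\<psi> by (simp add: field_simps)
  also have "\<dots> = ?rhs" unfolding A_def t_def by (simp add: algebra_simps)
  finally show ?thesis .
qed

section \<open>Construction of cutoffs\<close>

lemma pos_part_square_deriv:
  "((\<lambda>u::real. (max 0 u)\<^sup>2) has_field_derivative 2 * max 0 u) (at u)"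
proof -
  consider "u > 0" | "u < 0" | "u = 0" by linarith
  then show ?thesis
  proof cases
    case 1
    have "((\<lambda>u::real. u\<^sup>2) has_field_derivative 2 * max 0 u) (at u)"
      using 1 by (auto intro!: derivative_eq_intros)
    then show ?thesis
      by (rule has_field_derivative_transform_within_open[of _ _ _ "{0<..}"]) (use 1 in auto)
  next
    case 2
    have "((\<lambda>u::real. 0) has_field_derivative 2 * max 0 u) (at u)"
      using 2 by (auto intro!: derivative_eq_intros)
    then show ?thesis
      by (rule has_field_derivative_transform_within_open[of _ _ _ "{..<0}"]) (use 2 in auto)
  next
    case 3
    have "((\<lambda>h::real. (max 0 h)\<^sup>2 / h) \<longlongrightarrow> 0) (at 0)"
    proof (rule Lim_null_comparison)
      show "\<forall>\<^sub>F h in at 0. norm ((max 0 h)\<^sup>2 / h) \<le> \<bar>h\<bar>"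
        by (intro always_eventually allI) (auto simp: max_def power2_eq_square)
      show "((\<lambda>h::real. \<bar>h\<bar>) \<longlongrightarrow> 0) (at 0)" by (intro tendsto_rabs_zero tendsto_ident_at)
    qed
    then show ?thesis unfolding DERIV_def 3 by simp
  qed
qed

text \<open>The profile g(1 - g(v)), with g the square of the positive part, is continuously
  differentiable and flat at v = 0 and v = 1. It is applied to the affine function v of |x - p|^2
  that is 0 at distance r and 1 at distance 2 r.\<close>

lemma cutoff_ex:
  fixes p :: "'a::euclidean_space"
  assumes r: "0 < r"
  obtains \<theta> \<Theta> L where "cutoff \<theta> \<Theta> L" "\<And>x. dist x p \<le> r \<Longrightarrow> \<theta> x = 1" "\<And>x. 2 * r \<le> dist x p \<Longrightarrow> \<theta> x = 0"
proof
  define g where "g u = (max 0 u)\<^sup>2" for u :: real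
  define c where "c = 1 / (3 * r\<^sup>2)"
  define v where "v x = c * (inner (x - p) (x - p) - r\<^sup>2)" for x
  define d where "d u = (2 * max 0 (1 - g u)) * (- (2 * max 0 u))" for u
  define \<theta> where "\<theta> x = g (1 - g (v x))" for x
  define \<Theta> where "\<Theta> x = d (v x) *\<^sub>R ((2 * c) *\<^sub>R (x - p))" for x
  have g0: "0 \<le> g u" for u by (simp add: g_def)
  have g01: "g u \<le> 1" if "u \<le> 1" for u
    using that power_mono[of "max 0 u" 1 2] by (simp add: g_def)
  have vdist: "v x = ((dist x p)\<^sup>2 - r\<^sup>2) / (3 * r\<^sup>2)" for x
    by (simp add: v_def c_def dist_norm power2_norm_eq_inner)
  have gd: "(g has_field_derivative 2 * max 0 u) (at u)" for u
    unfolding g_def[abs_def] by (rule pos_part_square_deriv)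
  have ggd: "((\<lambda>u. g (1 - g u)) has_field_derivative d u) (at u)" for u
  proof -
    have "((\<lambda>u. 1 - g u) has_field_derivative (- (2 * max 0 u))) (at u)"
      using gd[of u] by (auto intro!: derivative_eq_intros)
    from DERIV_chain2[OF gd this] show ?thesis by (simp add: d_def)
  qed
  have vd: "GDERIV v x :> (2 * c) *\<^sub>R (x - p)" for x
  proof -
    have "((\<lambda>x. inner (x - p) (x - p)) has_derivative (\<lambda>h. inner (x - p) h + inner h (x - p))) (at x)"
      by (auto intro!: derivative_eq_intros)
    then have "(v has_derivative (\<lambda>h. c * (inner (x - p) h + inner h (x - p) - 0))) (at x)"
      unfolding v_def[abs_def] by (intro has_derivative_mult_right has_derivative_diff has_derivative_const)
    moreover have "(\<lambda>h. c * (inner (x - p) h + inner h (x - p) - 0)) = (\<lambda>h. inner h ((2 * c) *\<^sub>R (x - p)))"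
      by (rule ext) (simp add: inner_commute[of "x - p"])
    ultimately show ?thesis unfolding gderiv_def by simp
  qed
  have gder: "GDERIV \<theta> x :> \<Theta> x" for x
    using GDERIV_DERIV_compose[OF vd ggd] unfolding \<theta>_def[abs_def] \<Theta>_def .
  have cont: "continuous_on UNIV \<theta>"
    by (intro continuous_at_imp_continuous_on ballI has_derivative_continuous[OF gder[unfolded gderiv_def]])
  have contT: "continuous_on UNIV \<Theta>"
    unfolding \<Theta>_def d_def v_def g_def by (intro continuous_intros)
  have Lb: "norm (\<Theta> x) \<le> 6 / r" for x
  proof (cases "d (v x) = 0")
    case True
    then show ?thesis using r by (simp add: \<Theta>_def)
  next
    case False
    then have v: "0 < v x" "g (v x) < 1" by (auto simp: d_def max_def split: if_splits)
    have "v x < 1"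
    proof (rule ccontr)
      assume "\<not> v x < 1"
      then have "1 \<le> g (v x)" using power_mono[of 1 "v x" 2] by (simp add: g_def)
      then show False using v by simp
    qed
    then have "(dist x p)\<^sup>2 < (2 * r)\<^sup>2" unfolding vdist using r by (simp add: field_simps power2_eq_square)
    then have dx: "dist x p < 2 * r" using r by (intro power2_less_imp_less[of "dist x p"]) auto
    \<comment> \<open>The profile has slope at most 4 in absolute value and v has gradient at most 2
      c times 2 r; together 16 / (3 r), rounded up to 6 / r.\<close>
    have "\<bar>d (v x)\<bar> = (2 * max 0 (1 - g (v x))) * (2 * v x)" using v by (simp add: d_def abs_mult)
    also have "\<dots> \<le> (2 * 1) * (2 * 1)" using v \<open>v x < 1\<close> g0[of "v x"] by (intro mult_mono) auto
    finally have "norm (\<Theta> x) \<le> 4 * ((2 * c) * (2 * r))"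
      unfolding \<Theta>_def norm_scaleR using dx r
      by (intro mult_mono) (auto simp: dist_norm c_def)
    also have "\<dots> = (16 / 3) / r" using r by (simp add: c_def power2_eq_square)
    also have "\<dots> \<le> 6 / r" using r by (intro divide_right_mono) auto
    finally show ?thesis .
  qed
  show "cutoff \<theta> \<Theta> (6 / r)"
    unfolding cutoff_def
  proof (intro conjI allI impI)
    show "pw_grad \<theta> \<Theta>" unfolding pw_grad_def using cont gder by (auto intro!: exI[of _ "{}"])
    show "\<Theta> \<in> borel_measurable borel" using contT by (rule borel_measurable_continuous_onI)
    show "0 \<le> \<theta> x" "\<theta> x \<le> 1" for x using g0 by (auto simp: \<theta>_def intro: g01)
    show "norm (\<Theta> x) \<le> 6 / r" for x by (rule Lb)
    show "\<Theta> x = 0" if "\<theta> x = 0" for x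
      using that by (auto simp: \<theta>_def \<Theta>_def g_def d_def)
    show "\<bar>\<theta> x - \<theta> y\<bar> \<le> 6 / r * norm (x - y)" for x y
    proof -
      have "norm (\<theta> x - \<theta> y) \<le> 6 / r * norm (x - y)"
      proof (rule differentiable_bound[of UNIV \<theta> "\<lambda>x h. inner h (\<Theta> x)"])
        show "(\<theta> has_derivative (\<lambda>h. inner h (\<Theta> x))) (at x within UNIV)" for x
          using gder[of x] by (simp add: gderiv_def)
        show "onorm (\<lambda>h. inner h (\<Theta> x)) \<le> 6 / r" for x
        proof (rule onorm_le)
          fix h
          have "norm (inner h (\<Theta> x)) \<le> norm h * norm (\<Theta> x)" by (rule Cauchy_Schwarz_ineq2[folded real_norm_def])
          also have "\<dots> \<le> norm h * (6 / r)" using Lb by (intro mult_left_mono) auto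
          finally show "norm (inner h (\<Theta> x)) \<le> 6 / r * norm h" by (simp add: mult.commute)
        qed
      qed auto
      then show ?thesis by simp
    qed
  qed
  show "\<theta> x = 1" if "dist x p \<le> r" for x
  proof -
    have "v x \<le> 0" unfolding vdist using that r power_mono[of "dist x p" r 2] by (simp add: divide_nonpos_pos)
    then show ?thesis by (simp add: \<theta>_def g_def)
  qed
  show "\<theta> x = 0" if "2 * r \<le> dist x p" for x
  proof -
    have "(2 * r)\<^sup>2 \<le> (dist x p)\<^sup>2" using that r by (intro power_mono) auto
    then have "1 \<le> v x" unfolding vdist using r by (simp add: field_simps)
    then have "1 \<le> g (v x)" using power_mono[of 1 "v x" 2] by (simp add: g_def)
    then show ?thesis by (simp add: \<theta>_def g_def[of "1 - _"])
  qed
qed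

text \<open>A uniform cone condition: near p, adding t (n + w) with small w does not lead out of
  \<Omega>. The cutoff of the chart is supported within 2 r; the radius 3 r leaves room for boundary
  points close to that support.\<close>

definition chart :: "'a::euclidean_space set \<Rightarrow> 'a \<Rightarrow> real \<Rightarrow> 'a \<Rightarrow> real \<Rightarrow> bool" where
  "chart \<Omega> p r n \<kappa> \<longleftrightarrow> 0 < r \<and> norm n = 1 \<and> 0 < \<kappa> \<and> \<kappa> \<le> 1 \<and>
     (\<forall>x t w. dist x p < 3 * r \<longrightarrow> 0 \<le> t \<longrightarrow> t \<le> r \<longrightarrow> norm w \<le> \<kappa> \<longrightarrow> x - t *\<^sub>R (n + w) \<in> \<Omega> \<longrightarrow> x \<in> \<Omega>)"

lemma norm_orthogonal_part_le:
  fixes w n :: "'a::euclidean_space"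
  assumes "norm n = 1"
  shows "norm (w - inner w n *\<^sub>R n) \<le> norm w"
proof -
  have n1: "inner n n = 1" using assms by (simp add: norm_eq_1)
  have "(norm (w - inner w n *\<^sub>R n))\<^sup>2 = (norm w)\<^sup>2 - (inner w n)\<^sup>2"
    unfolding power2_norm_eq_inner
    by (simp add: inner_diff_left inner_diff_right inner_commute n1 power2_eq_square algebra_simps)
  then have "(norm (w - inner w n *\<^sub>R n))\<^sup>2 \<le> (norm w)\<^sup>2" by simp
  then show ?thesis by (rule power2_le_imp_le) simp
qed

text \<open>Around an interior point a small ball does. At a boundary point the step t (n + w) gains
  at least t (1 - |w|) in height, while the graph rises by at most L t |w|; this is safe for |w|
  \<le> 1 / (1 + L).\<close>

lemma lipschitz_chart_ex:
  fixes \<Omega> :: "'a::euclidean_space set"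
  assumes lip: "lipschitz_domain \<Omega>" and p: "p \<in> closure \<Omega>"
  obtains r n \<kappa> where "chart \<Omega> p r n \<kappa>"
proof (cases "p \<in> \<Omega>")
  case True
  have "open \<Omega>" using lip by (simp add: lipschitz_domain_def)
  then obtain e where e: "0 < e" "ball p e \<subseteq> \<Omega>" using True openE by blast
  obtain b :: 'a where b: "norm b = 1" using norm_Basis nonempty_Basis by blast
  have "chart \<Omega> p (e / 3) b 1"
    unfolding chart_def using e b by (auto simp: subset_iff dist_commute)
  then show ?thesis by (rule that)
next
  case False
  have "open \<Omega>" using lip by (simp add: lipschitz_domain_def)
  then have "p \<in> frontier \<Omega>" using False p by (simp add: frontier_def interior_open)
  then obtain n \<phi> L r where n: "norm n = 1" and r: "0 < r" and L: "L-lipschitz_on {z. inner z n = 0} \<phi>"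
    and gr: "\<Omega> \<inter> ball p r = {y \<in> ball p r. \<phi> (y - inner y n *\<^sub>R n) < inner y n}"
    using lip unfolding lipschitz_domain_def by blast
  have n1: "inner n n = 1" using n by (simp add: norm_eq_1)
  have L0: "0 \<le> L" using L by (rule lipschitz_on_nonneg)
  \<comment> \<open>The divisor 6 keeps both x, within r / 2 of p, and x - t (n + w), at most r / 3
    away from x, in the ball where \<Omega> lies above a graph.\<close>
  have "chart \<Omega> p (r / 6) n (1 / (1 + L))"
    unfolding chart_def
  proof (intro conjI allI impI)
    fix x t w
    assume x: "dist x p < 3 * (r / 6)" and t: "0 \<le> t" "t \<le> r / 6" and w: "norm w \<le> 1 / (1 + L)"
      and mem: "x - t *\<^sub>R (n + w) \<in> \<Omega>"
    have w1: "norm w \<le> 1" using w L0 order_trans[OF w] by (simp add: divide_le_eq)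
    have xb: "x \<in> ball p r" using x r by (simp add: dist_commute)
    have "norm (t *\<^sub>R (n + w)) \<le> (r / 6) * 2"
      unfolding norm_scaleR using t n w1 norm_triangle_ineq[of n w] by (intro mult_mono) auto
    moreover have "dist (x - t *\<^sub>R (n + w)) x = norm (t *\<^sub>R (n + w))" by (simp only: dist_norm) simp
    ultimately have "dist (x - t *\<^sub>R (n + w)) p < r"
      using x r dist_triangle[of "x - t *\<^sub>R (n + w)" p x] by linarith
    then have yb: "x - t *\<^sub>R (n + w) \<in> ball p r" by (simp add: dist_commute)
    define y where "y = x - t *\<^sub>R (n + w)"
    define a where "a = x - inner x n *\<^sub>R n"
    define b where "b = y - inner y n *\<^sub>R n"
    have yin: "\<phi> b < inner y n" using gr mem yb unfolding y_def b_def by blast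
    have ab: "a - b = t *\<^sub>R (w - inner w n *\<^sub>R n)"
      by (simp add: a_def b_def y_def inner_diff_left inner_add_left n1 algebra_simps)
    have "inner a n = 0" "inner b n = 0" by (simp_all add: a_def b_def inner_diff_left n1)
    then have "\<bar>\<phi> a - \<phi> b\<bar> \<le> L * norm (a - b)" using lipschitz_onD[OF L, of a b] by (simp add: dist_norm)
    also have "\<dots> \<le> L * (t * norm w)"
      unfolding ab using L0 t norm_orthogonal_part_le[OF n, of w] by (intro mult_left_mono) (auto intro: mult_left_mono)
    finally have "\<phi> a \<le> \<phi> b + L * (t * norm w)" by simp
    also have "\<dots> < inner y n + L * (t * norm w)" using yin by simp
    also have "\<dots> = inner x n - t * (1 + inner w n - L * norm w)"
      by (simp add: y_def inner_diff_left inner_add_left n1 algebra_simps)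
    also have "\<dots> \<le> inner x n"
    proof -
      have "\<bar>inner w n\<bar> \<le> norm w" using Cauchy_Schwarz_ineq2[of w n] n by simp
      moreover have "norm w * (1 + L) \<le> 1" using w L0 by (simp add: le_divide_eq)
      ultimately have "0 \<le> 1 + inner w n - L * norm w" by (simp add: algebra_simps)
      then show ?thesis using t by simp
    qed
    finally have "\<phi> (x - inner x n *\<^sub>R n) < inner x n" by (simp add: a_def)
    then show "x \<in> \<Omega>" using gr xb by blast
  qed (use r n L0 in auto)
  then show ?thesis by (rule that)
qed

text \<open>Removes the product rule term from the estimate of \<open>savare_step\<close>; its
  squared norm is O(|z|^2) by \<open>test_fn_shift_diff\<close>.\<close>

lemma translation_step:
  assumes m: "near_minimizer \<Omega> f \<epsilon> \<phi> G" and f: "bbs f" and c: "cutoff \<theta> \<Theta> L"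
    and adm: "\<And>x. \<theta> x \<noteq> 0 \<Longrightarrow> x - z \<in> \<Omega> \<Longrightarrow> x \<in> \<Omega>" and z: "norm z \<le> \<rho>" "\<rho> \<le> 1"
  shows "sq_int (\<lambda>x. \<theta> x *\<^sub>R (G (x - z) - G x))
    \<le> 16 * \<epsilon> + \<rho> * (4 * ((2 + 2 * L + 2 * L\<^sup>2) * sq_int G + sq_int f) + 2 * L\<^sup>2 * sq_int G)"
proof -
  note tf = near_minimizer_test_fn[OF m]
  note b = test_fn_bbs[OF tf]
  let ?K = "\<lambda>x. \<theta> x *\<^sub>R (G (x - z) - G x) + (\<phi> (x - z) - \<phi> x) *\<^sub>R \<Theta> x"
  let ?E = "\<lambda>x. (\<phi> (x - z) - \<phi> x) *\<^sub>R \<Theta> x"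
  have z1: "norm z \<le> 1" using z by simp
  note L0 = cutoffD(8)[OF c]
  have bK: "bbs ?K" using test_fn_bbs(2)[OF cutoff_test_fn[OF tf c adm]] .
  have bD: "bbs (\<lambda>x. \<phi> (x - z) - \<phi> x)" using b by (intro bbs_diff bbs_shift_minus)
  have bE: "bbs ?E" by (rule bbs_scale'[OF bD cutoffD(3)[OF c] cutoffD(7)[OF c]])
  have "sq_int ?E \<le> sq_int (\<lambda>x. L *\<^sub>R (\<phi> (x - z) - \<phi> x))"
  proof (rule sq_int_mono[OF bE bbs_cmult[OF bD]])
    show "norm ((\<phi> (x - z) - \<phi> x) *\<^sub>R \<Theta> x) \<le> norm (L *\<^sub>R (\<phi> (x - z) - \<phi> x))" for x
      using cutoffD(7)[OF c, of x] L0 by (simp add: abs_mult mult.commute[of _ "norm (\<Theta> x)"] mult_right_mono)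
  qed
  also have "\<dots> = L\<^sup>2 * sq_int (\<lambda>x. \<phi> (x - z) - \<phi> x)" by (rule sq_int_cmult)
  also have "\<dots> \<le> L\<^sup>2 * ((norm z)\<^sup>2 * sq_int G)"
    using test_fn_shift_diff[OF tf, of "- z"] by (intro mult_left_mono) auto
  also have "\<dots> \<le> L\<^sup>2 * (\<rho> * sq_int G)"
  proof -
    have "(norm z)\<^sup>2 \<le> \<rho>" using z mult_left_le[of "norm z" "norm z"] by (simp add: power2_eq_square)
    then show ?thesis by (intro mult_left_mono mult_right_mono sq_int_nonneg) auto
  qed
  finally have E: "sq_int ?E \<le> L\<^sup>2 * (\<rho> * sq_int G)" .
  have "sq_int (\<lambda>x. \<theta> x *\<^sub>R (G (x - z) - G x)) = sq_int (\<lambda>x. ?K x - ?E x)" by simp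
  also have "\<dots> \<le> 2 * sq_int ?K + 2 * sq_int ?E" by (rule sq_int_diff[OF bK bE])
  also have "\<dots> \<le> 2 * (8 * \<epsilon> + 2 * \<rho> * ((2 + 2 * L + 2 * L\<^sup>2) * sq_int G + sq_int f)) + 2 * (L\<^sup>2 * (\<rho> * sq_int G))"
  proof -
    have "2 * norm z * ((2 + 2 * L + 2 * L\<^sup>2) * sq_int G + sq_int f) \<le> 2 * \<rho> * ((2 + 2 * L + 2 * L\<^sup>2) * sq_int G + sq_int f)"
      using z L0 sq_int_nonneg[of G] sq_int_nonneg[of f] by (intro mult_right_mono add_nonneg_nonneg mult_nonneg_nonneg) auto
    then have "sq_int ?K \<le> 8 * \<epsilon> + 2 * \<rho> * ((2 + 2 * L + 2 * L\<^sup>2) * sq_int G + sq_int f)"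
      using savare_step[OF m f c adm z1] by linarith
    then show ?thesis using E by (intro add_mono mult_left_mono) auto
  qed
  finally show ?thesis by (simp add: algebra_simps)
qed

text \<open>Arbitrary small translations are differences of admissible ones.\<close>

lemma translation_difference:
  assumes m: "near_minimizer \<Omega> f \<epsilon> \<phi> G" and f: "bbs f" and c: "cutoff \<theta> \<Theta> L"
    and adm1: "\<And>x. \<theta> x \<noteq> 0 \<Longrightarrow> x - z1 \<in> \<Omega> \<Longrightarrow> x \<in> \<Omega>" and z1: "norm z1 \<le> \<rho>"
    and adm2: "\<And>x. \<theta> x \<noteq> 0 \<Longrightarrow> x - z2 \<in> \<Omega> \<Longrightarrow> x \<in> \<Omega>" and z2: "norm z2 \<le> \<rho>" and \<rho>: "\<rho> \<le> 1"
  shows "sq_int (\<lambda>x. \<theta> x *\<^sub>R (G (x - (z1 - z2)) - G x))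
    \<le> 200 * (1 + L + L\<^sup>2) * (\<rho> * (sq_int G + sq_int f) + \<epsilon>)"
proof -
  note tf = near_minimizer_test_fn[OF m]
  note b = test_fn_bbs(2)[OF tf]
  note L0 = cutoffD(8)[OF c]
  note e0 = near_minimizer_eps_nonneg[OF m]
  have \<rho>0: "0 \<le> \<rho>" using z1 norm_ge_zero order_trans by blast
  define T where "T = 16 * \<epsilon> + \<rho> * (4 * ((2 + 2 * L + 2 * L\<^sup>2) * sq_int G + sq_int f) + 2 * L\<^sup>2 * sq_int G)"
  have T1: "sq_int (\<lambda>x. \<theta> x *\<^sub>R (G (x - z1) - G x)) \<le> T" unfolding T_def by (rule translation_step[OF m f c adm1 z1 \<rho>])
  have T2: "sq_int (\<lambda>x. \<theta> x *\<^sub>R (G (x - z2) - G x)) \<le> T" unfolding T_def by (rule translation_step[OF m f c adm2 z2 \<rho>])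
  have bs: "bbs (\<lambda>x. \<theta> x *\<^sub>R (G (x - z) - G x))" for z
    by (intro bbs_scale[OF _ cutoffD(2)[OF c] cutoffD(6)[OF c]] bbs_diff bbs_shift_minus b)
  \<comment> \<open>After the change of variables \<theta> is evaluated at u - z2. The defect is at
    most L \<rho>, so it enters only at order \<rho>^2.\<close>
  define \<delta> where "\<delta> u = \<theta> (u - z2) - \<theta> u" for u
  have \<delta>m: "\<delta> \<in> borel_measurable borel"
    unfolding \<delta>_def using measurable_compose[OF _ cutoffD(2)[OF c], of "\<lambda>u. u - z2" borel] cutoffD(2)[OF c] by simp
  have \<delta>b: "\<bar>\<delta> u\<bar> \<le> L * \<rho>" for u
    using cutoffD(10)[OF c, of "u - z2" u] mult_left_mono[OF z2 L0] by (simp add: \<delta>_def)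
  have bab: "bbs (\<lambda>u. G (u - z1) - G (u - z2))" by (intro bbs_diff bbs_shift_minus b)
  have bd: "bbs (\<lambda>u. \<delta> u *\<^sub>R (G (u - z1) - G (u - z2)))" by (rule bbs_scale[OF bab \<delta>m \<delta>b])
  have s1: "sq_int (\<lambda>u. \<delta> u *\<^sub>R (G (u - z1) - G (u - z2))) \<le> (L * \<rho>)\<^sup>2 * (4 * sq_int G)"
  proof -
    have "sq_int (\<lambda>u. \<delta> u *\<^sub>R (G (u - z1) - G (u - z2))) \<le> sq_int (\<lambda>u. (L * \<rho>) *\<^sub>R (G (u - z1) - G (u - z2)))"
      using \<delta>b L0 \<rho>0 by (intro sq_int_mono bd bbs_cmult bab) (auto intro!: mult_right_mono)
    also have "\<dots> = (L * \<rho>)\<^sup>2 * sq_int (\<lambda>u. G (u - z1) - G (u - z2))" by (rule sq_int_cmult)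
    also have "\<dots> \<le> (L * \<rho>)\<^sup>2 * (4 * sq_int G)"
      using sq_int_diff[OF bbs_shift_minus[OF b] bbs_shift_minus[OF b], of z1 z2]
      by (intro mult_left_mono) (auto simp: sq_int_shift_minus)
    finally show ?thesis .
  qed
  have s2: "sq_int (\<lambda>u. \<theta> u *\<^sub>R (G (u - z1) - G u) - \<theta> u *\<^sub>R (G (u - z2) - G u)) \<le> 4 * T"
    using sq_int_diff[OF bs bs, of z1 z2] T1 T2 by simp
  have "sq_int (\<lambda>x. \<theta> x *\<^sub>R (G (x - (z1 - z2)) - G x)) = sq_int (\<lambda>u. \<theta> (u - z2) *\<^sub>R (G (u - z1) - G (u - z2)))"
    using sq_int_shift_minus[of "\<lambda>x. \<theta> x *\<^sub>R (G (x - (z1 - z2)) - G x)" z2] by (simp add: algebra_simps)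
  also have "\<dots> = sq_int (\<lambda>u. (\<theta> u *\<^sub>R (G (u - z1) - G u) - \<theta> u *\<^sub>R (G (u - z2) - G u)) + \<delta> u *\<^sub>R (G (u - z1) - G (u - z2)))"
    by (simp add: \<delta>_def algebra_simps)
  also have "\<dots> \<le> 2 * (4 * T) + 2 * ((L * \<rho>)\<^sup>2 * (4 * sq_int G))"
    using sq_int_add[OF bbs_diff[OF bs bs] bd, of z1 z2] s1 s2 by linarith
  also have "\<dots> \<le> 8 * T + 8 * L\<^sup>2 * (\<rho> * sq_int G)"
  proof -
    have "\<rho>\<^sup>2 \<le> \<rho>" using \<rho>0 \<rho> mult_left_le[of \<rho> \<rho>] by (simp add: power2_eq_square)
    then have "(8 * L\<^sup>2 * sq_int G) * \<rho>\<^sup>2 \<le> (8 * L\<^sup>2 * sq_int G) * \<rho>"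
      by (intro mult_left_mono mult_nonneg_nonneg sq_int_nonneg) auto
    then show ?thesis by (simp add: power_mult_distrib mult_ac)
  qed
  also have "\<dots> = 128 * \<epsilon> + (\<rho> * sq_int G) * (64 + 64 * L + 88 * L\<^sup>2) + (\<rho> * sq_int f) * 32"
    unfolding T_def by (simp add: algebra_simps)
  also have "\<dots> \<le> (200 * (1 + L + L\<^sup>2)) * \<epsilon> + (\<rho> * sq_int G) * (200 * (1 + L + L\<^sup>2)) + (\<rho> * sq_int f) * (200 * (1 + L + L\<^sup>2))"
    using e0 \<rho>0 L0 sq_int_nonneg[of G] sq_int_nonneg[of f]
    by (intro add_mono mult_left_mono mult_right_mono mult_nonneg_nonneg) (auto simp: add_nonneg_nonneg)
  also have "\<dots> = 200 * (1 + L + L\<^sup>2) * (\<rho> * (sq_int G + sq_int f) + \<epsilon>)" by (simp add: algebra_simps)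
  finally show ?thesis .
qed

lemma chart_admissible:
  assumes "chart \<Omega> p r n \<kappa>" "dist x p < 2 * r" "0 \<le> s" "s \<le> r" "norm w \<le> \<kappa>" "x - s *\<^sub>R (n + w) \<in> \<Omega>"
  shows "x \<in> \<Omega>"
proof -
  have "0 < r" using assms(1) by (simp add: chart_def)
  then have "dist x p < 3 * r" using assms(2) by simp
  then show ?thesis using assms unfolding chart_def by blast
qed

text \<open>Here w is the difference of w + s n and s n with s = |w| / \<kappa>. The first vector is
  s (n + w / s) with |w / s| = \<kappa>, so both are admissible, and the bound on w keeps their
  lengths within 2 s \<le> min 1 r.\<close>

lemma chart_translation:
  assumes ch: "chart \<Omega> p r n \<kappa>" and c: "cutoff \<theta> \<Theta> L" and supp: "\<And>x. 2 * r \<le> dist x p \<Longrightarrow> \<theta> x = 0"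
    and m: "near_minimizer \<Omega> f \<epsilon> \<phi> G" and f: "bbs f" and w: "norm w \<le> \<kappa> * min 1 r / 2"
  shows "sq_int (\<lambda>x. \<theta> x *\<^sub>R (G (x - w) - G x))
    \<le> (200 * (1 + L + L\<^sup>2) * (2 / \<kappa>)) * (norm w * (sq_int G + sq_int f) + \<epsilon>)"
proof (cases "w = 0")
  case True
  then show ?thesis
    using near_minimizer_eps_nonneg[OF m] cutoffD(8)[OF c] ch by (simp add: sq_int_def chart_def)
next
  case False
  have \<kappa>: "0 < \<kappa>" "\<kappa> \<le> 1" "0 < r" "norm n = 1" using ch by (auto simp: chart_def)
  define s where "s = norm w / \<kappa>"
  have s: "0 < s" using False \<kappa> by (simp add: s_def)
  have s_le: "2 * s \<le> min 1 r" 
  proof -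
    have "2 * norm w \<le> min 1 r * \<kappa>" using w by (simp only: mult.commute[of "min 1 r"])
    then show ?thesis unfolding s_def times_divide_eq_right using \<kappa>(1) by (simp only: pos_divide_le_eq)
  qed
  have nw: "norm w \<le> s" using \<kappa> by (simp add: s_def le_divide_eq mult_left_le)
  have adm1: "x \<in> \<Omega>" if "\<theta> x \<noteq> 0" "x - (w + s *\<^sub>R n) \<in> \<Omega>" for x
  proof (rule chart_admissible[OF ch])
    show "dist x p < 2 * r" using supp[of x] that(1) by force
    show "x - s *\<^sub>R (n + (1 / s) *\<^sub>R w) \<in> \<Omega>" using that(2) s by (simp add: algebra_simps)
    show "norm ((1 / s) *\<^sub>R w) \<le> \<kappa>" using s \<kappa> False by (simp add: s_def)
  qed (use s s_le in auto)
  have adm2: "x \<in> \<Omega>" if "\<theta> x \<noteq> 0" "x - s *\<^sub>R n \<in> \<Omega>" for x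
  proof (rule chart_admissible[OF ch])
    show "dist x p < 2 * r" using supp[of x] that(1) by force
    show "x - s *\<^sub>R (n + 0) \<in> \<Omega>" using that(2) by simp
  qed (use s s_le \<kappa> in auto)
  have "sq_int (\<lambda>x. \<theta> x *\<^sub>R (G (x - ((w + s *\<^sub>R n) - s *\<^sub>R n)) - G x))
    \<le> 200 * (1 + L + L\<^sup>2) * ((2 * s) * (sq_int G + sq_int f) + \<epsilon>)"
  proof (rule translation_difference[OF m f c adm1 _ adm2])
    show "norm (w + s *\<^sub>R n) \<le> 2 * s" using nw s \<kappa> norm_triangle_ineq[of w "s *\<^sub>R n"] by simp
  qed (use s s_le \<kappa> in auto)
  also have "\<dots> \<le> 200 * (1 + L + L\<^sup>2) * ((2 / \<kappa>) * (norm w * (sq_int G + sq_int f) + \<epsilon>))"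
  proof (rule mult_left_mono)
    have "1 \<le> 2 / \<kappa>" using \<kappa> by (simp add: le_divide_eq)
    then have "1 * \<epsilon> \<le> (2 / \<kappa>) * \<epsilon>" using near_minimizer_eps_nonneg[OF m] by (intro mult_right_mono)
    then show "(2 * s) * (sq_int G + sq_int f) + \<epsilon> \<le> (2 / \<kappa>) * (norm w * (sq_int G + sq_int f) + \<epsilon>)"
      by (simp add: s_def algebra_simps add_divide_distrib)
  qed (use cutoffD(8)[OF c] in \<open>simp add: add_nonneg_nonneg\<close>)
  finally show ?thesis by (simp only: mult.assoc add_diff_cancel_right')
qed

section \<open>From single charts to the whole domain\<close>

lemma chart_atlas:
  fixes \<Omega> :: "'a::euclidean_space set"
  assumes lip: "lipschitz_domain \<Omega>"
  obtains Q r n \<kappa> \<theta> \<Theta> L e where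
    "finite Q" "Q \<subseteq> closure \<Omega>" "0 < e"
    "\<And>p. p \<in> Q \<Longrightarrow> chart \<Omega> p (r p) (n p) (\<kappa> p)"
    "\<And>p. p \<in> Q \<Longrightarrow> cutoff (\<theta> p) (\<Theta> p) (L p)"
    "\<And>p x. p \<in> Q \<Longrightarrow> dist x p \<le> r p \<Longrightarrow> \<theta> p x = 1"
    "\<And>p x. p \<in> Q \<Longrightarrow> 2 * r p \<le> dist x p \<Longrightarrow> \<theta> p x = 0"
    "\<And>x y. y \<in> closure \<Omega> \<Longrightarrow> dist x y \<le> e \<Longrightarrow> \<exists>p\<in>Q. dist x p < r p"
proof -
  have "\<exists>r n \<kappa> \<theta> \<Theta> L. chart \<Omega> p r n \<kappa> \<and> cutoff \<theta> \<Theta> L \<and> (\<forall>x. dist x p \<le> r \<longrightarrow> \<theta> x = 1) \<and>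
      (\<forall>x. 2 * r \<le> dist x p \<longrightarrow> \<theta> x = 0)" if p: "p \<in> closure \<Omega>" for p
  proof -
    obtain r n \<kappa> where ch: "chart \<Omega> p r n \<kappa>" using lipschitz_chart_ex[OF lip p] .
    then have "0 < r" by (simp add: chart_def)
    then obtain \<theta> \<Theta> L where "cutoff \<theta> \<Theta> L" "\<And>x. dist x p \<le> r \<Longrightarrow> \<theta> x = 1" "\<And>x. 2 * r \<le> dist x p \<Longrightarrow> \<theta> x = 0"
      using cutoff_ex[of r p] by metis
    with ch show ?thesis by blast
  qed
  then obtain r n \<kappa> \<theta> \<Theta> L where *: "\<And>p. p \<in> closure \<Omega> \<Longrightarrow> chart \<Omega> p (r p) (n p) (\<kappa> p) \<and> cutoff (\<theta> p) (\<Theta> p) (L p) \<and>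
      (\<forall>x. dist x p \<le> r p \<longrightarrow> \<theta> p x = 1) \<and> (\<forall>x. 2 * r p \<le> dist x p \<longrightarrow> \<theta> p x = 0)"
    by metis
  have comp: "compact (closure \<Omega>)" using lip by (simp add: lipschitz_domain_def compact_closure)
  have "closure \<Omega> \<subseteq> (\<Union>p\<in>closure \<Omega>. ball p (r p))"
    using * by (auto simp: chart_def)
  then obtain Q where Q: "Q \<subseteq> closure \<Omega>" "finite Q" "closure \<Omega> \<subseteq> (\<Union>p\<in>Q. ball p (r p))"
    using compactE_image[OF comp, of "closure \<Omega>" "\<lambda>p. ball p (r p)"] by (metis open_ball)
  \<comment> \<open>The margin e extends the covering to points slightly outside the closure, as
    translates require.\<close>
  obtain e where e: "0 < e" "(\<Union>x\<in>closure \<Omega>. cball x e) \<subseteq> (\<Union>p\<in>Q. ball p (r p))"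
    using compact_subset_open_imp_cball_epsilon_subset[OF comp _ Q(3)] by (metis open_UN open_ball)
  have "\<exists>p\<in>Q. dist x p < r p" if "y \<in> closure \<Omega>" "dist x y \<le> e" for x y
  proof -
    have "x \<in> (\<Union>x\<in>closure \<Omega>. cball x e)" using that by (auto simp: dist_commute)
    then show ?thesis using e(2) by (force simp: dist_commute)
  qed
  with that[of Q e r n \<kappa> \<theta> \<Theta> L] Q e(1) * show ?thesis by blast
qed

text \<open>Chart by chart, \<open>\<phi>\<close> is replaced on the support of the cutoff by its shift into the domain.\<close>

lemma interior_shift_ex:
  fixes \<Omega> :: "'a::euclidean_space set"
  assumes b: "bounded \<Omega>" and fin: "finite Q"
    and ch: "\<And>p. p \<in> Q \<Longrightarrow> chart \<Omega> p (r p) (n p) (\<kappa> p)"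
    and c: "\<And>p. p \<in> Q \<Longrightarrow> cutoff (\<theta> p) (\<Theta> p) (L p)"
    and supp: "\<And>p x. p \<in> Q \<Longrightarrow> 2 * r p \<le> dist x p \<Longrightarrow> \<theta> p x = 0"
  shows "\<exists>C\<ge>0. \<forall>f \<epsilon> \<phi> G t. near_minimizer \<Omega> f \<epsilon> \<phi> G \<longrightarrow> bbs f \<longrightarrow> 0 \<le> t \<longrightarrow> t \<le> 1 \<longrightarrow> (\<forall>p\<in>Q. t \<le> r p) \<longrightarrow>
    (\<exists>\<psi> K. test_fn \<Omega> \<psi> K \<and> sq_int (\<lambda>x. K x - G x) \<le> C * (t * (sq_int G + sq_int f) + \<epsilon>) \<and>
       (\<forall>x. (\<forall>p\<in>Q. \<theta> p x \<noteq> 0 \<longrightarrow> \<phi> (x - t *\<^sub>R n p) = 0) \<longrightarrow> \<psi> x = (\<Prod>p\<in>Q. 1 - \<theta> p x) * \<phi> x))"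
  using fin ch c supp
proof (induction Q rule: finite_induct)
  case empty
  show ?case
  proof (intro exI[of _ 0] conjI allI impI)
    fix f \<epsilon> \<phi> G t
    assume m: "near_minimizer \<Omega> f \<epsilon> \<phi> G"
    show "\<exists>\<psi> K. test_fn \<Omega> \<psi> K \<and> sq_int (\<lambda>x. K x - G x) \<le> 0 * (t * (sq_int G + sq_int f) + \<epsilon>) \<and>
       (\<forall>x. (\<forall>p\<in>{}. \<theta> p x \<noteq> 0 \<longrightarrow> \<phi> (x - t *\<^sub>R n p) = 0) \<longrightarrow> \<psi> x = (\<Prod>p\<in>{}. 1 - \<theta> p x) * \<phi> x)"
      using near_minimizer_test_fn[OF m] by (intro exI[of _ \<phi>] exI[of _ G]) (simp add: sq_int_def)
  qed simp
next
  case (insert q Q)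
  obtain P where P: "0 < P" "\<And>\<phi> G. test_fn \<Omega> \<phi> G \<Longrightarrow> sq_int \<phi> \<le> P * sq_int G"
    using poincare[OF b] by blast
  have "\<exists>C\<ge>0. \<forall>f \<epsilon> \<phi> G t. near_minimizer \<Omega> f \<epsilon> \<phi> G \<longrightarrow> bbs f \<longrightarrow> 0 \<le> t \<longrightarrow> t \<le> 1 \<longrightarrow> (\<forall>p\<in>Q. t \<le> r p) \<longrightarrow>
    (\<exists>\<psi> K. test_fn \<Omega> \<psi> K \<and> sq_int (\<lambda>x. K x - G x) \<le> C * (t * (sq_int G + sq_int f) + \<epsilon>) \<and>
       (\<forall>x. (\<forall>p\<in>Q. \<theta> p x \<noteq> 0 \<longrightarrow> \<phi> (x - t *\<^sub>R n p) = 0) \<longrightarrow> \<psi> x = (\<Prod>p\<in>Q. 1 - \<theta> p x) * \<phi> x))"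
    using insert by blast
  then obtain C where C: "0 \<le> C" and CC: "\<And>f \<epsilon> \<phi> G t. near_minimizer \<Omega> f \<epsilon> \<phi> G \<Longrightarrow> bbs f \<Longrightarrow> 0 \<le> t \<Longrightarrow> t \<le> 1 \<Longrightarrow> (\<forall>p\<in>Q. t \<le> r p) \<Longrightarrow>
    (\<exists>\<psi> K. test_fn \<Omega> \<psi> K \<and> sq_int (\<lambda>x. K x - G x) \<le> C * (t * (sq_int G + sq_int f) + \<epsilon>) \<and>
       (\<forall>x. (\<forall>p\<in>Q. \<theta> p x \<noteq> 0 \<longrightarrow> \<phi> (x - t *\<^sub>R n p) = 0) \<longrightarrow> \<psi> x = (\<Prod>p\<in>Q. 1 - \<theta> p x) * \<phi> x))"
    by blast
  have ch: "chart \<Omega> q (r q) (n q) (\<kappa> q)" and c: "cutoff (\<theta> q) (\<Theta> q) (L q)"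
    and supp: "\<And>x. 2 * r q \<le> dist x q \<Longrightarrow> \<theta> q x = 0" using insert.prems by auto
  note L0 = cutoffD(8)[OF c]
  define C1 where "C1 = (4 + 4 * (L q)\<^sup>2 * P) * C + 16 + 8 * (1 + L q + (L q)\<^sup>2)"
  have C1: "0 \<le> C1" unfolding C1_def using C L0 P by (intro add_nonneg_nonneg mult_nonneg_nonneg) auto
  show ?case
  proof (intro exI[of _ C1] conjI allI impI C1)
    fix f \<epsilon> \<phi> G t
    assume m: "near_minimizer \<Omega> f \<epsilon> \<phi> G" and f: "bbs f" and t: "0 \<le> t" "t \<le> 1" and tr: "\<forall>p\<in>insert q Q. t \<le> r p"
    note tf = near_minimizer_test_fn[OF m]
    note e0 = near_minimizer_eps_nonneg[OF m]
    define Z where "Z = t * (sq_int G + sq_int f) + \<epsilon>"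
    have Z0: "0 \<le> Z" unfolding Z_def using t e0 sq_int_nonneg[of G] sq_int_nonneg[of f] by (intro add_nonneg_nonneg mult_nonneg_nonneg) auto
    obtain \<psi> K where \<psi>: "test_fn \<Omega> \<psi> K" "sq_int (\<lambda>x. K x - G x) \<le> C * Z"
      "\<And>x. (\<forall>p\<in>Q. \<theta> p x \<noteq> 0 \<longrightarrow> \<phi> (x - t *\<^sub>R n p) = 0) \<Longrightarrow> \<psi> x = (\<Prod>p\<in>Q. 1 - \<theta> p x) * \<phi> x"
      using CC[OF m f t] tr unfolding Z_def by blast
    have n1: "norm (t *\<^sub>R n q) = t" using ch t by (simp add: chart_def)
    have adm: "x \<in> \<Omega>" if "\<theta> q x \<noteq> 0" "x - t *\<^sub>R n q \<in> \<Omega>" for x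
    proof (rule chart_admissible[OF ch])
      show "dist x q < 2 * r q" using supp[of x] that(1) by force
      show "x - t *\<^sub>R (n q + 0) \<in> \<Omega>" using that(2) by simp
    qed (use t tr ch in \<open>auto simp: chart_def\<close>)
    define E where "E x = \<theta> q x *\<^sub>R (G (x - t *\<^sub>R n q) - G x) + (\<phi> (x - t *\<^sub>R n q) - \<phi> x) *\<^sub>R \<Theta> q x" for x
    define \<eta> where "\<eta> x = \<theta> q x * (\<phi> (x - t *\<^sub>R n q) - \<phi> x)" for x
    have te: "test_fn \<Omega> \<eta> E" unfolding \<eta>_def E_def by (rule cutoff_test_fn[OF tf c adm])
    have sE: "sq_int E \<le> (8 + 4 * (1 + L q + (L q)\<^sup>2)) * Z"
    proof -
      have "sq_int E \<le> 8 * \<epsilon> + 2 * t * ((2 + 2 * L q + 2 * (L q)\<^sup>2) * sq_int G + sq_int f)"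
      proof -
        have "norm (t *\<^sub>R n q) \<le> 1" unfolding n1 by (rule t(2))
        from savare_step[OF m f c adm this] show ?thesis unfolding E_def n1 .
      qed
      also have "\<dots> = 8 * \<epsilon> + (4 * (1 + L q + (L q)\<^sup>2)) * (t * sq_int G) + 2 * (t * sq_int f)" by (simp add: algebra_simps)
      also have "\<dots> \<le> (8 + 4 * (1 + L q + (L q)\<^sup>2)) * \<epsilon> + (8 + 4 * (1 + L q + (L q)\<^sup>2)) * (t * sq_int G)
          + (8 + 4 * (1 + L q + (L q)\<^sup>2)) * (t * sq_int f)"
        using e0 t L0 sq_int_nonneg[of G] sq_int_nonneg[of f]
        by (intro add_mono mult_right_mono mult_nonneg_nonneg) auto
      also have "\<dots> = (8 + 4 * (1 + L q + (L q)\<^sup>2)) * Z" by (simp add: Z_def algebra_simps)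
      finally show ?thesis .
    qed
    have td: "test_fn \<Omega> (\<lambda>x. \<psi> x - \<phi> x) (\<lambda>x. K x - G x)" by (rule test_fn_diff[OF \<psi>(1) tf])
    \<comment> \<open>This is (1 - \<theta>) \<psi> + \<theta> times the translate of \<phi>. The
      translate of \<phi> and not of \<psi> is inserted because \<open>savare_step\<close> is
      available only for the near-minimizer.\<close>
    define \<psi>' where "\<psi>' x = (\<psi> x - \<theta> q x * (\<psi> x - \<phi> x)) + \<eta> x" for x
    define K' where "K' x = (K x - (\<theta> q x *\<^sub>R (K x - G x) + (\<psi> x - \<phi> x) *\<^sub>R \<Theta> q x)) + E x" for x
    have "test_fn \<Omega> (\<lambda>x. \<theta> q x * (\<psi> x - \<phi> x)) (\<lambda>x. \<theta> q x *\<^sub>R (K x - G x) + (\<psi> x - \<phi> x) *\<^sub>R \<Theta> q x)"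
      unfolding test_fn_def
    proof (intro conjI)
      show "pw_grad (\<lambda>x. \<theta> q x * (\<psi> x - \<phi> x)) (\<lambda>x. \<theta> q x *\<^sub>R (K x - G x) + (\<psi> x - \<phi> x) *\<^sub>R \<Theta> q x)"
        by (rule pw_grad_mult[OF cutoffD(1)[OF c] test_fn_pw_grad[OF td]])
      show "bbs (\<lambda>x. \<theta> q x *\<^sub>R (K x - G x) + (\<psi> x - \<phi> x) *\<^sub>R \<Theta> q x)"
        by (intro bbs_add bbs_scale[OF _ cutoffD(2)[OF c] cutoffD(6)[OF c]] bbs_scale'[OF _ cutoffD(3)[OF c] cutoffD(7)[OF c]] test_fn_bbs[OF td])
      show "bounded \<Omega>" by (rule b)
    qed (use td in \<open>auto simp: test_fn_def\<close>)
    then have t': "test_fn \<Omega> \<psi>' K'" unfolding \<psi>'_def K'_def by (intro test_fn_add[OF test_fn_diff[OF \<psi>(1)] te])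
    \<comment> \<open>The error splits into (1 - \<theta>) (K - G), the term (\<psi> - \<phi>)
      \<Theta>, controlled by Poincare's inequality, and E; C1 collects the three constants.\<close>
    have "sq_int (\<lambda>x. K' x - G x) \<le> C1 * Z"
    proof -
      let ?X = "\<lambda>x. (1 - \<theta> q x) *\<^sub>R (K x - G x)"
      let ?Y = "\<lambda>x. (\<psi> x - \<phi> x) *\<^sub>R \<Theta> q x"
      have bX: "bbs ?X"
      proof (rule bbs_scale[where C=1])
        show "bbs (\<lambda>x. K x - G x)" by (rule test_fn_bbs(2)[OF td])
        show "(\<lambda>x. 1 - \<theta> q x) \<in> borel_measurable borel" using cutoffD(2)[OF c] by simp
        show "\<bar>1 - \<theta> q x\<bar> \<le> 1" for x using cutoffD(4,5)[OF c, of x] by simp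
      qed
      have bY: "bbs ?Y" by (rule bbs_scale'[OF test_fn_bbs(1)[OF td] cutoffD(3)[OF c] cutoffD(7)[OF c]])
      have sX: "sq_int ?X \<le> C * Z"
      proof -
        have "norm ((1 - \<theta> q x) *\<^sub>R (K x - G x)) \<le> norm (K x - G x)" for x
          using cutoffD(4,5)[OF c, of x] by (simp add: mult_left_le_one_le)
        then have "sq_int ?X \<le> sq_int (\<lambda>x. K x - G x)" by (rule sq_int_mono[OF bX test_fn_bbs(2)[OF td]])
        then show ?thesis using \<psi>(2) by simp
      qed
      have sY: "sq_int ?Y \<le> (L q)\<^sup>2 * (P * (C * Z))"
      proof -
        have "norm ((\<psi> x - \<phi> x) *\<^sub>R \<Theta> q x) \<le> norm (L q *\<^sub>R (\<psi> x - \<phi> x))" for x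
          using cutoffD(7)[OF c, of x] L0 by (simp add: abs_mult mult.commute[of _ "norm (\<Theta> q x)"] mult_right_mono)
        then have "sq_int ?Y \<le> sq_int (\<lambda>x. L q *\<^sub>R (\<psi> x - \<phi> x))"
          by (rule sq_int_mono[OF bY bbs_cmult[OF test_fn_bbs(1)[OF td]]])
        also have "\<dots> = (L q)\<^sup>2 * sq_int (\<lambda>x. \<psi> x - \<phi> x)" by (rule sq_int_cmult)
        also have "\<dots> \<le> (L q)\<^sup>2 * (P * (C * Z))"
        proof (rule mult_left_mono)
          have "sq_int (\<lambda>x. \<psi> x - \<phi> x) \<le> P * sq_int (\<lambda>x. K x - G x)" by (rule P(2)[OF td])
          also have "\<dots> \<le> P * (C * Z)" using \<psi>(2) P(1) by (intro mult_left_mono) auto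
          finally show "sq_int (\<lambda>x. \<psi> x - \<phi> x) \<le> P * (C * Z)" .
        qed simp
        finally show ?thesis .
      qed
      have "(\<lambda>x. K' x - G x) = (\<lambda>x. (?X x - ?Y x) + E x)" by (auto simp: K'_def algebra_simps)
      then have "sq_int (\<lambda>x. K' x - G x) \<le> 2 * sq_int (\<lambda>x. ?X x - ?Y x) + 2 * sq_int E"
        using sq_int_add[OF bbs_diff[OF bX bY] test_fn_bbs(2)[OF te]] by simp
      also have "\<dots> \<le> 2 * (2 * (C * Z) + 2 * ((L q)\<^sup>2 * (P * (C * Z)))) + 2 * ((8 + 4 * (1 + L q + (L q)\<^sup>2)) * Z)"
        by (intro add_mono mult_left_mono order_trans[OF sq_int_diff[OF bX bY]] sX sY sE) auto
      also have "\<dots> = C1 * Z" by (simp add: C1_def algebra_simps)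
      finally show ?thesis .
    qed
    \<comment> \<open>Where all relevant translates vanish, only the factors 1 - \<theta> are left,
      and one cutoff equal to 1 makes the function zero. Vanishing near the boundary is read off
      from this.\<close>
    moreover have "\<psi>' x = (\<Prod>p\<in>insert q Q. 1 - \<theta> p x) * \<phi> x"
      if x: "\<forall>p\<in>insert q Q. \<theta> p x \<noteq> 0 \<longrightarrow> \<phi> (x - t *\<^sub>R n p) = 0" for x
    proof -
      have "\<psi> x = (\<Prod>p\<in>Q. 1 - \<theta> p x) * \<phi> x" using \<psi>(3) x by blast
      moreover have "\<theta> q x * \<phi> (x - t *\<^sub>R n q) = 0" using x by auto
      ultimately show ?thesis using insert.hyps by (simp add: \<psi>'_def \<eta>_def algebra_simps)
    qed
    ultimately show "\<exists>\<psi> K. test_fn \<Omega> \<psi> K \<and> sq_int (\<lambda>x. K x - G x) \<le> C1 * (t * (sq_int G + sq_int f) + \<epsilon>) \<and>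
       (\<forall>x. (\<forall>p\<in>insert q Q. \<theta> p x \<noteq> 0 \<longrightarrow> \<phi> (x - t *\<^sub>R n p) = 0) \<longrightarrow> \<psi> x = (\<Prod>p\<in>insert q Q. 1 - \<theta> p x) * \<phi> x)"
      using t' unfolding Z_def by blast
  qed
qed

text \<open>Where the difference is nonzero, x or x - w lies in \<Omega>, so x is within e of
  \<Omega> and some cutoff equals 1 there. The sum of the localized squares therefore dominates the
  square.\<close>

lemma global_translation:
  fixes \<Omega> :: "'a::euclidean_space set"
  assumes fin: "finite Q"
    and ch: "\<And>p. p \<in> Q \<Longrightarrow> chart \<Omega> p (r p) (n p) (\<kappa> p)"
    and c: "\<And>p. p \<in> Q \<Longrightarrow> cutoff (\<theta> p) (\<Theta> p) (L p)"
    and one: "\<And>p x. p \<in> Q \<Longrightarrow> dist x p \<le> r p \<Longrightarrow> \<theta> p x = 1"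
    and supp: "\<And>p x. p \<in> Q \<Longrightarrow> 2 * r p \<le> dist x p \<Longrightarrow> \<theta> p x = 0"
    and cover: "\<And>x y. y \<in> closure \<Omega> \<Longrightarrow> dist x y \<le> e \<Longrightarrow> \<exists>p\<in>Q. dist x p < r p"
    and m: "near_minimizer \<Omega> f \<epsilon> \<phi> G" and f: "bbs f"
    and w: "norm w \<le> e" "\<And>p. p \<in> Q \<Longrightarrow> norm w \<le> \<kappa> p * min 1 (r p) / 2"
  shows "sq_int (\<lambda>x. G (x - w) - G x)
    \<le> (\<Sum>p\<in>Q. 200 * (1 + L p + (L p)\<^sup>2) * (2 / \<kappa> p)) * (norm w * (sq_int G + sq_int f) + \<epsilon>)"
proof -
  note tf = near_minimizer_test_fn[OF m]
  have bG: "bbs (\<lambda>x. G (x - w) - G x)" by (intro bbs_diff bbs_shift_minus test_fn_bbs[OF tf])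
  let ?g = "\<lambda>p x. (norm (\<theta> p x *\<^sub>R (G (x - w) - G x)))\<^sup>2"
  have bg: "bbs (?g p)" if "p \<in> Q" for p
    by (intro bbs_norm2 bbs_scale[OF bG cutoffD(2)[OF c[OF that]] cutoffD(6)[OF c[OF that]]])
  have "sq_int (\<lambda>x. G (x - w) - G x) \<le> (\<integral>x. (\<Sum>p\<in>Q. ?g p x) \<partial>lborel)"
    unfolding sq_int_def
  proof (rule bbs_integral_mono)
    show "bbs (\<lambda>x. (norm (G (x - w) - G x))\<^sup>2)" by (rule bbs_norm2[OF bG])
    show "bbs (\<lambda>x. \<Sum>p\<in>Q. ?g p x)" by (rule bbs_sum) (rule bg)
    fix x
    show "(norm (G (x - w) - G x))\<^sup>2 \<le> (\<Sum>p\<in>Q. ?g p x)"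
    proof (cases "x \<in> \<Omega> \<or> x - w \<in> \<Omega>")
      case True
      then obtain y where "y \<in> \<Omega>" "dist x y \<le> norm w" by (auto simp: dist_norm)
      then obtain p where p: "p \<in> Q" "dist x p < r p" using cover[of y x] w(1) closure_subset by force
      then have "(norm (G (x - w) - G x))\<^sup>2 = ?g p x" using one[of p x] by simp
      also have "\<dots> \<le> (\<Sum>p\<in>Q. ?g p x)" using p(1) fin by (intro member_le_sum) auto
      finally show ?thesis .
    next
      case False
      then have "G (x - w) - G x = 0" using tf by (simp add: test_fn_def)
      then show ?thesis by (simp add: sum_nonneg)
    qed
  qed
  also have "\<dots> = (\<Sum>p\<in>Q. sq_int (\<lambda>x. \<theta> p x *\<^sub>R (G (x - w) - G x)))"
    unfolding sq_int_def by (rule Bochner_Integration.integral_sum) (rule bbs_integrable[OF bg])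
  also have "\<dots> \<le> (\<Sum>p\<in>Q. (200 * (1 + L p + (L p)\<^sup>2) * (2 / \<kappa> p)) * (norm w * (sq_int G + sq_int f) + \<epsilon>))"
    using chart_translation[OF ch c supp m f w(2)] by (intro sum_mono) blast
  finally show ?thesis by (simp add: sum_distrib_right)
qed

section \<open>Regularity for the dual problem\<close>

lemma finite_positive_lower_bound:
  assumes "finite Q" "\<And>p. p \<in> Q \<Longrightarrow> 0 < (h p :: real)"
  obtains k where "0 < k" "k \<le> 1" "\<And>p. p \<in> Q \<Longrightarrow> k \<le> h p"
proof
  show "0 < Min (insert 1 (h ` Q))" using assms by (subst Min_gr_iff) auto
qed (use assms in auto)

text \<open>For the problem \<open>- \<Delta> z = f\<close> with homogeneous boundary values: \<open>\<phi>\<close> is an approximate solution,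
  \<open>\<psi>\<close> a nearby function vanishing close to the boundary, and the last two bounds express that the
  solution has half a derivative more than \<open>H\<^sup>1\<close>, measured at the scale \<open>H\<close>.\<close>

definition dual_estimate :: "'a::euclidean_space set \<Rightarrow> real \<Rightarrow> bool" where
  "dual_estimate \<Omega> C \<longleftrightarrow> (\<forall>f H. bbs f \<longrightarrow> 0 < H \<longrightarrow> 0 < sq_int f \<longrightarrow>
      (\<exists>\<phi> G \<psi> K. test_fn \<Omega> \<phi> G \<and> test_fn \<Omega> \<psi> K \<and>
        (\<forall>z Z. test_fn \<Omega> z Z \<longrightarrow> ((\<integral>x. inner (G x) (Z x) \<partial>lborel) - (\<integral>x. f x * z x \<partial>lborel))\<^sup>2 \<le> 2 * (H * sq_int f) * sq_int Z) \<and>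
        (\<forall>x q. q \<in> frontier \<Omega> \<longrightarrow> dist x q \<le> 2 * H \<longrightarrow> \<psi> x = 0) \<and>
        sq_int (\<lambda>x. K x - G x) \<le> C * (H * sq_int f) \<and>
        (\<forall>w. norm w \<le> 2 * H \<longrightarrow> sq_int (\<lambda>x. K (x + w) - K x) \<le> C * (H * sq_int f))))"

text \<open>Up to a threshold for H the charts apply: \<open>interior_shift_ex\<close> provides
  \<psi> and \<open>global_translation\<close> the half derivative. Beyond it \<psi> = 0 is good
  enough, because the whole energy is then bounded by a multiple of H |f|^2.\<close>

theorem dual_regularity:
  fixes \<Omega> :: "'a::euclidean_space set"
  assumes lip: "lipschitz_domain \<Omega>"
  obtains C where "0 < C"
    "dual_estimate \<Omega> C"
proof -
  have b: "bounded \<Omega>" and op: "open \<Omega>" using lip by (auto simp: lipschitz_domain_def)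
  obtain P where P: "0 < P" "\<And>\<phi> G. test_fn \<Omega> \<phi> G \<Longrightarrow> sq_int \<phi> \<le> P * sq_int G"
    using poincare[OF b] by blast
  obtain Q r n \<kappa> \<theta> \<Theta> L e where fin: "finite Q" and e: "0 < e"
    and ch: "\<And>p. p \<in> Q \<Longrightarrow> chart \<Omega> p (r p) (n p) (\<kappa> p)"
    and c: "\<And>p. p \<in> Q \<Longrightarrow> cutoff (\<theta> p) (\<Theta> p) (L p)"
    and one: "\<And>p x. p \<in> Q \<Longrightarrow> dist x p \<le> r p \<Longrightarrow> \<theta> p x = 1"
    and supp: "\<And>p x. p \<in> Q \<Longrightarrow> 2 * r p \<le> dist x p \<Longrightarrow> \<theta> p x = 0"
    and cover: "\<And>x y. y \<in> closure \<Omega> \<Longrightarrow> dist x y \<le> e \<Longrightarrow> \<exists>p\<in>Q. dist x p < r p"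
    by (rule chart_atlas[OF lip]) (rule that)
  obtain k where k: "0 < k" "k \<le> 1" "\<And>p. p \<in> Q \<Longrightarrow> k \<le> \<kappa> p"
    using finite_positive_lower_bound[OF fin, of \<kappa>] ch by (auto simp: chart_def)
  obtain \<rho>' where \<rho>': "0 < \<rho>'" "\<rho>' \<le> 1" "\<And>p. p \<in> Q \<Longrightarrow> \<rho>' \<le> r p"
    using finite_positive_lower_bound[OF fin, of r] ch by (auto simp: chart_def)
  define \<rho> where "\<rho> = min \<rho>' e"
  have \<rho>: "0 < \<rho>" "\<rho> \<le> 1" "\<rho> \<le> e" "\<And>p. p \<in> Q \<Longrightarrow> \<rho> \<le> r p" using \<rho>' e by (force simp: \<rho>_def)+
  obtain C5 where C5: "0 \<le> C5" and shift: "\<And>f \<epsilon> \<phi> G t. near_minimizer \<Omega> f \<epsilon> \<phi> G \<Longrightarrow> bbs f \<Longrightarrow> 0 \<le> t \<Longrightarrow> t \<le> 1 \<Longrightarrow> (\<forall>p\<in>Q. t \<le> r p) \<Longrightarrow>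
    (\<exists>\<psi> K. test_fn \<Omega> \<psi> K \<and> sq_int (\<lambda>x. K x - G x) \<le> C5 * (t * (sq_int G + sq_int f) + \<epsilon>) \<and>
       (\<forall>x. (\<forall>p\<in>Q. \<theta> p x \<noteq> 0 \<longrightarrow> \<phi> (x - t *\<^sub>R n p) = 0) \<longrightarrow> \<psi> x = (\<Prod>p\<in>Q. 1 - \<theta> p x) * \<phi> x))"
    using interior_shift_ex[where Q=Q and r=r and n=n and \<kappa>=\<kappa> and \<theta>=\<theta> and \<Theta>=\<Theta> and L=L, OF b fin ch c supp] by blast
  define CT where "CT = (\<Sum>p\<in>Q. 200 * (1 + L p + (L p)\<^sup>2) * (2 / \<kappa> p))"
  have \<kappa>pos: "0 < \<kappa> p" if "p \<in> Q" for p using ch[OF that] by (simp add: chart_def)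
  have CT: "0 \<le> CT" unfolding CT_def
    using cutoffD(8)[OF c] \<kappa>pos by (intro sum_nonneg mult_nonneg_nonneg) (auto simp: add_nonneg_nonneg less_imp_le)
  define H1 where "H1 = k * \<rho> / 4"
  have H1: "0 < H1" "H1 \<le> 1" using k(1,2) \<rho>(1,2) mult_le_one[of k \<rho>] by (auto simp: H1_def)
  \<comment> \<open>Bounds t (|G|^2 + |f|^2) + H |f|^2 by c2 H |f|^2 for t = 2 H / k, given |G|^2
    \<le> (4 P + 4) |f|^2.\<close>
  define c2 where "c2 = (2 / k) * (4 * P + 5) + 1"
  have c2: "0 \<le> c2" using k P by (simp add: c2_def)
  define C where "C = 6 * (C5 * c2) + 4 * (CT * c2) + (4 * P / H1 + 4)"
  have C_le: "4 * P / H1 + 4 \<le> C" "0 < C" "C5 * c2 \<le> C" "6 * (C5 * c2) + 4 * (CT * c2) \<le> C"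
  proof -
    have "0 \<le> C5 * c2" "0 \<le> CT * c2" "0 < 4 * P / H1 + 4"
      using C5 CT c2 P H1 by (auto simp: add_pos_pos)
    then show "4 * P / H1 + 4 \<le> C" "0 < C" "C5 * c2 \<le> C" "6 * (C5 * c2) + 4 * (CT * c2) \<le> C"
      unfolding C_def by linarith+
  qed
  show ?thesis
  proof (rule that[OF C_le(2)], unfold dual_estimate_def, intro allI impI)
    fix f :: "'a \<Rightarrow> real" and H :: real
    assume f: "bbs f" and H: "0 < H" and F: "0 < sq_int f"
    define F where "F = sq_int f"
    have F0: "0 < F" using F by (simp add: F_def)
    have HF: "0 < H * F" using H F0 by simp
    \<comment> \<open>The tolerance H |f|^2 has the order of all the bounds to be proved.\<close>
    obtain \<phi> G where m: "near_minimizer \<Omega> f (H * F) \<phi> G" using near_minimizer_ex[OF b f HF] .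
    note tf = near_minimizer_test_fn[OF m]
    have A: "sq_int G \<le> 4 * P * F + 4 * (H * F)" using near_minimizer_bound[OF P b f m] by (simp add: F_def)
    have EL: "\<forall>z Z. test_fn \<Omega> z Z \<longrightarrow> ((\<integral>x. inner (G x) (Z x) \<partial>lborel) - (\<integral>x. f x * z x \<partial>lborel))\<^sup>2 \<le> 2 * (H * sq_int f) * sq_int Z"
      using near_minimizer_euler_lagrange[OF m f] by (simp add: F_def)
    show "\<exists>\<phi> G \<psi> K. test_fn \<Omega> \<phi> G \<and> test_fn \<Omega> \<psi> K \<and>
        (\<forall>z Z. test_fn \<Omega> z Z \<longrightarrow> ((\<integral>x. inner (G x) (Z x) \<partial>lborel) - (\<integral>x. f x * z x \<partial>lborel))\<^sup>2 \<le> 2 * (H * sq_int f) * sq_int Z) \<and>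
        (\<forall>x q. q \<in> frontier \<Omega> \<longrightarrow> dist x q \<le> 2 * H \<longrightarrow> \<psi> x = 0) \<and>
        sq_int (\<lambda>x. K x - G x) \<le> C * (H * sq_int f) \<and>
        (\<forall>w. norm w \<le> 2 * H \<longrightarrow> sq_int (\<lambda>x. K (x + w) - K x) \<le> C * (H * sq_int f))"
    proof (cases "H \<le> H1")
      case False
      have "sq_int G \<le> (4 * P / H1 + 4) * (H * F)"
      proof -
        have "(4 * P) * F * 1 \<le> (4 * P) * F * (H / H1)"
          using False H1 P F0 by (intro mult_left_mono) (auto simp: le_divide_eq)
        then show ?thesis using A by (simp add: algebra_simps)
      qed
      also have "\<dots> \<le> C * (H * F)" using C_le(1) HF by (intro mult_right_mono) auto
      finally have "sq_int G \<le> C * (H * F)" .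
      then show ?thesis
        using tf EL test_fn_zero[OF b] C_le(2) HF
        by (intro exI[of _ \<phi>] exI[of _ G] exI[of _ "\<lambda>x. 0"]) (auto simp: sq_int_uminus F_def sq_int_def)
    next
      case True
      \<comment> \<open>Long enough that every q within 2 H of x satisfies |q - x| / t \<le> k \<le>
        \<kappa>, so that the displacement from x - t n to q lies in the cone of each chart.\<close>
      define t where "t = 2 * H / k"
      have t: "0 \<le> t" "t \<le> \<rho>" "t \<le> 1" "2 * H \<le> t"
      proof -
        show "0 \<le> t" using H k by (simp add: t_def)
        have "4 * H \<le> \<rho> * k" using True by (simp add: H1_def mult.commute)
        then have "2 * H \<le> \<rho> * k" using H by linarith
        then show "t \<le> \<rho>" unfolding t_def using k(1) by (simp only: pos_divide_le_eq)
        then show "t \<le> 1" using \<rho>(2) by simp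
        show "2 * H \<le> t" unfolding t_def using k(1,2) H mult_left_le[of k "2 * H"] by (simp add: pos_le_divide_eq)
      qed
      have AF: "sq_int G + F \<le> (4 * P + 5) * F"
      proof -
        have "H * F \<le> 1 * F" using True H1(2) F0 by (intro mult_right_mono) auto
        then show ?thesis using A by (simp add: algebra_simps)
      qed
      have Z: "t * (sq_int G + F) + H * F \<le> c2 * (H * F)"
      proof -
        have "t * (sq_int G + F) \<le> t * ((4 * P + 5) * F)" using AF t(1) by (rule mult_left_mono)
        then show ?thesis by (simp add: t_def c2_def algebra_simps)
      qed
      have tr: "\<forall>p\<in>Q. t \<le> r p" using t(2) \<rho>(4) by force
      from shift[OF m f t(1,3) tr] obtain \<psi> K where K: "test_fn \<Omega> \<psi> K"
        "sq_int (\<lambda>x. K x - G x) \<le> C5 * (t * (sq_int G + sq_int f) + H * F)"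
        "\<And>x. (\<forall>p\<in>Q. \<theta> p x \<noteq> 0 \<longrightarrow> \<phi> (x - t *\<^sub>R n p) = 0) \<Longrightarrow> \<psi> x = (\<Prod>p\<in>Q. 1 - \<theta> p x) * \<phi> x"
        by blast
      have sKG: "sq_int (\<lambda>x. K x - G x) \<le> (C5 * c2) * (H * F)"
      proof -
        have "C5 * (t * (sq_int G + sq_int f) + H * F) \<le> C5 * (c2 * (H * F))"
          using Z C5 unfolding F_def by (intro mult_left_mono) auto
        then show ?thesis using K(2) by (simp add: mult.assoc)
      qed
      have zero: "\<psi> x = 0" if q: "q \<in> frontier \<Omega>" "dist x q \<le> 2 * H" for x q
      proof -
        have qn: "q \<notin> \<Omega>" "q \<in> closure \<Omega>" using q(1) op by (auto simp: frontier_def interior_open)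
        have "\<phi> (x - t *\<^sub>R n p) = 0" if p: "p \<in> Q" "\<theta> p x \<noteq> 0" for p
        proof (rule ccontr)
          assume "\<phi> (x - t *\<^sub>R n p) \<noteq> 0"
          then have mem: "x - t *\<^sub>R n p \<in> \<Omega>" using tf unfolding test_fn_def by blast
          have tpos: "0 < t" using t(4) H by simp
          define w where "w = (1 / t) *\<^sub>R (q - x)"
          have "norm w \<le> \<kappa> p"
          proof -
            have "norm w = dist x q / t" using tpos by (simp add: w_def dist_norm norm_minus_commute)
            also have "\<dots> \<le> 2 * H / t" using q(2) tpos by (intro divide_right_mono) auto
            also have "\<dots> = k" using H k by (simp add: t_def)
            finally show ?thesis using k(3)[OF p(1)] by simp
          qed
          moreover have "q - t *\<^sub>R (n p + w) = x - t *\<^sub>R n p" using tpos by (simp add: w_def algebra_simps)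
          moreover have "dist q p < 3 * r p"
          proof -
            have "dist x p < 2 * r p" using supp[OF p(1), of x] p(2) by force
            moreover have "dist q x \<le> r p" using q(2) t(4) tr p(1) by (force simp: dist_commute)
            ultimately show ?thesis using dist_triangle[of q p x] by simp
          qed
          \<comment> \<open>The boundary point q is the point x - t n of \<Omega> moved by t (n +
            w), so the chart would place it in \<Omega>.\<close>
          ultimately have "q \<in> \<Omega>"
            using ch[OF p(1)] mem t(1) tr p(1) unfolding chart_def by metis
          then show False using qn by blast
        qed
        then have eq: "\<psi> x = (\<Prod>p\<in>Q. 1 - \<theta> p x) * \<phi> x" by (intro K(3)) blast
        have "dist x q \<le> e" using q(2) t(4) t(2) \<rho>(3) by linarith
        then obtain p where "p \<in> Q" "dist x p < r p" using cover[OF qn(2)] by blast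
        then have "(\<Prod>p\<in>Q. 1 - \<theta> p x) = 0" using fin one[of p x] by (intro prod_zero) auto
        then show ?thesis using eq by simp
      qed
      have trans: "sq_int (\<lambda>x. K (x + w) - K x) \<le> C * (H * F)" if w: "norm w \<le> 2 * H" for w
      proof -
        have T: "sq_int (\<lambda>x. G (x - (- w)) - G x) \<le> (CT * c2) * (H * F)"
        proof -
          have "sq_int (\<lambda>x. G (x - (- w)) - G x) \<le> CT * (norm (- w) * (sq_int G + sq_int f) + H * F)"
            unfolding CT_def
          proof (rule global_translation[where Q=Q and r=r and n=n and \<kappa>=\<kappa> and \<theta>=\<theta> and \<Theta>=\<Theta> and L=L and e=e, OF fin ch c one supp cover m f])
            show "norm (- w) \<le> e" using w t(2,4) \<rho>(3) by simp
            fix p assume p: "p \<in> Q"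
            have "norm (- w) \<le> k * \<rho> / 2" using w True by (simp add: H1_def)
            also have "\<dots> \<le> \<kappa> p * min 1 (r p) / 2"
              using k \<rho> p by (intro divide_right_mono mult_mono) (auto intro: order_trans[OF less_imp_le])
            finally show "norm (- w) \<le> \<kappa> p * min 1 (r p) / 2" .
          qed
          also have "\<dots> \<le> CT * (c2 * (H * F))"
          proof (rule mult_left_mono[OF _ CT])
            have "norm (- w) * (sq_int G + F) \<le> t * (sq_int G + F)"
              using w t(4) sq_int_nonneg[of G] F0 by (intro mult_right_mono) auto
            then show "norm (- w) * (sq_int G + sq_int f) + H * F \<le> c2 * (H * F)" using Z by (simp add: F_def)
          qed
          finally show ?thesis by (simp add: mult.assoc)
        qed
        have bKG: "bbs (\<lambda>x. K x - G x)" and bG: "bbs G" using test_fn_bbs(2)[OF K(1)] test_fn_bbs(2)[OF tf] by auto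
        let ?a = "\<lambda>x. K (x + w) - G (x + w)"
        let ?b = "\<lambda>x. G (x - (- w)) - G x"
        have ba: "bbs ?a" using bbs_shift[OF bKG] .
        have bb: "bbs ?b" using bG by (intro bbs_diff bbs_shift_minus)
        have sa: "sq_int ?a = sq_int (\<lambda>x. K x - G x)" by (rule sq_int_shift[of "\<lambda>x. K x - G x"])
        \<comment> \<open>G is inserted at both points: this leaves two copies of K - G, one of them
          translated, and the translation difference of G.\<close>
        have "sq_int (\<lambda>x. K (x + w) - K x) = sq_int (\<lambda>x. (?a x + ?b x) - (K x - G x))" by (simp add: algebra_simps)
        also have "\<dots> \<le> 2 * sq_int (\<lambda>x. ?a x + ?b x) + 2 * sq_int (\<lambda>x. K x - G x)"
          by (rule sq_int_diff[OF bbs_add[OF ba bb] bKG])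
        also have "\<dots> \<le> 6 * ((C5 * c2) * (H * F)) + 4 * ((CT * c2) * (H * F))"
          using sq_int_add[OF ba bb] sa sKG T by linarith
        also have "\<dots> = (6 * (C5 * c2) + 4 * (CT * c2)) * (H * F)" by (simp add: algebra_simps)
        also have "\<dots> \<le> C * (H * F)" using C_le(4) HF by (intro mult_right_mono) auto
        finally show ?thesis .
      qed
      have "sq_int (\<lambda>x. K x - G x) \<le> C * (H * F)"
        using sKG mult_right_mono[OF C_le(3), of "H * F"] HF by linarith
      then show ?thesis using tf K(1) EL zero trans unfolding F_def by blast
    qed
  qed
qed

section \<open>Strips along the boundary\<close>

text \<open>The graph function is extended to the whole space, constant along n, so that heights can
  be compared without projecting.\<close>

lemma lipschitz_graph_ex:
  fixes \<Omega> :: "'a::euclidean_space set"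
  assumes lip: "lipschitz_domain \<Omega>" and p: "p \<in> frontier \<Omega>"
  obtains h L R n where "norm n = 1" "0 < R" "0 \<le> L"
    "\<And>x y. \<bar>h x - h y\<bar> \<le> L * dist x y" "\<And>x t. h (x + t *\<^sub>R n) = (h x :: real)"
    "\<And>y. y \<in> ball p R \<Longrightarrow> y \<in> \<Omega> \<longleftrightarrow> h y < inner y n"
proof -
  obtain n \<phi> L r where n: "norm n = 1" and r: "0 < r" and L: "L-lipschitz_on {z. inner z n = 0} \<phi>"
    and gr: "\<Omega> \<inter> ball p r = {y \<in> ball p r. \<phi> (y - inner y n *\<^sub>R n) < inner y n}"
    using lip p unfolding lipschitz_domain_def by blast
  have n1: "inner n n = 1" using n by (simp add: norm_eq_1)
  have L0: "0 \<le> L" using L by (rule lipschitz_on_nonneg)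
  define h where "h y = \<phi> (y - inner y n *\<^sub>R n)" for y
  show ?thesis
  proof (rule that[OF n r L0])
    show "\<bar>h x - h y\<bar> \<le> L * dist x y" for x y
    proof -
      have "inner (x - inner x n *\<^sub>R n) n = 0" "inner (y - inner y n *\<^sub>R n) n = 0" by (simp_all add: inner_diff_left n1)
      then have "\<bar>h x - h y\<bar> \<le> L * norm ((x - inner x n *\<^sub>R n) - (y - inner y n *\<^sub>R n))"
        using lipschitz_onD[OF L, of "x - inner x n *\<^sub>R n" "y - inner y n *\<^sub>R n"] by (simp add: dist_norm h_def)
      also have "(x - inner x n *\<^sub>R n) - (y - inner y n *\<^sub>R n) = (x - y) - inner (x - y) n *\<^sub>R n"
        by (simp add: inner_diff_left algebra_simps)
      also have "L * norm \<dots> \<le> L * dist x y"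
        using norm_orthogonal_part_le[OF n, of "x - y"] L0 by (simp add: dist_norm mult_left_mono)
      finally show ?thesis .
    qed
    show "h (x + t *\<^sub>R n) = h x" for x t by (simp add: h_def inner_add_left n1 algebra_simps)
    show "y \<in> \<Omega> \<longleftrightarrow> h y < inner y n" if "y \<in> ball p r" for y
      using gr that unfolding h_def by blast
  qed
qed

lemma graph_closure_le:
  fixes \<Omega> :: "'a::euclidean_space set"
  assumes n: "norm n = 1" and L: "0 \<le> L" and lip: "\<And>x y. \<bar>h x - h y\<bar> \<le> L * dist x y"
    and gr: "\<And>y. y \<in> ball p R \<Longrightarrow> y \<in> \<Omega> \<Longrightarrow> h y < inner y n"
    and y: "y \<in> closure \<Omega>" "y \<in> ball p R"
  shows "h y \<le> inner y n"
proof (rule field_le_epsilon)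
  fix e :: real assume e: "0 < e"
  define e' where "e' = min (e / (1 + L)) (R - dist p y)"
  have e': "0 < e'" "e' \<le> R - dist p y" "e' * (1 + L) \<le> e"
  proof -
    show "0 < e'" using e L y(2) by (simp add: e'_def)
    show "e' \<le> R - dist p y" by (simp add: e'_def)
    have "e' \<le> e / (1 + L)" by (simp add: e'_def)
    then show "e' * (1 + L) \<le> e" using L by (simp add: pos_le_divide_eq)
  qed
  obtain z where z: "z \<in> \<Omega>" "dist z y < e'" using y(1) e'(1) closure_approachable by blast
  have "z \<in> ball p R" using z(2) e'(2) dist_triangle[of p z y] by (simp add: dist_commute)
  then have "h z < inner z n" using gr z(1) by blast
  moreover have "h y \<le> h z + L * dist y z" using lip[of y z] by simp
  moreover have "inner z n \<le> inner y n + dist z y"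
    using Cauchy_Schwarz_ineq2[of "z - y" n] n by (simp add: inner_diff_left dist_norm)
  moreover have "L * dist y z + dist z y \<le> e' * (1 + L)"
    using z(2) L mult_left_mono[of "dist z y" e' L] by (simp add: dist_commute algebra_simps)
  ultimately show "h y \<le> inner y n + e" using e'(3) by linarith
qed

text \<open>Excludes slits: points straight below a boundary point lie strictly below the graph,
  hence not in the closure. This is what places the interiors of the elements inside
  \<Omega>.\<close>

lemma interior_closure_lipschitz:
  assumes lip: "lipschitz_domain \<Omega>"
  shows "interior (closure \<Omega>) = \<Omega>"
proof (rule subset_antisym)
  have op: "open \<Omega>" using lip by (simp add: lipschitz_domain_def)
  show "\<Omega> \<subseteq> interior (closure \<Omega>)" using op closure_subset by (rule interior_maximal[rotated])
  show "interior (closure \<Omega>) \<subseteq> \<Omega>"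
  proof (rule ccontr)
    assume "\<not> interior (closure \<Omega>) \<subseteq> \<Omega>"
    then obtain x where x: "x \<in> interior (closure \<Omega>)" "x \<notin> \<Omega>" by blast
    then have xf: "x \<in> frontier \<Omega>" using op interior_subset by (auto simp: frontier_def interior_open)
    obtain h L R n where g: "norm n = 1" "0 < R" "0 \<le> L"
      "\<And>x y. \<bar>h x - h y\<bar> \<le> L * dist x y" "\<And>x t. h (x + t *\<^sub>R n) = h x"
      "\<And>y. y \<in> ball x R \<Longrightarrow> y \<in> \<Omega> \<longleftrightarrow> h y < inner y n"
      by (rule lipschitz_graph_ex[OF lip xf]) (rule that)
    obtain e where e: "0 < e" "ball x e \<subseteq> closure \<Omega>" using x(1) by (auto simp: mem_interior)
    define t where "t = min e R / 2"
    have t: "0 < t" "t < e" "t < R" using e(1) g(2) by (auto simp: t_def)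
    define y where "y = x + (- t) *\<^sub>R n"
    have d: "dist x y = t" using t g(1) by (simp add: y_def dist_norm)
    have "h y \<le> inner y n"
    proof (rule graph_closure_le[OF g(1,3,4)])
      show "y \<in> closure \<Omega>" using e(2) d t by auto
      show "y \<in> ball x R" using d t by simp
      show "h z < inner z n" if "z \<in> ball x R" "z \<in> \<Omega>" for z using g(6) that by blast
    qed
    moreover have "h y = h x" unfolding y_def by (rule g(5))
    moreover have "inner y n = inner x n - t" using g(1) by (simp add: y_def inner_diff_left norm_eq_1)
    moreover have "inner x n \<le> h x" using g(6)[of x] g(2) x(2) by auto
    ultimately show False using t by linarith
  qed
qed

text \<open>Moving x along n by the difference between the height of the graph and its own height
  lands on the boundary. Every line in direction n near p thus meets the boundary piece, which later
  bounds its surface measure from below.\<close>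

lemma frontier_sweep:
  fixes \<Omega> :: "'a::euclidean_space set"
  assumes lip: "lipschitz_domain \<Omega>" and p: "p \<in> frontier \<Omega>" and r: "0 < r"
  obtains n \<rho> s where "norm n = 1" "0 < \<rho>" "0 < s"
    "\<And>x. x \<in> ball p \<rho> \<Longrightarrow> \<exists>t. \<bar>t\<bar> \<le> s \<and> x + t *\<^sub>R n \<in> frontier \<Omega> \<inter> ball p r"
proof -
  have op: "open \<Omega>" using lip by (simp add: lipschitz_domain_def)
  obtain h L R n where g: "norm n = 1" "0 < R" "0 \<le> L"
    "\<And>x y. \<bar>h x - h y\<bar> \<le> L * dist x y" "\<And>x t. h (x + t *\<^sub>R n) = h x"
    "\<And>y. y \<in> ball p R \<Longrightarrow> y \<in> \<Omega> \<longleftrightarrow> h y < inner y n"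
    by (rule lipschitz_graph_ex[OF lip p]) (rule that)
  have n1: "inner n n = 1" using g(1) by (simp add: norm_eq_1)
  have pcl: "p \<in> closure \<Omega>" "p \<notin> \<Omega>" using p op by (auto simp: frontier_def interior_open)
  have hp: "h p = inner p n"
  proof (rule antisym)
    show "h p \<le> inner p n"
      by (rule graph_closure_le[OF g(1,3,4), where p=p and R=R and \<Omega>=\<Omega>]) (use g(2,6) pcl in auto)
    show "inner p n \<le> h p" using g(6)[of p] g(2) pcl by auto
  qed
  define m where "m = min r R"
  have m: "0 < m" using r g(2) by (simp add: m_def)
  \<comment> \<open>With this choice \<open>\<rho> + s\<close> equals \<open>m / 2\<close>, so the
    end point stays in both balls.\<close>
  define \<rho> where "\<rho> = m / (2 * (L + 2))"
  define s where "s = (L + 1) * \<rho>"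
  have \<rho>: "0 < \<rho>" using m g(3) by (simp add: \<rho>_def)
  have s: "0 < s" using \<rho> g(3) by (simp add: s_def)
  have sum: "\<rho> + s < m"
  proof -
    have "\<rho> + s = (L + 2) * \<rho>" by (simp add: s_def algebra_simps)
    also have "\<dots> = m / 2" using g(3) by (simp add: \<rho>_def field_simps)
    finally show ?thesis using m by simp
  qed
  show ?thesis
  proof (rule that[OF g(1) \<rho> s])
    fix x assume x: "x \<in> ball p \<rho>"
    define t where "t = h x - inner x n"
    define q where "q = x + t *\<^sub>R n"
    have "\<bar>t\<bar> \<le> \<bar>h x - h p\<bar> + \<bar>inner p n - inner x n\<bar>" using hp by (simp add: t_def)
    also have "\<dots> \<le> L * dist x p + dist x p"
      using g(4)[of x p] Cauchy_Schwarz_ineq2[of "p - x" n] g(1)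
      by (intro add_mono) (simp_all add: inner_diff_left dist_norm norm_minus_commute)
    also have "\<dots> \<le> s" using x g(3) mult_left_mono[of "dist x p" \<rho> L] by (simp add: s_def dist_commute algebra_simps)
    finally have ts: "\<bar>t\<bar> \<le> s" .
    have "dist p q \<le> dist p x + dist x q" by (rule dist_triangle)
    also have "dist x q = \<bar>t\<bar>" using g(1) by (simp add: q_def dist_norm)
    finally have pq: "dist p q < m" using x ts sum by simp
    have hq: "h q = h x" unfolding q_def by (rule g(5))
    have qn: "inner q n = h x" by (simp add: q_def t_def inner_add_left n1)
    have "q \<notin> \<Omega>" using g(6)[of q] pq hq qn by (simp add: m_def)
    moreover have "q \<in> closure \<Omega>"
      unfolding closure_approachable
    proof safe
      fix e :: real assume e: "0 < e"
      define u where "u = min e (m - dist p q) / 2"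
      have u: "0 < u" "u < e" "u < m - dist p q" using e pq by (auto simp: u_def)
      have "dist p (q + u *\<^sub>R n) < R"
        using dist_triangle[of p "q + u *\<^sub>R n" q] u g(1) by (simp add: dist_norm m_def)
      moreover have "h (q + u *\<^sub>R n) < inner (q + u *\<^sub>R n) n"
        using g(5)[of q u] hq qn u by (simp add: inner_add_left n1)
      ultimately have "q + u *\<^sub>R n \<in> \<Omega>" using g(6)[of "q + u *\<^sub>R n"] by simp
      moreover have "dist (q + u *\<^sub>R n) q < e" using u g(1) by (simp add: dist_norm)
      ultimately show "\<exists>y\<in>\<Omega>. dist y q < e" by blast
    qed
    ultimately have "q \<in> frontier \<Omega>" using op by (simp add: frontier_def interior_open)
    then show "\<exists>t. \<bar>t\<bar> \<le> s \<and> x + t *\<^sub>R n \<in> frontier \<Omega> \<inter> ball p r"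
      using ts pq unfolding q_def m_def by (intro exI[of _ t]) simp
  qed
qed

section \<open>Volumes of slabs and of boundary strips\<close>

lemma sum_indicator_le:
  assumes "finite I" "\<And>i. i \<in> I \<Longrightarrow> S i \<subseteq> T"
    and "\<And>i j. i \<in> I \<Longrightarrow> j \<in> I \<Longrightarrow> x \<in> S i \<Longrightarrow> x \<in> S j \<Longrightarrow> i = j"
  shows "(\<Sum>i\<in>I. indicator (S i) x :: real) \<le> indicator T x"
proof (cases "\<exists>i\<in>I. x \<in> S i")
  case True
  then obtain i where i: "i \<in> I" "x \<in> S i" by blast
  have "(\<Sum>j\<in>I. indicator (S j) x :: real) = indicator (S i) x + (\<Sum>j\<in>I - {i}. indicator (S j) x)"
    using assms(1) i(1) by (rule sum.remove)
  also have "(\<Sum>j\<in>I - {i}. indicator (S j) x :: real) = 0"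
    using assms(3) i by (intro sum.neutral) (auto split: split_indicator)
  finally show ?thesis using i assms(2)[of i] by (auto split: split_indicator)
next
  case False
  then have "(\<Sum>i\<in>I. indicator (S i) x :: real) = 0" by (intro sum.neutral) (auto split: split_indicator)
  then show ?thesis by simp
qed

lemma bbs_indicator_set: "S \<in> sets borel \<Longrightarrow> bounded S \<Longrightarrow> bbs (indicator S :: 'a::euclidean_space \<Rightarrow> real)"
  using bbs_indicator[of S "\<lambda>x. 1::real" 1] by simp

lemma sum_measure_le:
  fixes S :: "'i \<Rightarrow> 'a::euclidean_space set"
  assumes "finite I" "T \<in> sets borel" "bounded T" "\<And>i. i \<in> I \<Longrightarrow> S i \<subseteq> T" "\<And>i. i \<in> I \<Longrightarrow> S i \<in> sets borel"
    and "\<And>i j. i \<in> I \<Longrightarrow> j \<in> I \<Longrightarrow> i \<noteq> j \<Longrightarrow> S i \<inter> S j = {}"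
  shows "(\<Sum>i\<in>I. measure lborel (S i)) \<le> measure lborel T"
proof -
  have bS: "bbs (indicator (S i) :: 'a \<Rightarrow> real)" if "i \<in> I" for i
    using assms(3,4,5) that by (intro bbs_indicator_set) (auto intro: bounded_subset)
  have bT: "bbs (indicator T :: 'a \<Rightarrow> real)" using assms by (intro bbs_indicator_set)
  have "(\<Sum>i\<in>I. measure lborel (S i)) = (\<integral>x. (\<Sum>i\<in>I. indicator (S i) x) \<partial>lborel)"
    using bbs_integrable[OF bS] by (subst Bochner_Integration.integral_sum) auto
  also have "\<dots> \<le> (\<integral>x. indicator T x \<partial>lborel)"
  proof (rule bbs_integral_mono[OF _ bT])
    show "bbs (\<lambda>x. \<Sum>i\<in>I. indicator (S i) x :: real)" by (rule bbs_sum) (rule bS)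
    show "(\<Sum>i\<in>I. indicator (S i) x :: real) \<le> indicator T x" for x
    proof (rule sum_indicator_le[OF assms(1,4)])
      show "i = j" if "i \<in> I" "j \<in> I" "x \<in> S i" "x \<in> S j" for i j
        using assms(6)[OF that(1,2)] that(3,4) by blast
    qed
  qed
  finally show ?thesis by simp
qed

text \<open>Disjoint translates of a slab in its normal direction fill a bounded region.\<close>

lemma slab_measure_le:
  fixes a :: "'a::euclidean_space"
  assumes a: "norm a = 1" and R: "0 \<le> R" and \<delta>: "0 < \<delta>" "\<delta> \<le> 1"
  shows "measure lborel {x. \<bar>inner a x - b\<bar> \<le> \<delta> \<and> norm x \<le> R} \<le> 2 * measure lborel (cball (0::'a) (R + 3)) * \<delta>"
proof -
  define W where "W = {x. \<bar>inner a x - b\<bar> \<le> \<delta> \<and> norm x \<le> R}"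
  have W: "closed W" unfolding W_def by (intro closed_Collect_conj closed_Collect_le continuous_intros)
  have Wb: "W \<in> sets borel" using W by (rule borel_closed)
  have bW: "bounded W" by (rule bounded_subset[of "cball 0 R"]) (auto simp: W_def)
  have biW: "bbs (indicator W :: 'a \<Rightarrow> real)" using Wb bW by (rule bbs_indicator_set)
  define m where "m = nat \<lfloor>1 / \<delta>\<rfloor>"
  have m: "real m \<le> 1 / \<delta>" "1 / (2 * \<delta>) \<le> real m"
  proof -
    have 1: "1 \<le> 1 / \<delta>" using \<delta> by simp
    then have fl: "real m = of_int \<lfloor>1 / \<delta>\<rfloor>" unfolding m_def using \<delta> by (intro of_nat_nat) simp
    show "real m \<le> 1 / \<delta>" unfolding fl by (rule of_int_floor_le)
    have "1 \<le> \<lfloor>1 / \<delta>\<rfloor>" using 1 by (simp add: le_floor_iff)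
    then have "1 / \<delta> < 2 * real m" unfolding fl using floor_correct[of "1 / \<delta>"] by linarith
    then show "1 / (2 * \<delta>) \<le> real m" by simp
  qed
  \<comment> \<open>The step 3 \<delta> exceeds the thickness 2 \<delta> of the slab, so the
    translates are disjoint; about 1 / \<delta> of them displace it by at most 3.\<close>
  define z where "z k = (3 * \<delta> * real k) *\<^sub>R a" for k :: nat
  have az: "inner a (z k) = 3 * \<delta> * real k" for k using a by (simp add: z_def norm_eq_1)
  have "real m * measure lborel W = (\<Sum>k<m. \<integral>x. indicator W (x - z k) \<partial>lborel)"
    using integral_shift_minus[of "indicator W :: 'a \<Rightarrow> real"] by simp
  also have "\<dots> = (\<integral>x. (\<Sum>k<m. indicator W (x - z k)) \<partial>lborel)"
    by (rule Bochner_Integration.integral_sum[symmetric]) (rule bbs_integrable[OF bbs_shift_minus[OF biW]])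
  also have "\<dots> \<le> (\<integral>x. indicator (cball (0::'a) (R + 3)) x \<partial>lborel)"
  proof (rule bbs_integral_mono)
    show "bbs (\<lambda>x. \<Sum>k<m. indicator W (x - z k) :: real)" by (rule bbs_sum) (rule bbs_shift_minus[OF biW])
    show "bbs (indicator (cball (0::'a) (R + 3)) :: 'a \<Rightarrow> real)" by (rule bbs_indicator_set) auto
    fix x
    have "(\<Sum>k<m. indicator {y. y - z k \<in> W} x :: real) \<le> indicator (cball 0 (R + 3)) x"
    proof (rule sum_indicator_le)
      fix k assume k: "k \<in> {..<m}"
      have "norm (z k) \<le> 3"
      proof -
        have "real k \<le> 1 / \<delta>" using k m(1) by auto
        then have "3 * \<delta> * real k \<le> 3 * \<delta> * (1 / \<delta>)" using \<delta> by (intro mult_left_mono) auto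
        then show ?thesis using \<delta> a by (simp add: z_def)
      qed
      then have "norm y \<le> R + 3" if "y - z k \<in> W" for y
        using that norm_triangle_sub[of y "z k"] by (simp add: W_def)
      then show "{y. y - z k \<in> W} \<subseteq> cball 0 (R + 3)" by auto
    next
      fix i j assume "x \<in> {y. y - z i \<in> W}" "x \<in> {y. y - z j \<in> W}"
      then have "\<bar>inner a x - 3 * \<delta> * real i - b\<bar> \<le> \<delta>" "\<bar>inner a x - 3 * \<delta> * real j - b\<bar> \<le> \<delta>"
        by (auto simp: W_def inner_diff_right az)
      then have "\<bar>3 * \<delta> * real i - 3 * \<delta> * real j\<bar> \<le> 2 * \<delta>" by linarith
      then have "\<delta> * \<bar>3 * (real i - real j)\<bar> \<le> \<delta> * 2" using \<delta> by (simp add: abs_mult right_diff_distrib[symmetric] mult_ac)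
      then have "\<bar>3 * (real i - real j)\<bar> \<le> 2" using \<delta> by simp
      then have "\<bar>real i - real j\<bar> < 1" by simp
      then show "i = j" by linarith
    qed simp
    then show "(\<Sum>k<m. indicator W (x - z k) :: real) \<le> indicator (cball 0 (R + 3)) x"
      by (simp add: indicator_def)
  qed
  finally have mV: "real m * measure lborel W \<le> measure lborel (cball (0::'a) (R + 3))" by simp
  have "1 / (2 * \<delta>) * measure lborel W \<le> real m * measure lborel W" using m(2) by (intro mult_right_mono) auto
  then have "1 / (2 * \<delta>) * measure lborel W \<le> measure lborel (cball (0::'a) (R + 3))" using mV by simp
  then have "measure lborel W \<le> 2 * measure lborel (cball (0::'a) (R + 3)) * \<delta>"
    using \<delta> by (simp add: divide_le_eq mult_ac)
  then show ?thesis by (simp add: W_def)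
qed

definition tubular :: "'a::euclidean_space set \<Rightarrow> real \<Rightarrow> 'a set" where
  "tubular S \<delta> = {x. \<exists>q\<in>S. dist x q \<le> \<delta>}"

lemma closed_tubular:
  assumes "compact S"
  shows "closed (tubular S \<delta>)"
proof -
  have "tubular S \<delta> = (\<Union>x\<in>S. \<Union>y\<in>cball 0 \<delta>. {x + y})"
  proof safe
    fix x assume "x \<in> tubular S \<delta>"
    then obtain q where "q \<in> S" "dist x q \<le> \<delta>" by (auto simp: tubular_def)
    show "x \<in> (\<Union>x\<in>S. \<Union>y\<in>cball 0 \<delta>. {x + y})"
    proof (rule UN_I[OF \<open>q \<in> S\<close>], rule UN_I)
      show "x - q \<in> cball 0 \<delta>" using \<open>dist x q \<le> \<delta>\<close> by (simp add: dist_norm norm_minus_commute)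
    qed simp
  next
    fix x y :: 'a assume "x \<in> S" "y \<in> cball 0 \<delta>"
    then show "x + y \<in> tubular S \<delta>" by (auto simp: tubular_def dist_norm intro!: bexI[of _ x])
  qed
  then show ?thesis using compact_closed_sums[OF assms closed_cball[of 0 \<delta>]] by simp
qed

text \<open>Each face has dimension d - 1 and so lies in a hyperplane; points within \<delta> of the
  face lie in the slab of half-width \<delta> around it.\<close>

lemma tubular_measure_le:
  fixes \<Omega> :: "'a::euclidean_space set"
  assumes poly: "polyhedral_boundary \<Omega>" and b: "bounded \<Omega>"
  obtains C where "0 < C" "\<And>\<delta>. 0 < \<delta> \<Longrightarrow> \<delta> \<le> 1 \<Longrightarrow> measure lborel (tubular (frontier \<Omega>) \<delta>) \<le> C * \<delta>"
proof -
  obtain \<F> where F: "finite \<F>" "\<And>F. F \<in> \<F> \<Longrightarrow> aff_dim F = int DIM('a) - 1" "frontier \<Omega> = \<Union>\<F>"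
    using poly unfolding polyhedral_boundary_def by blast
  have "\<exists>a b. norm a = 1 \<and> F \<subseteq> {x. inner a x = b}" if "F \<in> \<F>" for F
  proof -
    have "aff_dim F < int DIM('a)" using F(2)[OF that] by simp
    then obtain a b where ab: "a \<noteq> 0" "F \<subseteq> {x. inner a x = b}"
      using aff_lowdim_subset_hyperplane by metis
    have "F \<subseteq> {x. inner ((1 / norm a) *\<^sub>R a) x = b / norm a}" using ab by auto
    moreover have "norm ((1 / norm a) *\<^sub>R a) = 1" using ab by simp
    ultimately show ?thesis by blast
  qed
  then obtain a c where ac: "\<And>F. F \<in> \<F> \<Longrightarrow> norm (a F) = 1 \<and> F \<subseteq> {x. inner (a F) x = c F}" by metis
  have bf: "bounded (frontier \<Omega>)" using compact_frontier_bounded[OF b] by (rule compact_imp_bounded)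
  obtain R where R: "0 < R" "\<And>x. x \<in> frontier \<Omega> \<Longrightarrow> norm x \<le> R" using bf unfolding bounded_pos by blast
  define K where "K = 2 * measure lborel (cball (0::'a) (R + 1 + 3))"
  have K: "0 \<le> K" by (simp add: K_def)
  show ?thesis
  proof (rule that[of "1 + real (card \<F>) * K"])
    show "0 < 1 + real (card \<F>) * K" using K by (simp add: add_pos_nonneg)
    fix \<delta> :: real assume \<delta>: "0 < \<delta>" "\<delta> \<le> 1"
    let ?W = "\<lambda>F. {x. \<bar>inner (a F) x - c F\<bar> \<le> \<delta> \<and> norm x \<le> R + 1}"
    have sub: "tubular (frontier \<Omega>) \<delta> \<subseteq> (\<Union>F\<in>\<F>. ?W F)"
    proof
      fix x assume "x \<in> tubular (frontier \<Omega>) \<delta>"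
      then obtain q where q: "q \<in> frontier \<Omega>" "dist x q \<le> \<delta>" by (auto simp: tubular_def)
      then obtain G where G: "G \<in> \<F>" "q \<in> G" using F(3) by blast
      have "inner (a G) x - c G = inner (a G) (x - q)" using ac[OF G(1)] G(2) by (auto simp: inner_diff_right)
      then have "\<bar>inner (a G) x - c G\<bar> \<le> \<delta>"
        using Cauchy_Schwarz_ineq2[of "a G" "x - q"] ac[OF G(1)] q(2) by (simp add: dist_norm)
      moreover have "norm x \<le> R + 1" using R(2)[OF q(1)] q(2) \<delta> norm_triangle_sub[of x q] by (simp add: dist_norm)
      ultimately show "x \<in> (\<Union>F\<in>\<F>. ?W F)" using G(1) by blast
    qed
    have cl: "closed (?W F)" for F by (intro closed_Collect_conj closed_Collect_le continuous_intros)
    have fin: "?W F \<in> fmeasurable lborel" for F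
    proof (rule fmeasurableI)
      have "bounded (?W F)" by (rule bounded_subset[of "cball 0 (R + 1)"]) auto
      then show "emeasure lborel (?W F) < \<infinity>" by (rule emeasure_bounded_finite)
    qed (use cl in \<open>simp add: borel_closed\<close>)
    have "measure lborel (tubular (frontier \<Omega>) \<delta>) \<le> measure lborel (\<Union>F\<in>\<F>. ?W F)"
    proof (rule measure_mono_fmeasurable[OF sub])
      show "tubular (frontier \<Omega>) \<delta> \<in> sets lborel"
        using closed_tubular[of "frontier \<Omega>" \<delta>] bf by (simp add: compact_frontier_bounded borel_closed b)
      show "(\<Union>F\<in>\<F>. ?W F) \<in> fmeasurable lborel" using F(1) fin by (intro fmeasurable.finite_UN) auto
    qed
    also have "\<dots> \<le> (\<Sum>F\<in>\<F>. measure lborel (?W F))" using F(1) fin by (intro measure_UNION_le fmeasurableD) auto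
    also have "\<dots> \<le> (\<Sum>F\<in>\<F>. K * \<delta>)"
      unfolding K_def using ac R(1) \<delta> by (intro sum_mono slab_measure_le) auto
    also have "\<dots> \<le> (1 + real (card \<F>) * K) * \<delta>" using \<delta> by (simp add: algebra_simps)
    finally show "measure lborel (tubular (frontier \<Omega>) \<delta>) \<le> (1 + real (card \<F>) * K) * \<delta>" .
  qed
qed

section \<open>Hausdorff measure of the boundary\<close>

text \<open>Pads a finite cover with empty sets, whose gauge is 0, to match the sequences in
  \<open>hausdorff_content\<close>.\<close>

lemma finite_set_enumeration_ennreal:
  fixes f :: "'b set \<Rightarrow> ennreal"
  assumes "finite F" "f {} = 0"
  obtains U :: "nat \<Rightarrow> 'b set" where "(\<Union>n. U n) = \<Union>F" "\<And>n. U n \<in> F \<or> U n = {}" "(\<Sum>n. f (U n)) = (\<Sum>S\<in>F. f S)"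
proof -
  obtain g where g: "bij_betw g {..<card F} F"
    using assms(1) by (metis bij_betw_from_nat_into_finite lessThan_atLeast0 ex_bij_betw_nat_finite)
  define U where "U n = (if n < card F then g n else {})" for n
  show ?thesis
  proof (rule that[of U])
    show "U n \<in> F \<or> U n = {}" for n using g by (auto simp: U_def bij_betw_def)
    show "(\<Union>n. U n) = \<Union>F"
    proof -
      have "(\<Union>n. U n) = \<Union>(g ` {..<card F})" by (auto simp: U_def split: if_splits)
      then show ?thesis using g by (simp add: bij_betw_def)
    qed
    have "(\<Sum>n. f (U n)) = (\<Sum>n<card F. f (U n))"
      by (rule suminf_finite) (auto simp: U_def assms(2))
    also have "\<dots> = (\<Sum>n<card F. f (g n))" by (intro sum.cong) (auto simp: U_def)
    also have "\<dots> = (\<Sum>S\<in>F. f S)" using g by (rule sum.reindex_bij_betw)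
    finally show "(\<Sum>n. f (U n)) = (\<Sum>S\<in>F. f S)" .
  qed
qed

lemma content_cball_scale:
  "0 \<le> r \<Longrightarrow> measure lborel (cball (a::'a::euclidean_space) r) = unit_ball_vol (real DIM('a)) * r ^ DIM('a)"
  by (simp add: content_cball)

text \<open>A packing argument: balls of radius \<eta> around a maximal \<eta>-separated set cover
  the boundary, while the balls of half that radius are disjoint and lie in a strip of volume
  O(\<eta>). Their number is O(\<eta>^(1-d)), so the contents are bounded uniformly.\<close>

lemma hausdorff_frontier_finite:
  fixes \<Omega> :: "'a::euclidean_space set"
  assumes poly: "polyhedral_boundary \<Omega>" and b: "bounded \<Omega>"
  shows "emeasure (hausdorff_measure (DIM('a) - 1)) (frontier \<Omega>) < \<infinity>"
proof -
  obtain C where C: "0 < C" "\<And>\<delta>. 0 < \<delta> \<Longrightarrow> \<delta> \<le> 1 \<Longrightarrow> measure lborel (tubular (frontier \<Omega>) \<delta>) \<le> C * \<delta>"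
    by (rule tubular_measure_le[OF poly b]) (rule that)
  have comp: "compact (frontier \<Omega>)" using b by (rule compact_frontier_bounded)
  define d where "d = DIM('a)"
  have d: "d = Suc (d - 1)" "0 < d" by (auto simp: d_def)
  define \<omega> where "\<omega> = unit_ball_vol (real d)"
  have \<omega>: "0 < \<omega>" by (simp add: \<omega>_def)
  define K where "K = C / \<omega> * 2 ^ (d - 1) * unit_ball_vol (real (d - 1))"
  have content: "hausdorff_content (d - 1) \<delta> (frontier \<Omega>) \<le> ennreal K" if \<delta>: "0 < \<delta>" for \<delta>
  proof -
    define \<eta> where "\<eta> = min \<delta> 1 / 2"
    have \<eta>: "0 < \<eta>" "2 * \<eta> \<le> \<delta>" "\<eta> / 2 \<le> 1" using \<delta> by (auto simp: \<eta>_def)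
    define sep where "sep F \<longleftrightarrow> finite F \<and> F \<subseteq> frontier \<Omega> \<and> (\<forall>x\<in>F. \<forall>y\<in>F. x \<noteq> y \<longrightarrow> \<eta> < dist x y)" for F
    define T where "T = tubular (frontier \<Omega>) (\<eta> / 2)"
    have Tb: "T \<in> sets borel" unfolding T_def by (intro borel_closed closed_tubular comp)
    have Tbd: "bounded T"
    proof -
      obtain R where R: "\<And>x. x \<in> frontier \<Omega> \<Longrightarrow> norm x \<le> R" using compact_imp_bounded[OF comp] unfolding bounded_iff by blast
      have "norm x \<le> R + \<eta> / 2" if xT: "x \<in> T" for x
      proof -
        obtain q where "q \<in> frontier \<Omega>" "dist x q \<le> \<eta> / 2" using xT by (auto simp: T_def tubular_def)
        then show ?thesis using R[of q] norm_triangle_sub[of x q] by (simp add: dist_norm)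
      qed
      then show ?thesis unfolding bounded_iff by blast
    qed
    have card: "real (card F) * (\<omega> * (\<eta> / 2) ^ d) \<le> C * (\<eta> / 2)" if "sep F" for F
    proof -
      have "(\<Sum>p\<in>F. measure lborel (cball p (\<eta> / 2))) \<le> measure lborel T"
      proof (rule sum_measure_le[OF _ Tb Tbd])
        show "finite F" using that by (simp add: sep_def)
        show "cball p (\<eta> / 2) \<subseteq> T" if "p \<in> F" for p
          using that \<open>sep F\<close> by (auto simp: T_def tubular_def sep_def dist_commute)
        show "cball x (\<eta> / 2) \<inter> cball y (\<eta> / 2) = {}" if "x \<in> F" "y \<in> F" "x \<noteq> y" for x y
        proof (rule ccontr)
          assume "\<not> ?thesis"
          then obtain z where "dist x z \<le> \<eta> / 2" "dist y z \<le> \<eta> / 2" by auto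
          then have "dist x y \<le> \<eta>" using dist_triangle2[of x y z] by simp
          moreover have "\<eta> < dist x y" using \<open>sep F\<close> that unfolding sep_def by blast
          ultimately show False by simp
        qed
      qed auto
      also have "\<dots> \<le> C * (\<eta> / 2)" unfolding T_def using \<eta> by (intro C(2)) auto
      finally show ?thesis using \<eta> by (simp add: content_cball_scale \<omega>_def d_def)
    qed
    define M where "M = nat \<lceil>C * (\<eta> / 2) / (\<omega> * (\<eta> / 2) ^ d)\<rceil>"
    have cardM: "card F \<le> M" if "sep F" for F
    proof -
      have "real (card F) \<le> C * (\<eta> / 2) / (\<omega> * (\<eta> / 2) ^ d)"
        using card[OF that] \<omega> \<eta> by (simp add: pos_le_divide_eq)
      then show ?thesis unfolding M_def by linarith
    qed
    have "sep {}" by (simp add: sep_def)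
    \<comment> \<open>Cardinalities of separated sets are bounded by M, so a largest one exists; a
      point left uncovered could be added to it.\<close>
    then obtain F where F: "sep F" "\<And>F'. sep F' \<Longrightarrow> card F' \<le> card F"
      using ex_has_greatest_nat[of sep "{}" card "Suc M"] cardM by (metis less_Suc_eq_le)
    have cov: "frontier \<Omega> \<subseteq> (\<Union>p\<in>F. cball p \<eta>)"
    proof (rule ccontr)
      assume "\<not> ?thesis"
      then obtain x where x: "x \<in> frontier \<Omega>" "\<And>p. p \<in> F \<Longrightarrow> \<eta> < dist p x" by fastforce
      then have "x \<notin> F" using \<eta> by force
      have "sep (insert x F)" using F(1) x by (auto simp: sep_def dist_commute)
      then have "card (insert x F) \<le> card F" by (rule F(2))
      moreover have "finite F" using F(1) by (simp add: sep_def)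
      ultimately show False using \<open>x \<notin> F\<close> by simp
    qed
    obtain U where U: "(\<Union>n. U n) = (\<Union>p\<in>F. cball p \<eta>)" "\<And>n::nat. U n \<in> (\<lambda>p. cball p \<eta>) ` F \<or> U n = {}"
      "(\<Sum>n. hausdorff_gauge (d - 1) (U n)) = (\<Sum>S\<in>(\<lambda>p. cball p \<eta>) ` F. hausdorff_gauge (d - 1) S)"
      using finite_set_enumeration_ennreal[of "(\<lambda>p. cball p \<eta>) ` F" "hausdorff_gauge (d - 1)"] F(1)
      by (auto simp: sep_def hausdorff_gauge_def)
    have "hausdorff_content (d - 1) \<delta> (frontier \<Omega>) \<le> (\<Sum>n. hausdorff_gauge (d - 1) (U n))"
      unfolding hausdorff_content_def
    proof (rule INF_lower, rule CollectI, intro conjI allI)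
      show "frontier \<Omega> \<subseteq> (\<Union>n. U n)" using cov U(1) by simp
      fix n
      show "bounded (U n)" using U(2)[of n] by auto
      show "diameter (U n) \<le> \<delta>" using U(2)[of n] \<eta> \<delta> by (auto simp: diameter_cball)
    qed
    also have "\<dots> \<le> (\<Sum>p\<in>F. hausdorff_gauge (d - 1) (cball p \<eta>))"
    proof -
      have "sum (hausdorff_gauge (d - 1)) ((\<lambda>p. cball p \<eta>) ` F) \<le> sum (hausdorff_gauge (d - 1) \<circ> (\<lambda>p. cball p \<eta>)) F"
        using F(1) by (intro sum_image_le) (simp_all add: sep_def)
      then show ?thesis unfolding U(3) by (simp only: o_def)
    qed
    also have "\<dots> = (\<Sum>p\<in>F. ennreal (unit_ball_vol (real (d - 1)) * \<eta> ^ (d - 1)))"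
      using \<eta> by (intro sum.cong) (auto simp: hausdorff_gauge_def diameter_cball)
    also have "\<dots> = ennreal (real (card F) * (unit_ball_vol (real (d - 1)) * \<eta> ^ (d - 1)))"
      using \<eta> by (simp add: ennreal_mult ennreal_of_nat_eq_real_of_nat)
    also have "\<dots> \<le> ennreal K"
    proof (rule ennreal_leI)
      have "real (card F) * \<omega> * (\<eta> / 2) ^ (d - 1) * (\<eta> / 2) \<le> C * (\<eta> / 2)"
        using card[OF F(1)] d(1) by (metis mult.assoc power_Suc2)
      then have "real (card F) * \<omega> * (\<eta> / 2) ^ (d - 1) \<le> C" using \<eta> by simp
      then have "real (card F) * \<eta> ^ (d - 1) \<le> C / \<omega> * 2 ^ (d - 1)"
        using \<omega> by (simp add: power_divide field_simps)
      then have "(real (card F) * \<eta> ^ (d - 1)) * unit_ball_vol (real (d - 1)) \<le> K"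
        unfolding K_def by (intro mult_right_mono) auto
      then show "real (card F) * (unit_ball_vol (real (d - 1)) * \<eta> ^ (d - 1)) \<le> K" by (simp add: mult_ac)
    qed
    finally show ?thesis .
  qed
  have "emeasure (hausdorff_measure (d - 1)) (frontier \<Omega>) = hausdorff_outer (d - 1) (frontier \<Omega>)"
    by (rule emeasure_hausdorff_measure) (simp add: borel_closed)
  also have "\<dots> \<le> ennreal K" unfolding hausdorff_outer_def using content by (intro SUP_least) auto
  also have "\<dots> < \<infinity>" by simp
  finally show ?thesis by (simp add: d_def)
qed

section \<open>A lower bound for the surface measure of the boundary\<close>

definition tube :: "'a::euclidean_space \<Rightarrow> real \<Rightarrow> 'a \<Rightarrow> real \<Rightarrow> 'a set" where
  "tube n s q D = {x. \<exists>t\<in>{-s..s}. x + t *\<^sub>R n \<in> cball q D}"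

lemma closed_tube: "closed (tube n s q D)"
proof -
  have eq: "tube n s q D = (\<Union>x\<in>(\<lambda>t. - (t *\<^sub>R n)) ` {-s..s}. \<Union>y\<in>cball q D. {x + y})"
  proof safe
    fix x assume "x \<in> tube n s q D"
    then obtain t where t: "t \<in> {-s..s}" "x + t *\<^sub>R n \<in> cball q D" by (auto simp: tube_def)
    show "x \<in> (\<Union>x\<in>(\<lambda>t. - (t *\<^sub>R n)) ` {-s..s}. \<Union>y\<in>cball q D. {x + y})"
    proof (rule UN_I, rule imageI[OF t(1)], rule UN_I[OF t(2)])
    qed simp
  next
    fix t y assume "t \<in> {-s..s}" "y \<in> cball q D"
    then show "- (t *\<^sub>R n) + y \<in> tube n s q D" unfolding tube_def by (intro CollectI bexI[of _ t]) auto
  qed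
  have c: "compact ((\<lambda>t. - (t *\<^sub>R n)) ` {-s..s})"
    by (intro compact_continuous_image continuous_intros) auto
  show ?thesis unfolding eq by (rule compact_closed_sums[OF c closed_cball])
qed

lemma tube_borel [simp]: "tube n s q D \<in> sets borel"
  using closed_tube by (rule borel_closed)

lemma bounded_tube: "bounded (tube n s q D)"
proof -
  have "norm x \<le> norm q + D + \<bar>s\<bar> * norm n" if "x \<in> tube n s q D" for x
  proof -
    obtain t where t0: "t \<in> {-s..s}" "x + t *\<^sub>R n \<in> cball q D"
      using \<open>x \<in> tube n s q D\<close> unfolding tube_def by blast
    have t: "\<bar>t\<bar> \<le> \<bar>s\<bar>" "norm (x + t *\<^sub>R n - q) \<le> D"
      using t0 by (auto simp: dist_norm norm_minus_commute)
    have "norm x \<le> norm ((x + t *\<^sub>R n - q) + q) + norm (t *\<^sub>R n)"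
      using norm_triangle_ineq4[of "x + t *\<^sub>R n" "t *\<^sub>R n"] by simp
    also have "\<dots> \<le> (D + norm q) + \<bar>s\<bar> * norm n"
      using t norm_triangle_ineq[of "x + t *\<^sub>R n - q" q] mult_right_mono[OF t(1), of "norm n"] by simp
    finally show ?thesis by simp
  qed
  then show ?thesis unfolding bounded_iff by blast
qed

text \<open>A tube of length \<open>2 s\<close> and radius \<open>D\<close> is covered by about \<open>s / D\<close> balls of radius \<open>2 D\<close>.\<close>

lemma tube_measure_le:
  fixes q n :: "'a::euclidean_space"
  assumes n: "norm n = 1" and D: "0 < D" "D \<le> s"
  shows "measure lborel (tube n s q D) \<le> 4 * s * unit_ball_vol (real DIM('a)) * 2 ^ DIM('a) * D ^ (DIM('a) - 1)"
proof -
  define d where "d = DIM('a)"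
  have d: "d = Suc (d - 1)" by (simp add: d_def)
  \<comment> \<open>Number of balls, with centres spaced D apart along the axis.\<close>
  define m where "m = nat \<lfloor>2 * s / D\<rfloor> + 1"
  have m: "real m \<le> 2 * s / D + 1"
    using D by (simp add: m_def)
  define c where "c k = q + (s - D * real k) *\<^sub>R n" for k :: nat
  have sub: "tube n s q D \<subseteq> (\<Union>k<m. cball (c k) (2 * D))"
  proof
    fix x assume "x \<in> tube n s q D"
    then obtain t where t: "- s \<le> t" "t \<le> s" "norm (x + t *\<^sub>R n - q) \<le> D" by (auto simp: tube_def dist_norm norm_minus_commute)
    define k where "k = nat \<lfloor>(s + t) / D\<rfloor>"
    have st: "0 \<le> (s + t) / D" using t D by simp
    have k: "real k \<le> (s + t) / D" "(s + t) / D < real k + 1"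
      unfolding k_def using st floor_correct[of "(s + t) / D"] by (auto simp: of_nat_nat)
    have "(s + t) / D \<le> 2 * s / D" using t D by (intro divide_right_mono) auto
    then have "\<lfloor>(s + t) / D\<rfloor> \<le> \<lfloor>2 * s / D\<rfloor>" by (rule floor_mono)
    then have "k < m" by (simp add: k_def m_def)
    have kD: "real k * D \<le> s + t" "s + t < (real k + 1) * D"
      using k D by (simp_all only: pos_le_divide_eq pos_divide_less_eq)
    have "dist (c k) x = norm ((x + t *\<^sub>R n - q) - (s + t - D * real k) *\<^sub>R n)"
      by (simp add: c_def dist_norm norm_minus_commute algebra_simps)
    also have "\<dots> \<le> norm (x + t *\<^sub>R n - q) + norm ((s + t - D * real k) *\<^sub>R n)" by (rule norm_triangle_ineq4)
    also have "norm ((s + t - D * real k) *\<^sub>R n) = \<bar>s + t - D * real k\<bar>" using n by simp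
    also have "\<dots> \<le> D" using kD by (simp add: abs_le_iff algebra_simps)
    finally have "dist (c k) x \<le> 2 * D" using t(3) by simp
    then show "x \<in> (\<Union>k<m. cball (c k) (2 * D))" using \<open>k < m\<close> by auto
  qed
  have fm: "cball (c k) (2 * D) \<in> fmeasurable lborel" for k
    by (intro fmeasurableI emeasure_bounded_finite) auto
  have "measure lborel (tube n s q D) \<le> measure lborel (\<Union>k<m. cball (c k) (2 * D))"
    using fm by (intro measure_mono_fmeasurable[OF sub] fmeasurable.finite_UN) auto
  also have "\<dots> \<le> (\<Sum>k<m. measure lborel (cball (c k) (2 * D)))"
    using fm by (intro measure_UNION_le fmeasurableD) auto
  also have "\<dots> = real m * (unit_ball_vol (real d) * (2 * D) ^ d)" using D by (simp add: content_cball_scale d_def)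
  also have "\<dots> \<le> (4 * s / D) * (unit_ball_vol (real d) * (2 * D) ^ d)"
  proof (rule mult_right_mono)
    have "1 \<le> s / D" using D by simp
    then show "real m \<le> 4 * s / D" using m by (simp add: add_divide_distrib)
  qed (use D in auto)
  also have "\<dots> = 4 * s * unit_ball_vol (real d) * 2 ^ d * D ^ (d - 1)"
  proof -
    have "D ^ d = D ^ (d - 1) * D" using d by (metis power_Suc2)
    then show ?thesis using D by (simp add: power_mult_distrib)
  qed
  finally show ?thesis by (simp add: d_def)
qed

lemma emeasure_bounded_eq_measure:
  fixes S :: "'a::euclidean_space set"
  assumes "bounded S" shows "emeasure lborel S = ennreal (measure lborel S)"
  using emeasure_bounded_finite[OF assms] by (simp add: emeasure_eq_ennreal_measure)

text \<open>By \<open>frontier_sweep\<close>, a cover of the boundary piece by small sets yields a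
  cover of a ball by tubes, each of volume O(diameter^(d-1)). The gauges therefore sum to at least a
  fixed multiple of the volume of that ball.\<close>

lemma hausdorff_frontier_positive:
  fixes \<Omega> :: "'a::euclidean_space set"
  assumes lip: "lipschitz_domain \<Omega>" and dim: "2 \<le> DIM('a)" and p: "p \<in> frontier \<Omega>" and r: "0 < r"
  shows "0 < emeasure (hausdorff_measure (DIM('a) - 1)) (frontier \<Omega> \<inter> ball p r)"
proof -
  obtain n \<rho> s where n: "norm n = 1" and \<rho>: "0 < \<rho>" and s: "0 < s"
    and sweep: "\<And>x. x \<in> ball p \<rho> \<Longrightarrow> \<exists>t. \<bar>t\<bar> \<le> s \<and> x + t *\<^sub>R n \<in> frontier \<Omega> \<inter> ball p r"
    by (rule frontier_sweep[OF lip p r]) (rule that)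
  define d where "d = DIM('a)"
  have d: "0 < d - 1" using dim by (simp add: d_def)
  define K where "K = 4 * s * unit_ball_vol (real d) * 2 ^ d"
  have K: "0 < K" using s by (simp add: K_def)
  define u where "u = unit_ball_vol (real (d - 1))"
  have u: "0 < u" by (simp add: u_def)
  \<comment> \<open>Converts K diameter^(d-1) into a multiple of the gauge, which is normalized with
    half the diameter.\<close>
  define K' where "K' = K * 2 ^ (d - 1) / u"
  have K': "0 < K'" using K u by (simp add: K'_def)
  have le0: "measure lborel (tube n s q D) \<le> K * D ^ (d - 1)" if D: "0 \<le> D" "D \<le> s" for q D
  proof (cases "D = 0")
    case False
    then show ?thesis using tube_measure_le[OF n, of D s q] D by (simp add: K_def d_def)
  next
    \<comment> \<open>A tube around a single point is contained in arbitrarily thin tubes, so its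
      volume is 0; the right-hand side is 0 too, because d - 1 > 0.\<close>
    case True
    have "measure lborel (tube n s q 0) \<le> 0 + e" if e: "0 < e" for e
    proof -
      define D' where "D' = min s (min 1 (e / K))"
      have D': "0 < D'" "D' \<le> s" "D' \<le> 1" "D' \<le> e / K" using s e K by (auto simp: D'_def)
      have "measure lborel (tube n s q 0) \<le> measure lborel (tube n s q D')"
      proof (rule measure_mono_fmeasurable)
        have "cball q 0 \<subseteq> cball q D'" using D'(1) by (intro subset_cball) simp
        then show "tube n s q 0 \<subseteq> tube n s q D'" unfolding tube_def by blast
        show "tube n s q D' \<in> fmeasurable lborel"
          using bounded_tube by (intro fmeasurableI emeasure_bounded_finite) auto
      qed simp
      also have "\<dots> \<le> K * D' ^ (d - 1)" using tube_measure_le[OF n D'(1,2), of q] by (simp add: K_def d_def)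
      also have "\<dots> \<le> K * D'" using D' d K power_decreasing[of 1 "d - 1" D'] by (intro mult_left_mono) auto
      also have "\<dots> \<le> K * (e / K)" using D'(4) K by (intro mult_left_mono) auto
      finally show ?thesis using K by simp
    qed
    then have "measure lborel (tube n s q 0) \<le> 0" by (rule field_le_epsilon)
    then show ?thesis using True d by (simp add: power_0_left)
  qed
  define A where "A = frontier \<Omega> \<inter> ball p r"
  define m where "m = measure lborel (ball p \<rho>)"
  have m: "0 < m" using \<rho> by (simp add: m_def content_ball)
  have "ennreal m \<le> ennreal K' * (\<Sum>k. hausdorff_gauge (d - 1) (U k))"
    if U: "A \<subseteq> (\<Union>k. U k)" "\<And>k. bounded (U k) \<and> diameter (U k) \<le> s" for U :: "nat \<Rightarrow> 'a set"
  proof -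
    define q where "q k = (SOME x. x \<in> U k)" for k
    define T where "T k = (if U k = {} then {} else tube n s (q k) (diameter (U k)))" for k
    have qU: "q k \<in> U k" if "U k \<noteq> {}" for k using that by (simp add: q_def some_in_eq)
    have Tm: "T k \<in> sets lborel" for k by (simp add: T_def)
    have Tb: "bounded (T k)" for k by (simp add: T_def bounded_tube)
    have cov: "ball p \<rho> \<subseteq> (\<Union>k. T k)"
    proof
      fix x assume "x \<in> ball p \<rho>"
      then obtain t where t: "\<bar>t\<bar> \<le> s" "x + t *\<^sub>R n \<in> A" using sweep unfolding A_def by blast
      then obtain k where k: "x + t *\<^sub>R n \<in> U k" using U(1) by blast
      then have "dist (q k) (x + t *\<^sub>R n) \<le> diameter (U k)"
        using qU[of k] U(2)[of k] by (intro diameter_bounded_bound) auto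
      then have "x \<in> T k" using k t(1) by (auto simp: T_def tube_def abs_le_iff intro!: bexI[of _ t])
      then show "x \<in> (\<Union>k. T k)" by blast
    qed
    have gauge: "emeasure lborel (T k) \<le> ennreal K' * hausdorff_gauge (d - 1) (U k)" for k
    proof (cases "U k = {}")
      case False
      have D: "0 \<le> diameter (U k)" "diameter (U k) \<le> s" using U(2)[of k] diameter_ge_0 by auto
      have "emeasure lborel (T k) = ennreal (measure lborel (T k))" by (rule emeasure_bounded_eq_measure[OF Tb])
      also have "\<dots> \<le> ennreal (K * diameter (U k) ^ (d - 1))" using False le0[OF D] by (intro ennreal_leI) (simp add: T_def)
      also have "K * diameter (U k) ^ (d - 1) = K' * (u * (diameter (U k) / 2) ^ (d - 1))"
        using u by (simp add: K'_def power_divide)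
      also have "ennreal \<dots> = ennreal K' * hausdorff_gauge (d - 1) (U k)"
        using False K' by (simp add: ennreal_mult' hausdorff_gauge_def u_def)
      finally show ?thesis .
    qed (simp add: T_def)
    have "ennreal m = emeasure lborel (ball p \<rho>)" unfolding m_def by (simp add: emeasure_bounded_eq_measure)
    also have "\<dots> \<le> emeasure lborel (\<Union>k. T k)" using cov Tm by (intro emeasure_mono) auto
    also have "\<dots> \<le> (\<Sum>k. emeasure lborel (T k))" using Tm by (intro emeasure_subadditive_countably) auto
    also have "\<dots> \<le> (\<Sum>k. ennreal K' * hausdorff_gauge (d - 1) (U k))" using gauge by (intro suminf_le) auto
    finally show ?thesis by simp
  qed
  then have "ennreal (m / K') \<le> hausdorff_content (d - 1) s A"
    unfolding hausdorff_content_def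
  proof (intro INF_greatest, safe)
    fix U :: "nat \<Rightarrow> 'a set"
    assume *: "\<And>U :: nat \<Rightarrow> 'a set. A \<subseteq> \<Union> (range U) \<Longrightarrow> (\<And>k. bounded (U k) \<and> diameter (U k) \<le> s) \<Longrightarrow>
        ennreal m \<le> ennreal K' * (\<Sum>k. hausdorff_gauge (d - 1) (U k))"
      and U: "A \<subseteq> \<Union> (range U)" "\<forall>n. bounded (U n) \<and> diameter (U n) \<le> s"
    have "ennreal (1 / K') * ennreal m \<le> ennreal (1 / K') * (ennreal K' * (\<Sum>k. hausdorff_gauge (d - 1) (U k)))"
      using *[OF U(1)] U(2) by (intro mult_left_mono) auto
    also have "\<dots> = (\<Sum>k. hausdorff_gauge (d - 1) (U k))"
      using K' by (simp add: mult.assoc[symmetric] ennreal_mult'[symmetric])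
    finally show "ennreal (m / K') \<le> (\<Sum>n. hausdorff_gauge (d - 1) (U n))"
      using K' m by (simp add: ennreal_mult'[symmetric])
  qed
  also have "\<dots> \<le> hausdorff_outer (d - 1) A"
    unfolding hausdorff_outer_def using s by (intro SUP_upper) auto
  also have "\<dots> = emeasure (hausdorff_measure (d - 1)) A"
    unfolding A_def by (intro emeasure_hausdorff_measure[symmetric] sets.Int borel_closed borel_open) auto
  finally have le: "ennreal (m / K') \<le> emeasure (hausdorff_measure (d - 1)) A" .
  have "0 < ennreal (m / K')" using m K' by simp
  from less_le_trans[OF this le] show ?thesis unfolding A_def d_def .
qed

section \<open>Linear finite elements\<close>

text \<open>If all defining inequalities were strict at a point, they would persist nearby, so a
  frontier point satisfies one of them with equality.\<close>

lemma polyhedron_frontier_thin: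
  fixes S :: "'a::euclidean_space set"
  assumes "polyhedron S"
  shows "thin (frontier S)"
proof -
  obtain F where F: "finite F" "S = \<Inter>F" "\<And>h. h \<in> F \<Longrightarrow> \<exists>a b. a \<noteq> 0 \<and> h = {x. inner a x \<le> b}"
    using assms unfolding polyhedron_def by blast
  then have "\<forall>h\<in>F. \<exists>a b. a \<noteq> 0 \<and> (\<forall>y. y \<in> h \<longleftrightarrow> inner a y \<le> b)" by blast
  then obtain a b where ab: "\<And>h. h \<in> F \<Longrightarrow> a h \<noteq> 0" "\<And>h y. h \<in> F \<Longrightarrow> y \<in> h \<longleftrightarrow> inner (a h) y \<le> b h"
    by metis
  have "frontier S \<subseteq> (\<Union>h\<in>F. {x. inner (a h) x = b h})"
  proof
    fix x assume x: "x \<in> frontier S"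
    have "closed S" using assms by (rule polyhedron_imp_closed)
    then have xS: "x \<in> S" using x frontier_subset_closed by blast
    show "x \<in> (\<Union>h\<in>F. {x. inner (a h) x = b h})"
    proof (rule ccontr)
      assume n: "\<not> ?thesis"
      have "inner (a h) x < b h" if "h \<in> F" for h
      proof -
        have "x \<in> h" using xS F(2) that by blast
        then have "inner (a h) x \<le> b h" using ab(2)[OF that] by simp
        moreover have "inner (a h) x \<noteq> b h" using n that by blast
        ultimately show ?thesis by simp
      qed
      then have "x \<in> (\<Inter>h\<in>F. {x. inner (a h) x < b h})" by blast
      moreover have "open (\<Inter>h\<in>F. {x. inner (a h) x < b h})"
        using F(1) by (intro open_INT) (auto simp: open_halfspace_lt)
      moreover have "(\<Inter>h\<in>F. {x. inner (a h) x < b h}) \<subseteq> S"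
      proof
        fix y assume "y \<in> (\<Inter>h\<in>F. {x. inner (a h) x < b h})"
        then have "y \<in> h" if "h \<in> F" for h using ab(2)[OF that, of y] that by (simp add: less_imp_le)
        then show "y \<in> S" using F(2) by blast
      qed
      ultimately have "x \<in> interior S" by (meson interior_maximal subsetD)
      then show False using x by (simp add: frontier_def)
    qed
  qed
  moreover have "thin (\<Union>h\<in>F. {x. inner (a h) x = b h})"
    unfolding thin_def
    by (intro exI[of _ "(\<lambda>h. (a h, b h)) ` F"]) (use F(1) ab(1) in auto)
  ultimately show ?thesis using thin_subset by blast
qed

section \<open>One triangulation: elements, nodes and barycentric coordinates\<close>

locale fem =
  fixes \<Omega> :: "'a::euclidean_space set" and \<T> :: "'a set set" and N :: nat
    and x :: "nat \<Rightarrow> 'a" and e :: "nat \<Rightarrow> 'a \<Rightarrow> real"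
  assumes lip: "lipschitz_domain \<Omega>" and tri: "triangulation_of (closure \<Omega>) \<T>"
    and num: "node_numbering \<Omega> \<T> N x" and basis: "nodal_basis \<Omega> \<T> N x e"
begin

lemma open_dom: "open \<Omega>" and bounded_dom: "bounded \<Omega>" and dom_nonempty: "\<Omega> \<noteq> {}"
  using lip by (auto simp: lipschitz_domain_def)

lemma finite_elements: "finite \<T>"
  using tri by (simp add: triangulation_of_def triangulation_def)

lemma elements_cover: "\<Union>\<T> = closure \<Omega>"
  using tri by (simp add: triangulation_of_def)

lemma element_subset: "T \<in> \<T> \<Longrightarrow> T \<subseteq> closure \<Omega>"
  using elements_cover by blast

lemma element_simplex: "T \<in> \<T> \<Longrightarrow> int DIM('a) simplex T"
  using tri by (simp add: triangulation_of_def)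

lemma element_face: "T \<in> \<T> \<Longrightarrow> T' \<in> \<T> \<Longrightarrow> (T \<inter> T') face_of T"
  using tri by (simp add: triangulation_of_def triangulation_def)

lemma element_convex: "T \<in> \<T> \<Longrightarrow> convex T" and element_compact: "T \<in> \<T> \<Longrightarrow> compact T"
  and element_closed: "T \<in> \<T> \<Longrightarrow> closed T" and element_bounded: "T \<in> \<T> \<Longrightarrow> bounded T"
  and element_frontier_thin: "T \<in> \<T> \<Longrightarrow> thin (frontier T)"
  using element_simplex convex_simplex compact_simplex closed_simplex compact_imp_bounded
    polyhedron_frontier_thin simplex_imp_polyhedron by blast+

lemma element_interior_nonempty:
  assumes "T \<in> \<T>" shows "interior T \<noteq> {}"
proof -
  have "aff_dim T = int DIM('a)" using aff_dim_simplex[OF element_simplex[OF assms]] .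
  then have "affine hull T = UNIV" "T \<noteq> {}" by (auto simp: aff_dim_eq_full)
  then show ?thesis
    using rel_interior_interior[of T] rel_interior_eq_empty[OF element_convex[OF assms]] by auto
qed

text \<open>The intersection is a face of each of the two elements, and a face that meets the
  interior is the whole element.\<close>

lemma element_interiors_disjoint:
  assumes "T \<in> \<T>" "T' \<in> \<T>" "p \<in> interior T" "p \<in> interior T'"
  shows "T = T'"
proof -
  have "T \<inter> T' = T"
    using face_of_disjoint_interior[OF element_face[OF assms(1,2)]] assms(3,4) interior_subset by blast
  moreover have "T' \<inter> T = T'"
    using face_of_disjoint_interior[OF element_face[OF assms(2,1)]] assms(3,4) interior_subset by blast
  ultimately show ?thesis by blast
qed

lemma element_interior_subset: "T \<in> \<T> \<Longrightarrow> interior T \<subseteq> \<Omega>"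
  using interior_mono[OF element_subset] interior_closure_lipschitz[OF lip] by metis

definition V :: "'a set \<Rightarrow> nat set" where "V T = {i. i < N \<and> x i \<in> T}"

lemma finite_V: "finite (V T)" by (simp add: V_def)

lemma node_inj: "i < N \<Longrightarrow> j < N \<Longrightarrow> x i = x j \<Longrightarrow> i = j"
  using num unfolding node_numbering_def bij_betw_def inj_on_def by auto

lemma node_in_nodes: "i < N \<Longrightarrow> x i \<in> nodes \<T>"
  using num unfolding node_numbering_def bij_betw_def by auto

lemma node_ex: "p \<in> nodes \<T> \<Longrightarrow> \<exists>i<N. x i = p"
  using num unfolding node_numbering_def bij_betw_def by (metis imageE lessThan_iff)

text \<open>There are no hanging nodes: the node is a vertex of some element, hence of its common
  face with T, which is also a face of T.\<close>

lemma node_extreme: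
  assumes "T \<in> \<T>" "i \<in> V T" shows "x i extreme_point_of T"
proof -
  have i: "i < N" "x i \<in> T" using assms(2) by (auto simp: V_def)
  obtain T' where T': "T' \<in> \<T>" "x i extreme_point_of T'" using node_in_nodes[OF i(1)] by (auto simp: nodes_def)
  have "x i \<in> T'" using T'(2) by (simp add: extreme_point_of_def)
  then have "x i extreme_point_of (T' \<inter> T)"
    using extreme_point_of_face[OF element_face[OF T'(1) assms(1)]] T'(2) i by blast
  then have "x i extreme_point_of (T \<inter> T')" by (simp add: Int_commute)
  then show ?thesis using extreme_point_of_face[OF element_face[OF assms(1) T'(1)]] by blast
qed

lemma element_extreme_points:
  assumes "T \<in> \<T>" shows "{p. p extreme_point_of T} = x ` V T"
proof
  show "x ` V T \<subseteq> {p. p extreme_point_of T}" using node_extreme[OF assms] by blast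
  show "{p. p extreme_point_of T} \<subseteq> x ` V T"
  proof
    fix p assume p: "p \<in> {p. p extreme_point_of T}"
    then obtain i where "i < N" "x i = p" using node_ex[of p] assms by (auto simp: nodes_def)
    then show "p \<in> x ` V T" using p by (auto simp: V_def extreme_point_of_def)
  qed
qed

lemma element_hull: "T \<in> \<T> \<Longrightarrow> T = convex hull (x ` V T)"
  using Krein_Milman_Minkowski[OF element_compact element_convex] element_extreme_points by metis

lemma card_V_le:
  assumes "T \<in> \<T>" shows "card (V T) \<le> DIM('a) + 1"
proof -
  obtain C where C: "finite C" "int (card C) = int DIM('a) + 1" "T = convex hull C"
    using element_simplex[OF assms] unfolding simplex by blast
  have "x ` V T \<subseteq> C" using element_extreme_points[OF assms] C(3) extreme_point_of_convex_hull by blast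
  then have "card (x ` V T) \<le> card C" using C(1) by (rule card_mono[rotated])
  moreover have "card (x ` V T) = card (V T)"
    by (intro card_image inj_onI) (auto simp: V_def intro: node_inj)
  ultimately show ?thesis using C(2) by linarith
qed

lemma basis_node: "i < N \<Longrightarrow> j < N \<Longrightarrow> e j (x i) = (if i = j then 1 else 0)"
  using basis by (simp add: nodal_basis_def)

lemma basis_continuous: "j < N \<Longrightarrow> continuous_on (closure \<Omega>) (e j)"
  using basis by (simp add: nodal_basis_def P1_space_def)

lemma basis_affine: "j < N \<Longrightarrow> T \<in> \<T> \<Longrightarrow> \<exists>a b. \<forall>p\<in>T. e j p = inner a p + b"
  using basis by (simp add: nodal_basis_def P1_space_def)

text \<open>With \<open>g0\<close> it gives an affine function on the whole space; its values
  outside T matter in the proof that interior basis functions vanish on the boundary.\<close>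

definition g :: "'a set \<Rightarrow> nat \<Rightarrow> 'a" where "g T j = (SOME a. \<exists>b. \<forall>p\<in>T. e j p = inner a p + b)"

definition g0 :: "'a set \<Rightarrow> nat \<Rightarrow> real" where "g0 T j = (SOME b. \<forall>p\<in>T. e j p = inner (g T j) p + b)"

lemma basis_eq_affine:
  assumes "j < N" "T \<in> \<T>" "p \<in> T" shows "e j p = inner (g T j) p + g0 T j"
proof -
  have "\<exists>b. \<forall>p\<in>T. e j p = inner (g T j) p + b"
    unfolding g_def by (rule someI_ex) (rule basis_affine[OF assms(1,2)])
  then have "\<forall>p\<in>T. e j p = inner (g T j) p + g0 T j" unfolding g0_def by (rule someI_ex)
  then show ?thesis using assms(3) by blast
qed

text \<open>An affine function evaluated at a convex combination of vertices is the combination of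
  its vertex values, and these are 1 at the own node and 0 at the others; so the basis functions
  return the weights.\<close>

lemma barycentric:
  assumes T: "T \<in> \<T>" and p: "p \<in> T"
  shows "\<And>j. j < N \<Longrightarrow> 0 \<le> e j p" "(\<Sum>i\<in>V T. e i p) = 1" "(\<Sum>i\<in>V T. e i p *\<^sub>R x i) = p"
    "\<And>j. j < N \<Longrightarrow> j \<notin> V T \<Longrightarrow> e j p = 0"
proof -
  have inj: "inj_on x (V T)" by (intro inj_onI) (auto simp: V_def intro: node_inj)
  have "p \<in> convex hull (x ` V T)" using p element_hull[OF T] by simp
  then obtain u where u: "\<And>q. q \<in> x ` V T \<Longrightarrow> 0 \<le> u q" "sum u (x ` V T) = 1" "(\<Sum>q\<in>x ` V T. u q *\<^sub>R q) = p"
    unfolding convex_hull_finite[OF finite_imageI[OF finite_V]] by blast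
  define w where "w i = u (x i)" for i
  have w: "\<And>i. i \<in> V T \<Longrightarrow> 0 \<le> w i" "(\<Sum>i\<in>V T. w i) = 1" "(\<Sum>i\<in>V T. w i *\<^sub>R x i) = p"
    using u by (auto simp: w_def sum.reindex[OF inj])
  have ew: "e j p = (if j \<in> V T then w j else 0)" if j: "j < N" for j
  proof -
    have "e j p = inner (g T j) (\<Sum>i\<in>V T. w i *\<^sub>R x i) + g0 T j" using basis_eq_affine[OF j T p] w(3) by simp
    also have "\<dots> = (\<Sum>i\<in>V T. w i * inner (g T j) (x i)) + (\<Sum>i\<in>V T. w i) * g0 T j"
      by (simp add: inner_sum_right w(2))
    also have "\<dots> = (\<Sum>i\<in>V T. w i * (inner (g T j) (x i) + g0 T j))"
      by (simp add: sum_distrib_right sum.distrib[symmetric] distrib_left)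
    also have "\<dots> = (\<Sum>i\<in>V T. w i * e j (x i))"
      using basis_eq_affine[OF j T] by (intro sum.cong) (auto simp: V_def)
    also have "\<dots> = (\<Sum>i\<in>V T. if i = j then w i else 0)"
      using basis_node[OF _ j] by (intro sum.cong) (auto simp: V_def)
    also have "\<dots> = (if j \<in> V T then w j else 0)" using finite_V by simp
    finally show ?thesis .
  qed
  show "0 \<le> e j p" if "j < N" for j using ew[OF that] w(1) by simp
  show "e j p = 0" if "j < N" "j \<notin> V T" for j using ew[OF that(1)] that by simp
  have eV: "e i p = w i" if "i \<in> V T" for i using ew[of i] that by (simp add: V_def)
  show "(\<Sum>i\<in>V T. e i p) = 1" using w(2) eV by simp
  show "(\<Sum>i\<in>V T. e i p *\<^sub>R x i) = p" using w(3) eV by simp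
qed

lemma element_of: "p \<in> closure \<Omega> \<Longrightarrow> \<exists>T\<in>\<T>. p \<in> T"
  using elements_cover by blast

lemma V_subset: "V T \<subseteq> {..<N}" by (auto simp: V_def)

lemma basis_nonneg: "p \<in> closure \<Omega> \<Longrightarrow> j < N \<Longrightarrow> 0 \<le> e j p"
  using element_of barycentric(1) by blast

lemma basis_sum: "p \<in> closure \<Omega> \<Longrightarrow> (\<Sum>j<N. e j p) = 1"
proof -
  assume "p \<in> closure \<Omega>"
  then obtain T where T: "T \<in> \<T>" "p \<in> T" using element_of by blast
  have "(\<Sum>j<N. e j p) = (\<Sum>j\<in>V T. e j p)"
    using barycentric(4)[OF T] V_subset by (intro sum.mono_neutral_right) auto
  then show ?thesis using barycentric(2)[OF T] by simp
qed

lemma basis_le_1: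
  assumes "p \<in> closure \<Omega>" "j < N" shows "e j p \<le> 1"
proof -
  have "e j p \<le> (\<Sum>j<N. e j p)" using assms basis_nonneg by (intro member_le_sum) auto
  then show ?thesis using basis_sum[OF assms(1)] by simp
qed

lemma basis_eq_1:
  assumes "p \<in> closure \<Omega>" "j < N" "e j p = 1" shows "p = x j"
proof -
  obtain T where T: "T \<in> \<T>" "p \<in> T" using element_of[OF assms(1)] by blast
  have jV: "j \<in> V T" by (rule ccontr) (use barycentric(4)[OF T assms(2)] assms(3) in simp)
  have "(\<Sum>i\<in>V T. e i p) = e j p + (\<Sum>i\<in>V T - {j}. e i p)" using finite_V jV by (rule sum.remove)
  then have "(\<Sum>i\<in>V T - {j}. e i p) = 0" using barycentric(2)[OF T] assms(3) by simp
  then have z: "\<forall>i\<in>V T - {j}. e i p = 0"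
    using sum_nonneg_eq_0_iff[of "V T - {j}" "\<lambda>i. e i p"] finite_V barycentric(1)[OF T] V_subset by blast
  have "p = (\<Sum>i\<in>V T. e i p *\<^sub>R x i)" using barycentric(3)[OF T] by simp
  also have "\<dots> = e j p *\<^sub>R x j + (\<Sum>i\<in>V T - {j}. e i p *\<^sub>R x i)" using finite_V jV by (rule sum.remove)
  also have "(\<Sum>i\<in>V T - {j}. e i p *\<^sub>R x i) = 0" using z by (intro sum.neutral) simp
  finally show ?thesis using assms(3) by simp
qed

text \<open>The dilation with small ratio centred at an interior node maps a neighbourhood of a point \<open>q\<close>
  with \<open>e i q > 0\<close> into the star of the node, and barycentric coordinates show that this
  neighbourhood is covered by the elements of the star.\<close>

lemma interior_basis_vanishes:
  assumes i: "i < N" "x i \<in> \<Omega>" and q: "q \<in> frontier \<Omega>"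
  shows "e i q = 0"
proof (rule ccontr)
  assume ne: "e i q \<noteq> 0"
  have qn: "q \<in> closure \<Omega>" "q \<notin> \<Omega>" using q open_dom by (auto simp: frontier_def interior_open)
  have pos: "0 < e i q" using basis_nonneg[OF qn(1) i(1)] ne by simp
  obtain T where T: "T \<in> \<T>" "q \<in> T" using element_of[OF qn(1)] by blast
  have iT: "i \<in> V T" using barycentric(4)[OF T i(1)] ne by blast
  define \<T>i where "\<T>i = {T \<in> \<T>. x i \<in> T}"
  have fin: "finite \<T>i" using finite_elements by (simp add: \<T>i_def)
  have "closed (\<Union>{T \<in> \<T>. x i \<notin> T})" using finite_elements element_closed by (intro closed_Union) auto
  then have "open (\<Omega> - \<Union>{T \<in> \<T>. x i \<notin> T})" using open_dom by (intro open_Diff)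
  moreover have "x i \<in> \<Omega> - \<Union>{T \<in> \<T>. x i \<notin> T}" using i by auto
  ultimately obtain r where r: "0 < r" "ball (x i) r \<subseteq> \<Omega> - \<Union>{T \<in> \<T>. x i \<notin> T}" using openE by blast
  have star: "\<exists>T'\<in>\<T>i. z \<in> T'" if "z \<in> ball (x i) r" for z
  proof -
    have "z \<in> \<Omega> - \<Union>{T \<in> \<T>. x i \<notin> T}" using that r(2) by blast
    then have "z \<in> closure \<Omega>" "z \<notin> \<Union>{T \<in> \<T>. x i \<notin> T}" using closure_subset by blast+
    then show ?thesis using element_of[of z] by (auto simp: \<T>i_def)
  qed
  \<comment> \<open>Brings the image of q within r of the node; the added 1 avoids a division by
    zero.\<close>
  define \<epsilon> where "\<epsilon> = min 1 (r / (2 * (norm (q - x i) + 1)))"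
  have \<epsilon>: "0 < \<epsilon>" "\<epsilon> \<le> 1" "\<epsilon> * norm (q - x i) < r"
  proof -
    have p1: "0 < norm (q - x i) + 1" by (simp add: add_nonneg_pos)
    then show "0 < \<epsilon>" using r(1) by (simp add: \<epsilon>_def)
    show "\<epsilon> \<le> 1" by (simp add: \<epsilon>_def)
    have "\<epsilon> * norm (q - x i) \<le> (r / (2 * (norm (q - x i) + 1))) * norm (q - x i)"
      by (intro mult_right_mono) (auto simp: \<epsilon>_def)
    also have "\<dots> < r" using p1 r(1) by (simp add: divide_less_eq)
    finally show "\<epsilon> * norm (q - x i) < r" .
  qed
  define D where "D z = x i + \<epsilon> *\<^sub>R (z - x i)" for z
  have Dc: "isCont D q" unfolding D_def by (intro continuous_intros)
  have Dconv: "D z = (1 - \<epsilon>) *\<^sub>R x i + \<epsilon> *\<^sub>R z" for z by (simp add: D_def algebra_simps)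
  have D1: "\<forall>\<^sub>F z in at q. D z \<in> ball (x i) r"
  proof -
    have "D q \<in> ball (x i) r" using \<epsilon> by (simp add: D_def dist_norm)
    then show ?thesis using Dc unfolding isCont_def by (intro topological_tendstoD[of D "D q"]) auto
  qed
  have lam: "inner (g T' k) (D z) + g0 T' k = (1 - \<epsilon>) * (inner (g T' k) (x i) + g0 T' k) + \<epsilon> * (inner (g T' k) z + g0 T' k)" for T' k z
    by (simp add: Dconv inner_add_right algebra_simps)
  \<comment> \<open>Only the coordinate belonging to i can become negative when the dilation is
    undone. In a star element containing the image of q it is positive at q, hence nearby; other
    star elements do not contain the image of points near q.\<close>
  have D2: "\<forall>\<^sub>F z in at q. \<forall>T'\<in>\<T>i. D z \<in> T' \<longrightarrow> 0 < inner (g T' i) z + g0 T' i"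
  proof (rule eventually_ball_finite[OF fin], rule ballI)
    fix T' assume T': "T' \<in> \<T>i"
    then have T'2: "T' \<in> \<T>" "x i \<in> T'" by (auto simp: \<T>i_def)
    show "\<forall>\<^sub>F z in at q. D z \<in> T' \<longrightarrow> 0 < inner (g T' i) z + g0 T' i"
    proof (cases "D q \<in> T'")
      case False
      then have "\<forall>\<^sub>F z in at q. D z \<in> - T'"
        using Dc element_closed[OF T'2(1)] unfolding isCont_def by (intro topological_tendstoD[of D "D q"]) auto
      then show ?thesis by eventually_elim auto
    next
      case True
      have DqT: "D q \<in> T" unfolding Dconv
        using element_convex[OF T(1)] T(2) iT \<epsilon> by (intro convexD) (auto simp: V_def)
      \<comment> \<open>The image of q lies in both T and T', so both affine representations give
        the same value there; as they agree at the node too, they agree at q.\<close>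
      have "e i (D q) = (1 - \<epsilon>) * e i (x i) + \<epsilon> * e i q"
        using lam[of T i q] basis_eq_affine[OF i(1) T(1)] DqT T(2) iT by (simp add: V_def)
      moreover have "e i (D q) = (1 - \<epsilon>) * e i (x i) + \<epsilon> * (inner (g T' i) q + g0 T' i)"
        using lam[of T' i q] basis_eq_affine[OF i(1) T'2(1)] True T'2(2) by simp
      ultimately have "inner (g T' i) q + g0 T' i = e i q" using \<epsilon>(1) by simp
      then have "0 < inner (g T' i) q + g0 T' i" using pos by simp
      moreover have "((\<lambda>z. inner (g T' i) z + g0 T' i) \<longlongrightarrow> inner (g T' i) q + g0 T' i) (at q)"
        by (intro tendsto_intros)
      ultimately have "\<forall>\<^sub>F z in at q. 0 < inner (g T' i) z + g0 T' i" by (rule order_tendstoD(1)[rotated])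
      then show ?thesis by eventually_elim auto
    qed
  qed
  from D1 D2 have "\<forall>\<^sub>F z in at q. z \<in> closure \<Omega>"
  proof eventually_elim
    case (elim z)
    obtain T' where T': "T' \<in> \<T>i" "D z \<in> T'" using star[OF elim(1)] by blast
    then have T'2: "T' \<in> \<T>" "x i \<in> T'" by (auto simp: \<T>i_def)
    have iV: "i \<in> V T'" using i T'2 by (simp add: V_def)
    define l where "l k = inner (g T' k) z + g0 T' k" for k
    have el: "e k (D z) = (1 - \<epsilon>) * (if i = k then 1 else 0) + \<epsilon> * l k" if "k \<in> V T'" for k
    proof -
      have k: "k < N" using that by (simp add: V_def)
      have "e k (D z) = (1 - \<epsilon>) * e k (x i) + \<epsilon> * l k"
        using lam[of T' k z] basis_eq_affine[OF k T'2(1)] T'(2) T'2(2) by (simp add: l_def)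
      then show ?thesis using basis_node[OF i(1) k] by simp
    qed
    \<comment> \<open>For k other than i the node contributes nothing, so the coordinate at z is
      that at its image divided by \<epsilon>.\<close>
    have l0: "0 \<le> l k" if "k \<in> V T'" for k
    proof (cases "k = i")
      case True
      then show ?thesis using elim(2) T' by (auto simp: l_def)
    next
      case False
      then have "0 \<le> \<epsilon> * l k" using el[OF that] barycentric(1)[OF T'2(1) T'(2), of k] that by (auto simp: V_def)
      then show ?thesis using \<epsilon>(1) by (simp add: zero_le_mult_iff)
    qed
    have "1 = (\<Sum>k\<in>V T'. (1 - \<epsilon>) * (if i = k then 1 else 0) + \<epsilon> * l k)"
      using barycentric(2)[OF T'2(1) T'(2)] el by simp
    also have "\<dots> = (1 - \<epsilon>) * (\<Sum>k\<in>V T'. if i = k then 1 else 0) + \<epsilon> * (\<Sum>k\<in>V T'. l k)"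
      by (simp add: sum.distrib sum_distrib_left)
    also have "(\<Sum>k\<in>V T'. if i = k then 1 else (0::real)) = 1" using iV finite_V by simp
    finally have s1: "(\<Sum>k\<in>V T'. l k) = 1" using \<epsilon>(1) by simp
    have "D z = (\<Sum>k\<in>V T'. ((1 - \<epsilon>) * (if i = k then 1 else 0) + \<epsilon> * l k) *\<^sub>R x k)"
      using barycentric(3)[OF T'2(1) T'(2)] el by simp
    also have "\<dots> = (\<Sum>k\<in>V T'. (if i = k then (1 - \<epsilon>) *\<^sub>R x k else 0) + \<epsilon> *\<^sub>R (l k *\<^sub>R x k))"
      by (intro sum.cong) (auto simp: algebra_simps)
    also have "\<dots> = (1 - \<epsilon>) *\<^sub>R x i + \<epsilon> *\<^sub>R (\<Sum>k\<in>V T'. l k *\<^sub>R x k)"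
      using iV finite_V by (simp add: sum.distrib scaleR_sum_right)
    finally have "\<epsilon> *\<^sub>R z = \<epsilon> *\<^sub>R (\<Sum>k\<in>V T'. l k *\<^sub>R x k)" by (simp add: Dconv)
    then have "z = (\<Sum>k\<in>V T'. l k *\<^sub>R x k)" using \<epsilon>(1) by simp
    also have "\<dots> \<in> T'"
      using element_convex[OF T'2(1)] l0 s1 finite_V by (intro convex_sum) (auto simp: V_def)
    finally show "z \<in> closure \<Omega>" using element_subset[OF T'2(1)] by blast
  qed
  then obtain U where U: "open U" "q \<in> U" "\<And>z. z \<in> U \<Longrightarrow> z \<noteq> q \<Longrightarrow> z \<in> closure \<Omega>"
    unfolding eventually_at_topological by blast
  then have "U \<subseteq> closure \<Omega>" using qn(1) by blast
  then have "q \<in> interior (closure \<Omega>)" using U(1,2) interior_maximal by blast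
  then show False using interior_closure_lipschitz[OF lip] qn(2) by simp
qed

section \<open>Discrete functions, their gradients and their extension by zero\<close>

definition skel :: "'a set" where "skel = (\<Union>T\<in>\<T>. frontier T)"

text \<open>A representative of the gradient defined everywhere: the sum has at most one nonzero
  term, and on the skeleton and outside \<Omega> it is 0.\<close>

definition Ge :: "nat \<Rightarrow> 'a \<Rightarrow> 'a" where
  "Ge j p = (\<Sum>T\<in>\<T>. indicator (interior T) p *\<^sub>R g T j)"

definition Y :: "(nat \<Rightarrow> real) \<Rightarrow> 'a \<Rightarrow> real" where "Y c p = (\<Sum>j<N. c j * e j p)"

definition DY :: "(nat \<Rightarrow> real) \<Rightarrow> 'a \<Rightarrow> 'a" where "DY c p = (\<Sum>j<N. c j *\<^sub>R Ge j p)"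

definition u :: "(nat \<Rightarrow> real) \<Rightarrow> 'a \<Rightarrow> real" where "u c p = indicator \<Omega> p * Y c p"

lemma skel_thin: "thin skel"
  unfolding skel_def by (intro thin_UN finite_elements element_frontier_thin)

lemma off_skel: "p \<in> closure \<Omega> \<Longrightarrow> p \<notin> skel \<Longrightarrow> \<exists>T\<in>\<T>. p \<in> interior T"
proof -
  assume p: "p \<in> closure \<Omega>" "p \<notin> skel"
  then obtain T where T: "T \<in> \<T>" "p \<in> T" using element_of by blast
  then have "p \<notin> frontier T" using p by (auto simp: skel_def)
  then have "p \<in> interior T" using T element_closed by (simp add: frontier_def)
  then show ?thesis using T by blast
qed

lemma Ge_interior:
  assumes "T \<in> \<T>" "p \<in> interior T" shows "Ge j p = g T j"
proof -
  have "Ge j p = (\<Sum>T'\<in>\<T>. if T' = T then g T j else 0)"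
    unfolding Ge_def
  proof (rule sum.cong[OF refl])
    fix T' assume "T' \<in> \<T>"
    then have "p \<in> interior T' \<Longrightarrow> T' = T" using element_interiors_disjoint assms by blast
    then show "indicator (interior T') p *\<^sub>R g T' j = (if T' = T then g T j else 0)"
      using assms(2) by (cases "T' = T") (auto simp: indicator_def)
  qed
  then show ?thesis using finite_elements assms(1) by simp
qed

lemma Ge_outside: "p \<notin> \<Omega> \<Longrightarrow> Ge j p = 0"
  unfolding Ge_def using element_interior_subset by (intro sum.neutral) (auto split: split_indicator)

lemma DY_outside: "p \<notin> \<Omega> \<Longrightarrow> DY c p = 0"
  unfolding DY_def by (simp add: Ge_outside)

lemma bbs_Ge: "bbs (Ge j)"
proof -
  have "bbs (\<lambda>p. indicator (interior T) p *\<^sub>R g T j)" if "T \<in> \<T>" for T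
    using bounded_subset[OF element_bounded[OF that] interior_subset]
    by (intro bbs_indicator[where B="norm (g T j)"]) (auto simp: borel_open)
  then have "bbs (\<lambda>p. \<Sum>T\<in>\<T>. indicator (interior T) p *\<^sub>R g T j)" by (rule bbs_sum)
  then show ?thesis by (simp add: Ge_def[abs_def])
qed

lemma bbs_DY: "bbs (DY c)"
  unfolding DY_def[abs_def] by (intro bbs_sum bbs_cmult bbs_Ge)

lemma GDERIV_basis:
  assumes "j < N" "T \<in> \<T>" "p \<in> interior T" shows "GDERIV (e j) p :> Ge j p"
proof -
  have "((\<lambda>q. inner (g T j) q + g0 T j) has_derivative (\<lambda>h. inner (g T j) h)) (at p)"
    by (auto intro!: derivative_eq_intros)
  then have "(e j has_derivative (\<lambda>h. inner (g T j) h)) (at p)"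
    by (rule has_derivative_transform_within_open[OF _ open_interior assms(3)])
       (simp add: basis_eq_affine[OF assms(1,2) subsetD[OF interior_subset]])
  then show ?thesis unfolding gderiv_def Ge_interior[OF assms(2,3)] by (simp add: inner_commute)
qed

lemma gradient_basis:
  assumes "j < N" "T \<in> \<T>" "p \<in> interior T" shows "gradient (e j) p = Ge j p"
  unfolding gradient_def
proof (rule the_equality)
  show "GDERIV (e j) p :> Ge j p" by (rule GDERIV_basis[OF assms])
  fix D assume "GDERIV (e j) p :> D"
  then have "(\<lambda>h. inner h D) = (\<lambda>h. inner h (Ge j p))"
    using GDERIV_basis[OF assms] unfolding gderiv_def by (rule has_derivative_unique)
  then have "inner (D - Ge j p) D = inner (D - Ge j p) (Ge j p)" by meson
  then have "inner (D - Ge j p) (D - Ge j p) = 0" by (simp add: inner_diff_right)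
  then show "D = Ge j p" by simp
qed

lemma GDERIV_Y:
  assumes "T \<in> \<T>" "p \<in> interior T" shows "GDERIV (Y c) p :> DY c p"
proof -
  have "((\<lambda>p. \<Sum>j<N. c j * e j p) has_derivative (\<lambda>h. \<Sum>j<N. c j * inner h (Ge j p))) (at p)"
    using GDERIV_basis[OF _ assms] unfolding gderiv_def
    by (intro has_derivative_sum has_derivative_mult_right) auto
  then show ?thesis unfolding gderiv_def Y_def[abs_def] DY_def by (simp add: inner_sum_right)
qed

lemma Y_continuous: "continuous_on (closure \<Omega>) (Y c)"
  unfolding Y_def[abs_def] by (intro continuous_intros basis_continuous) auto

lemma Y_node: "i < N \<Longrightarrow> Y c (x i) = c i"
proof -
  assume i: "i < N"
  have "Y c (x i) = (\<Sum>j<N. if j = i then c j else 0)"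
    unfolding Y_def using basis_node[OF i] by (intro sum.cong) auto
  then show ?thesis using i by simp
qed

lemma Y_element: "T \<in> \<T> \<Longrightarrow> p \<in> T \<Longrightarrow> Y c p = (\<Sum>i\<in>V T. c i * e i p)"
  unfolding Y_def using barycentric(4)[of T p] V_subset by (intro sum.mono_neutral_right) auto

lemma Y_linear: "Y (\<lambda>i. a i + t * b i) p = Y a p + t * Y b p"
  unfolding Y_def by (simp add: sum.distrib sum_distrib_left algebra_simps)

lemma DY_linear: "DY (\<lambda>i. a i + t * b i) p = DY a p + t *\<^sub>R DY b p"
  unfolding DY_def by (simp add: sum.distrib scaleR_sum_right scaleR_add_left)

lemma Y_diff: "Y (\<lambda>i. a i - b i) p = Y a p - Y b p"
  using Y_linear[of a "-1" b p] by simp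

lemma DY_diff: "DY (\<lambda>i. a i - b i) p = DY a p - DY b p"
  using DY_linear[of a "-1" b p] by simp

lemma bbs_u: "bbs (u c)"
proof -
  have "compact (Y c ` closure \<Omega>)"
    using bounded_dom Y_continuous by (intro compact_continuous_image) (auto simp: compact_closure)
  then obtain B where B: "\<And>p. p \<in> closure \<Omega> \<Longrightarrow> norm (Y c p) \<le> B"
    using compact_imp_bounded[of "Y c ` closure \<Omega>"] unfolding bounded_iff by auto
  obtain R where R: "\<And>p. p \<in> \<Omega> \<Longrightarrow> norm p \<le> R" using bounded_dom unfolding bounded_iff by blast
  show ?thesis
  proof (rule bbsI)
    have "continuous_on \<Omega> (Y c)" using Y_continuous closure_subset by (rule continuous_on_subset)
    then have "(\<lambda>p. indicator \<Omega> p *\<^sub>R Y c p) \<in> borel_measurable borel"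
      using open_dom by (intro borel_measurable_continuous_on_indicator) (auto simp: borel_open)
    then show "u c \<in> borel_measurable borel" by (simp add: u_def[abs_def])
    show "norm (u c p) \<le> max 0 B" for p
      using B[of p] closure_subset[of \<Omega>] order_trans[OF _ max.cobounded2[of B 0]]
      by (cases "p \<in> \<Omega>") (auto simp: u_def)
    show "norm p \<le> R" if "u c p \<noteq> 0" for p using that R by (auto simp: u_def split: split_indicator_asm)
  qed
qed

lemma Y_frontier_zero:
  assumes "\<And>j. j < N \<Longrightarrow> x j \<in> frontier \<Omega> \<Longrightarrow> c j = 0" and q: "q \<in> frontier \<Omega>"
  shows "Y c q = 0"
  unfolding Y_def
proof (rule sum.neutral, rule ballI)
  fix j assume "j \<in> {..<N}"
  then have j: "j < N" by simp
  have "x j \<in> closure \<Omega>" using node_in_nodes[OF j] element_subset by (auto simp: nodes_def extreme_point_of_def)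
  then consider "x j \<in> \<Omega>" | "x j \<in> frontier \<Omega>" using open_dom by (auto simp: frontier_def interior_open)
  then show "c j * e j q = 0"
    using interior_basis_vanishes[OF j _ q] assms(1)[OF j] by cases auto
qed

text \<open>With zero boundary coefficients only interior basis functions remain; they vanish on the
  frontier, so the extension by zero is continuous.\<close>

lemma u_test_fn:
  assumes "\<And>j. j < N \<Longrightarrow> x j \<in> frontier \<Omega> \<Longrightarrow> c j = 0"
  shows "test_fn \<Omega> (u c) (DY c)"
  unfolding test_fn_def
proof (intro conjI allI impI)
  show "bounded \<Omega>" by (rule bounded_dom)
  show "bbs (DY c)" by (rule bbs_DY)
  show "u c p = 0" "DY c p = 0" if "p \<notin> \<Omega>" for p using that by (simp_all add: u_def DY_outside)
  show "pw_grad (u c) (DY c)"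
    unfolding pw_grad_def
  proof (intro conjI exI[of _ skel] skel_thin allI impI)
    have "continuous_on (closure \<Omega> \<union> (- \<Omega>)) (\<lambda>p. if p \<in> \<Omega> then Y c p else 0)"
    proof (rule continuous_on_cases)
      show "closed (closure \<Omega>)" "closed (- \<Omega>)" using open_dom by auto
      show "\<forall>p. p \<in> closure \<Omega> \<and> p \<notin> \<Omega> \<or> p \<in> - \<Omega> \<and> p \<in> \<Omega> \<longrightarrow> Y c p = 0"
        using Y_frontier_zero[OF assms] open_dom by (auto simp: frontier_def interior_open)
    qed (auto intro: Y_continuous)
    moreover have "closure \<Omega> \<union> (- \<Omega>) = UNIV" using closure_subset[of \<Omega>] by auto
    moreover have "u c = (\<lambda>p. if p \<in> \<Omega> then Y c p else 0)" by (auto simp: u_def)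
    ultimately show "continuous_on UNIV (u c)" by simp
    fix p assume p: "p \<notin> skel"
    show "GDERIV (u c) p :> DY c p"
    proof (cases "p \<in> closure \<Omega>")
      case True
      then obtain T where T: "T \<in> \<T>" "p \<in> interior T" using off_skel p by blast
      show ?thesis unfolding gderiv_def
        by (rule has_derivative_transform_within_open[OF GDERIV_Y[OF T, unfolded gderiv_def] open_interior T(2)])
           (use element_interior_subset[OF T(1)] in \<open>auto simp: u_def\<close>)
    next
      case False
      then have n: "p \<notin> \<Omega>" using closure_subset by blast
      have o: "open (- closure \<Omega>)" and pin: "p \<in> - closure \<Omega>" using False by auto
      have "((\<lambda>p. 0) has_derivative (\<lambda>h. inner h (DY c p))) (at p)" using DY_outside[OF n] by simp
      then show ?thesis unfolding gderiv_def
        by (rule has_derivative_transform_within_open[OF _ o pin])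
           (use closure_subset[of \<Omega>] in \<open>auto simp: u_def split: split_indicator\<close>)
    qed
  qed
qed

section \<open>Inscribed balls and inverse estimates\<close>

lemma inscribed_bound:
  assumes T: "T \<in> \<T>" and K: "0 \<le> K" and le: "\<And>z r. 0 \<le> r \<Longrightarrow> cball z r \<subseteq> T \<Longrightarrow> G * (2 * r) \<le> K" and G: "0 \<le> G"
  shows "G * inscribed_diameter T \<le> K"
proof (cases "G = 0")
  case False
  then have G0: "0 < G" using G by simp
  have "inscribed_diameter T \<le> K / G"
    unfolding inscribed_diameter_def
  proof (rule cSup_least)
    \<comment> \<open>A ball of negative radius is empty and has diameter 0. It makes the set
      nonempty, and such members need a case of their own.\<close>
    have "cball (0::'a) (-1) \<subseteq> T" by simp
    then show "{diameter (cball p r) | p r. cball p r \<subseteq> T} \<noteq> {}" by blast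
    fix d assume "d \<in> {diameter (cball p r) | p r. cball p r \<subseteq> T}"
    then obtain p r where d: "d = diameter (cball p r)" "cball p r \<subseteq> T" by blast
    show "d \<le> K / G"
    proof (cases "r < 0")
      case True
      then show ?thesis using d K G0 by simp
    next
      case r: False
      then have "d = 2 * r" using d(1) by (simp add: diameter_cball)
      then show ?thesis using le[OF _ d(2)] r G0 by (simp add: le_divide_eq mult.commute)
    qed
  qed
  then show ?thesis using G0 by (simp add: le_divide_eq mult.commute)
qed (use K in simp)

lemma inscribed_ball:
  assumes T: "T \<in> \<T>"
  obtains z r where "0 < r" "cball z r \<subseteq> T" "inscribed_diameter T \<le> 4 * r" "2 * r \<le> inscribed_diameter T"
    "2 * r \<le> diameter T"
proof -
  let ?S = "{diameter (cball p r) | p r. cball p r \<subseteq> T}"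
  have bdd: "bdd_above ?S"
    unfolding bdd_above_def using diameter_subset[OF _ element_bounded[OF T]] by blast
  obtain y where "y \<in> interior T" using element_interior_nonempty[OF T] by blast
  then obtain s where s: "0 < s" "cball y s \<subseteq> T" by (auto simp: mem_interior_cball)
  have "2 * s \<le> inscribed_diameter T"
    unfolding inscribed_diameter_def using s by (intro cSup_upper bdd) (auto simp: diameter_cball intro!: exI[of _ y] exI[of _ s])
  then have pos: "0 < inscribed_diameter T" using s by simp
  then have "inscribed_diameter T / 2 < Sup ?S" by (simp add: inscribed_diameter_def)
  moreover have "?S \<noteq> {}" using s(2) by blast
  ultimately obtain d where d: "d \<in> ?S" "inscribed_diameter T / 2 < d" using less_cSupE by blast
  then obtain z r where zr: "d = diameter (cball z r)" "cball z r \<subseteq> T" by blast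
  have r: "0 < r" using d(2) pos zr(1) by (auto simp: diameter_cball split: if_splits)
  have d2: "d = 2 * r" using zr(1) r by (simp add: diameter_cball)
  show ?thesis
  proof (rule that[OF r zr(2)])
    show "inscribed_diameter T \<le> 4 * r" using d(2) d2 by simp
    show "2 * r \<le> inscribed_diameter T" unfolding d2[symmetric] inscribed_diameter_def using d(1) by (rule cSup_upper[OF _ bdd])
    show "2 * r \<le> diameter T" using diameter_subset[OF zr(2) element_bounded[OF T]] zr(1) d2 by simp
  qed
qed

text \<open>On T the function \<open>Y c\<close> minus the linear function of v is affine, so its
  oscillation is controlled by its vertex values. Across an inscribed ball in the direction of its
  gradient it changes by the norm of the gradient times the diameter of the ball. With v = 0 this is
  an inverse estimate, with v = K p the core of the quasi-interpolation bound.\<close>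

lemma DY_bound:
  assumes T: "T \<in> \<T>" "p \<in> interior T" and K: "0 \<le> K"
    and le: "\<And>i j. i \<in> V T \<Longrightarrow> j \<in> V T \<Longrightarrow> \<bar>c i - c j - inner v (x i - x j)\<bar> \<le> K"
  shows "norm (DY c p - v) * inscribed_diameter T \<le> K"
proof (rule inscribed_bound[OF T(1) K])
  define G where "G = DY c p - v"
  have DYT: "DY c p = (\<Sum>j<N. c j *\<^sub>R g T j)" unfolding DY_def using Ge_interior[OF T] by simp
  define l where "l q = Y c q - inner v q" for q
  have laff: "l q - l q' = inner G (q - q')" if q: "q \<in> T" "q' \<in> T" for q q'
  proof -
    have "Y c q = inner (DY c p) q + (\<Sum>j<N. c j * g0 T j)" if "q \<in> T" for q
      unfolding Y_def DYT using basis_eq_affine[OF _ T(1) that]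
      by (simp add: inner_sum_left sum.distrib distrib_left)
    then show ?thesis using q by (simp add: l_def G_def inner_diff_left inner_diff_right)
  qed
  define m where "m i = c i - inner v (x i)" for i
  have lbar: "l q = (\<Sum>i\<in>V T. e i q * m i)" if q: "q \<in> T" for q
  proof -
    have "inner v q = inner v (\<Sum>i\<in>V T. e i q *\<^sub>R x i)" using barycentric(3)[OF T(1) q] by simp
    also have "\<dots> = (\<Sum>i\<in>V T. e i q * inner v (x i))" by (simp add: inner_sum_right)
    finally have "l q = (\<Sum>i\<in>V T. c i * e i q) - (\<Sum>i\<in>V T. e i q * inner v (x i))"
      using Y_element[OF T(1) q] by (simp add: l_def)
    also have "\<dots> = (\<Sum>i\<in>V T. e i q * m i)" unfolding m_def sum_subtractf[symmetric] by (intro sum.cong) (auto simp: algebra_simps)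
    finally show ?thesis .
  qed
  have conv: "(\<Sum>i\<in>V T. e i q * a i) \<le> b" if q: "q \<in> T" and ab: "\<And>i. i \<in> V T \<Longrightarrow> a i \<le> b" for q a and b :: real
  proof -
    have "(\<Sum>i\<in>V T. e i q * a i) \<le> (\<Sum>i\<in>V T. e i q * b)"
      using barycentric(1)[OF T(1) q] ab V_subset by (intro sum_mono mult_left_mono) auto
    also have "\<dots> = b" using barycentric(2)[OF T(1) q] by (simp add: sum_distrib_right[symmetric])
    finally show ?thesis .
  qed
  have mm: "m i \<le> K + m j" if "i \<in> V T" "j \<in> V T" for i j
    using le[OF that] by (simp add: m_def inner_diff_right)
  have ll: "l q - l q' \<le> K" if q: "q \<in> T" "q' \<in> T" for q q'
  proof -
    have lk: "l q - K \<le> m j" if "j \<in> V T" for j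
      using conv[OF q(1), of m "K + m j"] mm[OF _ that] lbar[OF q(1)] by simp
    have "(\<Sum>j\<in>V T. e j q' * (- m j)) \<le> - (l q - K)"
    proof (rule conv[OF q(2)])
      show "- m j \<le> - (l q - K)" if "j \<in> V T" for j using lk[OF that] by linarith
    qed
    then show ?thesis using lbar[OF q(2)] by (simp add: sum_negf)
  qed
  show "norm (DY c p - v) * (2 * r) \<le> K" if r: "0 \<le> r" "cball z r \<subseteq> T" for z r
  proof (cases "G = 0")
    case True
    then show ?thesis using K by (simp add: G_def)
  next
    case False
    define q where "q = z + (r / norm G) *\<^sub>R G"
    define q' where "q' = z - (r / norm G) *\<^sub>R G"
    have "q \<in> cball z r" "q' \<in> cball z r" using r False by (auto simp: q_def q'_def dist_norm)
    then have "q \<in> T" "q' \<in> T" using r(2) by auto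
    then have "inner G (q - q') \<le> K" using ll laff by metis
    moreover have "q - q' = (2 * r / norm G) *\<^sub>R G" by (simp add: q_def q'_def scaleR_add_left[symmetric])
    moreover have "inner G ((2 * r / norm G) *\<^sub>R G) = norm G * (2 * r)"
      using False by (simp add: power2_norm_eq_inner[symmetric] power2_eq_square)
    ultimately show ?thesis by (simp add: G_def)
  qed
qed simp

lemma diameter_pos: "T \<in> \<T> \<Longrightarrow> 0 < diameter T"
  using inscribed_ball by (metis less_le_trans mult_pos_pos zero_less_numeral)

lemma inscribed_pos: "T \<in> \<T> \<Longrightarrow> 0 < inscribed_diameter T"
  using inscribed_ball by (metis less_le_trans mult_pos_pos zero_less_numeral)

lemma element_dist: "T \<in> \<T> \<Longrightarrow> p \<in> T \<Longrightarrow> q \<in> T \<Longrightarrow> dist p q \<le> diameter T"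
  using diameter_bounded_bound[OF element_bounded] by blast

lemma elements_nonempty: "\<T> \<noteq> {}"
  using elements_cover dom_nonempty by (metis Union_empty closure_eq_empty)

lemma measure_ball_eq:
  "0 \<le> r \<Longrightarrow> measure lborel (ball (a::'a) r) = unit_ball_vol (real DIM('a)) * r ^ DIM('a)"
  by (simp add: content_ball)

section \<open>Consequences of shape regularity\<close>

context
  fixes \<sigma> H :: real
  assumes regular: "\<And>T. T \<in> \<T> \<Longrightarrow> diameter T \<le> \<sigma> * inscribed_diameter T"
    and mesh: "\<And>T. T \<in> \<T> \<Longrightarrow> diameter T \<le> H"
begin

lemma sigma_pos: "0 < \<sigma>"
proof -
  obtain T where T: "T \<in> \<T>" using elements_nonempty by blast
  have "0 < \<sigma> * inscribed_diameter T" using regular[OF T] diameter_pos[OF T] by simp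
  then show ?thesis using inscribed_pos[OF T] by (simp add: zero_less_mult_iff)
qed

lemma mesh_pos: "0 < H"
  using elements_nonempty mesh diameter_pos by (meson all_not_in_conv less_le_trans)

lemma interior_measure_ge:
  assumes T: "T \<in> \<T>"
  shows "unit_ball_vol (real DIM('a)) * (diameter T / (4 * \<sigma>)) ^ DIM('a) \<le> measure lborel (interior T)"
proof -
  obtain z r where zr: "0 < r" "cball z r \<subseteq> T" "inscribed_diameter T \<le> 4 * r" by (rule inscribed_ball[OF T]) (rule that)
  have "diameter T \<le> \<sigma> * (4 * r)"
    using regular[OF T] mult_left_mono[OF zr(3) less_imp_le[OF sigma_pos]] by linarith
  then have "diameter T / (4 * \<sigma>) \<le> r" using sigma_pos by (simp add: divide_le_eq mult_ac)
  moreover have "0 \<le> diameter T / (4 * \<sigma>)" using diameter_pos[OF T] sigma_pos by simp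
  ultimately have "unit_ball_vol (real DIM('a)) * (diameter T / (4 * \<sigma>)) ^ DIM('a) \<le> measure lborel (ball z r)"
    using zr(1) by (simp add: measure_ball_eq power_mono)
  also have "\<dots> \<le> measure lborel (interior T)"
  proof (rule measure_mono_fmeasurable)
    show "ball z r \<subseteq> interior T" using zr(2) ball_subset_cball by (intro interior_maximal) (auto intro: subset_trans)
    show "interior T \<in> fmeasurable lborel"
      using bounded_subset[OF element_bounded[OF T] interior_subset]
      by (intro fmeasurableI emeasure_bounded_finite) (auto simp: borel_open)
  qed auto
  finally show ?thesis .
qed

text \<open>The elements at a node contain disjoint balls, all scaled into one ball around the node.\<close>

lemma valence_le:
  assumes i: "i < N"
  shows "real (card {T \<in> \<T>. x i \<in> T}) \<le> (4 * \<sigma>) ^ DIM('a)"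
proof (cases "{T \<in> \<T>. x i \<in> T} = {}")
  case True
  show ?thesis unfolding True using sigma_pos by simp
next
  case False
  define S where "S = {T \<in> \<T>. x i \<in> T}"
  have S: "finite S" "S \<noteq> {}" using finite_elements False by (auto simp: S_def)
  define r where "r = Min (diameter ` S)"
  have r: "0 < r" "\<And>T. T \<in> S \<Longrightarrow> r \<le> diameter T"
    using S diameter_pos by (auto simp: r_def S_def)
  have "\<forall>T\<in>S. \<exists>z s. 0 < s \<and> cball z s \<subseteq> T \<and> inscribed_diameter T \<le> 4 * s"
    using inscribed_ball unfolding S_def by (metis (no_types, lifting) mem_Collect_eq)
  then obtain z s where zs: "\<And>T. T \<in> S \<Longrightarrow> 0 < s T \<and> cball (z T) (s T) \<subseteq> T \<and> inscribed_diameter T \<le> 4 * s T" by metis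
  \<comment> \<open>Each element is shrunk towards the node until its diameter is the common
    smallest value r; convexity keeps the image in the element.\<close>
  define k where "k T = r / diameter T" for T :: "'a set"
  have k: "0 < k T" "k T \<le> 1" if "T \<in> S" for T
    using r that diameter_pos[of T] by (auto simp: k_def S_def)
  define b where "b T = ball (x i + k T *\<^sub>R (z T - x i)) (k T * s T)" for T
  have b_sub: "b T \<subseteq> T \<inter> cball (x i) r" if T: "T \<in> S" for T
  proof
    fix p assume "p \<in> b T"
    then have pd: "dist (x i + k T *\<^sub>R (z T - x i)) p < k T * s T" by (simp add: b_def)
    have T': "T \<in> \<T>" "x i \<in> T" using T by (auto simp: S_def)
    define q where "q = x i + (1 / k T) *\<^sub>R (p - x i)"
    have pq: "p = x i + k T *\<^sub>R (q - x i)" using k[OF T] by (simp add: q_def)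
    have "x i + k T *\<^sub>R (z T - x i) - p = k T *\<^sub>R (z T - q)" unfolding pq by (simp add: algebra_simps)
    then have "k T * dist (z T) q < k T * s T" using pd k[OF T] by (simp add: dist_norm)
    then have "dist (z T) q < s T" using k[OF T] by simp
    then have qT: "q \<in> T" using zs[OF T] by auto
    have "p = (1 - k T) *\<^sub>R x i + k T *\<^sub>R q" unfolding pq by (simp add: algebra_simps)
    then have "p \<in> T" using convexD[OF element_convex[OF T'(1)] T'(2) qT, of "1 - k T" "k T"] k[OF T] by simp
    moreover have "dist (x i) p = k T * dist (x i) q" unfolding pq using k[OF T] by (simp add: dist_norm norm_minus_commute)
    moreover have "k T * dist (x i) q \<le> k T * diameter T"
      using element_dist[OF T'(1,2) qT] k[OF T] by (intro mult_left_mono) auto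
    moreover have "k T * diameter T = r" using diameter_pos[OF T'(1)] by (simp add: k_def)
    ultimately show "p \<in> T \<inter> cball (x i) r" by simp
  qed
  have b_int: "b T \<subseteq> interior T" if "T \<in> S" for T
    using b_sub[OF that] by (intro interior_maximal) (auto simp: b_def)
  have b_m: "unit_ball_vol (real DIM('a)) * (r / (4 * \<sigma>)) ^ DIM('a) \<le> measure lborel (b T)" if T: "T \<in> S" for T
  proof -
    have T': "T \<in> \<T>" using T by (simp add: S_def)
    have "diameter T \<le> \<sigma> * (4 * s T)"
      using regular[OF T'] mult_left_mono[of "inscribed_diameter T" "4 * s T" \<sigma>] zs[OF T] sigma_pos by linarith
    then have "k T * diameter T \<le> k T * (\<sigma> * (4 * s T))" using k[OF T] by (intro mult_left_mono) auto
    moreover have "k T * diameter T = r" using diameter_pos[OF T'] by (simp add: k_def)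
    ultimately have "r / (4 * \<sigma>) \<le> k T * s T" using sigma_pos by (simp add: divide_le_eq mult_ac)
    then show ?thesis using r(1) sigma_pos k[OF T] zs[OF T]
      by (simp add: b_def measure_ball_eq power_mono)
  qed
  have "real (card S) * (unit_ball_vol (real DIM('a)) * (r / (4 * \<sigma>)) ^ DIM('a)) \<le> (\<Sum>T\<in>S. measure lborel (b T))"
    using sum_mono[of S "\<lambda>T. unit_ball_vol (real DIM('a)) * (r / (4 * \<sigma>)) ^ DIM('a)" "\<lambda>T. measure lborel (b T)"] b_m by simp
  also have "\<dots> \<le> measure lborel (cball (x i) r)"
  proof (rule sum_measure_le[OF S(1)])
    show "b T \<subseteq> cball (x i) r" if "T \<in> S" for T using b_sub[OF that] by blast
    show "b T \<inter> b T' = {}" if "T \<in> S" "T' \<in> S" "T \<noteq> T'" for T T'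
      using b_int[OF that(1)] b_int[OF that(2)] element_interiors_disjoint that by (fastforce simp: S_def)
  qed (auto simp: b_def)
  also have "\<dots> = unit_ball_vol (real DIM('a)) * r ^ DIM('a)" using r(1) by (simp add: content_cball)
  finally have "real (card S) * (r / (4 * \<sigma>)) ^ DIM('a) \<le> r ^ DIM('a)"
    by (simp add: mult.left_commute)
  then have "real (card S) \<le> (4 * \<sigma>) ^ DIM('a)"
    using r(1) sigma_pos by (simp add: power_divide divide_le_eq mult.commute)
  then show ?thesis by (simp add: S_def)
qed

text \<open>By the inverse estimate the gradient on T is at most 2 \<sigma> / diameter T times the
  norm of the vertex values, and T has volume O(diameter^d). The net exponent d - 2 is nonnegative,
  so H may replace the diameter; bounded valence sums the vertex values.\<close>

lemma energy_le:
  assumes dim: "2 \<le> DIM('a)"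
  shows "sq_int (DY c) \<le> 4 * \<sigma>\<^sup>2 * unit_ball_vol (real DIM('a)) * (4 * \<sigma>) ^ DIM('a) * H ^ (DIM('a) - 2) * (\<Sum>i<N. (c i)\<^sup>2)"
proof -
  define d where "d = DIM('a)"
  have d: "d = Suc (Suc (d - 2))" using dim by (simp add: d_def)
  define \<omega> where "\<omega> = unit_ball_vol (real d)"
  have \<omega>: "0 \<le> \<omega>" by (simp add: \<omega>_def)
  define s where "s T = (\<Sum>i\<in>V T. (c i)\<^sup>2)" for T
  have s0: "0 \<le> s T" for T by (simp add: s_def sum_nonneg)
  define a where "a T = 4 * \<sigma>\<^sup>2 / (diameter T)\<^sup>2 * s T" for T
  have pt: "(norm (DY c p))\<^sup>2 \<le> a T" if T: "T \<in> \<T>" "p \<in> interior T" for T p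
  proof -
    have "\<bar>c i - c j - inner 0 (x i - x j)\<bar> \<le> 2 * sqrt (s T)" if ij: "i \<in> V T" "j \<in> V T" for i j
    proof -
      have "\<bar>c i\<bar> \<le> sqrt (s T)" if "i \<in> V T" for i
        unfolding s_def using finite_V that by (intro real_le_rsqrt) (auto intro!: member_le_sum)
      from this[OF ij(1)] this[OF ij(2)] show ?thesis by simp
    qed
    then have "norm (DY c p - 0) * inscribed_diameter T \<le> 2 * sqrt (s T)"
      using s0 by (intro DY_bound[OF T]) auto
    then have "norm (DY c p) * (\<sigma> * inscribed_diameter T) \<le> \<sigma> * (2 * sqrt (s T))"
      using sigma_pos by (simp add: mult.left_commute)
    moreover have "norm (DY c p) * diameter T \<le> norm (DY c p) * (\<sigma> * inscribed_diameter T)"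
      using regular[OF T(1)] by (intro mult_left_mono) auto
    ultimately have "norm (DY c p) * diameter T \<le> \<sigma> * (2 * sqrt (s T))" by simp
    then have "(norm (DY c p) * diameter T)\<^sup>2 \<le> (\<sigma> * (2 * sqrt (s T)))\<^sup>2"
      using diameter_pos[OF T(1)] by (intro power_mono) auto
    then show ?thesis using diameter_pos[OF T(1)] s0
      by (simp add: a_def power_mult_distrib le_divide_eq mult_ac)
  qed
  have a0: "0 \<le> a T" for T using s0 by (simp add: a_def)
  have "sq_int (DY c) \<le> (\<integral>p. (\<Sum>T\<in>\<T>. a T * indicator (interior T) p) \<partial>lborel)"
    unfolding sq_int_def
  proof (rule integral_mono_AE)
    show "integrable lborel (\<lambda>p. (norm (DY c p))\<^sup>2)" by (intro bbs_integrable bbs_norm2 bbs_DY)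
    show "integrable lborel (\<lambda>p. \<Sum>T\<in>\<T>. a T * indicator (interior T) p)"
      using bounded_subset[OF element_bounded interior_subset]
      by (intro bbs_integrable bbs_sum bbs_cmult_real bbs_indicator_set) (auto simp: borel_open)
    show "AE p in lborel. (norm (DY c p))\<^sup>2 \<le> (\<Sum>T\<in>\<T>. a T * indicator (interior T) p)"
      using thin_AE[OF skel_thin]
    proof eventually_elim
      case (elim p)
      show ?case
      proof (cases "p \<in> \<Omega>")
        case True
        then obtain T where T: "T \<in> \<T>" "p \<in> interior T" using off_skel elim closure_subset by blast
        have "(norm (DY c p))\<^sup>2 \<le> a T * indicator (interior T) p" using pt[OF T] T(2) by simp
        also have "\<dots> \<le> (\<Sum>T\<in>\<T>. a T * indicator (interior T) p)" using T(1) finite_elements a0 by (intro member_le_sum) auto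
        finally show ?thesis .
      qed (simp add: DY_outside sum_nonneg a0)
    qed
  qed
  also have "\<dots> = (\<Sum>T\<in>\<T>. a T * measure lborel (interior T))"
    using bbs_integrable[OF bbs_indicator_set[OF borel_open[OF open_interior] bounded_subset[OF element_bounded interior_subset]]]
    by (subst Bochner_Integration.integral_sum) auto
  also have "\<dots> \<le> (\<Sum>T\<in>\<T>. 4 * \<sigma>\<^sup>2 * \<omega> * H ^ (d - 2) * s T)"
  proof (rule sum_mono)
    fix T assume T: "T \<in> \<T>"
    obtain p where p: "p \<in> T" using element_interior_nonempty[OF T] interior_subset by blast
    have dT: "0 < diameter T" by (rule diameter_pos[OF T])
    have "measure lborel (interior T) \<le> measure lborel (cball p (diameter T))"
    proof (rule measure_mono_fmeasurable)
      show "interior T \<subseteq> cball p (diameter T)" using element_dist[OF T p] interior_subset by fastforce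
      show "cball p (diameter T) \<in> fmeasurable lborel" by (intro fmeasurableI emeasure_bounded_finite) auto
    qed (simp add: borel_open)
    also have "\<dots> = \<omega> * diameter T ^ d" using dT by (simp add: content_cball \<omega>_def d_def)
    finally have "a T * measure lborel (interior T) \<le> a T * (\<omega> * diameter T ^ d)" using a0 by (intro mult_left_mono)
    also have "\<dots> = 4 * \<sigma>\<^sup>2 * \<omega> * s T * diameter T ^ (d - 2)"
    proof -
      have "diameter T ^ d = (diameter T)\<^sup>2 * diameter T ^ (d - 2)"
        using d by (metis power_add add_2_eq_Suc)
      then show ?thesis using dT by (simp add: a_def)
    qed
    also have "\<dots> \<le> 4 * \<sigma>\<^sup>2 * \<omega> * s T * H ^ (d - 2)"
      using \<omega> s0 mesh[OF T] dT by (intro mult_left_mono power_mono) auto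
    finally show "a T * measure lborel (interior T) \<le> 4 * \<sigma>\<^sup>2 * \<omega> * H ^ (d - 2) * s T" by (simp add: mult_ac)
  qed
  also have "\<dots> = 4 * \<sigma>\<^sup>2 * \<omega> * H ^ (d - 2) * (\<Sum>T\<in>\<T>. s T)" by (simp add: sum_distrib_left)
  also have "\<dots> \<le> 4 * \<sigma>\<^sup>2 * \<omega> * H ^ (d - 2) * ((4 * \<sigma>) ^ d * (\<Sum>i<N. (c i)\<^sup>2))"
  proof (rule mult_left_mono)
    have "(\<Sum>T\<in>\<T>. s T) = (\<Sum>T\<in>\<T>. \<Sum>i<N. if x i \<in> T then (c i)\<^sup>2 else 0)"
    proof (rule sum.cong[OF refl])
      fix T
      have "V T = {i \<in> {..<N}. x i \<in> T}" by (auto simp: V_def)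
      then show "s T = (\<Sum>i<N. if x i \<in> T then (c i)\<^sup>2 else 0)" unfolding s_def by (simp only: sum.inter_filter[OF finite_lessThan])
    qed
    also have "\<dots> = (\<Sum>i<N. \<Sum>T\<in>\<T>. if x i \<in> T then (c i)\<^sup>2 else 0)" by (rule sum.swap)
    also have "\<dots> = (\<Sum>i<N. real (card {T \<in> \<T>. x i \<in> T}) * (c i)\<^sup>2)"
      using finite_elements by (simp add: sum.inter_filter[symmetric])
    also have "\<dots> \<le> (\<Sum>i<N. (4 * \<sigma>) ^ d * (c i)\<^sup>2)"
      using valence_le by (intro sum_mono mult_right_mono) (auto simp: d_def)
    finally show "(\<Sum>T\<in>\<T>. s T) \<le> (4 * \<sigma>) ^ d * (\<Sum>i<N. (c i)\<^sup>2)" by (simp add: sum_distrib_left)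
  qed (use \<omega> mesh_pos in auto)
  finally show ?thesis by (simp add: \<omega>_def d_def mult_ac)
qed

end

end

section \<open>Stability of the discrete harmonic extension\<close>

text \<open>Fubini over position and shift: a bound for each shift becomes one for the integral over
  shifts, the form in which \<open>ball_average_diff\<close> delivers the error.\<close>

lemma bbs_component_integral:
  fixes K :: "'a::euclidean_space \<Rightarrow> 'a"
  assumes K: "bbs K" and r: "0 < r" and S: "\<And>w. norm w \<le> r \<Longrightarrow> sq_int (\<lambda>p. K (p + w) - K p) \<le> S"
  shows "(\<integral>p. (\<integral>w. indicator (cball 0 r) w * (norm (K (p + w) - K p))\<^sup>2 \<partial>lborel) \<partial>lborel) \<le> measure lborel (cball (0::'a) r) * S"
    and "integrable lborel (\<lambda>p. \<integral>w. indicator (cball 0 r) w * (norm (K (p + w) - K p))\<^sup>2 \<partial>lborel)"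
proof -
  obtain B R where BR: "K \<in> borel_measurable borel" "0 \<le> B" "\<And>x. norm (K x) \<le> B" "0 \<le> R" "\<And>x. K x \<noteq> 0 \<Longrightarrow> norm x \<le> R"
    by (rule bbsE[OF K]) (rule that)
  let ?f = "\<lambda>(p::'a, w::'a). indicator (cball 0 r) w * (norm (K (p + w) - K p))\<^sup>2 :: real"
  have "bbs ?f"
  proof (rule bbsI)
    have m: "(\<lambda>z::'a \<times> 'a. K (fst z + snd z)) \<in> borel_measurable borel" "(\<lambda>z::'a \<times> 'a. K (fst z)) \<in> borel_measurable borel"
      by (intro measurable_compose[OF _ BR(1)] borel_measurable_continuous_onI continuous_intros)+
    have "(snd :: 'a \<times> 'a \<Rightarrow> 'a) \<in> borel_measurable borel" by (intro borel_measurable_continuous_onI continuous_intros)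
    from measurable_compose[OF this borel_measurable_indicator[OF borel_closed[OF closed_cball]]]
    have i: "(\<lambda>z::'a \<times> 'a. indicator (cball 0 r) (snd z) :: real) \<in> borel_measurable borel" .
    show "?f \<in> borel_measurable borel" unfolding case_prod_unfold using m i by simp
    show "norm (?f z) \<le> (2 * B)\<^sup>2" for z
    proof -
      have "norm (K (fst z + snd z) - K (fst z)) \<le> 2 * B"
        using norm_triangle_ineq4[of "K (fst z + snd z)" "K (fst z)"] BR(3)[of "fst z + snd z"] BR(3)[of "fst z"] by linarith
      then have "(norm (K (fst z + snd z) - K (fst z)))\<^sup>2 \<le> (2 * B)\<^sup>2" by (intro power_mono) auto
      then show ?thesis by (auto simp: case_prod_unfold split: split_indicator)
    qed
    show "norm z \<le> (R + r) + r" if nz: "?f z \<noteq> 0" for z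
    proof -
      obtain p w where z: "z = (p, w)" by (cases z)
      have w: "norm w \<le> r" and "K (p + w) \<noteq> 0 \<or> K p \<noteq> 0" using nz by (auto simp: z split: split_indicator_asm)
      then have "norm (p + w) \<le> R \<or> norm p \<le> R" using BR(5) by blast
      then have "norm p \<le> R + r" using w r norm_triangle_ineq4[of "p + w" w] by auto
      then show ?thesis using norm_Pair_le[of p w] w by (simp add: z)
    qed
  qed
  then have int: "integrable (lborel \<Otimes>\<^sub>M lborel) ?f" using bbs_integrable by (simp add: lborel_prod)
  show "integrable lborel (\<lambda>p. \<integral>w. indicator (cball 0 r) w * (norm (K (p + w) - K p))\<^sup>2 \<partial>lborel)"
    using lborel_pair.integrable_fst'[OF int] by simp
  have "(\<integral>p. (\<integral>w. indicator (cball 0 r) w * (norm (K (p + w) - K p))\<^sup>2 \<partial>lborel) \<partial>lborel)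
      = (\<integral>w. (\<integral>p. indicator (cball 0 r) w * (norm (K (p + w) - K p))\<^sup>2 \<partial>lborel) \<partial>lborel)"
    using lborel_pair.Fubini_integral[OF int] by simp
  also have "\<dots> \<le> (\<integral>w. S * indicator (cball (0::'a) r) w \<partial>lborel)"
  proof (rule Bochner_Integration.integral_mono)
    show "integrable lborel (\<lambda>w. \<integral>p. indicator (cball 0 r) w * (norm (K (p + w) - K p))\<^sup>2 \<partial>lborel)"
      using lborel_pair.integrable_snd[OF int] by simp
    show "integrable lborel (\<lambda>w. S * indicator (cball (0::'a) r) w)"
      by (intro bbs_integrable bbs_cmult_real bbs_indicator_set) auto
    show "(\<integral>p. indicator (cball 0 r) w * (norm (K (p + w) - K p))\<^sup>2 \<partial>lborel) \<le> S * indicator (cball (0::'a) r) w" for w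
      using S[of w] by (auto simp: sq_int_def split: split_indicator)
  qed
  also have "\<dots> = measure lborel (cball (0::'a) r) * S" by simp
  finally show "(\<integral>p. (\<integral>w. indicator (cball 0 r) w * (norm (K (p + w) - K p))\<^sup>2 \<partial>lborel) \<partial>lborel) \<le> measure lborel (cball (0::'a) r) * S" .
qed

lemma continuous_frontier_integrable:
  fixes f :: "'a::euclidean_space \<Rightarrow> real"
  assumes K: "compact K" and fin: "emeasure (hausdorff_measure s) K < \<infinity>" and f: "continuous_on K f"
  shows "integrable (hausdorff_measure s) (\<lambda>p. indicator K p *\<^sub>R f p)"
proof -
  have "bounded (f ` K)" using K f by (intro compact_imp_bounded compact_continuous_image)
  then obtain B where B: "\<And>p. p \<in> K \<Longrightarrow> norm (f p) \<le> B" unfolding bounded_iff by auto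
  have Kb: "K \<in> sets borel" using K by (simp add: borel_closed compact_imp_closed)
  have m: "(\<lambda>p. indicator K p *\<^sub>R f p) \<in> borel_measurable borel"
    using f Kb by (intro borel_measurable_continuous_on_indicator) auto
  show ?thesis
  proof (rule integrableI_bounded_set[where A=K and B=B])
    show "(\<lambda>p. indicator K p *\<^sub>R f p) \<in> borel_measurable (hausdorff_measure s)"
      using m measurable_cong_sets[OF sets_hausdorff_measure refl] by blast
  qed (use Kb fin B in \<open>auto intro!: AE_I2\<close>)
qed

lemma integral_ge_on_subset:
  fixes f :: "'a \<Rightarrow> real"
  assumes int: "integrable M f" and nonneg: "\<And>p. 0 \<le> f p" and A: "A \<in> sets M" "emeasure M A < \<infinity>"
    and ge: "\<And>p. p \<in> A \<Longrightarrow> b \<le> f p"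
  shows "b * measure M A \<le> (\<integral>p. f p \<partial>M)"
proof -
  have "integrable M (\<lambda>p. b * indicator A p)" using A by auto
  then have "(\<integral>p. b * indicator A p \<partial>M) \<le> (\<integral>p. f p \<partial>M)"
    by (rule Bochner_Integration.integral_mono[OF _ int]) (use nonneg ge in \<open>auto split: split_indicator\<close>)
  then show ?thesis using A by simp
qed

text \<open>Each of the three terms is of order sqrt F, so one factor F cancels after
  squaring.\<close>

lemma three_term_bound:
  fixes F :: real
  assumes F: "0 \<le> F" "F \<le> a + b + c" and a: "a\<^sup>2 \<le> F * a'" and b: "b\<^sup>2 \<le> F * b'" and c: "c\<^sup>2 \<le> F * c'"
    and nn: "0 \<le> a'" "0 \<le> b'" "0 \<le> c'"
  shows "F \<le> 3 * (a' + b' + c')"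
proof (cases "F = 0")
  case False
  have "F\<^sup>2 \<le> (a + b + c)\<^sup>2" using F by (intro power_mono) auto
  also have "\<dots> \<le> 3 * (a\<^sup>2 + b\<^sup>2 + c\<^sup>2)"
    using sum_squares_ge_zero[of "a - b" "b - c"] zero_le_square[of "a - c"]
    by (simp add: power2_eq_square algebra_simps)
  also have "\<dots> \<le> 3 * (F * a' + F * b' + F * c')" using a b c by simp
  finally have "F * F \<le> F * (3 * (a' + b' + c'))" by (simp add: power2_eq_square algebra_simps)
  then show ?thesis using F(1) False by simp
qed (use nn in simp)

section \<open>Bounds for discrete functions: mass, quasi-interpolation and duality\<close>

context fem
begin

lemma Y_square_le:
  assumes "T \<in> \<T>" "p \<in> T" shows "(Y c p)\<^sup>2 \<le> (\<Sum>i\<in>V T. (c i)\<^sup>2)"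
proof -
  have b: "0 \<le> e i p" "e i p \<le> 1" if "i \<in> V T" for i
    using barycentric(1)[OF assms] basis_le_1[of p i] element_subset[OF assms(1)] assms(2) that by (auto simp: V_def)
  \<comment> \<open>The variance of the vertex values under the barycentric weights, so again
    Jensen's inequality.\<close>
  have "0 \<le> (\<Sum>i\<in>V T. e i p * (c i - Y c p)\<^sup>2)" using b by (intro sum_nonneg) auto
  also have "\<dots> = (\<Sum>i\<in>V T. e i p * (c i)\<^sup>2 - 2 * Y c p * (c i * e i p) + (Y c p)\<^sup>2 * e i p)"
    by (intro sum.cong) (auto simp: power2_diff algebra_simps)
  also have "\<dots> = (\<Sum>i\<in>V T. e i p * (c i)\<^sup>2) - 2 * Y c p * (\<Sum>i\<in>V T. c i * e i p) + (Y c p)\<^sup>2 * (\<Sum>i\<in>V T. e i p)"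
    by (simp add: sum.distrib sum_subtractf sum_distrib_left)
  also have "\<dots> = (\<Sum>i\<in>V T. e i p * (c i)\<^sup>2) - (Y c p)\<^sup>2"
    using Y_element[OF assms] barycentric(2)[OF assms] by (simp add: power2_eq_square)
  finally have "(Y c p)\<^sup>2 \<le> (\<Sum>i\<in>V T. e i p * (c i)\<^sup>2)" by simp
  also have "\<dots> \<le> (\<Sum>i\<in>V T. (c i)\<^sup>2)" using b by (intro sum_mono) (auto intro: mult_left_le_one_le)
  finally show ?thesis .
qed

lemma u_eq: "p \<in> \<Omega> \<Longrightarrow> u c p = Y c p" "p \<notin> \<Omega> \<Longrightarrow> u c p = 0"
  by (simp_all add: u_def)

lemma element_of_dom: "p \<in> \<Omega> \<Longrightarrow> \<exists>T\<in>\<T>. p \<in> T"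
  using element_of closure_subset by blast

definition bdry :: "(nat \<Rightarrow> real) \<Rightarrow> nat \<Rightarrow> real" where
  "bdry c j = (if x j \<in> frontier \<Omega> then c j else 0)"

definition discrete_harmonic :: "(nat \<Rightarrow> real) \<Rightarrow> bool" where
  "discrete_harmonic c \<longleftrightarrow> (\<forall>w. (\<forall>j<N. x j \<in> frontier \<Omega> \<longrightarrow> w j = 0) \<longrightarrow> (\<integral>p. inner (DY c p) (DY w p) \<partial>lborel) = 0)"

text \<open>Zero energy forces zero L2 norm by Poincare's inequality, whereas a nonzero nodal value
  would persist on a ball by continuity. This makes the interior block of the stiffness matrix
  injective.\<close>

lemma DY_eq_0_imp:
  assumes c: "\<And>j. j < N \<Longrightarrow> x j \<in> frontier \<Omega> \<Longrightarrow> c j = 0" and 0: "sq_int (DY c) = 0" and i: "i < N" "x i \<in> \<Omega>"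
  shows "c i = 0"
proof (rule ccontr)
  assume ne: "c i \<noteq> 0"
  obtain P where P: "0 < P" "\<And>\<phi> G. test_fn \<Omega> \<phi> G \<Longrightarrow> sq_int \<phi> \<le> P * sq_int G"
    using poincare[OF bounded_dom] by blast
  have tf: "test_fn \<Omega> (u c) (DY c)" by (rule u_test_fn) (rule c)
  have z: "sq_int (u c) = 0" using P(2)[OF tf] 0 sq_int_nonneg[of "u c"] by simp
  have cont: "continuous_on UNIV (u c)" using tf by (simp add: test_fn_def pw_grad_def)
  have ui: "u c (x i) = c i" using Y_node[OF i(1)] i(2) by (simp add: u_def)
  have "((\<lambda>p. (u c p)\<^sup>2) \<longlongrightarrow> (u c (x i))\<^sup>2) (at (x i))"
    using cont by (intro tendsto_power) (simp add: continuous_on_eq_continuous_at isCont_def)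
  then have "\<forall>\<^sub>F p in at (x i). (c i)\<^sup>2 / 2 < (u c p)\<^sup>2"
    by (rule order_tendstoD) (use ne ui in simp)
  then obtain r where r: "0 < r" "\<And>p. p \<noteq> x i \<Longrightarrow> dist p (x i) < r \<Longrightarrow> (c i)\<^sup>2 / 2 < (u c p)\<^sup>2"
    unfolding eventually_at by blast
  have ge: "(c i)\<^sup>2 / 2 \<le> (u c p)\<^sup>2" if "p \<in> ball (x i) r" for p
    using r(2)[of p] that ui by (cases "p = x i") (auto simp: dist_commute intro: less_imp_le)
  have "(c i)\<^sup>2 / 2 * measure lborel (ball (x i) r) \<le> (\<integral>p. (u c p)\<^sup>2 \<partial>lborel)"
  proof (rule integral_ge_on_subset)
    show "integrable lborel (\<lambda>p. (u c p)\<^sup>2)" by (intro bbs_integrable bbs_power2 bbs_u)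
    show "emeasure lborel (ball (x i) r) < \<infinity>" by (rule emeasure_bounded_finite) simp
  qed (use ge in auto)
  also have "\<dots> = 0" using z by (simp add: sq_int_def)
  finally show False using ne content_ball_pos[OF r(1), of "x i"] by (simp add: mult_le_0_iff del: content_ball_gt_0_iff)
qed

lemma DY_eq_0_on_element:
  assumes "p \<in> interior T" "T \<in> \<T>" "\<And>i. i \<in> V T \<Longrightarrow> c i = 0"
  shows "DY c p = 0"
proof -
  have "norm (DY c p - 0) * inscribed_diameter T \<le> 0"
    using assms(3) by (intro DY_bound[OF assms(2,1)]) auto
  then show ?thesis using inscribed_pos[OF assms(2)] by (simp add: mult_le_0_iff)
qed

context
  fixes \<sigma> H :: real
  assumes regular: "\<And>T. T \<in> \<T> \<Longrightarrow> diameter T \<le> \<sigma> * inscribed_diameter T"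
    and mesh: "\<And>T. T \<in> \<T> \<Longrightarrow> diameter T \<le> H"
begin

text \<open>At each point only nodes within distance H contribute, so the square is dominated by a
  weighted sum of indicators of balls of radius H around the nodes.\<close>

lemma mass_le: "sq_int (u c) \<le> unit_ball_vol (real DIM('a)) * H ^ DIM('a) * (\<Sum>i<N. (c i)\<^sup>2)"
proof -
  have H: "0 < H" by (rule mesh_pos[OF regular mesh])
  have bi: "bbs (indicator (cball (x i) H) :: 'a \<Rightarrow> real)" for i by (rule bbs_indicator_set) auto
  have "sq_int (u c) \<le> (\<integral>p. (\<Sum>i<N. (c i)\<^sup>2 * indicator (cball (x i) H) p) \<partial>lborel)"
    unfolding sq_int_def
  proof (rule bbs_integral_mono)
    show "bbs (\<lambda>p. (norm (u c p))\<^sup>2)" by (intro bbs_norm2 bbs_u)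
    show "bbs (\<lambda>p. \<Sum>i<N. (c i)\<^sup>2 * indicator (cball (x i) H) p)" by (intro bbs_sum bbs_cmult_real bi)
    fix p
    show "(norm (u c p))\<^sup>2 \<le> (\<Sum>i<N. (c i)\<^sup>2 * indicator (cball (x i) H) p)"
    proof (cases "p \<in> \<Omega>")
      case True
      obtain T where T: "T \<in> \<T>" "p \<in> T" using element_of_dom[OF True] by blast
      have "(norm (u c p))\<^sup>2 \<le> (\<Sum>i\<in>V T. (c i)\<^sup>2)" using Y_square_le[OF T] True by (simp add: u_eq)
      also have "\<dots> = (\<Sum>i\<in>V T. (c i)\<^sup>2 * indicator (cball (x i) H) p)"
      proof (rule sum.cong[OF refl])
        fix i assume "i \<in> V T"
        then have "dist (x i) p \<le> H" using element_dist[OF T(1) _ T(2), of "x i"] mesh[OF T(1)] by (auto simp: V_def)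
        then show "(c i)\<^sup>2 = (c i)\<^sup>2 * indicator (cball (x i) H) p" by simp
      qed
      also have "\<dots> \<le> (\<Sum>i<N. (c i)\<^sup>2 * indicator (cball (x i) H) p)" using V_subset by (intro sum_mono2) auto
      finally show ?thesis .
    next
      case False
      then show ?thesis by (simp add: u_eq sum_nonneg)
    qed
  qed
  also have "\<dots> = (\<Sum>i<N. (c i)\<^sup>2 * measure lborel (cball (x i) H))"
    using bbs_integrable[OF bi] by (subst Bochner_Integration.integral_sum) auto
  also have "\<dots> = unit_ball_vol (real DIM('a)) * H ^ DIM('a) * (\<Sum>i<N. (c i)\<^sup>2)"
    using H by (simp add: content_cball sum_distrib_left mult_ac)
  finally show ?thesis .
qed

text \<open>The sum of the boundary basis functions lies between 0 and 1 and vanishes on elements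
  without a boundary node.\<close>

lemma mass_boundary_le: "sq_int (u (bdry (\<lambda>j. 1))) \<le> measure lborel (\<Omega> \<inter> tubular (frontier \<Omega>) H)"
proof -
  define A where "A = \<Omega> \<inter> tubular (frontier \<Omega>) H"
  have A: "A \<in> sets borel" "bounded A"
    using open_dom closed_tubular[OF compact_frontier_bounded[OF bounded_dom]] bounded_dom
    by (auto simp: A_def borel_open borel_closed)
  have "sq_int (u (bdry (\<lambda>j. 1))) \<le> (\<integral>p. indicator A p \<partial>lborel)"
    unfolding sq_int_def
  proof (rule bbs_integral_mono)
    show "bbs (\<lambda>p. (norm (u (bdry (\<lambda>j. 1)) p))\<^sup>2)" by (intro bbs_norm2 bbs_u)
    show "bbs (indicator A :: 'a \<Rightarrow> real)" using A by (rule bbs_indicator_set)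
    fix p
    show "(norm (u (bdry (\<lambda>j. 1)) p))\<^sup>2 \<le> indicator A p"
    proof (cases "u (bdry (\<lambda>j. 1)) p = 0")
      case False
      then have p: "p \<in> \<Omega>" by (rule contrapos_np) (simp add: u_def)
      then have pc: "p \<in> closure \<Omega>" using closure_subset by blast
      obtain T where T: "T \<in> \<T>" "p \<in> T" using element_of_dom[OF p] by blast
      have "(\<Sum>i\<in>V T. bdry (\<lambda>j. 1) i * e i p) \<noteq> 0" using False p Y_element[OF T] by (simp add: u_eq)
      then obtain i where i: "i \<in> V T" "bdry (\<lambda>j. 1) i * e i p \<noteq> 0" by (meson sum.neutral)
      then have xi: "x i \<in> frontier \<Omega>" by (auto simp: bdry_def split: if_splits)
      have "dist p (x i) \<le> H" using element_dist[OF T(1,2), of "x i"] mesh[OF T(1)] i(1) by (auto simp: V_def)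
      then have "p \<in> A" using p xi by (auto simp: A_def tubular_def)
      moreover have "\<bar>Y (bdry (\<lambda>j. 1)) p\<bar> \<le> 1"
      proof -
        have "0 \<le> Y (bdry (\<lambda>j. 1)) p" unfolding Y_def bdry_def using basis_nonneg[OF pc] by (intro sum_nonneg) auto
        moreover have "Y (bdry (\<lambda>j. 1)) p \<le> (\<Sum>j<N. e j p)"
          unfolding Y_def bdry_def using basis_nonneg[OF pc] by (intro sum_mono) auto
        ultimately show ?thesis using basis_sum[OF pc] by simp
      qed
      ultimately show ?thesis using p by (simp add: u_eq abs_square_le_1)
    qed simp
  qed
  then show ?thesis by (simp add: A_def)
qed

text \<open>The basis functions of the vertices of T sum to 1 on T, so the volume of T is a lower
  bound.\<close>

lemma mass_element_ge:
  assumes T: "T \<in> \<T>"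
  shows "unit_ball_vol (real DIM('a)) * (diameter T / (4 * \<sigma>)) ^ DIM('a) \<le> sq_int (u (\<lambda>j. if x j \<in> T then 1 else 0))"
proof -
  let ?c = "\<lambda>j. if x j \<in> T then 1 else 0 :: real"
  have bi: "bbs (indicator (interior T) :: 'a \<Rightarrow> real)"
    using bounded_subset[OF element_bounded[OF T] interior_subset] by (intro bbs_indicator_set) (auto simp: borel_open)
  have "measure lborel (interior T) = (\<integral>p. indicator (interior T) p \<partial>lborel)" by simp
  also have "\<dots> \<le> sq_int (u ?c)"
    unfolding sq_int_def
  proof (rule bbs_integral_mono[OF bi])
    show "bbs (\<lambda>p. (norm (u ?c p))\<^sup>2)" by (intro bbs_norm2 bbs_u)
    fix p
    show "indicator (interior T) p \<le> (norm (u ?c p))\<^sup>2"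
    proof (cases "p \<in> interior T")
      case True
      then have pT: "p \<in> T" "p \<in> \<Omega>" using interior_subset element_interior_subset[OF T] by auto
      have "Y ?c p = (\<Sum>i\<in>V T. e i p)" unfolding Y_element[OF T pT(1)] by (intro sum.cong) (auto simp: V_def)
      then show ?thesis using barycentric(2)[OF T pT(1)] pT(2) by (simp add: u_eq)
    qed simp
  qed
  finally show ?thesis using interior_measure_ge[OF regular mesh T] by simp
qed

text \<open>A Clement-type operator with the global radius H. On T the increments of the averages
  deviate from those of the linear function of K p by at most diameter T times a local root mean
  square of K (p + w) - K p, and \<open>DY_bound\<close> trades the diameter for the inscribed one.
  The factor 2^d is the ratio of the volumes of balls of radii 2 H and H.\<close>

lemma clement:
  assumes t: "test_fn \<Omega> \<psi> K" and S: "\<And>w. norm w \<le> 2 * H \<Longrightarrow> sq_int (\<lambda>p. K (p + w) - K p) \<le> S"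
  shows "sq_int (\<lambda>p. DY (\<lambda>i. ball_average H \<psi> (x i)) p - K p) \<le> \<sigma>\<^sup>2 * 2 ^ DIM('a) * S"
proof -
  have H: "0 < H" by (rule mesh_pos[OF regular mesh])
  have \<sigma>: "0 < \<sigma>" by (rule sigma_pos[OF regular mesh])
  note b = test_fn_bbs[OF t]
  define m where "m i = ball_average H \<psi> (x i)" for i
  define W where "W = measure lborel (cball (0::'a) H)"
  have W: "0 < W" using H by (simp add: W_def measure_cball_pos)
  define I where "I p = (\<integral>w. indicator (cball 0 (2 * H)) w * (norm (K (p + w) - K p))\<^sup>2 \<partial>lborel)" for p
  have I0: "0 \<le> I p" for p unfolding I_def by (intro integral_nonneg_AE AE_I2) auto
  have H2: "0 < 2 * H" using H by simp
  have int: "(\<integral>p. I p \<partial>lborel) \<le> measure lborel (cball (0::'a) (2 * H)) * S" "integrable lborel I"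
    unfolding I_def[abs_def] by (rule bbs_component_integral[OF b(2) H2 S], assumption)+
  have pt: "(norm (DY m p - K p))\<^sup>2 \<le> \<sigma>\<^sup>2 / W * I p" if T: "T \<in> \<T>" "p \<in> interior T" for T p
  proof -
    have pT: "p \<in> T" using T(2) interior_subset by blast
    define k where "k = diameter T * sqrt (I p / W)"
    have k0: "0 \<le> k" using diameter_pos[OF T(1)] I0[of p] W by (simp add: k_def)
    have "\<bar>m i - m j - inner (K p) (x i - x j)\<bar> \<le> k" if ij: "i \<in> V T" "j \<in> V T" for i j
    proof -
      have xij: "x i \<in> T" "x j \<in> T" using ij by (auto simp: V_def)
      have near: "dist p (x j + s *\<^sub>R (x i - x j)) \<le> H" if "0 \<le> s" "s \<le> 1" for s
      proof -
        have "x j + s *\<^sub>R (x i - x j) = (1 - s) *\<^sub>R x j + s *\<^sub>R x i" by (simp add: algebra_simps)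
        then have "x j + s *\<^sub>R (x i - x j) \<in> T"
          using convexD[OF element_convex[OF T(1)] xij(2,1), of "1 - s" s] that by simp
        then show ?thesis using element_dist[OF T(1) pT] mesh[OF T(1)] order_trans by blast
      qed
      have "(m i - m j - inner (K p) (x i - x j))\<^sup>2 \<le> (norm (x i - x j))\<^sup>2 / W * I p"
        unfolding m_def W_def I_def by (rule ball_average_diff[OF test_fn_pw_grad[OF t] b H near])
      also have "\<dots> \<le> (diameter T)\<^sup>2 / W * I p"
        using element_dist[OF T(1) xij] I0[of p] W
        by (intro mult_right_mono divide_right_mono power_mono) (auto simp: dist_norm)
      also have "\<dots> = k\<^sup>2" using I0[of p] W by (simp add: k_def power_mult_distrib)
      finally show ?thesis using power2_le_iff_abs_le[OF k0] by blast
    qed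
    then have "norm (DY m p - K p) * inscribed_diameter T \<le> k" by (rule DY_bound[OF T k0])
    also have "k \<le> (\<sigma> * inscribed_diameter T) * sqrt (I p / W)"
      unfolding k_def using regular[OF T(1)] I0[of p] W by (intro mult_right_mono) auto
    finally have "norm (DY m p - K p) * inscribed_diameter T \<le> (\<sigma> * sqrt (I p / W)) * inscribed_diameter T"
      by (simp add: mult_ac)
    then have "norm (DY m p - K p) \<le> \<sigma> * sqrt (I p / W)" using inscribed_pos[OF T(1)] by simp
    then have "(norm (DY m p - K p))\<^sup>2 \<le> (\<sigma> * sqrt (I p / W))\<^sup>2" by (intro power_mono) auto
    then show ?thesis using I0[of p] W by (simp add: power_mult_distrib)
  qed
  have "sq_int (\<lambda>p. DY m p - K p) \<le> (\<integral>p. \<sigma>\<^sup>2 / W * I p \<partial>lborel)"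
    unfolding sq_int_def
  proof (rule integral_mono_AE)
    show "integrable lborel (\<lambda>p. (norm (DY m p - K p))\<^sup>2)" by (intro bbs_integrable bbs_norm2 bbs_diff bbs_DY b)
    show "integrable lborel (\<lambda>p. \<sigma>\<^sup>2 / W * I p)" using int(2) by simp
    show "AE p in lborel. (norm (DY m p - K p))\<^sup>2 \<le> \<sigma>\<^sup>2 / W * I p"
      using thin_AE[OF skel_thin]
    proof eventually_elim
      case (elim p)
      show ?case
      proof (cases "p \<in> \<Omega>")
        case True
        then obtain T where "T \<in> \<T>" "p \<in> interior T" using off_skel elim closure_subset by blast
        then show ?thesis by (rule pt)
      next
        case False
        then have "DY m p - K p = 0" using t by (simp add: DY_outside test_fn_def)
        then show ?thesis using I0[of p] W by simp
      qed
    qed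
  qed
  also have "\<dots> \<le> \<sigma>\<^sup>2 / W * (measure lborel (cball (0::'a) (2 * H)) * S)"
    using int(1) W by (simp add: mult_left_mono divide_right_mono)
  also have "measure lborel (cball (0::'a) (2 * H)) = 2 ^ DIM('a) * W"
    using H by (simp add: W_def content_cball power_mult_distrib)
  also have "\<sigma>\<^sup>2 / W * (2 ^ DIM('a) * W * S) = \<sigma>\<^sup>2 * 2 ^ DIM('a) * S" using W by simp
  finally show ?thesis unfolding m_def[abs_def] .
qed

text \<open>Duality: test the discrete function against the near-minimizer \<open>\<phi>\<close> with right-hand side
  \<open>u c\<close>. The quasi-interpolant vanishes on every element touching the boundary, so it does not
  see the boundary values.\<close>

lemma discrete_stability:
  assumes C: "0 < C" and dual: "dual_estimate \<Omega> C"
    and harm: "discrete_harmonic c"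
  shows "sq_int (u c) \<le> 3 * ((2 + 2 * C + 2 * \<sigma>\<^sup>2 * 2 ^ DIM('a) * C) * H * sq_int (DY (bdry c)) + sq_int (u (bdry c)))"
proof (cases "sq_int (u c) = 0")
  case True
  then show ?thesis
    using C mesh_pos[OF regular mesh] sq_int_nonneg[of "DY (bdry c)"] sq_int_nonneg[of "u (bdry c)"] by simp
next
  case False
  have H: "0 < H" by (rule mesh_pos[OF regular mesh])
  define F where "F = sq_int (u c)"
  have F: "0 < F" using False sq_int_nonneg[of "u c"] by (simp add: F_def)
  obtain \<phi> G \<psi> K where t\<phi>: "test_fn \<Omega> \<phi> G" and t\<psi>: "test_fn \<Omega> \<psi> K"
    and EL: "\<And>z Z. test_fn \<Omega> z Z \<Longrightarrow> ((\<integral>x. inner (G x) (Z x) \<partial>lborel) - (\<integral>x. u c x * z x \<partial>lborel))\<^sup>2 \<le> 2 * (H * F) * sq_int Z"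
    and van: "\<And>x q. q \<in> frontier \<Omega> \<Longrightarrow> dist x q \<le> 2 * H \<Longrightarrow> \<psi> x = 0"
    and KG: "sq_int (\<lambda>x. K x - G x) \<le> C * (H * F)"
    and tr: "\<And>w. norm w \<le> 2 * H \<Longrightarrow> sq_int (\<lambda>x. K (x + w) - K x) \<le> C * (H * F)"
    using dual[unfolded dual_estimate_def, rule_format, OF bbs_u[of c] H] F unfolding F_def by blast
  define m where "m i = ball_average H \<psi> (x i)" for i
  \<comment> \<open>The interior part of c, whose discrete function is an admissible test
    function.\<close>
  define z where "z = (\<lambda>i. c i - bdry c i)"
  have z0: "z j = 0" if "x j \<in> frontier \<Omega>" for j using that by (simp add: z_def bdry_def)
  have tz: "test_fn \<Omega> (u z) (DY z)" by (rule u_test_fn) (rule z0)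
  \<comment> \<open>The ball of radius H around such a node stays within 2 H of q, where \<psi>
    vanishes.\<close>
  have mz: "m i = 0" if q: "q \<in> frontier \<Omega>" "dist (x i) q \<le> H" for i q
  proof -
    have z: "indicator (cball 0 H) \<zeta> * \<psi> (x i + \<zeta>) = 0" for \<zeta>
    proof (cases "\<zeta> \<in> cball 0 H")
      case True
      have "dist (x i + \<zeta>) q \<le> dist (x i + \<zeta>) (x i) + dist (x i) q" by (rule dist_triangle)
      also have "\<dots> \<le> 2 * H" using True q(2) by (simp add: dist_norm)
      finally show ?thesis using van[OF q(1)] by simp
    qed simp
    have "(\<lambda>\<zeta>. indicator (cball 0 H) \<zeta> * \<psi> (x i + \<zeta>)) = (\<lambda>_. 0)" by (rule ext) (rule z)
    then show ?thesis by (simp only: m_def ball_average_def) simp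
  qed
  have clem: "sq_int (\<lambda>p. DY m p - K p) \<le> \<sigma>\<^sup>2 * 2 ^ DIM('a) * (C * (H * F))"
    unfolding m_def[abs_def] by (rule clement[OF t\<psi> tr])
  define a where "a = sq_int (DY (bdry c))"
  have a0: "0 \<le> a" unfolding a_def by (rule sq_int_nonneg)
  have orth: "(\<integral>p. inner (DY c p) (DY w p) \<partial>lborel) = 0" if "\<And>j. j < N \<Longrightarrow> x j \<in> frontier \<Omega> \<Longrightarrow> w j = 0" for w
    using harm that unfolding discrete_harmonic_def by blast
  have DYz: "DY z p = DY c p - DY (bdry c) p" for p unfolding z_def by (rule DY_diff)
  have uz: "u z p = u c p - u (bdry c) p" for p unfolding u_def z_def Y_diff by (simp add: right_diff_distrib)
  \<comment> \<open>Pythagoras: the gradient of the zero extension is DY c - DY z, and these two are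
    orthogonal by harmonicity.\<close>
  have sz: "sq_int (DY z) \<le> a"
  proof -
    have "a = sq_int (\<lambda>p. DY c p + (-1) *\<^sub>R DY z p)" unfolding a_def DYz by simp
    also have "\<dots> = sq_int (DY c) + 2 * (-1) * (\<integral>p. inner (DY c p) (DY z p) \<partial>lborel) + (-1)\<^sup>2 * sq_int (DY z)"
      by (rule sq_int_expand[OF bbs_DY bbs_DY])
    also have "(\<integral>p. inner (DY c p) (DY z p) \<partial>lborel) = 0" by (rule orth) (rule z0)
    finally show ?thesis using sq_int_nonneg[of "DY c"] by simp
  qed
  \<comment> \<open>On each element either m vanishes at all vertices, since one of them is a
    boundary node and the others are within H of it, or the boundary part of c does. Hence DY z may
    be replaced by DY c, and harmonicity applies because m vanishes at the boundary nodes.\<close>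
  have mB: "(\<integral>p. inner (DY m p) (DY z p) \<partial>lborel) = 0"
  proof -
    have "(\<integral>p. inner (DY m p) (DY z p) \<partial>lborel) = (\<integral>p. inner (DY c p) (DY m p) \<partial>lborel)"
    proof (rule integral_cong_AE)
      show "AE p in lborel. inner (DY m p) (DY z p) = inner (DY c p) (DY m p)"
        using thin_AE[OF skel_thin]
      proof eventually_elim
        case (elim p)
        have "inner (DY m p) (DY (bdry c) p) = 0"
        proof (cases "p \<in> \<Omega>")
          case True
          then obtain T where T: "T \<in> \<T>" "p \<in> interior T" using off_skel elim closure_subset by blast
          show ?thesis
          proof (cases "\<exists>j\<in>V T. x j \<in> frontier \<Omega>")
            case True
            then obtain j where j: "j \<in> V T" "x j \<in> frontier \<Omega>" by blast
            have "m i = 0" if "i \<in> V T" for i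
              using element_dist[OF T(1), of "x i" "x j"] mesh[OF T(1)] that j by (intro mz[OF j(2)]) (auto simp: V_def)
            then have "DY m p = 0" by (rule DY_eq_0_on_element[OF T(2,1)])
            then show ?thesis by simp
          next
            case False
            then have "DY (bdry c) p = 0" by (intro DY_eq_0_on_element[OF T(2,1)]) (auto simp: bdry_def)
            then show ?thesis by simp
          qed
        qed (simp add: DY_outside)
        then show ?case unfolding DYz by (simp add: inner_diff_right inner_commute)
      qed
    qed (intro borel_measurable_integrable bbs_integrable bbs_inner bbs_DY)+
    also have "\<dots> = 0"
    proof (rule orth)
      fix j assume "x j \<in> frontier \<Omega>"
      then show "m j = 0" by (rule mz) (use H in simp)
    qed
    finally show ?thesis .
  qed
  let ?E = "\<lambda>p. G p - DY m p"
  have bG: "bbs G" "bbs K" by (rule test_fn_bbs(2)[OF t\<phi>], rule test_fn_bbs(2)[OF t\<psi>])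
  have bE: "bbs ?E" by (intro bbs_diff bG bbs_DY)
  have sE: "sq_int ?E \<le> (2 * C + 2 * \<sigma>\<^sup>2 * 2 ^ DIM('a) * C) * (H * F)"
  proof -
    have "sq_int ?E = sq_int (\<lambda>p. - ((K p - G p) + (DY m p - K p)))" by (simp add: algebra_simps)
    also have "\<dots> = sq_int (\<lambda>p. (K p - G p) + (DY m p - K p))" by (rule sq_int_uminus)
    also have "\<dots> \<le> 2 * sq_int (\<lambda>p. K p - G p) + 2 * sq_int (\<lambda>p. DY m p - K p)"
      by (intro sq_int_add bbs_diff bG bbs_DY)
    also have "\<dots> \<le> 2 * (C * (H * F)) + 2 * (\<sigma>\<^sup>2 * 2 ^ DIM('a) * (C * (H * F)))"
      using KG clem by (intro add_mono mult_left_mono) auto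
    finally show ?thesis by (simp add: algebra_simps)
  qed
  define X where "X = (\<integral>p. inner (G p) (DY z p) \<partial>lborel)"
  have X: "X = (\<integral>p. inner (?E p) (DY z p) \<partial>lborel)"
  proof -
    have "X = (\<integral>p. inner (?E p) (DY z p) + inner (DY m p) (DY z p) \<partial>lborel)" by (simp add: X_def inner_diff_left)
    also have "\<dots> = (\<integral>p. inner (?E p) (DY z p) \<partial>lborel) + (\<integral>p. inner (DY m p) (DY z p) \<partial>lborel)"
      by (intro Bochner_Integration.integral_add bbs_integrable bbs_inner bbs_DY bE)
    finally show ?thesis using mB by simp
  qed
  have X2: "X\<^sup>2 \<le> F * ((2 * C + 2 * \<sigma>\<^sup>2 * 2 ^ DIM('a) * C) * H * a)"
  proof -
    have "X\<^sup>2 \<le> sq_int ?E * sq_int (DY z)" unfolding X by (rule inner_integral_Cauchy_Schwarz[OF bE bbs_DY])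
    also have "\<dots> \<le> ((2 * C + 2 * \<sigma>\<^sup>2 * 2 ^ DIM('a) * C) * (H * F)) * a"
      using sE sz sq_int_nonneg[of ?E] sq_int_nonneg[of "DY z"] by (intro mult_mono) (auto intro: order_trans)
    finally show ?thesis by (simp add: mult_ac)
  qed
  define D where "D = X - (\<integral>p. u c p * u z p \<partial>lborel)"
  have D2: "(- D)\<^sup>2 \<le> F * (2 * H * a)"
  proof -
    have "D\<^sup>2 \<le> 2 * (H * F) * sq_int (DY z)" unfolding D_def X_def by (rule EL[OF tz])
    also have "\<dots> \<le> 2 * (H * F) * a" using sz H F by (intro mult_left_mono) auto
    finally show ?thesis by (simp add: mult_ac)
  qed
  define Q where "Q = (\<integral>p. u c p * u (bdry c) p \<partial>lborel)"
  have Q2: "Q\<^sup>2 \<le> F * sq_int (u (bdry c))"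
    using inner_integral_Cauchy_Schwarz[OF bbs_u[of c] bbs_u[of "bdry c"]] by (simp add: Q_def F_def)
  have "F = (\<integral>p. u c p * u z p + u c p * u (bdry c) p \<partial>lborel)"
    unfolding uz F_def sq_int_def by (simp add: power2_eq_square algebra_simps)
  also have "\<dots> = (\<integral>p. u c p * u z p \<partial>lborel) + Q"
    unfolding Q_def by (intro Bochner_Integration.integral_add bbs_integrable bbs_mult bbs_u)
  \<comment> \<open>Residual of the near-minimizer, interpolation error and mass of the zero
    extension, each of order sqrt F.\<close>
  finally have "F \<le> (- D) + X + Q" by (simp add: D_def)
  then have "F \<le> 3 * (2 * H * a + (2 * C + 2 * \<sigma>\<^sup>2 * 2 ^ DIM('a) * C) * H * a + sq_int (u (bdry c)))"
    using F H C a0 sq_int_nonneg[of "u (bdry c)"] by (intro three_term_bound[OF _ _ D2 X2 Q2]) auto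
  also have "\<dots> = 3 * ((2 + 2 * C + 2 * \<sigma>\<^sup>2 * 2 ^ DIM('a) * C) * H * a + sq_int (u (bdry c)))"
    by (simp add: algebra_simps)
  finally show ?thesis by (simp add: F_def a_def)
qed

end

end

section \<open>The matrices of the discretization\<close>

lemma pick_lessThan: "i < n \<Longrightarrow> pick {..<n} i = i"
proof -
  assume i: "i < n"
  have "{a \<in> {..<n}. a < i} = {..<i}" using i by auto
  then show ?thesis using pick_card_in_set[of i "{..<n}"] i by simp
qed

lemma pick_atLeastLessThan: "i < m \<Longrightarrow> pick {n..<n + m} i = n + i"
proof -
  assume i: "i < m"
  have "{a \<in> {n..<n + m}. a < n + i} = {n..<n + i}" using i by auto
  then show ?thesis using pick_card_in_set[of "n + i" "{n..<n + m}"] i by simp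
qed

text \<open>With X the block matrix and J the columns of the identity, S solves X S = J: the
  boundary rows of X are those of the identity, the interior ones those of K. The hypothesis
  \<open>inj\<close> makes X invertible, so that \<open>inv_mat\<close> is a genuine
  inverse.\<close>

lemma extension_matrix_harmonic:
  fixes K :: "real mat"
  assumes K: "K \<in> carrier_mat (n + m) (n + m)"
    and inj: "\<And>c. c \<in> carrier_vec (n + m) \<Longrightarrow> (\<And>i. i < m \<Longrightarrow> c $ (n + i) = 0) \<Longrightarrow>
      (\<And>i. i < n \<Longrightarrow> (K *\<^sub>v c) $ i = 0) \<Longrightarrow> c = 0\<^sub>v (n + m)"
  defines "S \<equiv> extension_matrix K {..<n} {n..<n + m}"
  shows "S \<in> carrier_mat (n + m) m"
    and "\<And>v i. v \<in> carrier_vec m \<Longrightarrow> i < m \<Longrightarrow> (S *\<^sub>v v) $ (n + i) = v $ i"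
    and "\<And>v i. v \<in> carrier_vec m \<Longrightarrow> i < n \<Longrightarrow> (K *\<^sub>v (S *\<^sub>v v)) $ i = 0"
proof -
  let ?I = "{..<n}" and ?B = "{n..<n + m}"
  let ?E = "1\<^sub>m (n + m) :: real mat"
  have sets: "{i. i < n + m \<and> i < n} = {..<n}" "{i. i < n + m \<and> n \<le> i} = {n..<n + m}"
    "{i. i < n + m \<and> n \<le> i \<and> i < n + m} = {n..<n + m}" "{i. i < n + m} = {..<n + m}" by auto
  have dim: "dim_row K = n + m" "dim_col K = n + m" using K by auto
  define X where "X = four_block_mat (submatrix K ?I ?I) (submatrix K ?I ?B)
     (submatrix (0\<^sub>m (n + m) (n + m)) ?B ?I) (submatrix ?E ?B ?B)"
  define J where "J = submatrix ?E UNIV ?B"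
  have X: "X \<in> carrier_mat (n + m) (n + m)"
    unfolding X_def by (rule carrier_matI) (simp_all add: dim_submatrix dim sets)
  have J: "J \<in> carrier_mat (n + m) m"
    unfolding J_def by (rule carrier_matI) (simp_all add: dim_submatrix sets)
  have S_eq: "S = inv_mat X * J" by (simp add: S_def extension_matrix_def X_def J_def dim Let_def)
  have Xij: "X $$ (i, j) = (if i < n then K $$ (i, j) else if i = j then 1 else 0)"
    if ij: "i < n + m" "j < n + m" for i j
  proof -
    have le: "a - n < m" if "a < n + m" "\<not> a < n" for a using that by linarith
    have pB: "pick ?B (a - n) = a" if "a < n + m" "\<not> a < n" for a
      using pick_atLeastLessThan[OF le[OF that]] that by simp
    show ?thesis
      unfolding X_def using ij le pB
      by (auto simp: dim_submatrix dim sets submatrix_index pick_lessThan)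
  qed
  have Jij: "J $$ (i, j) = (if i = n + j then 1 else 0)" if "i < n + m" "j < m" for i j
    unfolding J_def using that by (simp add: submatrix_index sets pick_UNIV pick_atLeastLessThan)
  have Xv: "(X *\<^sub>v c) $ i = (if i < n then (K *\<^sub>v c) $ i else c $ i)"
    if c: "c \<in> carrier_vec (n + m)" and i: "i < n + m" for c i
  proof -
    have "(X *\<^sub>v c) $ i = (\<Sum>j = 0..<n + m. X $$ (i, j) * c $ j)"
      using X c i by (auto simp: scalar_prod_def intro!: sum.cong)
    also have "\<dots> = (if i < n then (K *\<^sub>v c) $ i else c $ i)"
    proof (cases "i < n")
      case True
      then show ?thesis using K c i by (auto simp: scalar_prod_def Xij intro!: sum.cong)
    next
      case False
      have "(\<Sum>j = 0..<n + m. X $$ (i, j) * c $ j) = (\<Sum>j = 0..<n + m. if i = j then c $ j else 0)"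
        using i False by (intro sum.cong) (auto simp: Xij)
      then show ?thesis using i False by simp
    qed
    finally show ?thesis .
  qed
  have Jv: "(J *\<^sub>v v) $ i = (if i < n then 0 else v $ (i - n))"
    if v: "v \<in> carrier_vec m" and i: "i < n + m" for v i
  proof -
    have "(J *\<^sub>v v) $ i = (\<Sum>j = 0..<m. if j = i - n \<and> n \<le> i then v $ j else 0)"
      using J v i by (auto simp: scalar_prod_def Jij intro!: sum.cong)
    then show ?thesis using i by (cases "i < n") auto
  qed
  have ker: "v = 0\<^sub>v (n + m)" if v: "v \<in> carrier_vec (n + m)" "X *\<^sub>v v = 0\<^sub>v (n + m)" for v
  proof (rule inj[OF v(1)])
    fix i assume "i < m" then show "v $ (n + i) = 0" using Xv[OF v(1), of "n + i"] v(2) by simp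
  next
    fix i assume "i < n" then show "(K *\<^sub>v v) $ i = 0" using Xv[OF v(1), of i] v(2) by simp
  qed
  note inv = inv_mat_props_inj[OF X ker]
  show S: "S \<in> carrier_mat (n + m) m" unfolding S_eq using inv(1) J by auto
  have XS: "X *\<^sub>v (S *\<^sub>v v) = J *\<^sub>v v" if v: "v \<in> carrier_vec m" for v
  proof -
    have "X * S = J" unfolding S_eq using assoc_mult_mat[OF X inv(1) J] inv(2) J by simp
    then show ?thesis using assoc_mult_mat_vec[OF X S v] by simp
  qed
  fix v :: "real vec" and i
  assume v: "v \<in> carrier_vec m"
  have Sv: "S *\<^sub>v v \<in> carrier_vec (n + m)" using S v by auto
  show "(S *\<^sub>v v) $ (n + i) = v $ i" if "i < m"
    using Xv[OF Sv, of "n + i"] Jv[OF v, of "n + i"] XS[OF v] that by simp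
  show "(K *\<^sub>v (S *\<^sub>v v)) $ i = 0" if "i < n"
    using Xv[OF Sv, of i] Jv[OF v, of i] XS[OF v] that by simp
qed

lemma congruence_form:
  fixes S M B :: "real mat"
  assumes S: "S \<in> carrier_mat N m" and M: "M \<in> carrier_mat N N" and B: "B \<in> carrier_mat m m"
    and v: "v \<in> carrier_vec m"
  shows "scalar_prod v ((transpose_mat S * M * S + \<nu> \<cdot>\<^sub>m B) *\<^sub>v v)
    = scalar_prod (S *\<^sub>v v) (M *\<^sub>v (S *\<^sub>v v)) + \<nu> * scalar_prod v (B *\<^sub>v v)"
proof -
  have St: "transpose_mat S \<in> carrier_mat m N" using S by simp
  have StM: "transpose_mat S * M \<in> carrier_mat m N" using St M by simp
  have Sv: "S *\<^sub>v v \<in> carrier_vec N" using S v by simp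
  have MSv: "M *\<^sub>v (S *\<^sub>v v) \<in> carrier_vec N" using M Sv by simp
  have Bv: "B *\<^sub>v v \<in> carrier_vec m" using B v by simp
  have "(transpose_mat S * M * S + \<nu> \<cdot>\<^sub>m B) *\<^sub>v v = (transpose_mat S * M * S) *\<^sub>v v + (\<nu> \<cdot>\<^sub>m B) *\<^sub>v v"
    using StM S B v by (intro add_mult_distrib_mat_vec[where nr=m and nc=m]) auto
  also have "(transpose_mat S * M * S) *\<^sub>v v = transpose_mat S *\<^sub>v (M *\<^sub>v (S *\<^sub>v v))"
    using assoc_mult_mat_vec[OF StM S v] assoc_mult_mat_vec[OF St M Sv] by simp
  also have "(\<nu> \<cdot>\<^sub>m B) *\<^sub>v v = \<nu> \<cdot>\<^sub>v (B *\<^sub>v v)" by (rule smult_mat_vec[OF B v])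
  finally have "scalar_prod v ((transpose_mat S * M * S + \<nu> \<cdot>\<^sub>m B) *\<^sub>v v)
    = scalar_prod v (transpose_mat S *\<^sub>v (M *\<^sub>v (S *\<^sub>v v)) + \<nu> \<cdot>\<^sub>v (B *\<^sub>v v))" by simp
  also have "\<dots> = scalar_prod v (transpose_mat S *\<^sub>v (M *\<^sub>v (S *\<^sub>v v))) + scalar_prod v (\<nu> \<cdot>\<^sub>v (B *\<^sub>v v))"
    using St MSv Bv v by (intro scalar_prod_add_distrib[where n=m]) auto
  also have "scalar_prod v (transpose_mat S *\<^sub>v (M *\<^sub>v (S *\<^sub>v v))) = scalar_prod (S *\<^sub>v v) (M *\<^sub>v (S *\<^sub>v v))"
    using transpose_vec_mult_scalar[OF S v MSv] comm_scalar_prod[OF v, of "transpose_mat S *\<^sub>v (M *\<^sub>v (S *\<^sub>v v))"]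
      comm_scalar_prod[OF Sv MSv] St MSv by simp
  also have "scalar_prod v (\<nu> \<cdot>\<^sub>v (B *\<^sub>v v)) = \<nu> * scalar_prod v (B *\<^sub>v v)"
    using v Bv by simp
  finally show ?thesis .
qed

lemma congruence_symmetric:
  fixes S M B :: "real mat"
  assumes S: "S \<in> carrier_mat N m" and M: "M \<in> carrier_mat N N" "symmetric_mat M"
    and B: "B \<in> carrier_mat m m" "symmetric_mat B"
  shows "symmetric_mat (transpose_mat S * M * S + \<nu> \<cdot>\<^sub>m B)"
proof -
  have St: "transpose_mat S \<in> carrier_mat m N" using S by simp
  have StM: "transpose_mat S * M \<in> carrier_mat m N" using St M by simp
  have "transpose_mat (transpose_mat S * M * S) = transpose_mat S * (M * S)"
    using M(2) by (simp add: transpose_mult[OF StM S] transpose_mult[OF St M(1)] symmetric_mat_def)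
  also have "\<dots> = transpose_mat S * M * S" using assoc_mult_mat[OF St M(1) S] by simp
  finally have 1: "transpose_mat (transpose_mat S * M * S) = transpose_mat S * M * S" .
  have 2: "transpose_mat (\<nu> \<cdot>\<^sub>m B) = \<nu> \<cdot>\<^sub>m B"
  proof (rule eq_matI)
    fix i j assume ij: "i < dim_row (\<nu> \<cdot>\<^sub>m B)" "j < dim_col (\<nu> \<cdot>\<^sub>m B)"
    have "B $$ (j, i) = transpose_mat B $$ (i, j)" using ij B(1) by simp
    then show "transpose_mat (\<nu> \<cdot>\<^sub>m B) $$ (i, j) = (\<nu> \<cdot>\<^sub>m B) $$ (i, j)"
      using ij B by (simp add: symmetric_mat_def)
  qed (use B in auto)
  have "transpose_mat (transpose_mat S * M * S + \<nu> \<cdot>\<^sub>m B) = transpose_mat (transpose_mat S * M * S) + transpose_mat (\<nu> \<cdot>\<^sub>m B)"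
    using StM S B by (intro transpose_add[where nr=m and nc=m]) auto
  then show ?thesis by (simp add: symmetric_mat_def 1 2)
qed

lemma pos_def_min_eigenvalue_pos:
  assumes A: "A \<in> carrier_mat n n" and sym: "symmetric_mat A" and n: "0 < n" and pd: "pos_def_mat A"
  shows "0 < min_eigenvalue A"
proof -
  obtain v where v: "v \<in> carrier_vec n" "v \<noteq> 0\<^sub>v n" "A *\<^sub>v v = min_eigenvalue A \<cdot>\<^sub>v v"
    using symmetric_eigenvalue_bounds(2)[OF A sym n] A unfolding eigenvalue_def eigenvector_def by auto
  have "0 < scalar_prod v (A *\<^sub>v v)" using pd v A by (auto simp: pos_def_mat_def)
  also have "\<dots> = min_eigenvalue A * scalar_prod v v" using v by simp
  finally show ?thesis using scalar_prod_self_pos[OF v(1,2)] by (simp add: zero_less_mult_iff)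
qed

lemma gram_quadratic_form:
  fixes f :: "nat \<Rightarrow> 'a \<Rightarrow> real"
  assumes "\<And>i j. i < n \<Longrightarrow> j < n \<Longrightarrow> integrable M (\<lambda>p. f i p * f j p)"
  shows "(\<Sum>i<n. \<Sum>j<n. v i * v j * (\<integral>p. f i p * f j p \<partial>M)) = (\<integral>p. (\<Sum>i<n. v i * f i p)\<^sup>2 \<partial>M)"
proof -
  have "(\<Sum>i<n. v i * f i p)\<^sup>2 = (\<Sum>i<n. \<Sum>j<n. v i * v j * (f i p * f j p))" for p
    by (simp add: power2_eq_square sum_product mult_ac)
  then have "(\<integral>p. (\<Sum>i<n. v i * f i p)\<^sup>2 \<partial>M) = (\<integral>p. (\<Sum>i<n. \<Sum>j<n. v i * v j * (f i p * f j p)) \<partial>M)" by simp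
  also have "\<dots> = (\<Sum>i<n. \<Sum>j<n. \<integral>p. v i * v j * (f i p * f j p) \<partial>M)"
    using assms by (subst Bochner_Integration.integral_sum; (intro Bochner_Integration.integrable_sum integrable_mult_right sum.cong refl Bochner_Integration.integral_sum)?) auto
  finally show ?thesis by simp
qed

text \<open>Continuity keeps |f| above half of |f p| near p. The point p has to lie only in S, so
  that a boundary node can serve when A is the open set \<Omega>.\<close>

lemma integral_square_pos:
  fixes f :: "'a::metric_space \<Rightarrow> real"
  assumes int: "integrable M (\<lambda>q. (indicator A q * f q)\<^sup>2)" and sets: "sets M = sets borel"
    and A: "A \<in> sets borel" "emeasure M A < \<infinity>" and f: "continuous_on S f" "A \<subseteq> S" and p: "p \<in> S" "f p \<noteq> 0"
    and pos: "\<And>r. 0 < r \<Longrightarrow> 0 < emeasure M (A \<inter> ball p r)"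
  shows "0 < (\<integral>q. (indicator A q * f q)\<^sup>2 \<partial>M)"
proof -
  have h: "0 < \<bar>f p\<bar> / 2" using p by simp
  then obtain r where r: "0 < r" "\<And>q. q \<in> S \<Longrightarrow> dist q p < r \<Longrightarrow> dist (f q) (f p) < \<bar>f p\<bar> / 2"
    using f(1) p(1) unfolding continuous_on_iff by blast
  let ?D = "A \<inter> ball p r"
  have D: "?D \<in> sets M" using A sets by auto
  have fin: "emeasure M ?D < \<infinity>"
    using emeasure_mono[of ?D A M] A sets by (auto intro: le_less_trans)
  have "(\<bar>f p\<bar> / 2)\<^sup>2 * measure M ?D \<le> (\<integral>q. (indicator A q * f q)\<^sup>2 \<partial>M)"
  proof (rule integral_ge_on_subset[OF int _ D fin])
    fix q assume q: "q \<in> ?D"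
    have "\<bar>f p\<bar> / 2 \<le> \<bar>f q\<bar>" using r(2)[of q] q f(2) by (auto simp: dist_commute dist_real_def subset_iff abs_if split: if_splits)
    then have "(\<bar>f p\<bar> / 2)\<^sup>2 \<le> \<bar>f q\<bar>\<^sup>2" using h by (intro power_mono) auto
    then show "(\<bar>f p\<bar> / 2)\<^sup>2 \<le> (indicator A q * f q)\<^sup>2" using q by simp
  qed simp
  moreover have "0 < measure M ?D"
    using pos[OF r(1)] fin unfolding measure_def by (simp add: enn2real_positive_iff)
  then have "0 < (\<bar>f p\<bar> / 2)\<^sup>2 * measure M ?D" using h by (intro mult_pos_pos) (auto intro: zero_less_power)
  ultimately show ?thesis by linarith
qed

text \<open>The point covers itself with diameter 0, and 0 to a positive power is 0.\<close>

lemma hausdorff_measure_singleton: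
  assumes "0 < s" shows "emeasure (hausdorff_measure s) {p :: 'a::metric_space} = 0"
proof -
  have "hausdorff_content s \<delta> {p} = 0" if "0 < \<delta>" for \<delta>
  proof -
    have "hausdorff_content s \<delta> {p} \<le> (\<Sum>n::nat. hausdorff_gauge s {p})"
      unfolding hausdorff_content_def using that by (intro INF_lower2[of "\<lambda>_. {p}"]) auto
    also have "\<dots> = 0" using assms by (simp add: hausdorff_gauge_def zero_power)
    finally show ?thesis by simp
  qed
  then have "hausdorff_outer s {p} = 0" unfolding hausdorff_outer_def by (simp cong: SUP_cong_simp)
  then show ?thesis by (subst emeasure_hausdorff_measure) auto
qed

section \<open>The mass and stiffness matrices of one mesh\<close>

context fem
begin

lemma u_Kronecker: "i < N \<Longrightarrow> u (\<lambda>k. if k = i then 1 else 0) p = indicator \<Omega> p * e i p"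
  by (simp add: u_def Y_def if_distrib[where f="\<lambda>t. t * _"] sum.delta cong: if_cong)

lemma bbs_basis:
  assumes "i < N" shows "bbs (\<lambda>p. indicator \<Omega> p * e i p :: real)"
proof -
  have "u (\<lambda>k. if k = i then 1 else 0) = (\<lambda>p. indicator \<Omega> p * e i p)"
    using u_Kronecker[OF assms] by (rule ext)
  then show ?thesis using bbs_u[of "\<lambda>k. if k = i then 1 else 0"] by simp
qed

lemma u_sum: "u c p = (\<Sum>i<N. c i * (indicator \<Omega> p * e i p))"
  by (simp add: u_def Y_def sum_distrib_left mult_ac)

lemma u_cong: "(\<And>j. j < N \<Longrightarrow> a j = b j) \<Longrightarrow> u a = u b"
  by (simp add: u_def[abs_def] Y_def)

abbreviation "mass \<equiv> mass_matrix \<Omega> N e"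
abbreviation "stiffness \<equiv> stiffness_matrix \<Omega> N e"

lemma mass_carrier: "mass \<in> carrier_mat N N" by (simp add: mass_matrix_def)

lemma mass_entry:
  assumes ij: "i < N" "j < N"
  shows "mass $$ (i, j) = (\<integral>p. (indicator \<Omega> p * e i p) * (indicator \<Omega> p * e j p) \<partial>lborel)"
proof -
  have "mass $$ (i, j) = (\<integral>p. (indicator \<Omega> p * e i p) * (indicator \<Omega> p * e j p) \<partial>lebesgue)"
    using ij by (auto simp: mass_matrix_def set_lebesgue_integral_def split: split_indicator intro!: Bochner_Integration.integral_cong)
  also have "\<dots> = (\<integral>p. (indicator \<Omega> p * e i p) * (indicator \<Omega> p * e j p) \<partial>lborel)"
    by (intro integral_completion borel_measurable_integrable bbs_integrable bbs_mult bbs_basis ij)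
  finally show ?thesis .
qed

lemma mass_symmetric: "symmetric_mat mass"
  unfolding symmetric_mat_def by (rule eq_matI) (use mass_carrier in \<open>auto simp: mass_entry mult.commute\<close>)

lemma mass_form:
  assumes v: "v \<in> carrier_vec N" shows "scalar_prod v (mass *\<^sub>v v) = sq_int (u (\<lambda>i. v $ i))"
proof -
  have "scalar_prod v (mass *\<^sub>v v) = (\<Sum>i<N. \<Sum>j<N. v $ i * v $ j * (\<integral>p. (indicator \<Omega> p * e i p) * (indicator \<Omega> p * e j p) \<partial>lborel))"
    unfolding quadratic_form_sum[OF mass_carrier v] by (intro sum.cong refl) (simp add: mass_entry)
  also have "\<dots> = (\<integral>p. (\<Sum>i<N. v $ i * (indicator \<Omega> p * e i p))\<^sup>2 \<partial>lborel)"
    by (intro gram_quadratic_form bbs_integrable bbs_mult bbs_basis)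
  finally show ?thesis by (simp add: sq_int_def u_sum[symmetric])
qed

lemma closure_eq: "closure \<Omega> = \<Omega> \<union> frontier \<Omega>"
  using open_dom closure_subset[of \<Omega>] by (auto simp: frontier_def interior_open)

lemma node_in_closure: "i < N \<Longrightarrow> x i \<in> closure \<Omega>"
  using node_in_nodes[of i] element_subset by (auto simp: nodes_def extreme_point_of_def)

lemma not_frontier: "p \<in> \<Omega> \<Longrightarrow> p \<notin> frontier \<Omega>"
  using open_dom by (simp add: frontier_def interior_open)

lemma open_positive: "p \<in> closure \<Omega> \<Longrightarrow> 0 < r \<Longrightarrow> 0 < emeasure lborel (\<Omega> \<inter> ball p r)"
proof -
  assume p: "p \<in> closure \<Omega>" "0 < r"
  then obtain q where q: "q \<in> \<Omega>" "dist q p < r" by (meson closure_approachable)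
  have "open (\<Omega> \<inter> ball p r)" using open_dom by auto
  moreover have "q \<in> \<Omega> \<inter> ball p r" using q by (simp add: dist_commute)
  ultimately obtain s where s: "0 < s" "ball q s \<subseteq> \<Omega> \<inter> ball p r" by (meson openE)
  have "0 < emeasure lborel (ball q s)" using content_ball_pos[OF s(1)] by (simp add: emeasure_bounded_eq_measure del: content_ball_gt_0_iff)
  also have "\<dots> \<le> emeasure lborel (\<Omega> \<inter> ball p r)" using s(2) open_dom by (intro emeasure_mono) auto
  finally show ?thesis .
qed

lemma dom_measure_finite: "emeasure lborel \<Omega> < \<infinity>" by (rule emeasure_bounded_finite[OF bounded_dom])

lemma mass_pos_def: "pos_def_mat mass"
  unfolding pos_def_mat_def
proof (intro ballI impI)
  fix v :: "real vec" assume "v \<in> carrier_vec (dim_col mass)" "v \<noteq> 0\<^sub>v (dim_col mass)"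
  then have v: "v \<in> carrier_vec N" "v \<noteq> 0\<^sub>v N" using mass_carrier by auto
  then obtain i where i: "i < N" "v $ i \<noteq> 0" by (auto simp: vec_eq_iff)
  have "0 < (\<integral>p. (indicator \<Omega> p * Y (\<lambda>i. v $ i) p)\<^sup>2 \<partial>lborel)"
  proof (rule integral_square_pos[where S="closure \<Omega>" and p="x i"])
    have "integrable lborel (\<lambda>p. (u (\<lambda>i. v $ i) p)\<^sup>2)" by (intro bbs_integrable bbs_power2 bbs_u)
    then show "integrable lborel (\<lambda>p. (indicator \<Omega> p * Y (\<lambda>i. v $ i) p)\<^sup>2)" by (simp add: u_def)
    show "\<Omega> \<in> sets borel" using open_dom by simp
  qed (use dom_measure_finite Y_continuous closure_subset node_in_closure[OF i(1)] i Y_node open_positive in auto)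
  then show "0 < scalar_prod v (mass *\<^sub>v v)" unfolding mass_form[OF v(1)] by (simp add: sq_int_def u_def)
qed

lemma stiffness_carrier: "stiffness \<in> carrier_mat N N" by (simp add: stiffness_matrix_def)

text \<open>Agreement of \<open>gradient\<close> with \<open>Ge\<close> is known only off the
  skeleton; passing through the gauge integral allows the integrand to be changed on that negligible
  set.\<close>

lemma stiffness_entry:
  assumes ij: "i < N" "j < N"
  shows "stiffness $$ (i, j) = (\<integral>p. inner (Ge i p) (Ge j p) \<partial>lborel)"
proof -
  let ?f = "\<lambda>p. inner (Ge i p) (Ge j p)" and ?g = "\<lambda>p. inner (gradient (e i) p) (gradient (e j) p)"
  have ind: "indicator \<Omega> p *\<^sub>R ?f p = ?f p" for p by (cases "p \<in> \<Omega>") (auto simp: Ge_outside)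
  have bf: "bbs ?f" by (intro bbs_inner bbs_Ge)
  have "integrable lebesgue ?f" using bbs_integrable[OF bf] by (simp add: integrable_completion borel_measurable_integrable)
  then have f: "?f absolutely_integrable_on \<Omega>" unfolding set_integrable_def ind .
  have eq: "?g p = ?f p" if p: "p \<in> \<Omega> - skel" for p
  proof -
    obtain T where "T \<in> \<T>" "p \<in> interior T" using off_skel p closure_subset by blast
    then show ?thesis using gradient_basis ij by metis
  qed
  have neg: "negligible skel" by (rule thin_negligible[OF skel_thin])
  have g: "?g absolutely_integrable_on \<Omega>"
    by (rule absolutely_integrable_spike[OF f neg]) (rule eq)
  have "stiffness $$ (i, j) = (LINT p:\<Omega>|lebesgue. ?g p)" using ij by (simp add: stiffness_matrix_def)
  also have "\<dots> = integral \<Omega> ?g" by (rule set_lebesgue_integral_eq_integral(2)[OF g])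
  also have "\<dots> = integral \<Omega> ?f" by (rule integral_spike[OF neg]) (simp add: eq)
  also have "\<dots> = (LINT p:\<Omega>|lebesgue. ?f p)" by (rule set_lebesgue_integral_eq_integral(2)[OF f, symmetric])
  also have "\<dots> = (\<integral>p. ?f p \<partial>lebesgue)" by (simp add: set_lebesgue_integral_def ind[unfolded real_scaleR_def])
  also have "\<dots> = (\<integral>p. ?f p \<partial>lborel)" by (intro integral_completion borel_measurable_integrable bbs_integrable bf)
  finally show ?thesis .
qed

lemma DY_inner_sum:
  "(\<integral>p. inner (DY c p) (DY w p) \<partial>lborel) = (\<Sum>j<N. w j * (\<integral>p. inner (DY c p) (Ge j p) \<partial>lborel))"
proof -
  have "(\<integral>p. inner (DY c p) (DY w p) \<partial>lborel) = (\<integral>p. (\<Sum>j<N. w j * inner (DY c p) (Ge j p)) \<partial>lborel)"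
    unfolding DY_def[of w] by (simp add: inner_sum_right)
  also have "\<dots> = (\<Sum>j<N. \<integral>p. w j * inner (DY c p) (Ge j p) \<partial>lborel)"
    by (intro Bochner_Integration.integral_sum integrable_mult_right bbs_integrable bbs_inner bbs_DY bbs_Ge)
  finally show ?thesis by simp
qed

lemma stiffness_vec:
  assumes v: "v \<in> carrier_vec N" and i: "i < N"
  shows "(stiffness *\<^sub>v v) $ i = (\<integral>p. inner (DY (\<lambda>j. v $ j) p) (Ge i p) \<partial>lborel)"
proof -
  have "(stiffness *\<^sub>v v) $ i = (\<Sum>j = 0..<N. stiffness $$ (i, j) * v $ j)"
    using stiffness_carrier v i by (auto simp: scalar_prod_def intro!: sum.cong)
  also have "\<dots> = (\<Sum>j<N. v $ j * (\<integral>p. inner (Ge i p) (Ge j p) \<partial>lborel))"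
    using i by (simp add: stiffness_entry atLeast0LessThan mult.commute)
  also have "\<dots> = (\<integral>p. (\<Sum>j<N. v $ j * inner (Ge i p) (Ge j p)) \<partial>lborel)"
    by (subst Bochner_Integration.integral_sum)
       (simp_all add: integrable_mult_right bbs_integrable bbs_inner bbs_Ge)
  also have "\<dots> = (\<integral>p. inner (DY (\<lambda>j. v $ j) p) (Ge i p) \<partial>lborel)"
    unfolding DY_def by (simp add: inner_sum_left inner_commute[of "Ge i _"])
  finally show ?thesis .
qed

lemma discrete_harmonicI:
  assumes v: "v \<in> carrier_vec N" and 0: "\<And>i. i < N \<Longrightarrow> x i \<in> \<Omega> \<Longrightarrow> (stiffness *\<^sub>v v) $ i = 0"
  shows "discrete_harmonic (\<lambda>j. v $ j)"
  unfolding discrete_harmonic_def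
proof (intro allI impI)
  fix w :: "nat \<Rightarrow> real" assume w: "\<forall>j<N. x j \<in> frontier \<Omega> \<longrightarrow> w j = 0"
  have "w j * (\<integral>p. inner (DY (\<lambda>j. v $ j) p) (Ge j p) \<partial>lborel) = 0" if "j < N" for j
    using 0[OF that] stiffness_vec[OF v that] w that node_in_closure[OF that] by (auto simp: closure_eq)
  then show "(\<integral>p. inner (DY (\<lambda>j. v $ j) p) (DY w p) \<partial>lborel) = 0" unfolding DY_inner_sum by (intro sum.neutral) auto
qed

text \<open>The discrete function is harmonic and vanishes at the boundary nodes, so it may be
  tested with itself and has zero energy.\<close>

lemma stiffness_inj:
  assumes v: "v \<in> carrier_vec N" and b: "\<And>j. j < N \<Longrightarrow> x j \<in> frontier \<Omega> \<Longrightarrow> v $ j = 0"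
    and 0: "\<And>i. i < N \<Longrightarrow> x i \<in> \<Omega> \<Longrightarrow> (stiffness *\<^sub>v v) $ i = 0"
  shows "v = 0\<^sub>v N"
proof (rule eq_vecI)
  have "(\<integral>p. inner (DY (\<lambda>j. v $ j) p) (DY (\<lambda>j. v $ j) p) \<partial>lborel) = 0"
    using discrete_harmonicI[OF v 0] b unfolding discrete_harmonic_def by blast
  then have sq: "sq_int (DY (\<lambda>j. v $ j)) = 0" by (simp add: sq_int_def power2_norm_eq_inner)
  fix i assume "i < dim_vec (0\<^sub>v N :: real vec)"
  then have i: "i < N" by simp
  show "v $ i = 0\<^sub>v N $ i"
  proof (cases "x i \<in> \<Omega>")
    case True
    then show ?thesis using DY_eq_0_imp[OF b sq i] i by simp
  next
    case False
    then have "x i \<in> frontier \<Omega>" using node_in_closure[OF i] by (simp add: closure_eq)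
    then show ?thesis using b[OF i] i by simp
  qed
qed (use v in auto)

text \<open>The number of interior nodes: they come first in the numbering, so it is the first index
  that is not interior.\<close>

definition nI :: nat where "nI = (LEAST j. j \<notin> interior_indexes \<Omega> N x)"
definition nB :: nat where "nB = N - nI"

lemma index_split: "interior_indexes \<Omega> N x = {..<nI}" "boundary_indexes \<Omega> N x = {nI..<nI + nB}" "N = nI + nB"
proof -
  \<comment> \<open>N itself is never an interior index, so the least index exists and is at most
    N.\<close>
  have ex: "N \<notin> interior_indexes \<Omega> N x" by (simp add: interior_indexes_def)
  then have le: "nI \<le> N" unfolding nI_def by (rule Least_le)
  then show N: "N = nI + nB" by (simp add: nB_def)
  have lt: "i \<in> interior_indexes \<Omega> N x" if "i < nI" for i using not_less_Least[of i] that unfolding nI_def by blast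
  have nn: "nI \<notin> interior_indexes \<Omega> N x" unfolding nI_def using ex by (rule LeastI)
  have ge: "i \<notin> interior_indexes \<Omega> N x" if "nI \<le> i" for i
  proof
    assume i: "i \<in> interior_indexes \<Omega> N x"
    then have "i \<noteq> nI" "i < N" "x i \<in> \<Omega>" using nn by (auto simp: interior_indexes_def)
    then have "nI < i" "nI < N" using that by auto
    then have "x nI \<in> frontier \<Omega>" using nn node_in_closure[of nI] by (simp add: closure_eq interior_indexes_def)
    then show False using num \<open>nI < N\<close> \<open>i < N\<close> \<open>x i \<in> \<Omega>\<close> \<open>nI < i\<close> unfolding node_numbering_def by (metis less_asym)
  qed
  show I: "interior_indexes \<Omega> N x = {..<nI}" using lt ge by (auto simp: not_less[symmetric])
  have "boundary_indexes \<Omega> N x = {..<N} - interior_indexes \<Omega> N x"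
    using node_in_closure not_frontier by (auto simp: boundary_indexes_def interior_indexes_def closure_eq)
  also have "\<dots> = {nI..<nI + nB}" unfolding I N[symmetric] by auto
  finally show "boundary_indexes \<Omega> N x = {nI..<nI + nB}" .
qed

lemma interior_index: "i < nI \<Longrightarrow> i < N \<and> x i \<in> \<Omega>"
  using index_split(1) by (auto simp: interior_indexes_def set_eq_iff)

lemma boundary_index: "i < nB \<Longrightarrow> nI + i < N \<and> x (nI + i) \<in> frontier \<Omega>"
proof -
  assume "i < nB"
  then have "nI + i \<in> boundary_indexes \<Omega> N x" unfolding index_split(2) by simp
  then show ?thesis by (simp add: boundary_indexes_def)
qed

lemma interior_index_iff: "i < N \<Longrightarrow> x i \<in> \<Omega> \<longleftrightarrow> i < nI"
  using index_split(1) by (auto simp: interior_indexes_def set_eq_iff)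

lemma frontier_index_iff: "i < N \<Longrightarrow> x i \<in> frontier \<Omega> \<longleftrightarrow> nI \<le> i"
  using interior_index_iff[of i] node_in_closure[of i] not_frontier[of "x i"] by (auto simp: closure_eq)

abbreviation "ext \<equiv> extension_matrix stiffness (interior_indexes \<Omega> N x) (boundary_indexes \<Omega> N x)"

lemma ext_harmonic:
  shows "ext \<in> carrier_mat N nB"
    and "v \<in> carrier_vec nB \<Longrightarrow> i < nB \<Longrightarrow> (ext *\<^sub>v v) $ (nI + i) = v $ i"
    and "v \<in> carrier_vec nB \<Longrightarrow> discrete_harmonic (\<lambda>j. (ext *\<^sub>v v) $ j)"
proof -
  note NN = index_split(3)[symmetric]
  have inj: "c = 0\<^sub>v (nI + nB)" if c: "c \<in> carrier_vec (nI + nB)" "\<And>i. i < nB \<Longrightarrow> c $ (nI + i) = 0"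
    "\<And>i. i < nI \<Longrightarrow> (stiffness *\<^sub>v c) $ i = 0" for c
  proof -
    have "c = 0\<^sub>v N"
    proof (rule stiffness_inj)
      fix j assume "j < N" "x j \<in> frontier \<Omega>"
      then have "nI \<le> j" "j - nI < nB" using frontier_index_iff[of j] index_split(3) by linarith+
      then show "c $ j = 0" using c(2)[of "j - nI"] by simp
    next
      fix i assume "i < N" "x i \<in> \<Omega>"
      then show "(stiffness *\<^sub>v c) $ i = 0" using interior_index_iff c(3) by simp
    qed (use c(1) NN in simp)
    then show ?thesis by (simp add: NN)
  qed
  have K: "stiffness \<in> carrier_mat (nI + nB) (nI + nB)" unfolding NN by (rule stiffness_carrier)
  have E: "ext \<in> carrier_mat (nI + nB) nB"
    unfolding index_split(1,2) by (rule extension_matrix_harmonic(1)[OF K]) (rule inj, assumption, blast+)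
  then show car: "ext \<in> carrier_mat N nB" unfolding NN .
  have E2: "(ext *\<^sub>v v) $ (nI + i) = v $ i" if "v \<in> carrier_vec nB" "i < nB" for v i
    unfolding index_split(1,2) by (rule extension_matrix_harmonic(2)[OF K _ that]) (rule inj, assumption, blast+)
  have E3: "(stiffness *\<^sub>v (ext *\<^sub>v v)) $ i = 0" if "v \<in> carrier_vec nB" "i < nI" for v i
    unfolding index_split(1,2) by (rule extension_matrix_harmonic(3)[OF K _ that]) (rule inj, assumption, blast+)
  show "v \<in> carrier_vec nB \<Longrightarrow> i < nB \<Longrightarrow> (ext *\<^sub>v v) $ (nI + i) = v $ i" by (rule E2)
  show "discrete_harmonic (\<lambda>j. (ext *\<^sub>v v) $ j)" if v: "v \<in> carrier_vec nB"
  proof (rule discrete_harmonicI)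
    show "ext *\<^sub>v v \<in> carrier_vec N" using car v by simp
    show "(stiffness *\<^sub>v (ext *\<^sub>v v)) $ i = 0" if "i < N" "x i \<in> \<Omega>" for i
      using E3[OF v] interior_index_iff[OF that(1)] that(2) by blast
  qed
qed

text \<open>If all off-diagonal entries vanished, nonnegativity and continuity would make the
  products of distinct basis functions zero on A. By the partition of unity a single one would equal
  1 at each point, so A would consist of nodes; being finite, it would have isolated points of
  positive measure, against \<open>atom\<close>.\<close>

lemma offdiagonal_ex:
  fixes \<mu> :: "'a measure"
  assumes A: "A \<in> sets borel" "emeasure \<mu> A < \<infinity>" "A \<subseteq> closure \<Omega>" "A \<noteq> {}" and sets: "sets \<mu> = sets borel"
    and pos: "\<And>p r. p \<in> A \<Longrightarrow> 0 < r \<Longrightarrow> 0 < emeasure \<mu> (A \<inter> ball p r)"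
    and atom: "\<And>p. emeasure \<mu> {p} = 0"
    and J: "J \<subseteq> {..<N}" "\<And>p. p \<in> A \<Longrightarrow> (\<Sum>j\<in>J. e j p) = 1"
    and int: "\<And>f :: 'a \<Rightarrow> real. continuous_on (closure \<Omega>) f \<Longrightarrow> integrable \<mu> (\<lambda>q. indicator A q * f q)"
  shows "\<exists>i\<in>J. \<exists>j\<in>J. i \<noteq> j \<and> (\<integral>q. indicator A q * (e i q * e j q) \<partial>\<mu>) \<noteq> 0"
proof (rule ccontr)
  assume "\<not> ?thesis"
  then have z: "(\<integral>q. indicator A q * (e i q * e j q) \<partial>\<mu>) = 0" if "i \<in> J" "j \<in> J" "i \<noteq> j" for i j using that by blast
  have finJ: "finite J" using J(1) finite_subset by blast
  have zero: "e i p * e j p = 0" if ij: "i \<in> J" "j \<in> J" "i \<noteq> j" and p: "p \<in> A" for i j p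
  proof (rule ccontr)
    assume ne: "e i p * e j p \<noteq> 0"
    have N: "i < N" "j < N" using ij J(1) by auto
    let ?f = "\<lambda>q. e i q * e j q"
    have c: "continuous_on (closure \<Omega>) ?f" using basis_continuous N by (intro continuous_on_mult) auto
    have sq: "(indicator A q * ?f q)\<^sup>2 = indicator A q * (?f q)\<^sup>2" for q by (simp split: split_indicator)
    have i2: "integrable \<mu> (\<lambda>q. (indicator A q * ?f q)\<^sup>2)"
      unfolding sq using int[OF continuous_on_power[OF c, of 2]] by simp
    have "0 < (\<integral>q. (indicator A q * ?f q)\<^sup>2 \<partial>\<mu>)"
      by (rule integral_square_pos[OF i2 sets A(1,2) c A(3) _ ne]) (use p A(3) pos in auto)
    also have "\<dots> \<le> (\<integral>q. indicator A q * ?f q \<partial>\<mu>)"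
    proof (rule Bochner_Integration.integral_mono[OF i2 int[OF c]])
      fix q
      show "(indicator A q * ?f q)\<^sup>2 \<le> indicator A q * ?f q"
      proof (cases "q \<in> A")
        case True
        then have q: "q \<in> closure \<Omega>" using A(3) by blast
        have "0 \<le> ?f q" "?f q \<le> 1" using basis_nonneg[OF q] basis_le_1[OF q] N by (auto intro: mult_le_one)
        then show ?thesis using True by (simp add: power2_eq_square mult_left_le)
      qed simp
    qed
    finally show False using z[OF ij] by simp
  qed
  have sub: "A \<subseteq> x ` {..<N}"
  proof
    fix p assume p: "p \<in> A"
    then obtain i where i: "i \<in> J" "e i p \<noteq> 0" using J(2) by (metis sum.neutral zero_neq_one)
    have "(\<Sum>j\<in>J. e j p) = e i p"
      using zero[OF i(1) _ _ p] i finJ by (subst sum.remove[OF finJ i(1)]) (auto intro!: sum.neutral)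
    then have "p = x i" using basis_eq_1[of p i] J p i A(3) by auto
    then show "p \<in> x ` {..<N}" using i(1) J(1) by auto
  qed
  obtain p where p: "p \<in> A" using A(4) by blast
  obtain r where r: "0 < r" "\<And>q. q \<in> A \<Longrightarrow> q \<noteq> p \<Longrightarrow> r \<le> dist p q"
    using finite_set_avoid[OF finite_subset[OF sub], of p] by auto
  have "q = p" if "q \<in> A" "dist p q < r" for q using r(2)[OF that(1)] that(2) by (cases "q = p") auto
  then have "A \<inter> ball p r = {p}" using r(1) p by auto
  then show False using pos[OF p r(1)] atom by simp
qed

lemma mass_offdiagonal: "\<exists>i<N. \<exists>j<N. i \<noteq> j \<and> mass $$ (i, j) \<noteq> 0"
proof -
  have eq: "(\<integral>q. indicator \<Omega> q * (e i q * e j q) \<partial>lborel) = mass $$ (i, j)" if "i < N" "j < N" for i j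
    unfolding mass_entry[OF that] by (intro Bochner_Integration.integral_cong) (auto split: split_indicator)
  have "\<exists>i\<in>{..<N}. \<exists>j\<in>{..<N}. i \<noteq> j \<and> (\<integral>q. indicator \<Omega> q * (e i q * e j q) \<partial>lborel) \<noteq> 0"
  proof (rule offdiagonal_ex)
    show "\<Omega> \<subseteq> closure \<Omega>" by (rule closure_subset)
    then show "0 < emeasure lborel (\<Omega> \<inter> ball p r)" if "p \<in> \<Omega>" "0 < r" for p r using open_positive that by blast
    show "(\<Sum>j<N. e j p) = 1" if "p \<in> \<Omega>" for p using basis_sum closure_subset that by blast
    fix f :: "'a \<Rightarrow> real" assume f: "continuous_on (closure \<Omega>) f"
    have "compact (closure \<Omega>)" using bounded_dom by (simp add: compact_closure)
    then have "bounded (f ` closure \<Omega>)" using f by (intro compact_imp_bounded compact_continuous_image)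
    then obtain B where B: "\<And>p. p \<in> closure \<Omega> \<Longrightarrow> norm (f p) \<le> B" unfolding bounded_iff by auto
    show "integrable lborel (\<lambda>q. indicator \<Omega> q * f q)"
    proof (rule integrableI_bounded_set[where A=\<Omega> and B=B])
      have "continuous_on \<Omega> f" using f closure_subset continuous_on_subset by blast
      then show "(\<lambda>q. indicator \<Omega> q * f q) \<in> borel_measurable lborel"
        using borel_measurable_continuous_on_indicator[of \<Omega> f] open_dom by simp
    qed (use open_dom dom_measure_finite B closure_subset in \<open>auto intro!: AE_I2\<close>)
  qed (use open_dom dom_measure_finite dom_nonempty in auto)
  then show ?thesis using eq by auto
qed

end

lemma block_sum: "(\<Sum>j<n + (m::nat). f j) = (\<Sum>j<n. f j) + (\<Sum>j<m. f (n + j) :: real)"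
proof -
  have "(\<Sum>j<n + m. f j) = (\<Sum>j<n. f j) + (\<Sum>j\<in>{n..<n + m}. f j)"
    by (subst sum.union_disjoint[symmetric]) (auto intro!: sum.cong)
  also have "(\<Sum>j\<in>{n..<n + m}. f j) = (\<Sum>j<m. f (n + j))"
    using sum.shift_bounds_nat_ivl[of f 0 n m] by (simp add: atLeast0LessThan add.commute)
  finally show ?thesis .
qed

section \<open>The boundary mass matrix\<close>

context fem
begin

abbreviation "\<mu> \<equiv> hausdorff_measure (DIM('a) - 1) :: 'a measure"
abbreviation "bnd \<equiv> boundary_block \<Omega> N x e"

lemma frontier_nonempty: "frontier \<Omega> \<noteq> {}"
  using dom_nonempty bounded_dom not_bounded_UNIV by (auto simp: frontier_eq_empty)

lemma frontier_compact: "compact (frontier \<Omega>)"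
  using bounded_dom by (rule compact_frontier_bounded)

lemma frontier_subset: "frontier \<Omega> \<subseteq> closure \<Omega>" by (simp add: frontier_def)

text \<open>Interior basis functions vanish on the frontier, so the boundary ones alone form a
  partition of unity there.\<close>

lemma boundary_basis_sum:
  assumes p: "p \<in> frontier \<Omega>" shows "(\<Sum>a<nB. e (nI + a) p) = 1"
proof -
  have "(\<Sum>j<nI + nB. e j p) = 1" using basis_sum[of p] p frontier_subset index_split(3) by auto
  moreover have "(\<Sum>j<nI. e j p) = 0"
    using interior_index interior_basis_vanishes p by (intro sum.neutral) auto
  ultimately show ?thesis unfolding block_sum by simp
qed

lemma nB_pos: "0 < nB"
proof -
  obtain p where "p \<in> frontier \<Omega>" using frontier_nonempty by blast
  then have "(\<Sum>a<nB. e (nI + a) p) = 1" by (rule boundary_basis_sum)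
  then show ?thesis by (cases nB) auto
qed

lemma N_pos: "0 < N" using nB_pos index_split(3) by linarith

lemma bnd_carrier: "bnd \<in> carrier_mat nB nB"
proof -
  have "{i. i < N \<and> i \<in> boundary_indexes \<Omega> N x} = {nI..<nI + nB}" unfolding index_split(2) using index_split(3) by auto
  then show ?thesis by (intro carrier_matI) (simp_all add: boundary_block_def dim_submatrix boundary_mass_matrix_def)
qed

lemma bnd_entry:
  assumes ab: "a < nB" "b < nB"
  shows "bnd $$ (a, b) = (\<integral>p. (indicator (frontier \<Omega>) p * e (nI + a) p) * (indicator (frontier \<Omega>) p * e (nI + b) p) \<partial>\<mu>)"
proof -
  have "{i. i < N \<and> i \<in> boundary_indexes \<Omega> N x} = {nI..<nI + nB}" unfolding index_split(2) using index_split(3) by auto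
  then have "bnd $$ (a, b) = boundary_mass_matrix \<Omega> N e $$ (nI + a, nI + b)"
    using ab by (simp add: boundary_block_def submatrix_index boundary_mass_matrix_def)
      (simp add: index_split(2) pick_atLeastLessThan)
  also have "\<dots> = (LINT p:frontier \<Omega>|\<mu>. e (nI + a) p * e (nI + b) p)"
    using ab boundary_index by (simp add: boundary_mass_matrix_def)
  also have "\<dots> = (\<integral>p. (indicator (frontier \<Omega>) p * e (nI + a) p) * (indicator (frontier \<Omega>) p * e (nI + b) p) \<partial>\<mu>)"
    unfolding set_lebesgue_integral_def by (intro Bochner_Integration.integral_cong) (auto split: split_indicator)
  finally show ?thesis .
qed

lemma bnd_symmetric: "symmetric_mat bnd"
  unfolding symmetric_mat_def by (rule eq_matI) (use bnd_carrier in \<open>auto simp: bnd_entry mult.commute\<close>)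

context
  assumes poly: "polyhedral_boundary \<Omega>" and dim: "2 \<le> DIM('a)"
begin

lemma frontier_finite: "emeasure \<mu> (frontier \<Omega>) < \<infinity>"
  by (rule hausdorff_frontier_finite[OF poly bounded_dom])

lemma frontier_integrable:
  "continuous_on (frontier \<Omega>) f \<Longrightarrow> integrable \<mu> (\<lambda>p. indicator (frontier \<Omega>) p * f p :: real)"
  using continuous_frontier_integrable[OF frontier_compact frontier_finite, of f] by simp

lemma basis_continuous_frontier: "j < N \<Longrightarrow> continuous_on (frontier \<Omega>) (e j)"
  using basis_continuous frontier_subset continuous_on_subset by blast

lemma bnd_form:
  assumes v: "v \<in> carrier_vec nB"
  shows "scalar_prod v (bnd *\<^sub>v v) = (\<integral>p. (indicator (frontier \<Omega>) p * (\<Sum>a<nB. v $ a * e (nI + a) p))\<^sup>2 \<partial>\<mu>)"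
proof -
  let ?f = "\<lambda>a p. indicator (frontier \<Omega>) p * e (nI + a) p :: real"
  have int: "integrable \<mu> (\<lambda>p. ?f a p * ?f b p)" if "a < nB" "b < nB" for a b
  proof -
    have "integrable \<mu> (\<lambda>p. indicator (frontier \<Omega>) p * (e (nI + a) p * e (nI + b) p))"
      using that boundary_index by (intro frontier_integrable continuous_on_mult basis_continuous_frontier) auto
    then show ?thesis by (rule Bochner_Integration.integrable_cong[THEN iffD1, rotated 2]) (auto split: split_indicator)
  qed
  have "scalar_prod v (bnd *\<^sub>v v) = (\<Sum>a<nB. \<Sum>b<nB. v $ a * v $ b * (\<integral>p. ?f a p * ?f b p \<partial>\<mu>))"
    unfolding quadratic_form_sum[OF bnd_carrier v] by (intro sum.cong refl) (simp add: bnd_entry)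
  also have "\<dots> = (\<integral>p. (\<Sum>a<nB. v $ a * ?f a p)\<^sup>2 \<partial>\<mu>)"
    by (rule gram_quadratic_form) (rule int)
  also have "\<dots> = (\<integral>p. (indicator (frontier \<Omega>) p * (\<Sum>a<nB. v $ a * e (nI + a) p))\<^sup>2 \<partial>\<mu>)"
    by (simp add: sum_distrib_left mult_ac)
  finally show ?thesis .
qed

lemma frontier_positive: "p \<in> frontier \<Omega> \<Longrightarrow> 0 < r \<Longrightarrow> 0 < emeasure \<mu> (frontier \<Omega> \<inter> ball p r)"
  by (rule hausdorff_frontier_positive[OF lip dim])

lemma bnd_pos_def: "pos_def_mat bnd"
  unfolding pos_def_mat_def
proof (intro ballI impI)
  fix v :: "real vec" assume "v \<in> carrier_vec (dim_col bnd)" "v \<noteq> 0\<^sub>v (dim_col bnd)"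
  then have v: "v \<in> carrier_vec nB" "v \<noteq> 0\<^sub>v nB" using bnd_carrier by auto
  then obtain i where i: "i < nB" "v $ i \<noteq> 0" by (auto simp: vec_eq_iff)
  let ?f = "\<lambda>p. \<Sum>a<nB. v $ a * e (nI + a) p"
  have c: "continuous_on (frontier \<Omega>) ?f"
    using boundary_index by (intro continuous_on_sum continuous_on_mult continuous_on_const basis_continuous_frontier) auto
  have "?f (x (nI + i)) = (\<Sum>a<nB. if a = i then v $ a else 0)"
    using i boundary_index by (intro sum.cong) (auto simp: basis_node)
  then have ne: "?f (x (nI + i)) \<noteq> 0" using i by simp
  have "integrable \<mu> (\<lambda>p. indicator (frontier \<Omega>) p * (?f p)\<^sup>2)"
    by (intro frontier_integrable continuous_on_power c)
  moreover have sq: "indicator (frontier \<Omega>) p * (?f p)\<^sup>2 = (indicator (frontier \<Omega>) p * ?f p)\<^sup>2" for p :: 'a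
    by (simp split: split_indicator)
  ultimately have int: "integrable \<mu> (\<lambda>p. (indicator (frontier \<Omega>) p * ?f p)\<^sup>2)" by simp
  show "0 < scalar_prod v (bnd *\<^sub>v v)" unfolding bnd_form[OF v(1)]
    by (rule integral_square_pos[OF int sets_hausdorff_measure _ frontier_finite c subset_refl _ ne])
       (use boundary_index[OF i(1)] frontier_compact frontier_positive in \<open>auto intro: borel_closed compact_imp_closed\<close>)
qed

lemma bnd_offdiagonal: "\<exists>a<nB. \<exists>b<nB. a \<noteq> b \<and> bnd $$ (a, b) \<noteq> 0"
proof -
  have "\<exists>i\<in>{nI..<nI + nB}. \<exists>j\<in>{nI..<nI + nB}. i \<noteq> j \<and> (\<integral>q. indicator (frontier \<Omega>) q * (e i q * e j q) \<partial>\<mu>) \<noteq> 0"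
  proof (rule offdiagonal_ex)
    show "frontier \<Omega> \<in> sets borel" using frontier_compact by (auto intro: borel_closed compact_imp_closed)
    show "0 < emeasure \<mu> (frontier \<Omega> \<inter> ball p r)" if "p \<in> frontier \<Omega>" "0 < r" for p r
      by (rule frontier_positive[OF that])
    show "emeasure \<mu> {p} = 0" for p by (rule hausdorff_measure_singleton) (use dim in simp)
    show "{nI..<nI + nB} \<subseteq> {..<N}" using index_split(3) by auto
    show "(\<Sum>j\<in>{nI..<nI + nB}. e j p) = 1" if "p \<in> frontier \<Omega>" for p
      using boundary_basis_sum[OF that] sum.shift_bounds_nat_ivl[of "\<lambda>j. e j p" 0 nI nB]
      by (simp add: atLeast0LessThan add.commute)
    show "integrable \<mu> (\<lambda>q. indicator (frontier \<Omega>) q * f q)" if "continuous_on (closure \<Omega>) f" for f :: "'a \<Rightarrow> real"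
      using that frontier_subset continuous_on_subset by (intro frontier_integrable) blast
  qed (use frontier_finite frontier_subset frontier_nonempty in auto)
  then obtain i j where ij: "i \<in> {nI..<nI + nB}" "j \<in> {nI..<nI + nB}" "i \<noteq> j"
    "(\<integral>q. indicator (frontier \<Omega>) q * (e i q * e j q) \<partial>\<mu>) \<noteq> 0" by blast
  have "bnd $$ (i - nI, j - nI) = (\<integral>q. indicator (frontier \<Omega>) q * (e i q * e j q) \<partial>\<mu>)"
    using ij by (subst bnd_entry) (auto intro!: Bochner_Integration.integral_cong split: split_indicator)
  then show ?thesis using ij by (intro exI[of _ "i - nI"] exI[of _ "j - nI"] conjI) auto
qed

lemma eigenvalues_bnd: "0 < min_eigenvalue bnd" "min_eigenvalue bnd < max_eigenvalue bnd"
proof -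
  show "0 < min_eigenvalue bnd" by (rule pos_def_min_eigenvalue_pos[OF bnd_carrier bnd_symmetric nB_pos bnd_pos_def])
  obtain a b where ab: "a < nB" "b < nB" "a \<noteq> b" "bnd $$ (a, b) \<noteq> 0" using bnd_offdiagonal by blast
  show "min_eigenvalue bnd < max_eigenvalue bnd"
    by (rule min_eigenvalue_less_max_eigenvalue[OF bnd_carrier bnd_symmetric ab])
qed

lemma frontier_measure_pos: "0 < measure \<mu> (frontier \<Omega>)"
proof -
  obtain p where p: "p \<in> frontier \<Omega>" using frontier_nonempty by blast
  have "0 < emeasure \<mu> (frontier \<Omega> \<inter> ball p 1)" by (rule frontier_positive[OF p]) simp
  also have "\<dots> \<le> emeasure \<mu> (frontier \<Omega>)"
    using frontier_compact by (intro emeasure_mono) (auto intro: borel_closed compact_imp_closed)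
  finally show ?thesis using frontier_finite unfolding measure_def by (simp add: enn2real_positive_iff)
qed

lemma max_eigenvalue_bnd_ge: "measure \<mu> (frontier \<Omega>) \<le> max_eigenvalue bnd * real nB"
proof -
  let ?w = "Matrix.vec nB (\<lambda>_. 1 :: real)"
  have fm: "frontier \<Omega> \<in> sets borel" using frontier_compact by (auto intro: borel_closed compact_imp_closed)
  have w: "?w \<in> carrier_vec nB" by simp
  have "scalar_prod ?w (bnd *\<^sub>v ?w) = (\<integral>p. indicator (frontier \<Omega>) p \<partial>\<mu>)"
    unfolding bnd_form[OF w] using boundary_basis_sum
    by (intro Bochner_Integration.integral_cong) (auto split: split_indicator)
  also have "\<dots> = measure \<mu> (frontier \<Omega>)" using fm by simp
  finally show ?thesis
    using symmetric_eigenvalue_bounds(3)[OF bnd_carrier bnd_symmetric nB_pos w] by (simp add: scalar_prod_def)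
qed

end

lemma eigenvalues_mass: "0 < min_eigenvalue mass" "min_eigenvalue mass < max_eigenvalue mass"
proof -
  show "0 < min_eigenvalue mass" by (rule pos_def_min_eigenvalue_pos[OF mass_carrier mass_symmetric N_pos mass_pos_def])
  obtain a b where ab: "a < N" "b < N" "a \<noteq> b" "mass $$ (a, b) \<noteq> 0" using mass_offdiagonal by blast
  show "min_eigenvalue mass < max_eigenvalue mass"
    by (rule min_eigenvalue_less_max_eigenvalue[OF mass_carrier mass_symmetric ab])
qed

lemma ext_norm:
  assumes v: "v \<in> carrier_vec nB"
  shows "scalar_prod v v \<le> scalar_prod (ext *\<^sub>v v) (ext *\<^sub>v v)"
    and "(\<Sum>i<N. (bdry (\<lambda>j. (ext *\<^sub>v v) $ j) i)\<^sup>2) = scalar_prod v v"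
proof -
  let ?y = "ext *\<^sub>v v"
  have y: "dim_vec ?y = N" using ext_harmonic(1) by auto
  have vv: "scalar_prod v v = (\<Sum>a<nB. (?y $ (nI + a))\<^sup>2)"
    using ext_harmonic(2)[OF v] v by (simp add: scalar_prod_def atLeast0LessThan power2_eq_square)
  have "scalar_prod ?y ?y = (\<Sum>j<nI + nB. (?y $ j)\<^sup>2)"
    using y index_split(3) by (simp add: scalar_prod_def atLeast0LessThan power2_eq_square)
  also have "\<dots> = (\<Sum>j<nI. (?y $ j)\<^sup>2) + scalar_prod v v" unfolding block_sum vv ..
  finally show "scalar_prod v v \<le> scalar_prod ?y ?y" by (simp add: sum_nonneg)
  have "(\<Sum>i<N. (bdry (\<lambda>j. ?y $ j) i)\<^sup>2) = (\<Sum>i<nI. (bdry (\<lambda>j. ?y $ j) i)\<^sup>2) + (\<Sum>a<nB. (bdry (\<lambda>j. ?y $ j) (nI + a))\<^sup>2)"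
    by (subst index_split(3)) (rule block_sum)
  also have "(\<Sum>i<nI. (bdry (\<lambda>j. ?y $ j) i)\<^sup>2) = 0"
    using interior_index not_frontier by (intro sum.neutral) (auto simp: bdry_def)
  also have "(\<Sum>a<nB. (bdry (\<lambda>j. ?y $ j) (nI + a))\<^sup>2) = scalar_prod v v"
    unfolding vv using boundary_index by (intro sum.cong) (auto simp: bdry_def)
  finally show "(\<Sum>i<N. (bdry (\<lambda>j. ?y $ j) i)\<^sup>2) = scalar_prod v v" by simp
qed

context
  fixes \<sigma> H :: real
  assumes regular: "\<And>T. T \<in> \<T> \<Longrightarrow> diameter T \<le> \<sigma> * inscribed_diameter T"
    and mesh: "\<And>T. T \<in> \<T> \<Longrightarrow> diameter T \<le> H"
begin

lemma min_eigenvalue_mass_le: "min_eigenvalue mass * real nB \<le> measure lborel (\<Omega> \<inter> tubular (frontier \<Omega>) H)"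
proof -
  define w :: "real vec" where "w = Matrix.vec N (bdry (\<lambda>_. 1))"
  have w: "w \<in> carrier_vec N" by (simp add: w_def)
  have "scalar_prod w w = (\<Sum>j<nI + nB. (bdry (\<lambda>_. 1) j)\<^sup>2)"
    using index_split(3) by (simp add: w_def scalar_prod_def atLeast0LessThan power2_eq_square)
  also have "\<dots> = (\<Sum>j<nI. 0) + (\<Sum>a<nB. 1)"
    unfolding block_sum using interior_index not_frontier boundary_index
    by (intro arg_cong2[where f="(+)"] sum.cong) (auto simp: bdry_def)
  finally have ww: "scalar_prod w w = real nB" by simp
  have "min_eigenvalue mass * scalar_prod w w \<le> scalar_prod w (mass *\<^sub>v w)"
    by (rule symmetric_eigenvalue_bounds(4)[OF mass_carrier mass_symmetric N_pos w])
  also have "\<dots> = sq_int (u (bdry (\<lambda>_. 1)))"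
    unfolding mass_form[OF w] by (intro arg_cong[where f=sq_int] u_cong) (simp add: w_def)
  also have "\<dots> \<le> measure lborel (\<Omega> \<inter> tubular (frontier \<Omega>) H)" by (rule mass_boundary_le[OF regular mesh])
  finally show ?thesis by (simp add: ww)
qed

lemma max_eigenvalue_mass_ge:
  assumes T: "T \<in> \<T>"
  shows "unit_ball_vol (real DIM('a)) * (diameter T / (4 * \<sigma>)) ^ DIM('a) \<le> max_eigenvalue mass * real (DIM('a) + 1)"
proof -
  define w :: "real vec" where "w = Matrix.vec N (\<lambda>j. if x j \<in> T then 1 else 0)"
  have w: "w \<in> carrier_vec N" by (simp add: w_def)
  have "scalar_prod w w = (\<Sum>j<N. if x j \<in> T then 1 else 0)"
    by (auto simp: w_def scalar_prod_def atLeast0LessThan intro!: sum.cong)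
  also have "\<dots> = real (card (V T))" by (simp add: sum.If_cases V_def Int_def)
  also have "\<dots> \<le> real (DIM('a) + 1)" using card_V_le[OF T] by simp
  finally have ww: "scalar_prod w w \<le> real (DIM('a) + 1)" .
  have "unit_ball_vol (real DIM('a)) * (diameter T / (4 * \<sigma>)) ^ DIM('a) \<le> sq_int (u (\<lambda>j. if x j \<in> T then 1 else 0))"
    by (rule mass_element_ge[OF regular mesh T])
  also have "\<dots> = scalar_prod w (mass *\<^sub>v w)"
    unfolding mass_form[OF w] by (intro arg_cong[where f=sq_int] u_cong) (simp add: w_def)
  also have "\<dots> \<le> max_eigenvalue mass * scalar_prod w w"
    by (rule symmetric_eigenvalue_bounds(3)[OF mass_carrier mass_symmetric N_pos w])
  also have "\<dots> \<le> max_eigenvalue mass * real (DIM('a) + 1)"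
    using ww eigenvalues_mass by (intro mult_left_mono) auto
  finally show ?thesis .
qed

end

end

text \<open>Multiplies the three Rayleigh bounds; m, the number of boundary nodes, cancels between
  the surface estimate and that of the smallest mass eigenvalue.\<close>

lemma ratio_bound:
  fixes a b k m s l1 lB lN :: real
  assumes a: "0 < a" "a \<le> lB * m" and b: "0 < b" "b \<le> lN * k" and s: "l1 * m \<le> s" and pos: "0 < l1" "0 < k" "0 < m"
    "0 < lB" "0 < lN"
  shows "a * b / (k * s) \<le> lB / l1 * lN"
proof -
  have s0: "0 < s" using s pos mult_pos_pos[of l1 m] by linarith
  have "a * b * l1 \<le> (lB * m) * (lN * k) * l1"
    using a b pos by (intro mult_right_mono mult_mono) auto
  also have "\<dots> = (lB * lN * k) * (l1 * m)" by simp
  also have "\<dots> \<le> (lB * lN * k) * s" using s pos by (intro mult_left_mono) auto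
  finally show ?thesis using s0 pos by (simp add: field_simps)
qed

section \<open>The control matrix\<close>

context fem
begin

lemma control_matrix_props:
  shows "control_matrix \<Omega> N x e \<nu> \<in> carrier_mat nB nB" "symmetric_mat (control_matrix \<Omega> N x e \<nu>)"
    and "v \<in> carrier_vec nB \<Longrightarrow> scalar_prod v (control_matrix \<Omega> N x e \<nu> *\<^sub>v v)
      = scalar_prod (ext *\<^sub>v v) (mass *\<^sub>v (ext *\<^sub>v v)) + \<nu> * scalar_prod v (bnd *\<^sub>v v)"
proof -
  have eq: "control_matrix \<Omega> N x e \<nu> = transpose_mat ext * mass * ext + \<nu> \<cdot>\<^sub>m bnd"
    by (simp add: control_matrix_def Let_def)
  show "control_matrix \<Omega> N x e \<nu> \<in> carrier_mat nB nB"
    unfolding eq using ext_harmonic(1) bnd_carrier by (intro carrier_matI) auto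
  show "symmetric_mat (control_matrix \<Omega> N x e \<nu>)"
    unfolding eq by (rule congruence_symmetric[OF ext_harmonic(1) mass_carrier mass_symmetric bnd_carrier bnd_symmetric])
  show "v \<in> carrier_vec nB \<Longrightarrow> scalar_prod v (control_matrix \<Omega> N x e \<nu> *\<^sub>v v)
      = scalar_prod (ext *\<^sub>v v) (mass *\<^sub>v (ext *\<^sub>v v)) + \<nu> * scalar_prod v (bnd *\<^sub>v v)"
    unfolding eq by (rule congruence_form[OF ext_harmonic(1) mass_carrier bnd_carrier])
qed

lemma control_form_ge:
  assumes v: "v \<in> carrier_vec nB" and \<nu>: "0 \<le> \<nu>"
  shows "(min_eigenvalue mass + \<nu> * min_eigenvalue bnd) * scalar_prod v v \<le> scalar_prod v (control_matrix \<Omega> N x e \<nu> *\<^sub>v v)"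
proof -
  have y: "ext *\<^sub>v v \<in> carrier_vec N" using ext_harmonic(1) v by simp
  have "min_eigenvalue mass * scalar_prod v v \<le> min_eigenvalue mass * scalar_prod (ext *\<^sub>v v) (ext *\<^sub>v v)"
    using ext_norm(1)[OF v] eigenvalues_mass(1) by (intro mult_left_mono) auto
  also have "\<dots> \<le> scalar_prod (ext *\<^sub>v v) (mass *\<^sub>v (ext *\<^sub>v v))"
    by (rule symmetric_eigenvalue_bounds(4)[OF mass_carrier mass_symmetric N_pos y])
  finally have 1: "min_eigenvalue mass * scalar_prod v v \<le> scalar_prod (ext *\<^sub>v v) (mass *\<^sub>v (ext *\<^sub>v v))" .
  have "\<nu> * (min_eigenvalue bnd * scalar_prod v v) \<le> \<nu> * scalar_prod v (bnd *\<^sub>v v)"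
    by (intro mult_left_mono symmetric_eigenvalue_bounds(4)[OF bnd_carrier bnd_symmetric nB_pos v] \<nu>)
  then show ?thesis unfolding control_matrix_props(3)[OF v] using 1 by (simp add: algebra_simps)
qed

lemma control_pos_def:
  assumes "polyhedral_boundary \<Omega>" "2 \<le> DIM('a)" and \<nu>: "0 \<le> \<nu>"
  shows "pos_def_mat (control_matrix \<Omega> N x e \<nu>)"
  unfolding pos_def_mat_def
proof (intro ballI impI)
  fix v :: "real vec"
  assume "v \<in> carrier_vec (dim_col (control_matrix \<Omega> N x e \<nu>))" "v \<noteq> 0\<^sub>v (dim_col (control_matrix \<Omega> N x e \<nu>))"
  then have v: "v \<in> carrier_vec nB" "v \<noteq> 0\<^sub>v nB" using control_matrix_props(1)[of \<nu>] by auto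
  have "0 \<le> \<nu> * min_eigenvalue bnd" using eigenvalues_bnd(1)[OF assms(1,2)] \<nu> by simp
  then have "0 < (min_eigenvalue mass + \<nu> * min_eigenvalue bnd) * scalar_prod v v"
    using eigenvalues_mass(1) scalar_prod_self_pos[OF v] by (intro mult_pos_pos) auto
  then show "0 < scalar_prod v (control_matrix \<Omega> N x e \<nu> *\<^sub>v v)" using control_form_ge[OF v(1) \<nu>] by linarith
qed

context
  fixes \<sigma> H :: real
  assumes regular: "\<And>T. T \<in> \<T> \<Longrightarrow> diameter T \<le> \<sigma> * inscribed_diameter T"
    and mesh: "\<And>T. T \<in> \<T> \<Longrightarrow> diameter T \<le> H"
begin

text \<open>The factor H of the duality argument times the energy H^(d-2) of the zero extension
  gives H^(d-1); the mass H^d of the zero extension is brought to the same power by H \<le>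
  D.\<close>

lemma ext_mass_le:
  assumes dim: "2 \<le> DIM('a)" and C: "0 < C" and dual: "dual_estimate \<Omega> C"
    and D: "H \<le> D" and v: "v \<in> carrier_vec nB"
  shows "scalar_prod (ext *\<^sub>v v) (mass *\<^sub>v (ext *\<^sub>v v))
    \<le> 3 * ((2 + 2 * C + 2 * \<sigma>\<^sup>2 * 2 ^ DIM('a) * C) * (4 * \<sigma>\<^sup>2 * unit_ball_vol (real DIM('a)) * (4 * \<sigma>) ^ DIM('a))
        + unit_ball_vol (real DIM('a)) * D) * H ^ (DIM('a) - 1) * scalar_prod v v"
proof -
  let ?c = "\<lambda>j. (ext *\<^sub>v v) $ j"
  define \<omega> where "\<omega> = unit_ball_vol (real DIM('a))"
  define c1 where "c1 = 2 + 2 * C + 2 * \<sigma>\<^sup>2 * 2 ^ DIM('a) * C"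
  define c2 where "c2 = 4 * \<sigma>\<^sup>2 * \<omega> * (4 * \<sigma>) ^ DIM('a)"
  define q where "q = scalar_prod v v"
  have H: "0 < H" by (rule mesh_pos[OF regular mesh])
  have \<omega>: "0 \<le> \<omega>" by (simp add: \<omega>_def)
  have c1: "0 \<le> c1" using C by (simp add: c1_def)
  have q: "0 \<le> q" unfolding q_def by (rule scalar_prod_self_nonneg)
  obtain d where d: "DIM('a) = Suc (Suc d)" using dim by (metis Suc_le_D numeral_2_eq_2 Suc_le_mono)
  have y: "ext *\<^sub>v v \<in> carrier_vec N" using ext_harmonic(1) v by simp
  have E: "sq_int (DY (bdry ?c)) \<le> c2 * H ^ d * q"
    using energy_le[OF regular mesh dim, of "bdry ?c"] ext_norm(2)[OF v] by (simp add: c2_def \<omega>_def q_def d)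
  have "sq_int (u (bdry ?c)) \<le> \<omega> * H ^ DIM('a) * q"
    using mass_le[OF regular mesh, of "bdry ?c"] ext_norm(2)[OF v] by (simp add: \<omega>_def q_def)
  also have "\<dots> = \<omega> * H * H ^ Suc d * q" by (simp add: d)
  also have "\<dots> \<le> \<omega> * D * H ^ Suc d * q" using D \<omega> H q by (intro mult_right_mono mult_left_mono) auto
  finally have B: "sq_int (u (bdry ?c)) \<le> \<omega> * D * H ^ Suc d * q" .
  have "scalar_prod (ext *\<^sub>v v) (mass *\<^sub>v (ext *\<^sub>v v)) = sq_int (u ?c)" by (rule mass_form[OF y])
  also have "\<dots> \<le> 3 * (c1 * H * sq_int (DY (bdry ?c)) + sq_int (u (bdry ?c)))"
    unfolding c1_def by (rule discrete_stability[OF regular mesh C dual ext_harmonic(3)[OF v]])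
  also have "\<dots> \<le> 3 * (c1 * H * (c2 * H ^ d * q) + \<omega> * D * H ^ Suc d * q)"
    using E B c1 H by (intro mult_left_mono add_mono) auto
  also have "\<dots> = 3 * (c1 * c2 + \<omega> * D) * H ^ Suc d * q" by (simp add: algebra_simps)
  finally show ?thesis by (simp add: c1_def c2_def \<omega>_def q_def d)
qed

lemma condition_bound:
  fixes \<kappa> \<gamma> Cs :: real
  assumes dim: "2 \<le> DIM('a)" and poly: "polyhedral_boundary \<Omega>" and T: "T \<in> \<T>" "diameter T = H" and \<kappa>: "0 < \<kappa>"
    and stable: "\<And>v. v \<in> carrier_vec nB \<Longrightarrow> scalar_prod (ext *\<^sub>v v) (mass *\<^sub>v (ext *\<^sub>v v)) \<le> \<kappa> * H ^ (DIM('a) - 1) * scalar_prod v v"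
    and Cs: "measure lborel (\<Omega> \<inter> tubular (frontier \<Omega>) H) \<le> Cs * H" "0 < Cs"
    and \<nu>: "0 \<le> \<nu>"
  defines "C \<equiv> \<kappa> * (4 * \<sigma>) ^ DIM('a) * (real (DIM('a) + 1) * Cs)
      / (measure \<mu> (frontier \<Omega>) * unit_ball_vol (real DIM('a)))"
  shows "condition_number (control_matrix \<Omega> N x e \<nu>)
    \<le> (C * (max_eigenvalue bnd / min_eigenvalue mass) * max_eigenvalue mass + \<nu> * max_eigenvalue bnd)
      / (min_eigenvalue mass + \<nu> * min_eigenvalue bnd)"
proof (rule condition_number_le[OF control_matrix_props(1,2) nB_pos _ control_form_ge[OF _ \<nu>]])
  define \<omega> where "\<omega> = unit_ball_vol (real DIM('a))"
  define \<gamma> where "\<gamma> = measure \<mu> (frontier \<Omega>)"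
  have \<omega>: "0 < \<omega>" by (simp add: \<omega>_def)
  have \<gamma>: "0 < \<gamma>" unfolding \<gamma>_def by (rule frontier_measure_pos[OF poly dim])
  have H: "0 < H" by (rule mesh_pos[OF regular mesh])
  have \<sigma>: "0 < \<sigma>" by (rule sigma_pos[OF regular mesh])
  note eB = eigenvalues_bnd[OF poly dim] and eM = eigenvalues_mass
  show "0 < min_eigenvalue mass + \<nu> * min_eigenvalue bnd"
    using eB eM \<nu> by (intro add_pos_nonneg) auto
  define b where "b = \<omega> * (H / (4 * \<sigma>)) ^ DIM('a)"
  define k where "k = real (DIM('a) + 1)"
  have b: "0 < b" "b \<le> max_eigenvalue mass * k"
    using \<omega> H \<sigma> max_eigenvalue_mass_ge[OF regular mesh T(1)] by (simp_all add: b_def T(2) k_def \<omega>_def)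
  have k: "0 < k" by (simp add: k_def)
  have s: "min_eigenvalue mass * real nB \<le> Cs * H"
    using min_eigenvalue_mass_le[OF regular mesh] Cs(1) by (rule order_trans)
  have "\<gamma> * b / (k * (Cs * H)) \<le> max_eigenvalue bnd / min_eigenvalue mass * max_eigenvalue mass"
    using max_eigenvalue_bnd_ge[OF poly dim] \<gamma> b s k eB eM nB_pos
    by (intro ratio_bound[where m="real nB"]) (auto simp: \<gamma>_def)
  \<comment> \<open>C is chosen to make this an identity: it collects the constants of the three
    Rayleigh bounds, while the powers of H on both sides agree.\<close>
  moreover have "\<kappa> * H ^ (DIM('a) - 1) = C * (\<gamma> * b / (k * (Cs * H)))"
  proof -
    have HH: "H ^ DIM('a) = H ^ (DIM('a) - 1) * H" using dim by (metis power_minus_mult DIM_positive)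
    have "C * (\<gamma> * b / (k * (Cs * H))) = \<kappa> * (4 * \<sigma>) ^ DIM('a) * (k * Cs) / (\<gamma> * \<omega>) * (\<gamma> * (\<omega> * (H ^ (DIM('a) - 1) * H / (4 * \<sigma>) ^ DIM('a))) / (k * (Cs * H)))"
      unfolding C_def b_def by (simp add: power_divide HH \<gamma>_def \<omega>_def k_def)
    also have "\<dots> = \<kappa> * H ^ (DIM('a) - 1)"
      using \<gamma> \<omega> k Cs(2) H \<sigma> by (simp add: divide_simps del: power_mult_distrib)
    finally show ?thesis by simp
  qed
  moreover have C0: "0 \<le> C" using \<kappa> \<sigma> Cs(2) by (simp add: C_def)
  ultimately have key: "\<kappa> * H ^ (DIM('a) - 1) \<le> C * (max_eigenvalue bnd / min_eigenvalue mass) * max_eigenvalue mass"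
    using mult_left_mono by (metis mult.assoc)
  fix v :: "real vec" assume v: "v \<in> carrier_vec nB"
  have "scalar_prod v (control_matrix \<Omega> N x e \<nu> *\<^sub>v v) \<le> \<kappa> * H ^ (DIM('a) - 1) * scalar_prod v v + \<nu> * (max_eigenvalue bnd * scalar_prod v v)"
    unfolding control_matrix_props(3)[OF v]
    by (intro add_mono stable v mult_left_mono \<nu> symmetric_eigenvalue_bounds(3)[OF bnd_carrier bnd_symmetric nB_pos])
  also have "\<dots> \<le> C * (max_eigenvalue bnd / min_eigenvalue mass) * max_eigenvalue mass * scalar_prod v v + \<nu> * (max_eigenvalue bnd * scalar_prod v v)"
    by (intro add_right_mono mult_right_mono key scalar_prod_self_nonneg)
  finally show "scalar_prod v (control_matrix \<Omega> N x e \<nu> *\<^sub>v v)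
    \<le> (C * (max_eigenvalue bnd / min_eigenvalue mass) * max_eigenvalue mass + \<nu> * max_eigenvalue bnd) * scalar_prod v v"
    by (simp add: algebra_simps)
qed

end

end

section \<open>Choice of the uniform constant\<close>

lemma bounded_tubular:
  assumes "bounded S" shows "bounded (tubular S \<delta>)"
proof -
  obtain B where B: "\<And>q. q \<in> S \<Longrightarrow> norm q \<le> B" using assms unfolding bounded_iff by blast
  have "norm p \<le> B + \<delta>" if p: "p \<in> tubular S \<delta>" for p
  proof -
    obtain q where q: "q \<in> S" "dist p q \<le> \<delta>" using p by (auto simp: tubular_def)
    then show ?thesis using B[OF q(1)] norm_triangle_sub[of p q] by (simp add: dist_norm)
  qed
  then show ?thesis unfolding bounded_iff by blast
qed

lemma boundary_strip_measure_le:
  fixes \<Omega> :: "'a::euclidean_space set"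
  assumes lip: "lipschitz_domain \<Omega>" and poly: "polyhedral_boundary \<Omega>"
  obtains C where "0 < C" "\<And>H. 0 < H \<Longrightarrow> measure lborel (\<Omega> \<inter> tubular (frontier \<Omega>) H) \<le> C * H"
proof -
  have b: "bounded \<Omega>" and op: "open \<Omega>" using lip by (auto simp: lipschitz_domain_def)
  obtain C where C: "0 < C" "\<And>\<delta>. 0 < \<delta> \<Longrightarrow> \<delta> \<le> 1 \<Longrightarrow> measure lborel (tubular (frontier \<Omega>) \<delta>) \<le> C * \<delta>"
    using tubular_measure_le[OF poly b] by auto
  have cf: "compact (frontier \<Omega>)" using b by (rule compact_frontier_bounded)
  show ?thesis
  proof (rule that[of "C + measure lborel \<Omega>"])
    show "0 < C + measure lborel \<Omega>" using C(1) by (simp add: add_pos_nonneg)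
    fix H :: real assume H: "0 < H"
    have clt: "tubular (frontier \<Omega>) H \<in> sets borel" using closed_tubular[OF cf] by (rule borel_closed)
    show "measure lborel (\<Omega> \<inter> tubular (frontier \<Omega>) H) \<le> (C + measure lborel \<Omega>) * H"
    proof (cases "H \<le> 1")
      case True
      have bt: "bounded (tubular (frontier \<Omega>) H)" by (rule bounded_tubular[OF compact_imp_bounded[OF cf]])
      have "measure lborel (\<Omega> \<inter> tubular (frontier \<Omega>) H) \<le> measure lborel (tubular (frontier \<Omega>) H)"
        using op clt emeasure_bounded_finite[OF bt] by (intro measure_mono_fmeasurable) (auto simp: fmeasurable_def)
      also have "\<dots> \<le> C * H" by (rule C(2)[OF H True])
      also have "\<dots> \<le> (C + measure lborel \<Omega>) * H" using H by (intro mult_right_mono) auto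
      finally show ?thesis .
    next
      \<comment> \<open>For H > 1 the whole volume of \<Omega> is at most its product with
        H.\<close>
      case False
      have "measure lborel (\<Omega> \<inter> tubular (frontier \<Omega>) H) \<le> measure lborel \<Omega>"
        using op clt emeasure_bounded_finite[OF b] by (intro measure_mono_fmeasurable) (auto simp: fmeasurable_def)
      also have "\<dots> \<le> measure lborel \<Omega> * H" using False by (simp add: mult_le_cancel_left1)
      also have "\<dots> \<le> (C + measure lborel \<Omega>) * H" using H C(1) by (intro mult_right_mono) auto
      finally show ?thesis .
    qed
  qed
qed

theorem lemma3p1:
  fixes \<Omega> :: "'a::euclidean_space set"
    and \<T> :: "'h \<Rightarrow> 'a set set"
    and N :: "'h \<Rightarrow> nat"
    and x :: "'h \<Rightarrow> nat \<Rightarrow> 'a"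
    and e :: "'h \<Rightarrow> nat \<Rightarrow> 'a \<Rightarrow> real"
  defines "\<A> \<equiv> \<lambda>h \<nu>. control_matrix \<Omega> (N h) (x h) (e h) \<nu>"
    and "\<M> \<equiv> \<lambda>h. mass_matrix \<Omega> (N h) (e h)"
    and "\<B> \<equiv> \<lambda>h. boundary_block \<Omega> (N h) (x h) (e h)"
  assumes "DIM('a) = 2 \<or> DIM('a) = 3"
    and "lipschitz_domain \<Omega>"
    and "polyhedral_boundary \<Omega>"
    and "\<And>h. triangulation_of (closure \<Omega>) (\<T> h)"
    and "regular_family \<T>"
    and "\<And>h. node_numbering \<Omega> (\<T> h) (N h) (x h)"
    and "\<And>h. nodal_basis \<Omega> (\<T> h) (N h) (x h) (e h)"
  shows "(\<forall>h. \<forall>\<nu>\<ge>0. symmetric_mat (\<A> h \<nu>) \<and> pos_def_mat (\<A> h \<nu>))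
    \<and> (\<exists>C>0. \<forall>h. \<forall>\<nu>\<ge>0. condition_number (\<A> h \<nu>) \<le>
           (C * (max_eigenvalue (\<B> h) / min_eigenvalue (\<M> h)) * max_eigenvalue (\<M> h)
              + \<nu> * max_eigenvalue (\<B> h))
           / (min_eigenvalue (\<M> h) + \<nu> * min_eigenvalue (\<B> h)))
    \<and> (\<forall>h. 0 < min_eigenvalue (\<B> h) \<and> min_eigenvalue (\<B> h) < max_eigenvalue (\<B> h) \<and>
             0 < min_eigenvalue (\<M> h) \<and> min_eigenvalue (\<M> h) < max_eigenvalue (\<M> h))"
proof -
  have dim: "2 \<le> DIM('a)" using assms(4) by auto
  have fem: "fem \<Omega> (\<T> h) (N h) (x h) (e h)" for h by (rule fem.intro) (rule assms)+
  note poly = assms(6)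
  obtain \<sigma> where \<sigma>: "\<And>h T. T \<in> \<T> h \<Longrightarrow> diameter T \<le> \<sigma> * inscribed_diameter T"
    using assms(8) unfolding regular_family_def by blast
  \<comment> \<open>The largest diameter is attained, as the lower bound on the greatest mass
    eigenvalue requires.\<close>
  define H where "H h = Max (diameter ` \<T> h)" for h
  have H_attained: "\<exists>T\<in>\<T> h. diameter T = H h" for h
  proof -
    have "H h \<in> diameter ` \<T> h"
      unfolding H_def using fem.finite_elements[OF fem, of h] fem.elements_nonempty[OF fem, of h] by (intro Max_in) auto
    then show ?thesis by (rule imageE) auto
  qed
  have mesh: "diameter T \<le> H h" if "T \<in> \<T> h" for T h
    unfolding H_def using that fem.finite_elements[OF fem, of h] by (intro Max_ge) auto
  have H_pos: "0 < H h" for h by (rule fem.mesh_pos[OF fem \<sigma> mesh])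
  have \<sigma>_pos: "0 < \<sigma>" by (rule fem.sigma_pos[OF fem \<sigma> mesh])
  \<comment> \<open>Bounds all mesh sizes at once, which keeps \<kappa> independent of h.\<close>
  define D where "D = diameter (closure \<Omega>)"
  have H_le: "H h \<le> D" for h
  proof -
    obtain T where T: "T \<in> \<T> h" "diameter T = H h" using H_attained by blast
    have "bounded (closure \<Omega>)" using assms(5) by (auto simp: lipschitz_domain_def)
    then show ?thesis unfolding D_def T(2)[symmetric] by (intro diameter_subset fem.element_subset[OF fem T(1)])
  qed
  have D_pos: "0 < D" using H_pos H_le less_le_trans by blast
  obtain C where C: "0 < C" and dual: "dual_estimate \<Omega> C"
    by (rule dual_regularity[OF assms(5)]) (rule that)
  obtain Cs where Cs: "0 < Cs" "\<And>H. 0 < H \<Longrightarrow> measure lborel (\<Omega> \<inter> tubular (frontier \<Omega>) H) \<le> Cs * H"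
    by (rule boundary_strip_measure_le[OF assms(5,6)]) (rule that)
  define \<omega> where "\<omega> = unit_ball_vol (real DIM('a))"
  define \<kappa> where "\<kappa> = 3 * ((2 + 2 * C + 2 * \<sigma>\<^sup>2 * 2 ^ DIM('a) * C) * (4 * \<sigma>\<^sup>2 * \<omega> * (4 * \<sigma>) ^ DIM('a)) + \<omega> * D)"
  define \<gamma> where "\<gamma> = measure (hausdorff_measure (DIM('a) - 1)) (frontier \<Omega>)"
  have \<omega>_pos: "0 < \<omega>" by (simp add: \<omega>_def)
  have \<gamma>_pos: "0 < \<gamma>" unfolding \<gamma>_def by (rule fem.frontier_measure_pos[OF fem poly dim])
  have \<kappa>_pos: "0 < \<kappa>" unfolding \<kappa>_def using C \<sigma>_pos \<omega>_pos D_pos by (intro mult_pos_pos add_nonneg_pos mult_nonneg_nonneg add_nonneg_nonneg) auto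
  \<comment> \<open>Only the domain, its dimension and the shape regularity constant enter, so one
    value serves all h and \<nu>.\<close>
  define C' where "C' = \<kappa> * (4 * \<sigma>) ^ DIM('a) * (real (DIM('a) + 1) * Cs) / (\<gamma> * \<omega>)"
  have C': "0 < C'" unfolding C'_def using \<kappa>_pos \<sigma>_pos Cs(1) \<gamma>_pos \<omega>_pos by simp
  have "condition_number (\<A> h \<nu>) \<le>
           (C' * (max_eigenvalue (\<B> h) / min_eigenvalue (\<M> h)) * max_eigenvalue (\<M> h) + \<nu> * max_eigenvalue (\<B> h))
           / (min_eigenvalue (\<M> h) + \<nu> * min_eigenvalue (\<B> h))" if \<nu>: "0 \<le> \<nu>" for h \<nu>
  proof -
    obtain T where T: "T \<in> \<T> h" "diameter T = H h" using H_attained by blast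
    show ?thesis unfolding \<A>_def \<M>_def \<B>_def C'_def \<gamma>_def \<omega>_def
    proof (rule fem.condition_bound[OF fem \<sigma> mesh dim poly T \<kappa>_pos _ Cs(2)[OF H_pos] Cs(1) \<nu>])
      fix v :: "real vec" assume v: "v \<in> carrier_vec (fem.nB \<Omega> (N h) (x h))"
      show "scalar_prod (extension_matrix (stiffness_matrix \<Omega> (N h) (e h)) (interior_indexes \<Omega> (N h) (x h)) (boundary_indexes \<Omega> (N h) (x h)) *\<^sub>v v)
          (mass_matrix \<Omega> (N h) (e h) *\<^sub>v (extension_matrix (stiffness_matrix \<Omega> (N h) (e h)) (interior_indexes \<Omega> (N h) (x h)) (boundary_indexes \<Omega> (N h) (x h)) *\<^sub>v v))
          \<le> \<kappa> * H h ^ (DIM('a) - 1) * scalar_prod v v"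
        unfolding \<kappa>_def \<omega>_def by (rule fem.ext_mass_le[OF fem \<sigma> mesh dim C dual H_le v])
    qed
  qed
  moreover have "symmetric_mat (\<A> h \<nu>)" for h \<nu> unfolding \<A>_def by (rule fem.control_matrix_props(2)[OF fem])
  moreover have "pos_def_mat (\<A> h \<nu>)" if "0 \<le> \<nu>" for h \<nu>
    unfolding \<A>_def by (rule fem.control_pos_def[OF fem poly dim that])
  moreover have "0 < min_eigenvalue (\<B> h)" "min_eigenvalue (\<B> h) < max_eigenvalue (\<B> h)" for h
    unfolding \<B>_def by (rule fem.eigenvalues_bnd[OF fem poly dim])+
  moreover have "0 < min_eigenvalue (\<M> h)" "min_eigenvalue (\<M> h) < max_eigenvalue (\<M> h)" for h
    unfolding \<M>_def by (rule fem.eigenvalues_mass[OF fem])+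
  ultimately show ?thesis using C' by blast
qed

end
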